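(* Let $d\ge1$, $Q=2d+2$, let $0<\kappa<\sqrt{4d}$, and let $(p,q)$ satisfy $\frac2q+\frac Qp=\frac Q2$ with $2\le p\le\infty$. There exists a constant $C(q,\kappa)>0$ such that for all $R_0>0$, all $w_0\in\mathbb{H}^d$ and all $u_0\in L^2(\mathbb{H}^d)$ supported in $B_{\mathbb{H}}(w_0,R_0)$, the solution $u(t)=e^{-it\Delta_{\mathbb{H}}}u_0$ of $i\partial_tu-\Delta_{\mathbb{H}}u=0$, $u_{|t=0}=u_0$, satisfies $$\Big\|\,t\mapsto\|u(t,\cdot)\|_{L^p(B_{\mathbb{H}}(w_0,\kappa\sqrt{|t|}))}\Big\|_{L^q(]-\infty,-C_\kappa R_0^2]\cup[C_\kappa R_0^2,+\infty[)}\le C(q,\kappa)\|u_0\|_{L^2(B_{\mathbb{H}}(w_0,R_0))},$$ where $C_\kappa=(\sqrt{4d}-\kappa)^{-2}$.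
   Context: The Heisenberg group $\mathbb{H}^d$ is $\mathbb{R}^{2d+1}$ with points $w=(Y,s)=(y,\eta,s)$, $y,\eta\in\mathbb{R}^d$, and product $(Y,s)\cdot(Y',s')=(Y+Y',\,s+s'+2\langle\eta,y'\rangle-2\langle\eta',y\rangle)$, with Lebesgue measure. The Korányi distance is $d_{\mathbb{H}}(w,w')=\rho_{\mathbb{H}}(w^{-1}\cdot w')$ with $\rho_{\mathbb{H}}(Y,s)=(|Y|^4+s^2)^{1/4}$, and $B_{\mathbb{H}}(w_0,R)=\{w:d_{\mathbb{H}}(w,w_0)<R\}$. The sublaplacian is $\Delta_{\mathbb{H}}=\sum_{j=1}^d(\mathcal{X}_j^2+\Xi_j^2)$, $\mathcal{X}_j=\partial_{y_j}+2\eta_j\partial_s$, $\Xi_j=\partial_{\eta_j}-2y_j\partial_s$; $e^{-it\Delta_{\mathbb{H}}}$ is the unitary group on $L^2(\mathbb{H}^d)$ given by functional calculus of the nonnegative self-adjoint operator $-\Delta_{\mathbb{H}}$. *)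

theory Defs
  imports "HOL-Analysis.Analysis" "HOL-Probability.Essential_Supremum"
begin

type_synonym 'd heis = "(real^'d) \<times> (real^'d) \<times> real"

definition heis_mult :: "'d::finite heis \<Rightarrow> 'd heis \<Rightarrow> 'd heis" where
  "heis_mult w w' = (case w of (y, \<eta>, s) \<Rightarrow> case w' of (y', \<eta>', s') \<Rightarrow>
     (y + y', \<eta> + \<eta>', s + s' + 2 * (\<eta> \<bullet> y') - 2 * (\<eta>' \<bullet> y)))"

definition heis_inv :: "'d::finite heis \<Rightarrow> 'd heis" where
  "heis_inv w = (case w of (y, \<eta>, s) \<Rightarrow> (-y, -\<eta>, -s))"

definition koranyi :: "'d::finite heis \<Rightarrow> real" where
  "koranyi w = (case w of (y, \<eta>, s) \<Rightarrow>
     ((norm y ^ 2 + norm \<eta> ^ 2) ^ 2 + s ^ 2) powr (1/4))"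

definition heis_dist :: "'d::finite heis \<Rightarrow> 'd heis \<Rightarrow> real" where
  "heis_dist w w' = koranyi (heis_mult (heis_inv w) w')"

definition heis_ball :: "'d::finite heis \<Rightarrow> real \<Rightarrow> 'd heis set" where
  "heis_ball w0 R = {w. heis_dist w w0 < R}"

text \<open>Power on ennreal (for positive real exponents).\<close>
definition ennpow :: "ennreal \<Rightarrow> real \<Rightarrow> ennreal" where
  "ennpow x r = (if x = \<infinity> then \<infinity> else ennreal (enn2real x powr r))"

definition lpnorm_enn :: "'a measure \<Rightarrow> ennreal \<Rightarrow> ('a \<Rightarrow> ennreal) \<Rightarrow> ennreal" where
  "lpnorm_enn M p g = (if p = \<infinity> then esssup M g
     else ennpow (\<integral>\<^sup>+ x. ennpow (g x) (enn2real p) \<partial>M) (1 / enn2real p))"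

definition lpnorm :: "'a measure \<Rightarrow> ennreal \<Rightarrow> ('a \<Rightarrow> complex) \<Rightarrow> ennreal" where
  "lpnorm M p f = lpnorm_enn M p (\<lambda>x. ennreal (norm (f x)))"

definition L2 :: "('d::finite heis \<Rightarrow> complex) \<Rightarrow> bool" where
  "L2 f \<longleftrightarrow> f \<in> borel_measurable lborel \<and> lpnorm lborel 2 f < \<infinity>"

definition dirder :: "('a::real_normed_vector \<Rightarrow> complex) \<Rightarrow> 'a \<Rightarrow> 'a \<Rightarrow> complex" where
  "dirder f v w = vector_derivative (\<lambda>h::real. f (w + h *\<^sub>R v)) (at 0)"

fun iter_dirder :: "('a::real_normed_vector \<Rightarrow> complex) \<Rightarrow> 'a list \<Rightarrow> 'a \<Rightarrow> complex" where
  "iter_dirder f [] = f"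
| "iter_dirder f (v # vs) = dirder (iter_dirder f vs) v"

definition smooth_fun :: "('a::real_normed_vector \<Rightarrow> complex) \<Rightarrow> bool" where
  "smooth_fun f \<longleftrightarrow> (\<forall>vs. continuous_on UNIV (iter_dirder f vs) \<and>
      (\<forall>v w. (\<lambda>h::real. iter_dirder f vs (w + h *\<^sub>R v)) differentiable (at 0)))"

definition test_fun :: "('a::real_normed_vector \<Rightarrow> complex) \<Rightarrow> bool" where
  "test_fun f \<longleftrightarrow> smooth_fun f \<and> compact (closure {x. f x \<noteq> 0})"

definition vfX :: "'d::finite \<Rightarrow> ('d heis \<Rightarrow> complex) \<Rightarrow> 'd heis \<Rightarrow> complex" where
  "vfX j f w = dirder f (axis j 1, 0, 0) w
      + complex_of_real (2 * (fst (snd w) $ j)) * dirder f (0, 0, 1) w"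

definition vfXi :: "'d::finite \<Rightarrow> ('d heis \<Rightarrow> complex) \<Rightarrow> 'd heis \<Rightarrow> complex" where
  "vfXi j f w = dirder f (0, axis j 1, 0) w
      - complex_of_real (2 * (fst w $ j)) * dirder f (0, 0, 1) w"

definition sublap :: "('d::finite heis \<Rightarrow> complex) \<Rightarrow> 'd heis \<Rightarrow> complex" where
  "sublap f w = (\<Sum>j\<in>UNIV. vfX j (vfX j f) w + vfXi j (vfXi j f) w)"

text \<open>U is the Schroedinger group e^{-it Delta_H} on L^2(H^d): a strongly continuous
  group of linear isometries (acting on representatives, compatibly with a.e.
  equality) whose generator extends -i Delta_H on C_c^infinity.  Since Delta_H is
  essentially self-adjoint on C_c^infinity, by Stone's theorem this determines U
  uniquely and U(t) = exp(-it Delta_H) by functional calculus.\<close>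
definition schroedinger_group :: "(real \<Rightarrow> ('d::finite heis \<Rightarrow> complex) \<Rightarrow> ('d heis \<Rightarrow> complex)) \<Rightarrow> bool" where
  "schroedinger_group U \<longleftrightarrow>
     (\<forall>f t. L2 f \<longrightarrow> L2 (U t f)) \<and>
     (\<forall>f g t. L2 f \<longrightarrow> L2 g \<longrightarrow> (AE x in lborel. f x = g x) \<longrightarrow>
        (AE x in lborel. U t f x = U t g x)) \<and>
     (\<forall>f g t. L2 f \<longrightarrow> L2 g \<longrightarrow>
        (AE x in lborel. U t (\<lambda>y. f y + g y) x = U t f x + U t g x)) \<and>
     (\<forall>f c t. L2 f \<longrightarrow> (AE x in lborel. U t (\<lambda>y. c * f y) x = c * U t f x)) \<and>
     (\<forall>f t. L2 f \<longrightarrow> lpnorm lborel 2 (U t f) = lpnorm lborel 2 f) \<and>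
     (\<forall>f. L2 f \<longrightarrow> (AE x in lborel. U 0 f x = f x)) \<and>
     (\<forall>f s t. L2 f \<longrightarrow> (AE x in lborel. U (s + t) f x = U s (U t f) x)) \<and>
     (\<forall>f t0. L2 f \<longrightarrow>
        ((\<lambda>t. lpnorm lborel 2 (\<lambda>x. U t f x - U t0 f x)) \<longlongrightarrow> 0) (at t0)) \<and>
     (\<forall>\<phi>. test_fun \<phi> \<longrightarrow>
        ((\<lambda>h. lpnorm lborel 2 (\<lambda>x. (U h \<phi> x - \<phi> x) / complex_of_real h
                                   + \<i> * sublap \<phi> x)) \<longlongrightarrow> 0) (at 0))"

end

theory Submission
  imports Defs "HOL-Computational_Algebra.Polynomial" "HOL-Complex_Analysis.Cauchy_Integral_Theorem" "HOL-Real_Asymp.Real_Asymp"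
begin

text \<open>The operator is diagonalised by the Fourier transform in the central variable \<open>s\<close>: on each
  mode \<open>\<lambda>\<close> a Gaussian in \<open>(y, \<eta>)\<close> evolves explicitly (Mehler's formula). Superposing these modes yields
  wave packets, and cutting them off to test functions identifies the pairing of a packet with
  \<open>U t u0\<close> as the pairing of the evolved packet with \<open>u0\<close>. Rotating the \<open>\<lambda>\<close>-contour onto the imaginary
  axis bounds the evolved packet by a multiple of \<open>\<bar>t\<bar> ^ - (d + 1)\<close> as long as
  \<open>\<bar>s\<bar> \<le> (4 * d - c) * \<bar>t\<bar>\<close>, uniformly in its width. Translated packets form an approximate identity, and
  the geometry of the Koranyi distance keeps all relevant points in that region when
  \<open>R0 \<le> (sqrt (4 * d) - \<kappa>) * sqrt \<bar>t\<bar>\<close>; this gives a local dispersive estimate from \<open>L\<^sup>1\<close> to \<open>L\<^sup>\<infinity>\<close>.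
  Interpolating with conservation of the \<open>L\<^sup>2\<close> norm, the \<open>L\<^sup>p\<close> norm at time \<open>t\<close> is
  \<open>O ((R0\<^sup>2 / t\<^sup>2) powr (1 / q))\<close>, and the \<open>q\<close>-th power of this has integral \<open>O (1)\<close> over
  \<open>\<bar>t\<bar> \<ge> C\<^sub>\<kappa> * R0\<^sup>2\<close>.\<close>

text \<open>The value 4 * d is where convergence on the imaginary axis fails: at frequency \<i> *
  \<nu> the amplitude \<open>(b / kD) ^ d\<close> decays like exp (- 4 * d * \<nu> * t) up to a
  power, while the central character may grow like exp (\<bar>s\<bar> * \<nu>). So the bound is
  local in s / t, and sqrt (4 * d) is the threshold for \<kappa>. The contour turns inside the first
  quadrant, where \<open>kD\<close> has no zeros; negative frequencies are therefore folded onto the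
  positive half-line, and packets sum the frequencies x and - x. The second obstacle is that the
  group is given by axioms: its generator is known on test functions only, and a Gaussian has no
  compact support. Uniqueness is replaced by duality: if \<Phi> solves the equation up to an error,
  its pairing with the group changes at a rate bounded by the L2 norm of that error. For a mode cut
  off at radius N the error is a commutator of pointwise size 1 / N on a slab of height 2 * N, so
  its L2 norm is of order 1 / sqrt N. A bare mode is not square integrable in s, so the cutoffs are
  removed only after integration over the frequencies.\<close>

section \<open>Flat functions and smoothness\<close>

text \<open>The index polynomial makes the family closed under differentiation, so that smoothness across \<open>0\<close>
  needs no induction on the order of the derivative.\<close>

definition flat :: "real poly \<Rightarrow> real \<Rightarrow> real" where
  "flat p x = (if x > 0 then poly p (1 / x) * exp (- 1 / x) else 0)"

lemma poly_exp_tendsto_0: "((\<lambda>u::real. poly p u * exp (- u)) \<longlongrightarrow> 0) at_top"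
proof -
  have "((\<lambda>u. \<Sum>i\<le>degree p. coeff p i * (u ^ i / exp u)) \<longlongrightarrow> (\<Sum>i\<le>degree p. coeff p i * 0)) at_top"
    by (intro tendsto_intros tendsto_power_div_exp_0)
  then show ?thesis
    by (simp add: poly_altdef sum_distrib_right exp_minus divide_inverse mult.assoc)
qed

lemma flat_tendsto_0: "(flat p \<longlongrightarrow> 0) (at 0)"
proof -
  have "((\<lambda>x. poly p (inverse x) * exp (- inverse x)) \<longlongrightarrow> 0) (at_right (0::real))"
    by (rule filterlim_compose[OF poly_exp_tendsto_0 filterlim_inverse_at_top_right])
  then have "(flat p \<longlongrightarrow> 0) (at_right 0)"
    by (rule Lim_transform_eventually)
       (auto simp: eventually_at_filter flat_def divide_inverse)
  moreover have "(flat p \<longlongrightarrow> 0) (at_left 0)"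
    by (rule Lim_transform_eventually[where f = "\<lambda>_. 0"])
       (auto simp: eventually_at_filter flat_def)
  ultimately show ?thesis
    by (simp add: filterlim_at_split)
qed

text \<open>In the variable u = 1 / x the operator d/dx is - u^2 d/du, which turns p(u) exp (- u)
  into u^2 (p - p')(u) exp (- u). The two \<open>pCons 0\<close> are the factor u^2.\<close>

lemma flat_has_derivative:
  "(flat p has_real_derivative flat (pCons 0 (pCons 0 (p - pderiv p))) x) (at x)"
proof -
  consider "x > 0" | "x < 0" | "x = 0" by linarith
  then show ?thesis
  proof cases
    case 1
    have "((\<lambda>x. poly p (1 / x) * exp (- 1 / x)) has_real_derivative
        flat (pCons 0 (pCons 0 (p - pderiv p))) x) (at x)"
      using 1 by (auto intro!: derivative_eq_intros DERIV_chain'[OF _ poly_DERIV]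
          simp: flat_def field_simps power2_eq_square)
    moreover have "eventually (\<lambda>x. x > 0) (nhds x)"
      using 1 by (intro eventually_nhds_in_open[of "{0<..}", simplified]) auto
    ultimately show ?thesis
      by (subst DERIV_cong_ev[OF refl _ refl]) (auto simp: flat_def elim!: eventually_mono)
  next
    case 2
    have "((\<lambda>x. 0) has_real_derivative flat (pCons 0 (pCons 0 (p - pderiv p))) x) (at x)"
      using 2 by (auto simp: flat_def)
    moreover have "eventually (\<lambda>x. x < 0) (nhds x)"
      using 2 by (intro eventually_nhds_in_open[of "{..<0}", simplified]) auto
    ultimately show ?thesis
      by (subst DERIV_cong_ev[OF refl _ refl]) (auto simp: flat_def elim!: eventually_mono)
  next
    case 3
    \<comment> \<open>Dividing by h is one more power of 1 / h, so the quotient is again a member of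
      the family, with index \<open>pCons 0 p\<close>.\<close>
    have "((\<lambda>h. (flat p (0 + h) - flat p 0) / h) \<longlongrightarrow> 0) (at 0)"
      by (rule Lim_transform_eventually[OF flat_tendsto_0[of "pCons 0 p"]])
         (auto simp: eventually_at_filter flat_def)
    then show ?thesis
      using 3 by (simp add: DERIV_def flat_def)
  qed
qed

lemma flat_continuous: "continuous_on A (flat p)"
  by (meson DERIV_isCont continuous_at_imp_continuous_on flat_has_derivative)

text \<open>A class of functions closed under directional derivatives, which makes smoothness
  in the sense of \<open>smooth_fun\<close> a structural property.\<close>

inductive_set elem :: "('a::real_normed_vector \<Rightarrow> complex) set" where
  const: "(\<lambda>_. c) \<in> elem"
| lin: "bounded_linear l \<Longrightarrow> (\<lambda>w. complex_of_real (l w)) \<in> elem"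
| add: "f \<in> elem \<Longrightarrow> g \<in> elem \<Longrightarrow> (\<lambda>w. f w + g w) \<in> elem"
| mult: "f \<in> elem \<Longrightarrow> g \<in> elem \<Longrightarrow> (\<lambda>w. f w * g w) \<in> elem"
| exp: "f \<in> elem \<Longrightarrow> (\<lambda>w. exp (f w)) \<in> elem"
| Re: "f \<in> elem \<Longrightarrow> (\<lambda>w. complex_of_real (Re (f w))) \<in> elem"
| flat: "f \<in> elem \<Longrightarrow> (\<lambda>w. complex_of_real (flat p (Re (f w)))) \<in> elem"

text \<open>Only real differentiability is claimed, because \<open>Re\<close> and
  \<open>flat\<close> are not holomorphic. Closure is asked for each fixed direction v, which is the
  form that \<open>iter_dirder\<close> iterates.\<close>

lemma elem_derivative:
  assumes "f \<in> elem"
  obtains f' where "\<And>w. (f has_derivative f' w) (at w)" "\<And>v. (\<lambda>w. f' w v) \<in> elem"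
proof -
  have "\<exists>f'. (\<forall>w. (f has_derivative f' w) (at w)) \<and> (\<forall>v. (\<lambda>w. f' w v) \<in> elem)"
    using assms
  proof induction
    case (const c)
    show ?case
      by (rule exI[of _ "\<lambda>_ _. 0"]) (auto intro: elem.const)
  next
    case (lin l)
    show ?case
      by (rule exI[of _ "\<lambda>_ v. complex_of_real (l v)"])
         (use has_derivative_of_real[OF bounded_linear_imp_has_derivative[OF lin]] in \<open>auto intro: elem.const\<close>)
  next
    case (add f g)
    then obtain f' g' where "\<And>w. (f has_derivative f' w) (at w)" "\<And>v. (\<lambda>w. f' w v) \<in> elem"
      "\<And>w. (g has_derivative g' w) (at w)" "\<And>v. (\<lambda>w. g' w v) \<in> elem" by blast
    with add show ?case
      by (intro exI[of _ "\<lambda>w v. f' w v + g' w v"])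
         (auto intro!: elem.add derivative_eq_intros)
  next
    case (mult f g)
    then obtain f' g' where "\<And>w. (f has_derivative f' w) (at w)" "\<And>v. (\<lambda>w. f' w v) \<in> elem"
      "\<And>w. (g has_derivative g' w) (at w)" "\<And>v. (\<lambda>w. g' w v) \<in> elem" by blast
    with mult show ?case
      by (intro exI[of _ "\<lambda>w v. f w * g' w v + f' w v * g w"])
         (auto intro!: elem.add elem.mult has_derivative_mult)
  next
    case (exp f)
    then obtain f' where f': "\<And>w. (f has_derivative f' w) (at w)" "\<And>v. (\<lambda>w. f' w v) \<in> elem"
      by blast
    have "((\<lambda>w. exp (f w)) has_derivative (\<lambda>v. exp (f w) * f' w v)) (at w)" for w
    proof -
      have "(exp has_derivative (*) (exp (f w))) (at (f w))"
        using DERIV_exp[of "f w"] by (simp add: has_field_derivative_def)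
      from has_derivative_compose[OF f'(1)[of w] this] show ?thesis .
    qed
    with exp f' show ?case
      by (intro exI[of _ "\<lambda>w v. exp (f w) * f' w v"]) (auto intro!: elem.mult elem.exp)
  next
    case (Re f)
    then obtain f' where f': "\<And>w. (f has_derivative f' w) (at w)" "\<And>v. (\<lambda>w. f' w v) \<in> elem"
      by blast
    with Re show ?case
      by (intro exI[of _ "\<lambda>w v. complex_of_real (Re (f' w v))"])
         (auto intro!: elem.Re has_derivative_of_real has_derivative_Re)
  next
    case (flat f p)
    then obtain f' where f': "\<And>w. (f has_derivative f' w) (at w)" "\<And>v. (\<lambda>w. f' w v) \<in> elem"
      by blast
    let ?q = "pCons 0 (pCons 0 (p - pderiv p))"
    have "((\<lambda>w. complex_of_real (flat p (Re (f w)))) has_derivative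
       (\<lambda>v. complex_of_real (flat ?q (Re (f w)) * Re (f' w v)))) (at w)" for w
    proof -
      have "(flat p has_derivative (*) (flat ?q (Re (f w)))) (at (Re (f w)))"
        using flat_has_derivative[of p "Re (f w)"] by (simp add: has_field_derivative_def)
      from has_derivative_compose[OF has_derivative_Re[OF f'(1)[of w]] this] show ?thesis
        by (rule has_derivative_of_real)
    qed
    with flat f' show ?case
      by (intro exI[of _ "\<lambda>w v. complex_of_real (flat ?q (Re (f w)) * Re (f' w v))"])
         (auto intro!: elem.mult[of "\<lambda>w. complex_of_real (flat ?q (Re (f w)))"] elem.Re elem.flat)
  qed
  then show ?thesis using that by blast
qed

section \<open>Directional derivatives within the class\<close>

lemma has_derivative_dirder:
  assumes "(f has_derivative f') (at w)"
  shows "((\<lambda>h::real. f (w + h *\<^sub>R v)) has_vector_derivative f' v) (at 0)" "dirder f v w = f' v"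
proof -
  have "((\<lambda>h::real. w + h *\<^sub>R v) has_derivative (\<lambda>h. h *\<^sub>R v)) (at 0)"
    by (auto intro!: derivative_eq_intros)
  from has_derivative_compose[OF this, of f f'] assms
  have "((\<lambda>h::real. f (w + h *\<^sub>R v)) has_derivative (\<lambda>h. f' (h *\<^sub>R v))) (at 0)"
    by simp
  then show 1: "((\<lambda>h::real. f (w + h *\<^sub>R v)) has_vector_derivative f' v) (at 0)"
    using has_derivative_bounded_linear[OF assms]
    by (simp add: has_vector_derivative_def linear_simps)
  then show "dirder f v w = f' v"
    by (simp add: dirder_def vector_derivative_at)
qed

lemma elem_has_derivative:
  assumes "f \<in> elem" shows "(f has_derivative (\<lambda>v. dirder f v w)) (at w)"
proof -
  obtain f' where f': "\<And>w. (f has_derivative f' w) (at w)"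
    using elem_derivative[OF assms] by blast
  from has_derivative_dirder(2)[OF f'] have "(\<lambda>v. dirder f v w) = f' w" by auto
  with f' show ?thesis by simp
qed

lemma elem_dirder:
  assumes "f \<in> elem" shows "dirder f v \<in> elem"
proof -
  obtain f' where f': "\<And>w. (f has_derivative f' w) (at w)" "\<And>v. (\<lambda>w. f' w v) \<in> elem"
    using elem_derivative[OF assms] by blast
  from has_derivative_dirder(2)[OF f'(1)] have "dirder f v = (\<lambda>w. f' w v)" by auto
  with f' show ?thesis by simp
qed

lemma elem_continuous: "f \<in> elem \<Longrightarrow> continuous_on A f"
  by (meson continuous_at_imp_continuous_on elem_has_derivative has_derivative_continuous)

lemma elem_smooth: "f \<in> elem \<Longrightarrow> smooth_fun f"
proof -
  assume f: "f \<in> elem"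
  have *: "iter_dirder f vs \<in> elem" for vs
    by (induction vs) (auto intro: f elem_dirder)
  show ?thesis
    unfolding smooth_fun_def
    using elem_continuous[OF *] has_derivative_dirder(1)[OF elem_has_derivative[OF *]]
    by (force simp: has_vector_derivative_def differentiable_def)
qed

text \<open>Left translations of the group are affine maps in Euclidean coordinates, so this makes
  the class invariant under them.\<close>

lemma elem_affine:
  assumes "f \<in> elem" "bounded_linear T"
  shows "(\<lambda>w. f (a + T w)) \<in> elem"
  using assms(1)
proof induction
  case (lin l)
  have "(\<lambda>w. complex_of_real (l (a + T w))) = (\<lambda>w. complex_of_real (l a) + complex_of_real ((l \<circ> T) w))"
    by (auto simp: linear_simps[OF lin])
  moreover have "bounded_linear (l \<circ> T)"
    unfolding o_def by (rule bounded_linear_compose[OF lin assms(2)])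
  ultimately show ?case
    using elem.add[OF elem.const elem.lin] by metis
qed (auto intro: elem.intros)

lemma elem_uminus: "f \<in> elem \<Longrightarrow> (\<lambda>w. - f w) \<in> elem"
  using elem.mult[OF elem.const[of "-1"], of f] by simp

lemma elem_diff: "f \<in> elem \<Longrightarrow> g \<in> elem \<Longrightarrow> (\<lambda>w. f w - g w) \<in> elem"
  using elem.add[OF _ elem_uminus, of f g] by simp

lemma elem_sum: "(\<And>i. i \<in> I \<Longrightarrow> f i \<in> elem) \<Longrightarrow> (\<lambda>w. \<Sum>i\<in>I. f i w) \<in> elem"
  by (induction I rule: infinite_finite_induct) (auto intro: elem.intros)

section \<open>Square integrable functions and the unitary group\<close>

lemma ennpow_ennreal: "0 \<le> x \<Longrightarrow> ennpow (ennreal x) r = ennreal (x powr r)"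
  by (simp add: ennpow_def)

lemma ennpow_mono: "x \<le> y \<Longrightarrow> 0 \<le> r \<Longrightarrow> ennpow x r \<le> ennpow y r"
  unfolding ennpow_def
  by (cases x; cases y) (auto intro!: ennreal_leI powr_mono2 simp: top_unique)

lemma ennpow_two: "ennpow (ennreal (norm (z::complex))) 2 = ennreal ((norm z)\<^sup>2)"
  by (simp add: ennpow_ennreal)

lemma measurable_ennpow[measurable]: "(\<lambda>x. ennpow x r) \<in> borel_measurable borel"
  unfolding ennpow_def by measurable

lemma lpnorm_2: "lpnorm M 2 f = ennpow (\<integral>\<^sup>+ x. ennreal ((norm (f x))\<^sup>2) \<partial>M) (1/2)"
  unfolding lpnorm_def lpnorm_enn_def by (simp add: ennpow_two)

lemma lpnorm_2_integrable:
  assumes "integrable M (\<lambda>x. (norm (f x))\<^sup>2)"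
  shows "lpnorm M 2 f = ennreal (sqrt (\<integral>x. (norm (f x))\<^sup>2 \<partial>M))"
  using nn_integral_eq_integral[OF assms] by (simp add: lpnorm_2 ennpow_ennreal powr_half_sqrt)

lemma L2_iff: "L2 f \<longleftrightarrow> f \<in> borel_measurable lborel \<and> integrable lborel (\<lambda>x. (norm (f x))\<^sup>2)"
proof -
  have "lpnorm lborel 2 f < \<infinity> \<longleftrightarrow> (\<integral>\<^sup>+ x. ennreal ((norm (f x))\<^sup>2) \<partial>lborel) < \<infinity>"
    by (auto simp: lpnorm_2 ennpow_def less_top)
  then show ?thesis
    unfolding L2_def by (auto simp: integrable_iff_bounded)
qed

lemma borel_measurable_cnj[measurable]: "cnj \<in> borel_measurable borel"
  by (intro borel_measurable_continuous_onI continuous_intros)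

definition l2norm :: "('d::finite heis \<Rightarrow> complex) \<Rightarrow> real" where
  "l2norm f = sqrt (\<integral>x. (norm (f x))\<^sup>2 \<partial>lborel)"

lemma lpnorm_L2: "L2 f \<Longrightarrow> lpnorm lborel 2 f = ennreal (l2norm f)"
  by (simp add: L2_iff lpnorm_2_integrable l2norm_def)

lemma l2norm_nonneg: "0 \<le> l2norm f"
  by (simp add: l2norm_def)

lemma l2norm_sq: "(l2norm f)\<^sup>2 = (\<integral>x. (norm (f x))\<^sup>2 \<partial>lborel)"
  by (simp add: l2norm_def)

lemma L2_add: assumes "L2 f" "L2 g" shows "L2 (\<lambda>x. f x + g x)"
proof -
  have [measurable]: "f \<in> borel_measurable borel" "g \<in> borel_measurable borel"
    using assms by (auto simp: L2_iff)
  have "integrable lborel (\<lambda>x. 2 * (norm (f x))\<^sup>2 + 2 * (norm (g x))\<^sup>2)"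
    using assms by (auto simp: L2_iff)
  then have "integrable lborel (\<lambda>x. (norm (f x + g x))\<^sup>2)"
  proof (rule Bochner_Integration.integrable_bound)
    show "AE x in lborel. norm ((norm (f x + g x))\<^sup>2) \<le> norm (2 * (norm (f x))\<^sup>2 + 2 * (norm (g x))\<^sup>2)"
    proof (rule AE_I2)
      fix x
      have "(norm (f x + g x))\<^sup>2 \<le> (norm (f x) + norm (g x))\<^sup>2"
        by (intro power_mono norm_triangle_ineq norm_ge_zero)
      also have "\<dots> \<le> 2 * (norm (f x))\<^sup>2 + 2 * (norm (g x))\<^sup>2"
        using sum_squares_bound[of "norm (f x)" "norm (g x)"] by (simp add: power2_sum)
      finally show "norm ((norm (f x + g x))\<^sup>2) \<le> norm (2 * (norm (f x))\<^sup>2 + 2 * (norm (g x))\<^sup>2)"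
        by simp
    qed
  qed measurable
  then show ?thesis by (simp add: L2_iff)
qed

lemma L2_cmult: "L2 f \<Longrightarrow> L2 (\<lambda>x. c * f x)"
  by (auto simp: L2_iff norm_mult power_mult_distrib)

lemma L2_diff: "L2 f \<Longrightarrow> L2 g \<Longrightarrow> L2 (\<lambda>x. f x - g x)"
  using L2_add[OF _ L2_cmult[of g "-1"], of f] by simp

lemma l2norm_cmult: "l2norm (\<lambda>x. c * f x) = norm c * l2norm f"
  by (simp add: l2norm_def norm_mult power_mult_distrib real_sqrt_mult)

lemma l2norm_cong_AE:
  assumes "L2 f" "L2 g" "AE x in lborel. f x = g x" shows "l2norm f = l2norm g"
proof -
  have [measurable]: "f \<in> borel_measurable borel" "g \<in> borel_measurable borel"
    using assms by (auto simp: L2_iff)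
  show ?thesis
    unfolding l2norm_def
    by (intro arg_cong[where f = sqrt] integral_cong_AE) (use assms in auto)
qed

section \<open>The inner product and its polarization\<close>

definition ip :: "('d::finite heis \<Rightarrow> complex) \<Rightarrow> ('d heis \<Rightarrow> complex) \<Rightarrow> complex" where
  "ip f g = (\<integral>x. cnj (f x) * g x \<partial>lborel)"

lemma L2_product_bound:
  fixes f g :: "'d::finite heis \<Rightarrow> complex"
  assumes "L2 f" "L2 g"
  shows "integrable lborel (\<lambda>x. norm (f x) * norm (g x))"
    "(\<integral>x. norm (f x) * norm (g x) \<partial>lborel) \<le> l2norm f * l2norm g"
proof -
  have [measurable]: "f \<in> borel_measurable borel" "g \<in> borel_measurable borel"
    using assms by (auto simp: L2_iff)
  have F: "(\<integral>\<^sup>+x. ennreal (norm (f x)) ^ 2 \<partial>lborel) = ennreal ((l2norm f)\<^sup>2)"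
    and G: "(\<integral>\<^sup>+x. ennreal (norm (g x)) ^ 2 \<partial>lborel) = ennreal ((l2norm g)\<^sup>2)"
    using assms by (auto simp: L2_iff l2norm_sq ennreal_power intro!: nn_integral_eq_integral)
  define I where "I = (\<integral>\<^sup>+x. ennreal (norm (f x) * norm (g x)) \<partial>lborel)"
  have I: "I\<^sup>2 \<le> ennreal ((l2norm f * l2norm g)\<^sup>2)"
    using Cauchy_Schwarz_nn_integral[of "\<lambda>x. ennreal (norm (f x))" lborel "\<lambda>x. ennreal (norm (g x))"]
    unfolding I_def F G by (simp add: ennreal_mult power_mult_distrib)
  then have "I \<noteq> top"
    by (metis ennreal_neq_top ennreal_top_eq_mult_iff top.extremum_unique power2_eq_square zero_neq_one ennreal_zero_neq_top)
  then have fin: "I < \<infinity>" by (simp add: less_top)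
  show int: "integrable lborel (\<lambda>x. norm (f x) * norm (g x))"
    using fin by (intro integrableI_nonneg) (auto simp: I_def)
  have "I = ennreal (\<integral>x. norm (f x) * norm (g x) \<partial>lborel)"
    unfolding I_def by (rule nn_integral_eq_integral[OF int]) auto
  with I have "(\<integral>x. norm (f x) * norm (g x) \<partial>lborel)\<^sup>2 \<le> (l2norm f * l2norm g)\<^sup>2"
    by (simp add: ennreal_power integral_nonneg)
  then show "(\<integral>x. norm (f x) * norm (g x) \<partial>lborel) \<le> l2norm f * l2norm g"
    by (rule power2_le_imp_le) (simp add: l2norm_nonneg)
qed

lemma ip_integrable: 
  assumes "L2 f" "L2 g" shows "integrable lborel (\<lambda>x. cnj (f x) * g x)"
proof -
  have [measurable]: "f \<in> borel_measurable borel" "g \<in> borel_measurable borel"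
    using assms by (auto simp: L2_iff)
  show ?thesis
    by (rule Bochner_Integration.integrable_bound[OF L2_product_bound(1)[OF assms]])
       (auto simp: norm_mult)
qed

lemma norm_ip_le:
  assumes "L2 f" "L2 g" shows "norm (ip f g) \<le> l2norm f * l2norm g"
proof -
  have "norm (ip f g) \<le> (\<integral>x. norm (cnj (f x) * g x) \<partial>lborel)"
    unfolding ip_def by (rule integral_norm_bound)
  also have "\<dots> = (\<integral>x. norm (f x) * norm (g x) \<partial>lborel)"
    by (simp add: norm_mult)
  also have "\<dots> \<le> l2norm f * l2norm g"
    by (rule L2_product_bound(2)[OF assms])
  finally show ?thesis .
qed

lemma ip_add_right: "L2 f \<Longrightarrow> L2 g \<Longrightarrow> L2 h \<Longrightarrow> ip f (\<lambda>x. g x + h x) = ip f g + ip f h"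
  unfolding ip_def by (simp add: ip_integrable distrib_left)

lemma ip_add_left: "L2 f \<Longrightarrow> L2 g \<Longrightarrow> L2 h \<Longrightarrow> ip (\<lambda>x. f x + g x) h = ip f h + ip g h"
  unfolding ip_def by (simp add: ip_integrable distrib_right)

lemma ip_diff_right: "L2 f \<Longrightarrow> L2 g \<Longrightarrow> L2 h \<Longrightarrow> ip f (\<lambda>x. g x - h x) = ip f g - ip f h"
  unfolding ip_def by (simp add: ip_integrable right_diff_distrib)

lemma ip_diff_left: "L2 f \<Longrightarrow> L2 g \<Longrightarrow> L2 h \<Longrightarrow> ip (\<lambda>x. f x - g x) h = ip f h - ip g h"
  unfolding ip_def by (simp add: ip_integrable left_diff_distrib)

lemma ip_cmult_right: "ip f (\<lambda>x. c * g x) = c * ip f g"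
  unfolding ip_def by (simp add: mult.left_commute flip: integral_mult_right_zero)

lemma ip_cmult_left: "ip (\<lambda>x. c * f x) g = cnj c * ip f g"
  unfolding ip_def by (simp add: mult.assoc flip: integral_mult_right_zero)

lemma ip_cong_AE:
  assumes "L2 f" "L2 f'" "L2 g" "L2 g'" "AE x in lborel. f x = f' x" "AE x in lborel. g x = g' x"
  shows "ip f g = ip f' g'"
  unfolding ip_def
proof (rule integral_cong_AE)
  show "AE x in lborel. cnj (f x) * g x = cnj (f' x) * g' x"
    using assms(5,6) by eventually_elim simp
qed (use ip_integrable assms in \<open>blast intro: borel_measurable_integrable\<close>)+

lemma ip_self: "ip f f = complex_of_real ((l2norm f)\<^sup>2)"
proof -
  have "ip f f = (\<integral>x. complex_of_real ((norm (f x))\<^sup>2) \<partial>lborel)"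
    unfolding ip_def by (simp only: complex_norm_square mult.commute)
  also have "\<dots> = complex_of_real ((l2norm f)\<^sup>2)"
    unfolding l2norm_sq by (rule integral_complex_of_real)
  finally show ?thesis .
qed

lemma l2norm_triangle:
  assumes "L2 f" "L2 g" shows "l2norm (\<lambda>x. f x + g x) \<le> l2norm f + l2norm g"
proof -
  have fg: "L2 (\<lambda>x. f x + g x)" using assms by (rule L2_add)
  have "complex_of_real ((l2norm (\<lambda>x. f x + g x))\<^sup>2) = ip f f + ip g f + ip f g + ip g g"
    by (simp only: ip_self[symmetric] ip_add_right[OF fg assms] ip_add_left[OF assms assms(1)]
        ip_add_left[OF assms assms(2)] add.assoc)
  then have "(l2norm (\<lambda>x. f x + g x))\<^sup>2 = Re (ip f f + ip g f + ip f g + ip g g)"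
    by (metis Re_complex_of_real)
  also have "\<dots> = (l2norm f)\<^sup>2 + (l2norm g)\<^sup>2 + Re (ip g f) + Re (ip f g)"
    by (simp add: ip_self)
  also have "\<dots> \<le> (l2norm f + l2norm g)\<^sup>2"
    using norm_ip_le[OF assms] norm_ip_le[OF assms(2,1)] complex_Re_le_cmod[of "ip g f"]
      complex_Re_le_cmod[of "ip f g"]
    unfolding power2_sum by (simp only: mult.commute[of "l2norm g" "l2norm f"] mult.assoc)
  finally show ?thesis
    by (rule power2_le_imp_le) (simp add: l2norm_nonneg)
qed

text \<open>The isometry axiom speaks of norms; this identity turns it into preservation of inner
  products. \<open>ip\<close> is conjugate linear in its first argument, whence the sign of the \<i>
  term.\<close>

lemma ip_polarization:
  assumes "L2 f" "L2 g"
  shows "ip f g = complex_of_real ((l2norm (\<lambda>x. f x + g x))\<^sup>2 - (l2norm f)\<^sup>2 - (l2norm g)\<^sup>2) / 2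
    - \<i> * complex_of_real ((l2norm (\<lambda>x. f x + \<i> * g x))\<^sup>2 - (l2norm f)\<^sup>2 - (l2norm g)\<^sup>2) / 2"
proof -
  have fg: "L2 (\<lambda>x. f x + g x)" using assms by (rule L2_add)
  have ig: "L2 (\<lambda>x. \<i> * g x)" using assms by (intro L2_cmult)
  have fig: "L2 (\<lambda>x. f x + \<i> * g x)" using assms(1) ig by (rule L2_add)
  have 1: "complex_of_real ((l2norm (\<lambda>x. f x + g x))\<^sup>2) = ip f f + ip g f + (ip f g + ip g g)"
    by (simp only: ip_self[symmetric] ip_add_right[OF fg assms] ip_add_left[OF assms assms(1)]
        ip_add_left[OF assms assms(2)])
  have 2: "complex_of_real ((l2norm (\<lambda>x. f x + \<i> * g x))\<^sup>2) = ip f f - \<i> * ip g f + (\<i> * ip f g + ip g g)"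
    by (simp del: of_real_power add: ip_self[symmetric] ip_add_right[OF fig assms(1) ig] ip_add_left[OF assms(1) ig assms(1)]
        ip_add_left[OF assms(1) ig ig] ip_cmult_left ip_cmult_right)
  show ?thesis
    unfolding of_real_diff 1 2 ip_self[symmetric] by (simp add: field_simps)
qed

lemma continuous_compact_L2:
  assumes "continuous_on UNIV f" "compact S" "\<And>x. x \<notin> S \<Longrightarrow> f x = 0"
  shows "L2 f"
proof -
  have m: "f \<in> borel_measurable borel"
    using assms(1) by (rule borel_measurable_continuous_onI)
  have "integrable lborel (\<lambda>x. indicator S x *\<^sub>R (norm (f x))\<^sup>2)"
    by (intro borel_integrable_compact assms continuous_intros continuous_on_subset[OF assms(1)]) auto
  also have "(\<lambda>x. indicator S x *\<^sub>R (norm (f x))\<^sup>2) = (\<lambda>x. (norm (f x))\<^sup>2)"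
    using assms(3) by (auto simp: indicator_def fun_eq_iff)
  finally show ?thesis using m by (simp add: L2_iff)
qed

lemma test_fun_L2: 
  assumes "test_fun f" shows "L2 f"
proof (rule continuous_compact_L2)
  show "continuous_on UNIV f"
    using assms unfolding test_fun_def smooth_fun_def by (metis iter_dirder.simps(1))
  show "compact (closure {x. f x \<noteq> 0})" using assms by (simp add: test_fun_def)
  show "x \<notin> closure {x. f x \<noteq> 0} \<Longrightarrow> f x = 0" for x
    using closure_subset[of "{x. f x \<noteq> 0}"] by auto
qed

section \<open>Consequences of the group axioms\<close>

context
  fixes U :: "real \<Rightarrow> ('d::finite heis \<Rightarrow> complex) \<Rightarrow> ('d heis \<Rightarrow> complex)"
  assumes sg: "schroedinger_group U"
begin

lemma sg_L2: "L2 f \<Longrightarrow> L2 (U t f)"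
  using sg unfolding schroedinger_group_def by blast

lemma sg_add: "L2 f \<Longrightarrow> L2 g \<Longrightarrow> AE x in lborel. U t (\<lambda>y. f y + g y) x = U t f x + U t g x"
  using sg unfolding schroedinger_group_def by blast

lemma sg_cmult: "L2 f \<Longrightarrow> AE x in lborel. U t (\<lambda>y. c * f y) x = c * U t f x"
  using sg unfolding schroedinger_group_def by blast

lemma sg_zero: "L2 f \<Longrightarrow> AE x in lborel. U 0 f x = f x"
  using sg unfolding schroedinger_group_def by blast

lemma sg_plus: "L2 f \<Longrightarrow> AE x in lborel. U (s + t) f x = U s (U t f) x"
  using sg unfolding schroedinger_group_def by blast

lemma sg_norm: assumes "L2 f" shows "l2norm (U t f) = l2norm f"
proof -
  have "lpnorm lborel 2 (U t f) = lpnorm lborel 2 f"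
    using sg assms unfolding schroedinger_group_def by blast
  then show ?thesis
    using assms sg_L2[OF assms] by (simp add: lpnorm_L2 l2norm_nonneg)
qed

lemma sg_continuous:
  assumes "L2 f" shows "((\<lambda>t. l2norm (\<lambda>x. U t f x - U t0 f x)) \<longlongrightarrow> 0) (at t0)"
proof -
  have "((\<lambda>t. lpnorm lborel 2 (\<lambda>x. U t f x - U t0 f x)) \<longlongrightarrow> 0) (at t0)"
    using sg assms unfolding schroedinger_group_def by blast
  then have "((\<lambda>t. ennreal (l2norm (\<lambda>x. U t f x - U t0 f x))) \<longlongrightarrow> ennreal 0) (at t0)"
    by (simp add: lpnorm_L2[OF L2_diff] sg_L2 assms)
  then show ?thesis
    by (subst (asm) tendsto_ennreal_iff) (auto simp: l2norm_nonneg)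
qed

lemma sg_generator:
  assumes "test_fun \<phi>" "L2 (sublap \<phi>)"
  shows "((\<lambda>h. l2norm (\<lambda>x. (U h \<phi> x - \<phi> x) / complex_of_real h + \<i> * sublap \<phi> x)) \<longlongrightarrow> 0) (at 0)"
proof -
  have L: "L2 (\<lambda>x. (U h \<phi> x - \<phi> x) / complex_of_real h + \<i> * sublap \<phi> x)" for h
    using L2_add[OF L2_cmult[OF L2_diff[OF sg_L2[OF test_fun_L2[OF assms(1)], of h] test_fun_L2[OF assms(1)]],
          of "inverse (complex_of_real h)"]
        L2_cmult[OF assms(2), of \<i>]]
    by (simp add: divide_inverse mult.commute)
  have "((\<lambda>h. lpnorm lborel 2 (\<lambda>x. (U h \<phi> x - \<phi> x) / complex_of_real h + \<i> * sublap \<phi> x)) \<longlongrightarrow> 0) (at 0)"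
    using sg assms(1) unfolding schroedinger_group_def by blast
  then have "((\<lambda>h. ennreal (l2norm (\<lambda>x. (U h \<phi> x - \<phi> x) / complex_of_real h + \<i> * sublap \<phi> x))) \<longlongrightarrow> ennreal 0) (at 0)"
    by (simp add: lpnorm_L2[OF L])
  then show ?thesis
    by (subst (asm) tendsto_ennreal_iff) (auto simp: l2norm_nonneg)
qed

lemma sg_ip:
  assumes "L2 f" "L2 g" shows "ip (U t f) (U t g) = ip f g"
proof -
  have ig: "L2 (\<lambda>x. \<i> * g x)" using assms by (intro L2_cmult)
  have "l2norm (\<lambda>x. U t f x + U t g x) = l2norm (U t (\<lambda>x. f x + g x))"
    using sg_add[OF assms, of t]
    by (intro l2norm_cong_AE L2_add sg_L2 assms) (auto elim: eventually_mono)
  then have 1: "l2norm (\<lambda>x. U t f x + U t g x) = l2norm (\<lambda>x. f x + g x)"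
    by (simp add: sg_norm L2_add assms)
  have "AE x in lborel. U t f x + \<i> * U t g x = U t (\<lambda>x. f x + \<i> * g x) x"
    using sg_add[OF assms(1) ig, of t] sg_cmult[OF assms(2), where t = t and c = \<i>] by eventually_elim simp
  then have "l2norm (\<lambda>x. U t f x + \<i> * U t g x) = l2norm (U t (\<lambda>x. f x + \<i> * g x))"
    by (intro l2norm_cong_AE L2_add sg_L2 assms ig L2_cmult)
  then have 2: "l2norm (\<lambda>x. U t f x + \<i> * U t g x) = l2norm (\<lambda>x. f x + \<i> * g x)"
    by (simp add: sg_norm L2_add assms ig)
  show ?thesis
    using assms by (simp add: ip_polarization sg_L2 1 2 sg_norm)
qed

lemma sg_adjoint:
  assumes "L2 f" "L2 g" shows "ip f (U t g) = ip (U (- t) f) g"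
proof -
  have "AE x in lborel. f x = U t (U (- t) f) x"
    using sg_plus[OF assms(1), of t "-t"] sg_zero[OF assms(1)] by (auto elim: eventually_elim2)
  then have "ip f (U t g) = ip (U t (U (- t) f)) (U t g)"
    by (intro ip_cong_AE sg_L2 assms) auto
  also have "\<dots> = ip (U (- t) f) g"
    by (intro sg_ip sg_L2 assms)
  finally show ?thesis .
qed

text \<open>f is merely square integrable, so U s f need not be differentiable in s. By
  \<open>sg_adjoint\<close> its increment is moved onto the test function
  \<open>\<Phi> \<tau>\<close>, where the generator is known; the time step there is - h. The rest
  is the product rule, in which strong continuity suffices for the moving factor
  \<open>U (\<tau> + h) f\<close>.\<close>

lemma sg_pairing_derivative:
  assumes f: "L2 f"
    and test: "test_fun (\<Phi> \<tau>)" and S: "L2 (sublap (\<Phi> \<tau>))"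
    and L: "\<And>s. L2 (\<Phi> s)" and L': "L2 \<Phi>'"
    and D: "((\<lambda>h. l2norm (\<lambda>x. (\<Phi> (\<tau> + h) x - \<Phi> \<tau> x) / complex_of_real h - \<Phi>' x)) \<longlongrightarrow> 0) (at 0)"
  shows "((\<lambda>s. ip (\<Phi> s) (U s f)) has_vector_derivative
      ip (\<lambda>x. \<Phi>' x + \<i> * sublap (\<Phi> \<tau>) x) (U \<tau> f)) (at \<tau>)"
proof -
  define g where "g = U \<tau> f"
  define DQ where "DQ h = (\<lambda>x. (\<Phi> (\<tau> + h) x - \<Phi> \<tau> x) / complex_of_real h)" for h
  define GQ where "GQ h = (\<lambda>x. (U h (\<Phi> \<tau>) x - \<Phi> \<tau> x) / complex_of_real h + \<i> * sublap (\<Phi> \<tau>) x)" for h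
  note [intro] = L L' S f sg_L2
  have g: "L2 g" unfolding g_def by auto
  have L2div: "L2 u \<Longrightarrow> L2 (\<lambda>x. u x / c)" for u :: "'d heis \<Rightarrow> complex" and c
    using L2_cmult[of u "inverse c"] by (simp add: divide_inverse mult.commute)
  have LDQ: "L2 (DQ h)" for h
    unfolding DQ_def by (intro L2div L2_diff) auto
  have LGQ: "L2 (GQ h)" for h
    unfolding GQ_def by (intro L2div L2_diff L2_add L2_cmult) auto
  have iS: "L2 (\<lambda>x. \<i> * sublap (\<Phi> \<tau>) x)" by (intro L2_cmult) auto
  have quot: "(ip (\<Phi> (\<tau> + h)) (U (\<tau> + h) f) - ip (\<Phi> \<tau>) (U \<tau> f)) / complex_of_real h
      - ip (\<lambda>x. \<Phi>' x + \<i> * sublap (\<Phi> \<tau>) x) g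
    = ip (\<lambda>x. DQ h x - \<Phi>' x) (U (\<tau> + h) f) + ip \<Phi>' (\<lambda>x. U (\<tau> + h) f x - g x) - ip (GQ (- h)) g"
    if "h \<noteq> 0" for h
  proof -
    have "AE x in lborel. U (\<tau> + h) f x = U h g x"
      unfolding g_def using sg_plus[OF f, of h \<tau>] by (simp add: add.commute)
    then have "ip (\<Phi> \<tau>) (U (\<tau> + h) f) = ip (\<Phi> \<tau>) (U h g)"
      by (intro ip_cong_AE g sg_L2) auto
    also have "\<dots> = ip (U (- h) (\<Phi> \<tau>)) g"
      by (intro sg_adjoint g) auto
    finally have A: "ip (\<Phi> \<tau>) (U (\<tau> + h) f) = ip (U (- h) (\<Phi> \<tau>)) g" .
    have "ip (DQ h) (U (\<tau> + h) f) = ip (\<lambda>x. inverse (complex_of_real h) * (\<Phi> (\<tau> + h) x - \<Phi> \<tau> x)) (U (\<tau> + h) f)"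
      unfolding DQ_def by (simp add: divide_inverse mult.commute)
    also have "\<dots> = inverse (complex_of_real h) * (ip (\<Phi> (\<tau> + h)) (U (\<tau> + h) f) - ip (\<Phi> \<tau>) (U (\<tau> + h) f))"
      unfolding ip_cmult_left by (subst ip_diff_left) auto
    finally have B: "ip (DQ h) (U (\<tau> + h) f) = inverse (complex_of_real h) * (ip (\<Phi> (\<tau> + h)) (U (\<tau> + h) f) - ip (\<Phi> \<tau>) (U (\<tau> + h) f))" .
    have "ip (GQ (- h)) g = ip (\<lambda>x. inverse (complex_of_real (- h)) * (U (- h) (\<Phi> \<tau>) x - \<Phi> \<tau> x) + \<i> * sublap (\<Phi> \<tau>) x) g"
      unfolding GQ_def by (simp add: divide_inverse mult.commute)
    also have "\<dots> = ip (\<lambda>x. inverse (complex_of_real (- h)) * (U (- h) (\<Phi> \<tau>) x - \<Phi> \<tau> x)) g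
       + ip (\<lambda>x. \<i> * sublap (\<Phi> \<tau>) x) g"
      by (intro ip_add_left g iS L2_cmult L2_diff) auto
    also have "ip (\<lambda>x. inverse (complex_of_real (- h)) * (U (- h) (\<Phi> \<tau>) x - \<Phi> \<tau> x)) g
       = - inverse (complex_of_real h) * (ip (U (- h) (\<Phi> \<tau>)) g - ip (\<Phi> \<tau>) g)"
      unfolding ip_cmult_left by (subst ip_diff_left) (use g in auto)
    finally have C: "ip (GQ (- h)) g = - inverse (complex_of_real h) * (ip (U (- h) (\<Phi> \<tau>)) g - ip (\<Phi> \<tau>) g)
       + ip (\<lambda>x. \<i> * sublap (\<Phi> \<tau>) x) g" .
    have E: "ip (\<lambda>x. \<Phi>' x + \<i> * sublap (\<Phi> \<tau>) x) g = ip \<Phi>' g + ip (\<lambda>x. \<i> * sublap (\<Phi> \<tau>) x) g"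
      by (intro ip_add_left g iS) auto
    have F: "ip (\<lambda>x. DQ h x - \<Phi>' x) (U (\<tau> + h) f) = ip (DQ h) (U (\<tau> + h) f) - ip \<Phi>' (U (\<tau> + h) f)"
      by (intro ip_diff_left LDQ) auto
    have G: "ip \<Phi>' (\<lambda>x. U (\<tau> + h) f x - g x) = ip \<Phi>' (U (\<tau> + h) f) - ip \<Phi>' g"
      by (intro ip_diff_right g) auto
    show ?thesis
      unfolding E F G B C A g_def[symmetric] by (simp add: divide_inverse algebra_simps)
  qed
  have lim_DQ: "((\<lambda>h. l2norm (\<lambda>x. DQ h x - \<Phi>' x) * l2norm f) \<longlongrightarrow> 0) (at 0)"
    using tendsto_mult_left_zero[OF D] unfolding DQ_def .
  have lim_U: "((\<lambda>h. l2norm \<Phi>' * l2norm (\<lambda>x. U (\<tau> + h) f x - g x)) \<longlongrightarrow> 0) (at 0)"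
    using LIM_offset_zero[OF sg_continuous[OF f, of \<tau>]] unfolding g_def
    by (rule tendsto_mult_right_zero)
  have lim_G: "((\<lambda>h. l2norm (GQ (- h)) * l2norm g) \<longlongrightarrow> 0) (at 0)"
  proof (rule tendsto_mult_left_zero)
    have "((\<lambda>h. l2norm (GQ h)) \<longlongrightarrow> 0) (at 0)"
      using sg_generator[OF test S] unfolding GQ_def .
    then show "((\<lambda>h. l2norm (GQ (- h))) \<longlongrightarrow> 0) (at 0)"
    proof (rule filterlim_compose)
      show "filterlim uminus (at 0) (at (0::real))"
        by (auto simp: filterlim_at eventually_at_filter intro!: tendsto_eq_intros)
    qed
  qed
  have "((\<lambda>h. (ip (\<Phi> (\<tau> + h)) (U (\<tau> + h) f) - ip (\<Phi> \<tau>) (U \<tau> f)) / complex_of_real h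
      - ip (\<lambda>x. \<Phi>' x + \<i> * sublap (\<Phi> \<tau>) x) g) \<longlongrightarrow> 0) (at 0)"
  proof (rule Lim_null_comparison)
    show "((\<lambda>h. l2norm (\<lambda>x. DQ h x - \<Phi>' x) * l2norm f + l2norm \<Phi>' * l2norm (\<lambda>x. U (\<tau> + h) f x - g x)
        + l2norm (GQ (- h)) * l2norm g) \<longlongrightarrow> 0) (at 0)"
      using tendsto_add[OF tendsto_add[OF lim_DQ lim_U] lim_G] by simp
    have "norm (ip (\<lambda>x. DQ h x - \<Phi>' x) (U (\<tau> + h) f)) \<le> l2norm (\<lambda>x. DQ h x - \<Phi>' x) * l2norm f"
      "norm (ip \<Phi>' (\<lambda>x. U (\<tau> + h) f x - g x)) \<le> l2norm \<Phi>' * l2norm (\<lambda>x. U (\<tau> + h) f x - g x)"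
      "norm (ip (GQ (- h)) g) \<le> l2norm (GQ (- h)) * l2norm g" for h
      using norm_ip_le[OF L2_diff[OF LDQ L'] sg_L2[OF f], of h "\<tau> + h"] sg_norm[OF f, of "\<tau> + h"]
        norm_ip_le[OF L' L2_diff[OF sg_L2[OF f] g], of "\<tau> + h"] norm_ip_le[OF LGQ g, of "-h"] by auto
    then show "\<forall>\<^sub>F h in at 0. norm ((ip (\<Phi> (\<tau> + h)) (U (\<tau> + h) f) - ip (\<Phi> \<tau>) (U \<tau> f)) / complex_of_real h
      - ip (\<lambda>x. \<Phi>' x + \<i> * sublap (\<Phi> \<tau>) x) g)
      \<le> l2norm (\<lambda>x. DQ h x - \<Phi>' x) * l2norm f + l2norm \<Phi>' * l2norm (\<lambda>x. U (\<tau> + h) f x - g x)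
        + l2norm (GQ (- h)) * l2norm g"
      unfolding eventually_at_filter
    proof (intro always_eventually allI impI)
      fix h :: real assume "h \<noteq> 0"
      have tri: "norm (a + b - c) \<le> a' + b' + c'" if "norm a \<le> a'" "norm b \<le> b'" "norm c \<le> c'"
        for a b c :: complex and a' b' c'
        using norm_triangle_ineq4[of "a + b" c] norm_triangle_ineq[of a b] that by linarith
      show "norm ((ip (\<Phi> (\<tau> + h)) (U (\<tau> + h) f) - ip (\<Phi> \<tau>) (U \<tau> f)) / complex_of_real h
          - ip (\<lambda>x. \<Phi>' x + \<i> * sublap (\<Phi> \<tau>) x) g)
        \<le> l2norm (\<lambda>x. DQ h x - \<Phi>' x) * l2norm f + l2norm \<Phi>' * l2norm (\<lambda>x. U (\<tau> + h) f x - g x)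
          + l2norm (GQ (- h)) * l2norm g"
        unfolding quot[OF \<open>h \<noteq> 0\<close>] by (rule tri) fact+
    qed
  qed
  then have "((\<lambda>h. norm (ip (\<Phi> (\<tau> + h)) (U (\<tau> + h) f) - ip (\<Phi> \<tau>) (U \<tau> f)
      - h *\<^sub>R ip (\<lambda>x. \<Phi>' x + \<i> * sublap (\<Phi> \<tau>) x) g) / norm h) \<longlongrightarrow> 0) (at 0)"
  proof (rule Lim_transform_eventually[OF tendsto_norm_zero])
    have "norm (a / complex_of_real h - b) = norm (a - h *\<^sub>R b) / norm h" if "h \<noteq> 0" for a b h
    proof -
      have "a / complex_of_real h - b = (a - h *\<^sub>R b) / complex_of_real h"
        using that by (simp add: field_simps scaleR_conv_of_real)
      then show ?thesis by (simp add: norm_divide)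
    qed
    then show "\<forall>\<^sub>F h in at 0. norm ((ip (\<Phi> (\<tau> + h)) (U (\<tau> + h) f) - ip (\<Phi> \<tau>) (U \<tau> f)) / complex_of_real h
      - ip (\<lambda>x. \<Phi>' x + \<i> * sublap (\<Phi> \<tau>) x) g) =
      norm (ip (\<Phi> (\<tau> + h)) (U (\<tau> + h) f) - ip (\<Phi> \<tau>) (U \<tau> f)
      - h *\<^sub>R ip (\<lambda>x. \<Phi>' x + \<i> * sublap (\<Phi> \<tau>) x) g) / norm h"
      unfolding eventually_at_filter by (intro always_eventually allI impI) blast
  qed
  then have "((\<lambda>s. ip (\<Phi> s) (U s f)) has_vector_derivative
      ip (\<lambda>x. \<Phi>' x + \<i> * sublap (\<Phi> \<tau>) x) g) (at \<tau>)"
    unfolding has_vector_derivative_def has_derivative_at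
    by (simp add: bounded_linear_scaleR_left)
  then show ?thesis unfolding g_def .
qed

text \<open>K bounds the residual of \<Phi> as an approximate solution. This is the mean value
  inequality for the pairing, with \<open>sg_norm\<close> removing the group from the bound; it
  takes the place of a uniqueness theorem for the equation.\<close>

lemma sg_pairing_bound:
  assumes f: "L2 f"
    and test: "\<And>\<tau>. test_fun (\<Phi> \<tau>)" and S: "\<And>\<tau>. L2 (sublap (\<Phi> \<tau>))" and L': "\<And>\<tau>. L2 (\<Phi>' \<tau>)"
    and D: "\<And>\<tau>. ((\<lambda>h. l2norm (\<lambda>x. (\<Phi> (\<tau> + h) x - \<Phi> \<tau> x) / complex_of_real h - \<Phi>' \<tau> x)) \<longlongrightarrow> 0) (at 0)"
    and K: "\<And>\<tau>. \<tau> \<in> closed_segment 0 t \<Longrightarrow> l2norm (\<lambda>x. \<Phi>' \<tau> x + \<i> * sublap (\<Phi> \<tau>) x) \<le> K"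
  shows "norm (ip (\<Phi> t) (U t f) - ip (\<Phi> 0) f) \<le> K * l2norm f * \<bar>t\<bar>"
proof -
  have "norm (ip (\<Phi> t) (U t f) - ip (\<Phi> 0) (U 0 f)) \<le> K * l2norm f * norm (t - 0)"
  proof (rule differentiable_bound[where S = "closed_segment 0 t" and f = "\<lambda>s. ip (\<Phi> s) (U s f)"
          and x = t and y = 0
        and f' = "\<lambda>\<tau> h. h *\<^sub>R ip (\<lambda>x. \<Phi>' \<tau> x + \<i> * sublap (\<Phi> \<tau>) x) (U \<tau> f)"])
    fix \<tau> assume \<tau>: "\<tau> \<in> closed_segment 0 t"
    show "((\<lambda>s. ip (\<Phi> s) (U s f)) has_derivative
      (\<lambda>h. h *\<^sub>R ip (\<lambda>x. \<Phi>' \<tau> x + \<i> * sublap (\<Phi> \<tau>) x) (U \<tau> f))) (at \<tau> within closed_segment 0 t)"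
      unfolding has_vector_derivative_def[symmetric]
      by (rule has_vector_derivative_at_within[OF sg_pairing_derivative[OF f test S test_fun_L2[OF test] L' D]])
    have "norm (ip (\<lambda>x. \<Phi>' \<tau> x + \<i> * sublap (\<Phi> \<tau>) x) (U \<tau> f))
        \<le> l2norm (\<lambda>x. \<Phi>' \<tau> x + \<i> * sublap (\<Phi> \<tau>) x) * l2norm (U \<tau> f)"
      by (intro norm_ip_le L2_add L2_cmult S L' sg_L2 f)
    also have "\<dots> \<le> K * l2norm f"
      unfolding sg_norm[OF f] by (intro mult_right_mono K \<tau> l2norm_nonneg)
    finally show "onorm (\<lambda>h. h *\<^sub>R ip (\<lambda>x. \<Phi>' \<tau> x + \<i> * sublap (\<Phi> \<tau>) x) (U \<tau> f)) \<le> K * l2norm f"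
      by (intro onorm_le) (simp add: mult.commute mult_left_mono)
  qed auto
  moreover have "ip (\<Phi> 0) (U 0 f) = ip (\<Phi> 0) f"
    by (intro ip_cong_AE test_fun_L2 test sg_L2 f sg_zero) auto
  ultimately show ?thesis by simp
qed

end

section \<open>The Fourier kernel of a Gaussian and its contour rotation\<close>

text \<open>Absorbs a polynomial into an arbitrarily small part of an exponential, with an explicit
  constant: 1 + p * x is at most (1 + n * p / \<epsilon>) * (1 + \<epsilon> * x / n), and the last
  factor is at most exp (\<epsilon> * x / n).\<close>

lemma power_le_exp:
  fixes x p \<epsilon> :: real
  assumes "0 \<le> x" "0 \<le> p" "0 < \<epsilon>"
  shows "(1 + p * x) ^ n \<le> (1 + n * p / \<epsilon>) ^ n * exp (\<epsilon> * x)"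
proof (cases "n = 0")
  case True
  then show ?thesis using assms by simp
next
  case False
  have "1 + p * x \<le> (1 + n * p / \<epsilon>) * (1 + \<epsilon> * x / n)"
    using assms False by (simp add: field_simps)
  also have "\<dots> \<le> (1 + n * p / \<epsilon>) * exp (\<epsilon> * x / n)"
    using assms exp_ge_add_one_self[of "\<epsilon> * x / n"] by (intro mult_left_mono) auto
  finally have "(1 + p * x) ^ n \<le> ((1 + n * p / \<epsilon>) * exp (\<epsilon> * x / n)) ^ n"
    using assms by (intro power_mono) auto
  also have "\<dots> = (1 + n * p / \<epsilon>) ^ n * exp (\<epsilon> * x)"
    using False by (simp add: power_mult_distrib flip: exp_of_nat_mult)
  finally show ?thesis .
qed

lemma set_integrable_exp:
  fixes a :: real assumes "0 < a" shows "set_integrable lborel {0..} (\<lambda>x. exp (- a * x))"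
proof -
  have "(\<integral>\<^sup>+x. ennreal (exp (- a * x)) * indicator {0..} x \<partial>lborel) = ennreal (0 - (- exp (- a * 0) / a))"
  proof (rule nn_integral_FTC_atLeast)
    show "((\<lambda>x. - exp (- a * x) / a) \<longlongrightarrow> 0) at_top"
      using assms by real_asymp
  qed (use assms in \<open>auto intro!: derivative_eq_intros\<close>)
  then show ?thesis
    unfolding set_integrable_def
    by (intro integrableI_nonneg) (auto simp: ennreal_mult'' ennreal_indicator mult.commute)
qed

text \<open>Filling the removable singularity makes \<open>kD\<close> continuous at frequency 0,
  which is a vertex of the contour used later.\<close>

definition csinc :: "complex \<Rightarrow> complex" where
  "csinc z = (if z = 0 then 1 else sin z / z)"

lemma csinc_continuous: "continuous_on A csinc"
proof (rule continuous_at_imp_continuous_on, rule ballI)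
  fix z :: complex
  show "isCont csinc z"
  proof (cases "z = 0")
    case True
    have "((\<lambda>y. (sin y - sin 0) / (y - 0)) \<longlongrightarrow> cos (0::complex)) (at 0)"
      using DERIV_sin[of "0::complex"] by (simp only: has_field_derivative_iff)
    then have "((\<lambda>y. (sin y - sin 0) / (y - 0)) \<longlongrightarrow> 1) (at (0::complex))" by simp
    then have "(csinc \<longlongrightarrow> 1) (at 0)"
      by (rule Lim_transform_eventually) (auto simp: csinc_def eventually_at_filter)
    then show ?thesis using True by (simp add: isCont_def csinc_def)
  next
    case False
    then have "isCont (\<lambda>z. sin z / z) z" by (intro continuous_intros) auto
    moreover have "eventually (\<lambda>x. x \<noteq> 0) (nhds z)"
      using False by (metis t1_space_nhds)
    ultimately show ?thesis
      by (subst isCont_cong[where g = "\<lambda>z. sin z / z"]) (auto simp: csinc_def elim: eventually_mono)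
  qed
qed

text \<open>\<open>(b / kD) ^ d * exp (- (kE / kD) * r)\<close> is the \<open>\<lambda>\<close>-Fourier component at time \<open>t\<close> of the solution
  with initial value \<open>b ^ d * exp (- b * r)\<close>, where \<open>r\<close> is the squared norm of the horizontal part.\<close>

definition kD :: "real \<Rightarrow> real \<Rightarrow> complex \<Rightarrow> complex" where
  "kD b t l = cos (4 * l * t) - \<i> * b * (4 * t) * csinc (4 * l * t)"

definition kE :: "real \<Rightarrow> real \<Rightarrow> complex \<Rightarrow> complex" where
  "kE b t l = b * cos (4 * l * t) - \<i> * l * sin (4 * l * t)"

lemma kD_nonzero: "l \<noteq> 0 \<Longrightarrow> kD b t l = cos (4 * l * t) - \<i> * b * sin (4 * l * t) / l"
  by (simp add: kD_def csinc_def field_simps)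

lemma kD_zero: "kD b t 0 = 1 - \<i> * (4 * b * t)"
  by (simp add: kD_def csinc_def)

lemma kE_zero: "kE b t 0 = b"
  by (simp add: kE_def)

text \<open>The sign of Re (kE / kD) is that of Re (kE * cnj kD). The factor x^2 + y^2 clears the
  division by l in \<open>kD\<close>; the result is written with sin and cos of \<alpha>, sinh and
  cosh of \<beta>, so that its sign can be discussed term by term.\<close>

lemma Re_kE_kD:
  fixes l :: complex and t :: real
  assumes "l \<noteq> 0"
  defines "x \<equiv> Re l" and "y \<equiv> Im l" and "\<alpha> \<equiv> 4 * Re l * t" and "\<beta> \<equiv> 4 * Im l * t"
  shows "(x\<^sup>2 + y\<^sup>2) * Re (kE b t l * cnj (kD b t l)) =
     b * (x\<^sup>2 + y\<^sup>2 - 2 * y\<^sup>2 * (sin \<alpha>)\<^sup>2 + 2 * x\<^sup>2 * (sinh \<beta>)\<^sup>2)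
     + b\<^sup>2 * (x * (cosh \<beta> * sinh \<beta>) - y * (sin \<alpha> * cos \<alpha>))
     + (x\<^sup>2 + y\<^sup>2) * (x * (cosh \<beta> * sinh \<beta>) + y * (sin \<alpha> * cos \<alpha>))"
proof -
  define c where "c = cos (4 * l * t)"
  define s where "s = sin (4 * l * t)"
  define n where "n = x\<^sup>2 + y\<^sup>2"
  have n: "complex_of_real n = l * cnj l"
    by (simp add: n_def x_def y_def complex_mult_cnj)
  have ab: "Re (4 * l * t) = \<alpha>" "Im (4 * l * t) = \<beta>"
    by (auto simp: \<alpha>_def \<beta>_def)
  have c: "Re c = cos \<alpha> * cosh \<beta>" "Im c = - sin \<alpha> * sinh \<beta>"
    unfolding c_def Re_cos Im_cos ab by (simp_all add: cosh_field_def sinh_field_def field_simps)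
  have s: "Re s = sin \<alpha> * cosh \<beta>" "Im s = cos \<alpha> * sinh \<beta>"
    unfolding s_def Re_sin Im_sin ab by (simp_all add: cosh_field_def sinh_field_def field_simps)
  have D: "n * cnj (kD b t l) = n * cnj c + \<i> * b * l * cnj s"
    using assms(1) unfolding n kD_nonzero[OF assms(1)] c_def[symmetric] s_def[symmetric]
    by (simp add: field_simps)
  have E: "kE b t l = b * c - \<i> * l * s"
    by (simp add: kE_def c_def s_def)
  have "n * Re (kE b t l * cnj (kD b t l)) = Re (kE b t l * (n * cnj (kD b t l)))"
    by (simp add: algebra_simps)
  also have "\<dots> = Re ((b * c - \<i> * l * s) * (n * cnj c + \<i> * b * l * cnj s))"
    unfolding D E ..
  also have "\<dots> = b * n * ((Re c)\<^sup>2 + (Im c)\<^sup>2) + b * (x\<^sup>2 - y\<^sup>2) * ((Re s)\<^sup>2 + (Im s)\<^sup>2)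
      + b\<^sup>2 * (x * (Im s * Re c - Re s * Im c) - y * (Re s * Re c + Im s * Im c))
      + n * (x * (Im s * Re c - Re s * Im c) + y * (Re s * Re c + Im s * Im c))"
    unfolding x_def y_def by (simp add: power2_eq_square algebra_simps)
  also have "Im s * Re c - Re s * Im c = cosh \<beta> * sinh \<beta> * ((sin \<alpha>)\<^sup>2 + (cos \<alpha>)\<^sup>2)"
  proof -
    have "q * k * (q * h) - p * h * (- p * k) = h * k * (p\<^sup>2 + q\<^sup>2)" for p q h k :: real
      by (simp add: power2_eq_square algebra_simps)
    then show ?thesis unfolding c s by blast
  qed
  also have "\<dots> = cosh \<beta> * sinh \<beta>" by (simp only: sin_cos_squared_add mult_1_right)
  also have "Re s * Re c + Im s * Im c = sin \<alpha> * cos \<alpha> * ((cosh \<beta>)\<^sup>2 - (sinh \<beta>)\<^sup>2)"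
    unfolding c s by (simp add: power2_eq_square algebra_simps)
  also have "\<dots> = sin \<alpha> * cos \<alpha>" by (simp add: cosh_square_eq)
  also have "(Re c)\<^sup>2 + (Im c)\<^sup>2 = 1 - (sin \<alpha>)\<^sup>2 + (sinh \<beta>)\<^sup>2"
    unfolding c power_mult_distrib cosh_square_eq cos_squared_eq by (simp add: algebra_simps)
  also have "(Re s)\<^sup>2 + (Im s)\<^sup>2 = (sin \<alpha>)\<^sup>2 + (sinh \<beta>)\<^sup>2"
    unfolding s power_mult_distrib cosh_square_eq cos_squared_eq by (simp add: algebra_simps)
  finally show ?thesis unfolding n_def by (simp add: algebra_simps)
qed

text \<open>A conserved quantity: for real frequency the time derivative of kE * cnj kD is purely
  imaginary, so its real part keeps the initial value b.\<close>

lemma Re_kE_kD_real: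
  assumes "x \<noteq> 0"
  shows "Re (kE b t (complex_of_real x) * cnj (kD b t (complex_of_real x))) = b"
proof -
  have "x\<^sup>2 * Re (kE b t (complex_of_real x) * cnj (kD b t (complex_of_real x))) = x\<^sup>2 * b"
    using Re_kE_kD[of "complex_of_real x" b t] assms by (simp add: mult.commute)
  then show ?thesis using assms by simp
qed

lemma sinh_ge: assumes "0 \<le> x" shows "x \<le> sinh (x::real)"
proof -
  have "sinh 0 - 0 \<le> sinh x - x"
  proof (rule DERIV_nonneg_imp_nondecreasing[OF assms])
    fix y :: real
    show "\<exists>z. ((\<lambda>x. sinh x - x) has_real_derivative z) (at y) \<and> 0 \<le> z"
      using cosh_real_ge_1[of y] by (intro exI[of _ "cosh y - 1"]) (auto intro!: derivative_eq_intros)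
  qed
  then show ?thesis by simp
qed

text \<open>Every term of the formula that may be negative carries a factor y * sin \<alpha>. Since
  x * \<beta> = y * \<alpha>, the inequalities \<bar>sin \<alpha>\<bar> \<le> \<alpha> and \<beta>
  \<le> sinh \<beta> bound it by x * sinh \<beta>, which the positive terms supply. Two consequences
  are used: \<open>kD\<close> has no zeros in the closed first quadrant, and the Gaussian factor has
  modulus at most 1 there.\<close>

lemma Re_kE_kD_ge:
  assumes "0 \<le> Re l" "0 \<le> Im l" "0 \<le> t" "0 < b"
  shows "b \<le> Re (kE b t l * cnj (kD b t l))"
proof (cases "l = 0")
  case True
  then show ?thesis by (simp add: kE_zero kD_zero)
next
  case False
  define x y \<alpha> \<beta> where "x = Re l" "y = Im l" "\<alpha> = 4 * Re l * t" "\<beta> = 4 * Im l * t"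
  note def = this
  have n: "0 < x\<^sup>2 + y\<^sup>2"
    using False by (simp add: def complex_neq_0)
  have nn: "0 \<le> x" "0 \<le> y" "0 \<le> \<alpha>" "0 \<le> \<beta>" and eq: "x * \<beta> = y * \<alpha>"
    using assms by (auto simp: def)
  have sh: "\<beta> \<le> sinh \<beta>" using nn by (intro sinh_ge)
  have sn: "\<bar>sin \<alpha>\<bar> \<le> \<alpha>" using nn abs_sin_x_le_abs_x[of \<alpha>] by simp
  have 1: "y * \<bar>sin \<alpha>\<bar> \<le> x * sinh \<beta>"
    using mult_left_mono[OF sn nn(2)] mult_left_mono[OF sh nn(1)] eq by linarith
  then have "(y * \<bar>sin \<alpha>\<bar>)\<^sup>2 \<le> (x * sinh \<beta>)\<^sup>2"
    using nn by (intro power_mono) auto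
  then have 2: "y\<^sup>2 * (sin \<alpha>)\<^sup>2 \<le> x\<^sup>2 * (sinh \<beta>)\<^sup>2"
    by (simp add: power_mult_distrib)
  have "\<bar>y * (sin \<alpha> * cos \<alpha>)\<bar> = (y * \<bar>sin \<alpha>\<bar>) * \<bar>cos \<alpha>\<bar>"
    using nn by (simp add: abs_mult)
  also have "\<dots> \<le> y * \<bar>sin \<alpha>\<bar>"
    using nn by (intro mult_left_le) auto
  also have "\<dots> \<le> x * (cosh \<beta> * sinh \<beta>)"
    using 1 nn mult_left_mono[OF mult_right_mono[OF cosh_real_ge_1[of \<beta>], of "sinh \<beta>"], of x] by auto
  finally have 3: "0 \<le> x * (cosh \<beta> * sinh \<beta>) - y * (sin \<alpha> * cos \<alpha>)"
    "0 \<le> x * (cosh \<beta> * sinh \<beta>) + y * (sin \<alpha> * cos \<alpha>)" by linarith+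
  have "(x\<^sup>2 + y\<^sup>2) * b + 0 + 0 \<le> b * (x\<^sup>2 + y\<^sup>2 - 2 * y\<^sup>2 * (sin \<alpha>)\<^sup>2 + 2 * x\<^sup>2 * (sinh \<beta>)\<^sup>2)
     + b\<^sup>2 * (x * (cosh \<beta> * sinh \<beta>) - y * (sin \<alpha> * cos \<alpha>))
     + (x\<^sup>2 + y\<^sup>2) * (x * (cosh \<beta> * sinh \<beta>) + y * (sin \<alpha> * cos \<alpha>))"
  proof (intro add_mono mult_nonneg_nonneg 3)
    have "b * (x\<^sup>2 + y\<^sup>2) \<le> b * (x\<^sup>2 + y\<^sup>2 - 2 * y\<^sup>2 * (sin \<alpha>)\<^sup>2 + 2 * x\<^sup>2 * (sinh \<beta>)\<^sup>2)"
      using 2 assms(4) by (intro mult_left_mono) auto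
    then show "(x\<^sup>2 + y\<^sup>2) * b \<le> b * (x\<^sup>2 + y\<^sup>2 - 2 * y\<^sup>2 * (sin \<alpha>)\<^sup>2 + 2 * x\<^sup>2 * (sinh \<beta>)\<^sup>2)"
      by (simp add: mult.commute)
  qed auto
  also have "\<dots> = (x\<^sup>2 + y\<^sup>2) * Re (kE b t l * cnj (kD b t l))"
    using Re_kE_kD[OF False, of b t] by (simp add: def)
  finally show ?thesis using n by simp
qed

lemma Re_divide_norm: "Re (u / v) = Re (u * cnj v) / (norm v)\<^sup>2"
  by (subst complex_div_cnj) (simp only: Re_divide_of_real of_real_power[symmetric])

lemma kD_neq_0:
  assumes "0 \<le> Re l" "0 \<le> Im l" "0 \<le> t" "0 < b" shows "kD b t l \<noteq> 0"
  using Re_kE_kD_ge[OF assms] assms(4) by force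

lemma kD_real_neq_0:
  assumes "x \<noteq> 0" "0 < b" shows "kD b t (complex_of_real x) \<noteq> 0"
  using Re_kE_kD_real[OF assms(1), of b t] assms(2) by force

text \<open>2 * l * kD is the sum of (l + b) and (l - b) times the two exponentials of frequency 4 *
  l * t, whose moduli are exp \<beta> and exp (- \<beta>).\<close>

lemma kD_lower_bound:
  fixes t :: real assumes "0 \<le> Re l" "0 < b" "l \<noteq> 0"
  defines "\<beta> \<equiv> 4 * Im l * t"
  shows "norm (l + b) * exp \<beta> - norm (l - b) * exp (- \<beta>) \<le> 2 * norm (l * kD b t l)"
proof -
  have e: "norm (exp (\<i> * (4 * l * t))) = exp (- \<beta>)" "norm (exp (- (\<i> * (4 * l * t)))) = exp \<beta>"
    by (simp_all add: \<beta>_def norm_exp_eq_Re)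
  have "2 * (l * kD b t l) = (l + b) * exp (- (\<i> * (4 * l * t))) + (l - b) * exp (\<i> * (4 * l * t))"
    using assms(3) by (simp add: kD_nonzero cos_exp_eq sin_exp_eq field_simps)
  then have "norm (2 * (l * kD b t l)) = norm ((l + b) * exp (- (\<i> * (4 * l * t))) + (l - b) * exp (\<i> * (4 * l * t)))"
    by simp
  also have "\<dots> \<ge> norm ((l + b) * exp (- (\<i> * (4 * l * t)))) - norm ((l - b) * exp (\<i> * (4 * l * t)))"
    using norm_diff_ineq by blast
  finally show ?thesis by (simp add: norm_mult e \<beta>_def)
qed

text \<open>Two mechanisms separate the terms of \<open>kD_lower_bound\<close>. Near the real end it
  is the gap between the moduli of l + b and l - b: their squares differ by 4 * b * Re l, and their
  sum is at most 4 * R, so the gap is at least b / 2. Near the imaginary end it is the gap between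
  the exponentials: 1 / (4 * t) \<le> R forces 2 \<le> exp (2 * \<beta>).\<close>

lemma kD_hypotenuse_bound:
  assumes l: "0 \<le> Re l" "0 \<le> Im l" "Re l + Im l = R" and "0 < b" "0 < t" "b \<le> R" "1 / (4 * t) \<le> R"
  shows "b / 4 * exp (4 * Im l * t) \<le> norm (l * kD b t l)"
proof -
  have l0: "l \<noteq> 0" using assms by auto
  have R: "0 < R" using assms by linarith
  have np: "norm (l - b) \<le> norm (l + b)"
    unfolding cmod_def using assms by (intro real_sqrt_le_mono) (auto simp: power2_eq_square algebra_simps)
  let ?\<beta> = "4 * Im l * t"
  have \<beta>: "0 \<le> ?\<beta>" using assms by auto
  have main: "norm (l + b) * exp ?\<beta> - norm (l - b) * exp (- ?\<beta>) \<le> 2 * norm (l * kD b t l)"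
    by (rule kD_lower_bound) (use assms l0 in auto)
  show ?thesis
  proof (cases "R / 2 \<le> Re l")
    case True
    have "norm l \<le> R" using cmod_le[of l] assms by auto
    then have sum: "norm (l + b) + norm (l - b) \<le> 4 * R"
      using norm_triangle_ineq[of l b] norm_triangle_ineq4[of l b] assms by auto
    have "2 * R * b \<le> 4 * Re l * b" using True assms by auto
    also have "\<dots> = (norm (l + b))\<^sup>2 - (norm (l - b))\<^sup>2"
      unfolding cmod_power2 by (simp add: power2_eq_square algebra_simps)
    also have "\<dots> = (norm (l + b) - norm (l - b)) * (norm (l + b) + norm (l - b))"
      by (simp add: power2_eq_square algebra_simps)
    also have "\<dots> \<le> (norm (l + b) - norm (l - b)) * (4 * R)"
      using np sum by (intro mult_left_mono) auto
    finally have "R * (2 * b) \<le> R * (4 * (norm (l + b) - norm (l - b)))" by (simp add: algebra_simps)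
    then have d: "b / 2 \<le> norm (l + b) - norm (l - b)" using R by simp
    have "b / 2 * exp ?\<beta> \<le> (norm (l + b) - norm (l - b)) * exp ?\<beta>"
      using d by (intro mult_right_mono) auto
    also have "\<dots> \<le> norm (l + b) * exp ?\<beta> - norm (l - b) * exp (- ?\<beta>)"
      using \<beta> by (simp add: left_diff_distrib mult_left_mono)
    finally show ?thesis using main by simp
  next
    case False
    then have y: "R / 2 \<le> Im l" using l by simp
    have "1 \<le> 4 * R * t" using assms by (simp add: field_simps)
    also have "\<dots> \<le> 2 * ?\<beta>" using y assms by simp
    finally have "exp 1 \<le> exp (2 * ?\<beta>)" by simp
    then have "2 \<le> exp (2 * ?\<beta>)" using exp_ge_add_one_self[of 1] by linarith
    then have "2 * exp (- ?\<beta>) \<le> exp (2 * ?\<beta>) * exp (- ?\<beta>)"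
      by (intro mult_right_mono) auto
    also have "\<dots> = exp ?\<beta>" by (simp flip: exp_add)
    finally have e: "exp (- ?\<beta>) \<le> exp ?\<beta> / 2" by simp
    have lb: "b \<le> norm (l + b)" using complex_Re_le_cmod[of "l + b"] assms by auto
    have "b * (exp ?\<beta> / 2) \<le> norm (l + b) * (exp ?\<beta> - exp (- ?\<beta>))"
      using lb e assms by (intro mult_mono) auto
    also have "\<dots> \<le> norm (l + b) * exp ?\<beta> - norm (l - b) * exp (- ?\<beta>)"
      using np by (simp add: right_diff_distrib mult_right_mono)
    finally show ?thesis using main by simp
  qed
qed

text \<open>For real frequency \<open>kD_lower_bound\<close> reads min x b \<le> x * norm kD. The
  resulting bound is polynomial in x and uniform in time, hence integrable against exp (- \<delta> *
  x).\<close>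

lemma kD_real_bound:
  assumes "0 < x" "0 < b" shows "b / norm (kD b t (complex_of_real x)) \<le> b + x"
proof -
  let ?D = "kD b t (complex_of_real x)"
  have "norm (complex_of_real x + b) - norm (complex_of_real x - b) \<le> 2 * norm (x * ?D)"
    using kD_lower_bound[of "complex_of_real x" b t] assms by simp
  moreover have "norm (complex_of_real x + b) = x + b" "norm (complex_of_real x - b) = \<bar>x - b\<bar>"
    using assms by (simp_all flip: of_real_add of_real_diff)
  ultimately have "2 * min x b \<le> 2 * (x * norm ?D)" using assms by (auto simp: norm_mult)
  then have *: "min x b \<le> x * norm ?D" by simp
  have D: "0 < norm ?D" using kD_real_neq_0 assms by auto
  have "b * x \<le> (b + x) * min x b"
    using assms by (auto simp: min_def algebra_simps)
  also have "\<dots> \<le> (b + x) * (x * norm ?D)"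
    using * assms by (intro mult_left_mono) auto
  finally have "x * b \<le> x * ((b + x) * norm ?D)" by (simp add: algebra_simps)
  then have "b \<le> (b + x) * norm ?D" using assms by (simp only: mult_le_cancel_left_pos)
  then show ?thesis using D by (simp add: pos_divide_le_eq)
qed

text \<open>At frequency \<i> * \<nu> the sine and cosine become hyperbolic. Keeping only the
  imaginary part of \<open>kD\<close> gives \<nu> / sinh (4 * \<nu> * t), from which b has
  cancelled. The decay exp (- 4 * \<nu> * t), raised to the power d, produces the critical value 4 *
  d.\<close>

lemma kD_imaginary_bound:
  assumes "0 \<le> \<nu>" "0 < b" "0 < t"
  shows "b / norm (kD b t (\<i> * complex_of_real \<nu>)) \<le> (1 + 8 * (\<nu> * t)) * exp (- 4 * (\<nu> * t)) / (4 * t)"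
proof (cases "\<nu> = 0")
  case True
  have "4 * b * t \<le> norm (1 - \<i> * (4 * b * t))"
    using abs_Im_le_cmod[of "1 - \<i> * (4 * b * t)"] assms by simp
  moreover have "0 < 4 * b * t" using assms by simp
  ultimately have "b / norm (1 - \<i> * (4 * b * t)) \<le> b / (4 * b * t)"
    using assms by (intro divide_left_mono mult_pos_pos) auto
  then show ?thesis using True assms by (simp add: kD_zero)
next
  case False
  then have \<nu>: "0 < \<nu>" using assms by simp
  define \<mu> where "\<mu> = \<nu> * t"
  have \<mu>: "0 < \<mu>" using \<nu> assms by (simp add: \<mu>_def)
  have s: "sin (\<i> * complex_of_real (4 * \<mu>)) = \<i> * sinh (4 * \<mu>)"
    by (simp add: complex_eq_iff Re_sin Im_sin sinh_field_def)
  have c: "cos (\<i> * complex_of_real (4 * \<mu>)) = cosh (4 * \<mu>)"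
    by (simp add: complex_eq_iff Re_cos Im_cos cosh_field_def)
  have "kD b t (\<i> * \<nu>) = cosh (4 * \<mu>) - \<i> * b * sin (\<i> * complex_of_real (4 * \<mu>)) / (\<i> * \<nu>)"
  proof -
    have eq: "4 * (\<i> * complex_of_real \<nu>) * complex_of_real t = \<i> * complex_of_real (4 * \<mu>)"
      by (simp add: \<mu>_def)
    show ?thesis using \<nu> kD_nonzero[of "\<i> * \<nu>" b t] unfolding eq c by simp
  qed
  also have "\<dots> = cosh (4 * \<mu>) - \<i> * (b * sinh (4 * \<mu>) / \<nu>)"
    unfolding s using \<nu> by (simp add: field_simps)
  finally have "Im (kD b t (\<i> * \<nu>)) = - (b * sinh (4 * \<mu>) / \<nu>)"
    by simp
  then have D: "b * sinh (4 * \<mu>) / \<nu> \<le> norm (kD b t (\<i> * \<nu>))"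
    using abs_Im_le_cmod[of "kD b t (\<i> * \<nu>)"] by linarith
  have "1 + 8 * \<mu> \<le> exp (8 * \<mu>)" by (rule exp_ge_add_one_self)
  then have "8 * \<mu> * exp (8 * \<mu>) \<le> (exp (8 * \<mu>) - 1) * (1 + 8 * \<mu>)" by (simp add: algebra_simps)
  then have "8 * \<mu> * exp (8 * \<mu>) * exp (- 4 * \<mu>) \<le> (exp (8 * \<mu>) - 1) * (1 + 8 * \<mu>) * exp (- 4 * \<mu>)"
    by (intro mult_right_mono) auto
  moreover have "exp (8 * \<mu>) * exp (- 4 * \<mu>) = exp (4 * \<mu>)" by (simp flip: exp_add)
  ultimately have "8 * \<mu> * exp (4 * \<mu>) \<le> (exp (4 * \<mu>) - exp (- 4 * \<mu>)) * (1 + 8 * \<mu>)"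
    by (simp add: algebra_simps)
  then have sh: "4 * \<mu> * exp (4 * \<mu>) \<le> sinh (4 * \<mu>) * (1 + 8 * \<mu>)"
    by (simp add: sinh_field_def field_simps)
  have sh0: "0 < sinh (4 * \<mu>)" using \<mu> by simp
  have "b / norm (kD b t (\<i> * \<nu>)) \<le> b / (b * sinh (4 * \<mu>) / \<nu>)"
  proof -
    have "0 < b * sinh (4 * \<mu>) / \<nu>" using assms sh0 \<nu> by (intro divide_pos_pos mult_pos_pos)
    then show ?thesis using D assms by (intro divide_left_mono mult_pos_pos) linarith+
  qed
  also have "\<dots> = \<nu> / sinh (4 * \<mu>)" using assms by simp
  also have "\<dots> \<le> (1 + 8 * \<mu>) * exp (- 4 * \<mu>) / (4 * t)"
  proof -
    have "4 * \<mu> \<le> sinh (4 * \<mu>) * (1 + 8 * \<mu>) * exp (- 4 * \<mu>)"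
      using mult_right_mono[OF sh, of "exp (- 4 * \<mu>)"] by (simp add: mult.assoc flip: exp_add)
    then show ?thesis using sh0 assms by (simp add: field_simps \<mu>_def)
  qed
  finally show ?thesis unfolding \<mu>_def .
qed

section \<open>The Fourier integrand at complex frequency and its bounds on the sides of a
  triangle\<close>

definition kG :: "nat \<Rightarrow> real \<Rightarrow> real \<Rightarrow> real \<Rightarrow> real \<Rightarrow> real \<Rightarrow> complex \<Rightarrow> complex" where
  "kG d b \<delta> t r s l = (b / kD b t l) ^ d * exp (- \<delta> * l + \<i> * l * s - kE b t l / kD b t l * r)"

lemma norm_kG:
  assumes "0 < b"
  shows "norm (kG d b \<delta> t r s l) = (b / norm (kD b t l)) ^ d
    * exp (- \<delta> * Re l - s * Im l - Re (kE b t l * cnj (kD b t l)) / (norm (kD b t l))\<^sup>2 * r)"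
proof -
  have "Re (- \<delta> * l + \<i> * l * s - kE b t l / kD b t l * r)
      = - \<delta> * Re l - s * Im l - Re (kE b t l / kD b t l) * r"
    by (simp add: times_divide_eq_left[symmetric] del: times_divide_eq_left)
  then show ?thesis
    using assms unfolding kG_def norm_mult norm_exp_eq_Re Re_divide_norm by (simp add: norm_power norm_divide)
qed

text \<open>In the closed first quadrant \<open>Re_kE_kD_ge\<close> lets the Gaussian factor be
  dropped, which is why the later bounds are uniform in r.\<close>

lemma norm_kG_le:
  assumes "0 < b" "0 \<le> Re l" "0 \<le> Im l" "0 \<le> t" "0 \<le> r"
  shows "norm (kG d b \<delta> t r s l) \<le> (b / norm (kD b t l)) ^ d * exp (- \<delta> * Re l + \<bar>s\<bar> * Im l)"
proof -
  have "0 \<le> Re (kE b t l * cnj (kD b t l)) / (norm (kD b t l))\<^sup>2 * r"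
    using Re_kE_kD_ge[of l t b] assms by (intro mult_nonneg_nonneg divide_nonneg_nonneg) auto
  moreover have "- s * Im l \<le> \<bar>s\<bar> * Im l"
    using assms by (intro mult_right_mono) auto
  ultimately show ?thesis
    using assms unfolding norm_kG[OF assms(1)] by (intro mult_left_mono) auto
qed

lemma continuous_on_kD: "continuous_on A (kD b t)" and continuous_on_kE: "continuous_on A (kE b t)"
proof -
  have "continuous_on A (\<lambda>l. csinc (4 * l * complex_of_real t))"
    by (rule continuous_on_compose2[OF csinc_continuous[of UNIV]]) (auto intro!: continuous_intros)
  then show "continuous_on A (kD b t)"
    unfolding kD_def by (intro continuous_intros)
  show "continuous_on A (kE b t)"
    unfolding kE_def by (intro continuous_intros)
qed

lemma continuous_on_kG:
  assumes "\<And>l. l \<in> A \<Longrightarrow> kD b t l \<noteq> 0" shows "continuous_on A (kG d b \<delta> t r s)"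
  unfolding kG_def by (intro continuous_intros continuous_on_kD continuous_on_kE) (use assms in blast)+

lemma kG_field_differentiable:
  assumes "l \<noteq> 0" "kD b t l \<noteq> 0"
  shows "kG d b \<delta> t r s field_differentiable at l"
proof -
  have D: "kD b t field_differentiable at l"
  proof -
    obtain D' where "((\<lambda>l. cos (4 * l * t) - \<i> * b * sin (4 * l * t) / l) has_field_derivative D') (at l)"
      using assms(1) by (auto intro!: that derivative_eq_intros)
    then have "(kD b t has_field_derivative D') (at l)"
      by (rule has_field_derivative_transform_within_open[of _ _ _ "- {0}"]) (use assms in \<open>auto simp: kD_nonzero\<close>)
    then show ?thesis by (auto simp: field_differentiable_def)
  qed
  have E: "kE b t field_differentiable at l"
    unfolding kE_def field_differentiable_def by (auto intro!: exI derivative_eq_intros)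
  obtain D' where D': "(kD b t has_field_derivative D') (at l)"
    using D by (auto simp: field_differentiable_def)
  obtain E' where E': "(kE b t has_field_derivative E') (at l)"
    using E by (auto simp: field_differentiable_def)
  show ?thesis
    unfolding kG_def field_differentiable_def
    using assms by (auto intro!: exI derivative_eq_intros D' E')
qed

lemma kG_real_bound:
  assumes "0 < b" "0 \<le> t" "0 \<le> r" "0 < x"
  shows "norm (kG d b \<delta> t r s (complex_of_real x)) \<le> (b + x) ^ d * exp (- \<delta> * x)"
proof -
  have "norm (kG d b \<delta> t r s (complex_of_real x)) \<le> (b / norm (kD b t x)) ^ d * exp (- \<delta> * x)"
    using norm_kG_le[of b "complex_of_real x" t r d \<delta> s] assms by simp
  also have "\<dots> \<le> (b + x) ^ d * exp (- \<delta> * x)"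
    using assms kD_real_bound[of x b t] by (intro mult_right_mono power_mono) auto
  finally show ?thesis .
qed

lemma set_integrable_poly_exp:
  fixes b \<delta> :: real
  assumes "0 < b" "0 < \<delta>"
  shows "set_integrable lborel {0..} (\<lambda>x. (b + x) ^ d * exp (- \<delta> * x))"
proof -
  define K where "K = b ^ d * (1 + d * (1 / b) / (\<delta> / 2)) ^ d"
  have "set_integrable lborel {0..} (\<lambda>x. K * exp (- (\<delta> / 2) * x))"
    using set_integrable_exp[of "\<delta> / 2"] assms by (intro set_integrable_mult_right) auto
  then show ?thesis
  proof (rule set_integrable_bound)
    show "set_borel_measurable lborel {0..} (\<lambda>x. (b + x) ^ d * exp (- \<delta> * x))"
      unfolding set_borel_measurable_def by measurable
    show "AE x in lborel. x \<in> {0..} \<longrightarrow> norm ((b + x) ^ d * exp (- \<delta> * x)) \<le> norm (K * exp (- (\<delta> / 2) * x))"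
    proof (intro AE_I2 impI)
      fix x :: real assume "x \<in> {0..}"
      then have x: "0 \<le> x" by simp
      have "(b + x) ^ d = b ^ d * (1 + 1 / b * x) ^ d"
        using assms by (simp add: field_simps flip: power_mult_distrib)
      also have "\<dots> \<le> b ^ d * ((1 + d * (1 / b) / (\<delta> / 2)) ^ d * exp (\<delta> / 2 * x))"
        using assms x by (intro mult_left_mono power_le_exp) auto
      finally have "(b + x) ^ d * exp (- \<delta> * x) \<le> K * exp (\<delta> / 2 * x) * exp (- \<delta> * x)"
        unfolding K_def by (intro mult_right_mono) (simp_all only: mult.assoc exp_ge_zero)
      also have "\<dots> = K * exp (- (\<delta> / 2) * x)"
        by (simp add: mult.assoc flip: exp_add)
      finally show "norm ((b + x) ^ d * exp (- \<delta> * x)) \<le> norm (K * exp (- (\<delta> / 2) * x))"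
        using assms x by (simp add: K_def)
    qed
  qed
qed

lemma kG_integrable:
  assumes "0 < b" "0 < \<delta>" "0 \<le> t" "0 \<le> r"
  shows "set_integrable lborel {0..} (\<lambda>x. kG d b \<delta> t r s (complex_of_real x))"
proof (rule set_integrable_bound[OF set_integrable_poly_exp[OF assms(1,2), of d]])
  have "continuous_on {0..} (\<lambda>x. kG d b \<delta> t r s (complex_of_real x))"
    by (rule continuous_on_compose2[OF continuous_on_kG[of "complex_of_real ` {0..}"]])
       (use assms kD_neq_0 in \<open>auto intro!: continuous_intros\<close>)
  then show "set_borel_measurable lborel {0..} (\<lambda>x. kG d b \<delta> t r s (complex_of_real x))"
    unfolding set_borel_measurable_def by (simp add: borel_measurable_continuous_on_indicator)
  show "AE x in lborel. x \<in> {0..} \<longrightarrow> norm (kG d b \<delta> t r s (complex_of_real x)) \<le> norm ((b + x) ^ d * exp (- \<delta> * x))"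
    using AE_lborel_singleton[of "0::real"]
  proof eventually_elim
    case (elim x)
    then show ?case
      using kG_real_bound[OF assms(1,3,4), of x d \<delta> s] assms(1) by auto
  qed
qed

text \<open>The decay exp (- 4 * d * \<nu> * t) beats the growth exp (\<bar>s\<bar> * \<nu>) by exp
  (- c * \<nu> * t). Half of that rate absorbs (1 + 8 * \<nu> * t) ^ d through
  \<open>power_le_exp\<close>, whence 16 * d / c = d * 8 / (c / 2); the other half remains for the
  integration in \<nu>.\<close>

lemma kG_imaginary_bound:
  assumes "0 < b" "0 < t" "0 \<le> r" "0 \<le> \<nu>" "0 < c" "\<bar>s\<bar> \<le> (4 * d - c) * t"
  shows "norm (kG d b \<delta> t r s (\<i> * complex_of_real \<nu>))
    \<le> ((1 + 16 * real d / c) / (4 * t)) ^ d * exp (- (c * t / 2) * \<nu>)"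
proof -
  define \<mu> where "\<mu> = \<nu> * t"
  have \<mu>: "0 \<le> \<mu>" using assms by (simp add: \<mu>_def)
  have s: "\<bar>s\<bar> * \<nu> \<le> (4 * d - c) * \<mu>"
    using mult_right_mono[OF assms(6) assms(4)] by (simp add: \<mu>_def algebra_simps)
  have "norm (kG d b \<delta> t r s (\<i> * \<nu>)) \<le> (b / norm (kD b t (\<i> * \<nu>))) ^ d * exp (\<bar>s\<bar> * \<nu>)"
    using norm_kG_le[of b "\<i> * \<nu>" t r d \<delta> s] assms by simp
  also have "\<dots> \<le> ((1 + 8 * \<mu>) * exp (- 4 * \<mu>) / (4 * t)) ^ d * exp ((4 * d - c) * \<mu>)"
    using kD_imaginary_bound[of \<nu> b t] s assms
    by (intro mult_mono power_mono) (auto simp: \<mu>_def)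
  also have "\<dots> = (1 + 8 * \<mu>) ^ d * exp (- c * \<mu>) / (4 * t) ^ d"
  proof -
    have "exp (- 4 * \<mu>) ^ d * exp ((4 * d - c) * \<mu>) = exp (- c * \<mu>)"
      by (simp add: algebra_simps flip: exp_of_nat_mult exp_add)
    then show ?thesis by (simp add: power_mult_distrib power_divide mult.assoc)
  qed
  also have "\<dots> \<le> ((1 + 16 * real d / c) ^ d * exp (c / 2 * \<mu>)) * exp (- c * \<mu>) / (4 * t) ^ d"
  proof (intro divide_right_mono mult_right_mono)
    have "real d * 8 / (c / 2) = 16 * real d / c" by simp
    then show "(1 + 8 * \<mu>) ^ d \<le> (1 + 16 * real d / c) ^ d * exp (c / 2 * \<mu>)"
      using \<mu> assms power_le_exp[of \<mu> 8 "c / 2" d] by (simp only:)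
  qed (use assms in auto)
  also have "\<dots> = ((1 + 16 * real d / c) / (4 * t)) ^ d * exp (- (c * t / 2) * \<nu>)"
    by (simp add: \<mu>_def power_divide mult.assoc flip: exp_add)
  finally show ?thesis .
qed

text \<open>Along the hypotenuse the decay rate is \<delta> in the real part of l and 4 * d * t -
  \<bar>s\<bar> in its imaginary part; m is any common lower bound, and the two parts add up to
  R.\<close>

lemma kG_hypotenuse_bound:
  assumes l: "0 \<le> Re l" "0 \<le> Im l" "Re l + Im l = R" and "0 < b" "0 < t" "0 \<le> r" "b \<le> R" "1 / (4 * t) \<le> R"
    and m: "m \<le> \<delta>" "m \<le> 4 * d * t - \<bar>s\<bar>"
  shows "norm (kG d b \<delta> t r s l) \<le> (4 * R) ^ d * exp (- m * R)"
proof -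
  have l0: "l \<noteq> 0" using assms by auto
  have lR: "norm l \<le> R" using cmod_le[of l] l by auto
  have D: "0 < norm (kD b t l)" using kD_neq_0[of l t b] assms by auto
  have "b / 4 * exp (4 * Im l * t) \<le> norm l * norm (kD b t l)"
    using kD_hypotenuse_bound[OF l] assms by (simp add: norm_mult)
  also have "\<dots> \<le> R * norm (kD b t l)" by (intro mult_right_mono lR) auto
  finally have "b * exp (4 * Im l * t) \<le> 4 * R * norm (kD b t l)" by simp
  then have "b * exp (4 * Im l * t) * exp (- 4 * Im l * t) \<le> 4 * R * norm (kD b t l) * exp (- 4 * Im l * t)"
    by (intro mult_right_mono) auto
  then have "b \<le> 4 * R * norm (kD b t l) * exp (- 4 * Im l * t)"
    by (simp add: mult.assoc flip: exp_add)
  then have bD: "b / norm (kD b t l) \<le> 4 * R * exp (- 4 * Im l * t)"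
    using D by (simp add: pos_divide_le_eq algebra_simps)
  have "norm (kG d b \<delta> t r s l) \<le> (b / norm (kD b t l)) ^ d * exp (- \<delta> * Re l + \<bar>s\<bar> * Im l)"
    by (rule norm_kG_le) (use assms in auto)
  also have "\<dots> \<le> (4 * R * exp (- 4 * Im l * t)) ^ d * exp (- \<delta> * Re l + \<bar>s\<bar> * Im l)"
    using bD assms by (intro mult_right_mono power_mono) auto
  also have "\<dots> = (4 * R) ^ d * exp (- \<delta> * Re l - (4 * d * t - \<bar>s\<bar>) * Im l)"
    by (simp add: power_mult_distrib algebra_simps flip: exp_of_nat_mult exp_add)
  also have "\<dots> \<le> (4 * R) ^ d * exp (- m * R)"
  proof -
    have "m * Re l + m * Im l \<le> \<delta> * Re l + (4 * d * t - \<bar>s\<bar>) * Im l"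
      using m l by (intro add_mono mult_right_mono) auto
    then have "m * R \<le> \<delta> * Re l + (4 * d * t - \<bar>s\<bar>) * Im l"
      unfolding l(3)[symmetric] by (simp add: distrib_left)
    then show ?thesis using assms by (intro mult_left_mono) auto
  qed
  finally show ?thesis .
qed

section \<open>Rotation of the contour\<close>

lemma closed_quadrant_triangle:
  assumes "0 < R" "z \<in> convex hull {0, complex_of_real R, \<i> * complex_of_real R}"
  shows "0 \<le> Re z" "0 \<le> Im z"
proof -
  have "convex hull {0, complex_of_real R, \<i> * complex_of_real R} \<subseteq> {z. 0 \<le> Re z} \<inter> {z. 0 \<le> Im z}"
    using assms(1) by (intro hull_minimal convex_Int convex_halfspace_Re_ge convex_halfspace_Im_ge) auto
  with assms(2) show "0 \<le> Re z" "0 \<le> Im z" by auto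
qed

lemma integral_exp_le:
  fixes a R :: real
  assumes "0 < a" "0 \<le> R"
  shows "(\<lambda>x. exp (- a * x)) integrable_on {0..R}" "integral {0..R} (\<lambda>x. exp (- a * x)) \<le> 1 / a"
proof -
  have "((\<lambda>x. exp (- a * x)) has_integral (- exp (- a * R) / a - - exp (- a * 0) / a)) {0..R}"
    using assms by (intro fundamental_theorem_of_calculus)
      (auto intro!: derivative_eq_intros simp flip: has_real_derivative_iff_has_vector_derivative)
  then show "(\<lambda>x. exp (- a * x)) integrable_on {0..R}" "integral {0..R} (\<lambda>x. exp (- a * x)) \<le> 1 / a"
    using assms by (auto simp: integral_unique field_simps)
qed

text \<open>Rotating the half-line of integration onto the positive imaginary axis, where the integrand is
  bounded independently of \<open>b\<close> and \<open>\<delta>\<close>.\<close>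

lemma kG_truncated_integral_bound:
  assumes "0 < b" "0 < \<delta>" "0 < t" "0 \<le> r" "0 < c" "\<bar>s\<bar> \<le> (4 * d - c) * t"
    and R: "b \<le> R" "1 / (4 * t) \<le> R" and m: "m = min \<delta> (c * t)"
  shows "norm (integral {0..R} (\<lambda>x. kG d b \<delta> t r s (complex_of_real x)))
     \<le> ((1 + 16 * real d / c) / (4 * t)) ^ d * (2 / (c * t)) + (4 * R) ^ d * exp (- m * R) * (2 * R)"
proof -
  define G where "G = kG d b \<delta> t r s"
  have R0: "0 < R" using R assms by linarith
  let ?T = "convex hull {0, complex_of_real R, \<i> * complex_of_real R}"
  have nz: "kD b t z \<noteq> 0" if "z \<in> ?T" for z
    using closed_quadrant_triangle[OF R0 that] assms by (intro kD_neq_0) auto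
  have cont: "continuous_on ?T G"
    unfolding G_def by (intro continuous_on_kG nz)
  have "(G has_contour_integral 0) (linepath 0 (complex_of_real R) +++
      linepath (complex_of_real R) (\<i> * complex_of_real R) +++ linepath (\<i> * complex_of_real R) 0)"
  \<comment> \<open>At the vertex 0 only continuity is at hand, because
    \<open>kG_field_differentiable\<close> divides by l; a finite exceptional set is harmless for
    the theorem.\<close>
  proof (rule Cauchy_theorem_triangle_cofinite[OF cont, of "{0}"])
    fix z assume z: "z \<in> interior ?T - {0}"
    then have "z \<in> ?T" using interior_subset by blast
    with z show "G field_differentiable at z"
      unfolding G_def by (intro kG_field_differentiable nz) auto
  qed auto
  from has_chain_integral_chain_integral3[OF this]
  have sum: "contour_integral (linepath 0 (complex_of_real R)) G
     + contour_integral (linepath (complex_of_real R) (\<i> * complex_of_real R)) G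
     + contour_integral (linepath (\<i> * complex_of_real R) 0) G = 0" .
  have sub: "closed_segment a b' \<subseteq> ?T" if "a \<in> {0, complex_of_real R, \<i> * complex_of_real R}"
      "b' \<in> {0, complex_of_real R, \<i> * complex_of_real R}" for a b'
    using that by (intro closed_segment_subset_convex_hull) (auto intro: hull_inc)
  have 1: "contour_integral (linepath 0 (complex_of_real R)) G = integral {0..R} (\<lambda>x. G (complex_of_real x))"
    using R0 by (subst contour_integral_linepath_Reals_eq) auto
  have "contour_integral (linepath (\<i> * complex_of_real R) 0) G = - contour_integral (linepath 0 (\<i> * complex_of_real R)) G"
    by (intro contour_integral_reverse_linepath continuous_on_subset[OF cont] sub) auto
  also have "contour_integral (linepath 0 (\<i> * complex_of_real R)) G
      = \<i> * integral {0..R} (\<lambda>x. G (Complex 0 x))"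
    using R0 by (intro contour_integral_linepath_same_Re) auto
  finally have 3: "norm (contour_integral (linepath (\<i> * complex_of_real R) 0) G)
      = norm (integral {0..R} (\<lambda>x. G (\<i> * complex_of_real x)))"
    by (simp add: norm_mult Complex_eq)
  have "norm (integral {0..R} (\<lambda>x. G (\<i> * complex_of_real x)))
     \<le> integral {0..R} (\<lambda>x. ((1 + 16 * real d / c) / (4 * t)) ^ d * exp (- (c * t / 2) * x))"
  proof (rule integral_norm_bound_integral)
    have "continuous_on {0..R} (\<lambda>x. G (\<i> * complex_of_real x))"
      unfolding G_def
      by (rule continuous_on_compose2[OF continuous_on_kG[of "(\<lambda>x. \<i> * complex_of_real x) ` {0..R}"]])
         (use assms kD_neq_0 in \<open>auto intro!: continuous_intros\<close>)
    then show "(\<lambda>x. G (\<i> * complex_of_real x)) integrable_on {0..R}"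
      by (rule integrable_continuous_interval)
    show "(\<lambda>x. ((1 + 16 * real d / c) / (4 * t)) ^ d * exp (- (c * t / 2) * x)) integrable_on {0..R}"
      using assms R0 by (intro integrable_on_mult_right integral_exp_le(1)) auto
    show "norm (G (\<i> * complex_of_real x)) \<le> ((1 + 16 * real d / c) / (4 * t)) ^ d * exp (- (c * t / 2) * x)"
      if "x \<in> {0..R}" for x
      unfolding G_def using that assms by (intro kG_imaginary_bound) auto
  qed
  also have "\<dots> = ((1 + 16 * real d / c) / (4 * t)) ^ d * integral {0..R} (\<lambda>x. exp (- (c * t / 2) * x))"
    by (rule integral_mult_right)
  also have "\<dots> \<le> ((1 + 16 * real d / c) / (4 * t)) ^ d * (1 / (c * t / 2))"
    using assms R0 by (intro mult_left_mono integral_exp_le(2)) auto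
  finally have v: "norm (contour_integral (linepath (\<i> * complex_of_real R) 0) G)
      \<le> ((1 + 16 * real d / c) / (4 * t)) ^ d * (2 / (c * t))"
    unfolding 3 by simp
  have "norm (contour_integral (linepath (complex_of_real R) (\<i> * complex_of_real R)) G)
      \<le> ((4 * R) ^ d * exp (- m * R)) * norm (\<i> * complex_of_real R - complex_of_real R)"
  proof (rule contour_integral_bound_linepath)
    show "G contour_integrable_on linepath (complex_of_real R) (\<i> * complex_of_real R)"
      by (intro contour_integrable_continuous_linepath continuous_on_subset[OF cont] sub) auto
    fix z assume z: "z \<in> closed_segment (complex_of_real R) (\<i> * complex_of_real R)"
    then obtain u where u: "0 \<le> u" "u \<le> 1" "z = (1 - u) *\<^sub>R complex_of_real R + u *\<^sub>R (\<i> * complex_of_real R)"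
      by (auto simp: in_segment)
    have "Re z + Im z = R" unfolding u(3) by (simp add: algebra_simps)
    moreover have "0 \<le> Re z" "0 \<le> Im z" using u R0 by auto
    moreover have "m \<le> 4 * d * t - \<bar>s\<bar>" using m assms by (simp add: algebra_simps)
    ultimately show "norm (G z) \<le> (4 * R) ^ d * exp (- m * R)"
      unfolding G_def using assms by (intro kG_hypotenuse_bound) auto
  qed (use R0 in auto)
  also have "\<dots> \<le> (4 * R) ^ d * exp (- m * R) * (2 * R)"
    using norm_triangle_ineq4[of "\<i> * complex_of_real R" "complex_of_real R"] R0
    by (intro mult_left_mono) (auto simp: norm_mult)
  finally have h: "norm (contour_integral (linepath (complex_of_real R) (\<i> * complex_of_real R)) G)
      \<le> (4 * R) ^ d * exp (- m * R) * (2 * R)" .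
  have "integral {0..R} (\<lambda>x. G (complex_of_real x)) = - (contour_integral (linepath (\<i> * complex_of_real R) 0) G
      + contour_integral (linepath (complex_of_real R) (\<i> * complex_of_real R)) G)"
    using sum unfolding 1 by (simp add: add_eq_0_iff algebra_simps)
  then have "norm (integral {0..R} (\<lambda>x. G (complex_of_real x))) \<le>
      norm (contour_integral (linepath (\<i> * complex_of_real R) 0) G)
      + norm (contour_integral (linepath (complex_of_real R) (\<i> * complex_of_real R)) G)"
    by (metis norm_minus_cancel norm_triangle_ineq)
  with v h show ?thesis unfolding G_def by linarith
qed

text \<open>As R tends to infinity the hypotenuse contributes a power of R times exp (- m * R),
  which vanishes. Its rate m depends on \<delta>, but the limiting bound comes from the imaginary
  axis alone.\<close>

lemma kG_integral_bound:
  assumes "0 < b" "0 < \<delta>" "0 < t" "0 \<le> r" "0 < c" "\<bar>s\<bar> \<le> (4 * d - c) * t"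
  shows "norm (LINT x:{0..}|lborel. kG d b \<delta> t r s (complex_of_real x))
     \<le> ((1 + 16 * real d / c) / (4 * t)) ^ d * (2 / (c * t))"
proof -
  let ?f = "\<lambda>x. indicator {0..} x *\<^sub>R kG d b \<delta> t r s (complex_of_real x)"
  have int: "set_integrable lborel {0..} (\<lambda>x. kG d b \<delta> t r s (complex_of_real x))"
    using assms by (intro kG_integrable) auto
  have L1: "((\<lambda>R. norm (\<integral>x. indicator {..R} x *\<^sub>R ?f x \<partial>lborel)) \<longlongrightarrow>
      norm (LINT x:{0..}|lborel. kG d b \<delta> t r s (complex_of_real x))) at_top"
    unfolding set_lebesgue_integral_def
    using int[unfolded set_integrable_def] by (intro tendsto_norm tendsto_integral_at_top) auto
  define m where "m = min \<delta> (c * t)"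
  have m: "0 < m" using assms by (simp add: m_def)
  have "((\<lambda>R. (4 * R) ^ d * exp (- m * R) * (2 * R)) \<longlongrightarrow> 0) at_top"
    using m by real_asymp
  from tendsto_add[OF tendsto_const this]
  have L2: "((\<lambda>R. ((1 + 16 * real d / c) / (4 * t)) ^ d * (2 / (c * t)) + (4 * R) ^ d * exp (- m * R) * (2 * R))
     \<longlongrightarrow> ((1 + 16 * real d / c) / (4 * t)) ^ d * (2 / (c * t))) at_top"
    by simp
  have "\<forall>\<^sub>F R in at_top. norm (\<integral>x. indicator {..R} x *\<^sub>R ?f x \<partial>lborel)
    \<le> ((1 + 16 * real d / c) / (4 * t)) ^ d * (2 / (c * t)) + (4 * R) ^ d * exp (- m * R) * (2 * R)"
    using eventually_ge_at_top[of b] eventually_ge_at_top[of "1 / (4 * t)"]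
  proof eventually_elim
    case (elim R)
    have "(\<integral>x. indicator {..R} x *\<^sub>R ?f x \<partial>lborel) = (LINT x:{0..R}|lborel. kG d b \<delta> t r s (complex_of_real x))"
      unfolding set_lebesgue_integral_def by (intro Bochner_Integration.integral_cong) (auto simp: indicator_def)
    also have "\<dots> = integral {0..R} (\<lambda>x. kG d b \<delta> t r s (complex_of_real x))"
      by (rule set_borel_integral_eq_integral(2)) (rule set_integrable_subset[OF int], auto)
    finally show ?case
      using kG_truncated_integral_bound[OF assms elim m_def] by simp
  qed
  then show ?thesis by (intro tendsto_le[OF _ L2 L1]) simp_all
qed

section \<open>Geometry of the Heisenberg group\<close>

lemma heis_mult_assoc: "heis_mult (heis_mult u v) w = heis_mult u (heis_mult v w)"
  by (cases u; cases v; cases w) (simp add: heis_mult_def inner_simps algebra_simps)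

lemma heis_mult_zero [simp]: "heis_mult 0 w = w" "heis_mult w 0 = w"
  by (cases w, simp add: heis_mult_def zero_prod_def)+

lemma heis_mult_inv [simp]: "heis_mult w (heis_inv w) = 0" "heis_mult (heis_inv w) w = 0"
  by (cases w, simp add: heis_mult_def heis_inv_def zero_prod_def inner_commute)+

lemma heis_inv_inv [simp]: "heis_inv (heis_inv w) = w"
  by (cases w) (simp add: heis_inv_def)

lemma heis_inv_mult: "heis_inv (heis_mult u v) = heis_mult (heis_inv v) (heis_inv u)"
  by (cases u; cases v) (simp add: heis_mult_def heis_inv_def algebra_simps)

lemma heis_mult_inv_left [simp]: "heis_mult (heis_inv w) (heis_mult w v) = v" "heis_mult w (heis_mult (heis_inv w) v) = v"
  by (simp_all flip: heis_mult_assoc)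

lemma koranyi_inv [simp]: "koranyi (heis_inv w) = koranyi w"
  by (cases w) (simp add: koranyi_def heis_inv_def)

lemma heis_dist_commute: "heis_dist w w' = heis_dist w' w"
proof -
  have "heis_mult (heis_inv w) w' = heis_inv (heis_mult (heis_inv w') w)"
    by (simp add: heis_inv_mult)
  then show ?thesis unfolding heis_dist_def by (simp only: koranyi_inv)
qed

text \<open>The linear part of the left translation by a, and hence also its derivative at every
  point.\<close>

definition heis_shear :: "'d::finite heis \<Rightarrow> 'd heis \<Rightarrow> 'd heis" where
  "heis_shear a w = (case w of (y, \<eta>, s) \<Rightarrow> (y, \<eta>, s + (2 * (fst (snd a) \<bullet> y) - 2 * (\<eta> \<bullet> fst a))))"

lemma heis_mult_shear: "heis_mult a w = a + heis_shear a w"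
  by (cases a; cases w) (simp add: heis_mult_def heis_shear_def algebra_simps)

lemma bounded_linear_heis_shear: "bounded_linear (heis_shear a)"
proof -
  have "linear (heis_shear a)"
    by (rule linearI) (auto simp: heis_shear_def inner_simps algebra_simps)
  then show ?thesis by (simp add: linear_conv_bounded_linear)
qed

lemma continuous_heis_mult [continuous_intros]:
  "continuous_on A f \<Longrightarrow> continuous_on A g \<Longrightarrow> continuous_on A (\<lambda>x. heis_mult (f x) (g x))"
  unfolding heis_mult_def case_prod_beta by (intro continuous_intros)

lemma continuous_heis_inv [continuous_intros]:
  "continuous_on A f \<Longrightarrow> continuous_on A (\<lambda>x. heis_inv (f x))"
  unfolding heis_inv_def case_prod_beta by (intro continuous_intros)

lemma continuous_koranyi [continuous_intros]:
  "continuous_on A f \<Longrightarrow> continuous_on A (\<lambda>x. koranyi (f x))"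
  unfolding koranyi_def case_prod_beta
  by (intro continuous_on_powr' continuous_intros; auto)

lemma continuous_heis_dist [continuous_intros]:
  "continuous_on A f \<Longrightarrow> continuous_on A g \<Longrightarrow> continuous_on A (\<lambda>x. heis_dist (f x) (g x))"
  unfolding heis_dist_def by (intro continuous_intros)

lemma measurable_heis_mult [measurable]: "heis_mult a \<in> borel_measurable borel"
  by (intro borel_measurable_continuous_onI continuous_intros)

lemma heis_dist_translate: "heis_dist (heis_mult a u) (heis_mult a v) = heis_dist u v"
  unfolding heis_dist_def heis_inv_mult by (simp add: heis_mult_assoc)

lemma open_heis_ball: "open (heis_ball w0 R)"
proof -
  have "open ((\<lambda>w. heis_dist w w0) -` {..<R})"
    by (intro open_vimage continuous_intros open_lessThan)
  moreover have "(\<lambda>w. heis_dist w w0) -` {..<R} = heis_ball w0 R"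
    by (auto simp: heis_ball_def)
  ultimately show ?thesis by simp
qed

lemma heis_ball_borel [measurable]: "heis_ball w0 R \<in> sets borel"
  by (rule borel_open[OF open_heis_ball])

section \<open>Lebesgue measure under translations and dilations\<close>

lemma nn_integral_heis:
  fixes f :: "'d::finite heis \<Rightarrow> ennreal"
  assumes [measurable]: "f \<in> borel_measurable borel"
  shows "(\<integral>\<^sup>+w. f w \<partial>lborel) = (\<integral>\<^sup>+y. \<integral>\<^sup>+\<eta>. \<integral>\<^sup>+s. f (y, \<eta>, s) \<partial>lborel \<partial>lborel \<partial>lborel)"
proof -
  have [measurable]: "f \<in> borel_measurable (borel \<Otimes>\<^sub>M borel)"
    "f \<in> borel_measurable (borel \<Otimes>\<^sub>M borel \<Otimes>\<^sub>M borel)"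
    by (simp_all add: borel_prod)
  have "(\<integral>\<^sup>+w. f w \<partial>lborel) = (\<integral>\<^sup>+w. f w \<partial>(lborel \<Otimes>\<^sub>M lborel))"
    by (simp add: lborel_prod)
  also have "\<dots> = (\<integral>\<^sup>+y. \<integral>\<^sup>+v. f (y, v) \<partial>lborel \<partial>lborel)"
    by (rule lborel.nn_integral_fst[symmetric]) simp
  also have "\<dots> = (\<integral>\<^sup>+y. \<integral>\<^sup>+v. f (y, v) \<partial>(lborel \<Otimes>\<^sub>M lborel) \<partial>lborel)"
    by (simp add: lborel_prod)
  also have "\<dots> = (\<integral>\<^sup>+y. \<integral>\<^sup>+\<eta>. \<integral>\<^sup>+s. f (y, \<eta>, s) \<partial>lborel \<partial>lborel \<partial>lborel)"
    by (intro nn_integral_cong lborel.nn_integral_fst[symmetric]) simp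
  finally show ?thesis .
qed

lemma nn_integral_lborel_shift:
  fixes f :: "'a::euclidean_space \<Rightarrow> ennreal"
  assumes [measurable]: "f \<in> borel_measurable borel"
  shows "(\<integral>\<^sup>+x. f (a + x) \<partial>lborel) = (\<integral>\<^sup>+x. f x \<partial>lborel)"
  by (subst (2) lborel_distr_plus[of a, symmetric]) (simp add: nn_integral_distr)

lemma nn_integral_lborel_scale:
  fixes f :: "'a::euclidean_space \<Rightarrow> ennreal"
  assumes [measurable]: "f \<in> borel_measurable borel" and "0 < c"
  shows "(\<integral>\<^sup>+x. f x \<partial>lborel) = ennreal (c ^ DIM('a)) * (\<integral>\<^sup>+x. f (c *\<^sub>R x) \<partial>lborel)"
  using assms(2) by (subst lborel_affine[of c 0]) (simp_all add: nn_integral_density nn_integral_distr nn_integral_cmult)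

text \<open>Lebesgue measure is left invariant. The central coordinate has to be integrated
  innermost: its shift depends on y and \<eta>, so it is a plain translation only while these are
  frozen.\<close>

lemma distr_heis_mult: "distr lborel borel (heis_mult a) = (lborel :: 'd::finite heis measure)"
proof (rule measure_eqI)
  fix X assume "X \<in> sets (distr lborel borel (heis_mult a))"
  then have [measurable]: "X \<in> sets borel" by simp
  have "emeasure (distr lborel borel (heis_mult a)) X = (\<integral>\<^sup>+w. indicator X (heis_mult a w) \<partial>lborel)"
    by (subst nn_integral_indicator[symmetric], simp, subst nn_integral_distr) simp_all
  also have "\<dots> = (\<integral>\<^sup>+y. \<integral>\<^sup>+\<eta>. \<integral>\<^sup>+s. indicator X (heis_mult a (y, \<eta>, s)) \<partial>lborel \<partial>lborel \<partial>lborel)"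
    by (rule nn_integral_heis) measurable
  also have "\<dots> = (\<integral>\<^sup>+y. \<integral>\<^sup>+\<eta>. \<integral>\<^sup>+s. indicator X (fst a + y, fst (snd a) + \<eta>, s) \<partial>lborel \<partial>lborel \<partial>lborel)"
  proof (rule nn_integral_cong, rule nn_integral_cong)
    fix y \<eta> :: "real^'d"
    have "(\<integral>\<^sup>+s. indicator X (heis_mult a (y, \<eta>, s)) \<partial>lborel) =
      (\<integral>\<^sup>+s. indicator X (fst a + y, fst (snd a) + \<eta>, (snd (snd a) + 2 * (fst (snd a) \<bullet> y) - 2 * (\<eta> \<bullet> fst a)) + s) \<partial>lborel)"
      by (intro nn_integral_cong arg_cong[where f = "indicator X"]) (auto simp: heis_mult_def case_prod_beta)
    also have "\<dots> = (\<integral>\<^sup>+s. indicator X (fst a + y, fst (snd a) + \<eta>, s) \<partial>lborel)"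
      by (rule nn_integral_lborel_shift[where f = "\<lambda>s. indicator X (fst a + y, fst (snd a) + \<eta>, s)"]) measurable
    finally show "(\<integral>\<^sup>+s. indicator X (heis_mult a (y, \<eta>, s)) \<partial>lborel) =
      (\<integral>\<^sup>+s. indicator X (fst a + y, fst (snd a) + \<eta>, s) \<partial>lborel)" .
  qed
  also have "\<dots> = (\<integral>\<^sup>+y. \<integral>\<^sup>+\<eta>. \<integral>\<^sup>+s. indicator X (fst a + y, \<eta>, s) \<partial>lborel \<partial>lborel \<partial>lborel)"
    by (intro nn_integral_cong
      nn_integral_lborel_shift[where f = "\<lambda>\<eta>. \<integral>\<^sup>+s. indicator X (fst a + _, \<eta>, s) \<partial>lborel"]) measurable
  also have "\<dots> = (\<integral>\<^sup>+y. \<integral>\<^sup>+\<eta>. \<integral>\<^sup>+s. indicator X (y, \<eta>, s) \<partial>lborel \<partial>lborel \<partial>lborel)"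
    by (rule nn_integral_lborel_shift[where f = "\<lambda>y. \<integral>\<^sup>+\<eta>. \<integral>\<^sup>+s. indicator X (y, \<eta>, s) \<partial>lborel \<partial>lborel"]) measurable
  also have "\<dots> = (\<integral>\<^sup>+w. indicator X w \<partial>lborel)"
    by (rule nn_integral_heis[symmetric]) measurable
  finally show "emeasure (distr lborel borel (heis_mult a)) X = emeasure lborel X" by simp
qed simp

definition heis_dil :: "real \<Rightarrow> 'd::finite heis \<Rightarrow> 'd heis" where
  "heis_dil c w = (case w of (y, \<eta>, s) \<Rightarrow> (c *\<^sub>R y, c *\<^sub>R \<eta>, c\<^sup>2 * s))"

lemma continuous_heis_dil [continuous_intros]: "continuous_on A f \<Longrightarrow> continuous_on A (\<lambda>x. heis_dil c (f x))"
  unfolding heis_dil_def case_prod_beta by (intro continuous_intros)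

lemma measurable_heis_dil [measurable]: "heis_dil c \<in> borel_measurable borel"
  by (intro borel_measurable_continuous_onI continuous_intros)

text \<open>The exponent is the homogeneous dimension Q: the two horizontal blocks give c ^ d each,
  and the centre, which scales quadratically, gives c^2.\<close>

lemma nn_integral_heis_dil:
  fixes f :: "'d::finite heis \<Rightarrow> ennreal"
  assumes [measurable]: "f \<in> borel_measurable borel" and c: "0 < c"
  shows "(\<integral>\<^sup>+w. f w \<partial>lborel) = ennreal (c ^ (2 * CARD('d) + 2)) * (\<integral>\<^sup>+w. f (heis_dil c w) \<partial>lborel)"
proof -
  have [measurable]: "f \<in> borel_measurable (borel \<Otimes>\<^sub>M borel \<Otimes>\<^sub>M borel)"
    by (simp add: borel_prod)
  have "(\<integral>\<^sup>+w. f w \<partial>lborel) = (\<integral>\<^sup>+y. \<integral>\<^sup>+\<eta>. \<integral>\<^sup>+s. f (y, \<eta>, s) \<partial>lborel \<partial>lborel \<partial>lborel)"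
    by (rule nn_integral_heis) measurable
  also have "\<dots> = (\<integral>\<^sup>+y. \<integral>\<^sup>+\<eta>. ennreal (c\<^sup>2) * (\<integral>\<^sup>+s. f (y, \<eta>, c\<^sup>2 * s) \<partial>lborel) \<partial>lborel \<partial>lborel)"
  proof (intro nn_integral_cong)
    fix y \<eta>
    show "(\<integral>\<^sup>+s. f (y, \<eta>, s) \<partial>lborel) = ennreal (c\<^sup>2) * (\<integral>\<^sup>+s. f (y, \<eta>, c\<^sup>2 * s) \<partial>lborel)"
      using c by (subst nn_integral_lborel_scale[where c = "c\<^sup>2"]) simp_all
  qed
  also have "\<dots> = (\<integral>\<^sup>+y. ennreal (c ^ CARD('d)) * (\<integral>\<^sup>+\<eta>. ennreal (c\<^sup>2) * (\<integral>\<^sup>+s. f (y, c *\<^sub>R \<eta>, c\<^sup>2 * s) \<partial>lborel) \<partial>lborel) \<partial>lborel)"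
  proof (intro nn_integral_cong)
    fix y
    show "(\<integral>\<^sup>+\<eta>. ennreal (c\<^sup>2) * (\<integral>\<^sup>+s. f (y, \<eta>, c\<^sup>2 * s) \<partial>lborel) \<partial>lborel)
      = ennreal (c ^ CARD('d)) * (\<integral>\<^sup>+\<eta>. ennreal (c\<^sup>2) * (\<integral>\<^sup>+s. f (y, c *\<^sub>R \<eta>, c\<^sup>2 * s) \<partial>lborel) \<partial>lborel)"
      using c by (subst nn_integral_lborel_scale[where c = c]) simp_all
  qed
  also have "\<dots> = ennreal (c ^ CARD('d)) * (\<integral>\<^sup>+y. ennreal (c ^ CARD('d)) * (\<integral>\<^sup>+\<eta>. ennreal (c\<^sup>2) * (\<integral>\<^sup>+s. f (c *\<^sub>R y, c *\<^sub>R \<eta>, c\<^sup>2 * s) \<partial>lborel) \<partial>lborel) \<partial>lborel)"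
    using c by (subst nn_integral_lborel_scale[where c = c]) simp_all
  also have "\<dots> = ennreal (c ^ CARD('d)) * (ennreal (c ^ CARD('d)) * (ennreal (c\<^sup>2) *
      (\<integral>\<^sup>+y. \<integral>\<^sup>+\<eta>. \<integral>\<^sup>+s. f (heis_dil c (y, \<eta>, s)) \<partial>lborel \<partial>lborel \<partial>lborel)))"
    by (simp add: nn_integral_cmult heis_dil_def)
  also have "(\<integral>\<^sup>+y. \<integral>\<^sup>+\<eta>. \<integral>\<^sup>+s. f (heis_dil c (y, \<eta>, s)) \<partial>lborel \<partial>lborel \<partial>lborel) = (\<integral>\<^sup>+w. f (heis_dil c w) \<partial>lborel)"
    by (rule nn_integral_heis[symmetric]) measurable
  also have "ennreal (c ^ CARD('d)) * (ennreal (c ^ CARD('d)) * (ennreal (c\<^sup>2) * (\<integral>\<^sup>+w. f (heis_dil c w) \<partial>lborel)))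
    = ennreal (c ^ (2 * CARD('d) + 2)) * (\<integral>\<^sup>+w. f (heis_dil c w) \<partial>lborel)"
  proof -
    have "c ^ (2 * CARD('d) + 2) = c ^ CARD('d) * (c ^ CARD('d) * c\<^sup>2)"
      by (simp add: power_add mult_2 power2_eq_square)
    then show ?thesis using c by (simp add: ennreal_mult mult.assoc)
  qed
  finally show ?thesis .
qed

section \<open>The Koranyi norm and its balls\<close>

lemma koranyi_dil: "0 < c \<Longrightarrow> koranyi (heis_dil c w) = c * koranyi w"
proof -
  assume c: "0 < c"
  obtain y \<eta> s where w: "w = (y, \<eta>, s)" by (cases w)
  have "((norm (c *\<^sub>R y))\<^sup>2 + (norm (c *\<^sub>R \<eta>))\<^sup>2)\<^sup>2 + (c\<^sup>2 * s)\<^sup>2 = c ^ 4 * (((norm y)\<^sup>2 + (norm \<eta>)\<^sup>2)\<^sup>2 + s\<^sup>2)"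
    unfolding norm_scaleR power_mult_distrib power2_abs by (simp add: power2_sum power_mult_distrib algebra_simps flip: power_mult)
  then have "koranyi (heis_dil c w) = (c ^ 4 * (((norm y)\<^sup>2 + (norm \<eta>)\<^sup>2)\<^sup>2 + s\<^sup>2)) powr (1 / 4)"
    unfolding koranyi_def heis_dil_def w by simp
  also have "\<dots> = (c ^ 4) powr (1 / 4) * koranyi w"
    unfolding koranyi_def w by (simp add: powr_mult)
  also have "(c ^ 4) powr (1 / 4) = c"
    using c powr_powr[of c 4 "1/4"] powr_numeral[of c "num.Bit0 (num.Bit0 num.One)"] by simp
  finally show ?thesis .
qed

lemma koranyi_bounds:
  assumes "koranyi (y, \<eta>, s) \<le> R"
  shows "((norm y)\<^sup>2 + (norm \<eta>)\<^sup>2)\<^sup>2 + s\<^sup>2 \<le> R ^ 4"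
proof -
  let ?N = "((norm y)\<^sup>2 + (norm \<eta>)\<^sup>2)\<^sup>2 + s\<^sup>2"
  have N: "0 \<le> ?N" by simp
  have "?N = (?N powr (1 / 4)) ^ 4"
    using N by (simp add: powr_powr flip: powr_numeral)
  also have "\<dots> \<le> R ^ 4"
    using assms unfolding koranyi_def by (intro power_mono) auto
  finally show ?thesis .
qed

lemma bounded_heis_ball0: "bounded (heis_ball 0 R)"
proof -
  have "norm w \<le> 2 * R + R\<^sup>2" if "w \<in> heis_ball 0 R" for w :: "'a::finite heis"
  proof -
    obtain y \<eta> s where w: "w = (y, \<eta>, s)" by (cases w)
    have k: "koranyi w \<le> R" using that by (simp add: heis_ball_def heis_dist_def)
    have R: "0 \<le> R" using k by (rule order_trans[rotated]) (simp add: koranyi_def case_prod_beta)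
    have N: "((norm y)\<^sup>2 + (norm \<eta>)\<^sup>2)\<^sup>2 + s\<^sup>2 \<le> (R\<^sup>2)\<^sup>2"
      using koranyi_bounds[of y \<eta> s R] k w by simp
    have "s\<^sup>2 \<le> (R\<^sup>2)\<^sup>2" "((norm y)\<^sup>2 + (norm \<eta>)\<^sup>2)\<^sup>2 \<le> (R\<^sup>2)\<^sup>2"
      using N zero_le_power2[of "(norm y)\<^sup>2 + (norm \<eta>)\<^sup>2"] zero_le_power2[of s] by linarith+
    then have s: "\<bar>s\<bar> \<le> R\<^sup>2" and r: "(norm y)\<^sup>2 + (norm \<eta>)\<^sup>2 \<le> R\<^sup>2"
      by (auto intro: power2_le_imp_le)
    have y: "norm y \<le> R" "norm \<eta> \<le> R"
      by (rule power2_le_imp_le; use r R zero_le_power2[of "norm y"] zero_le_power2[of "norm \<eta>"] in linarith)+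
    have "norm w \<le> norm y + norm (\<eta>, s)" unfolding w by (rule norm_Pair_le)
    also have "norm (\<eta>, s) \<le> norm \<eta> + norm s" by (rule norm_Pair_le)
    finally show ?thesis using y s by simp
  qed
  then show ?thesis by (rule boundedI)
qed

lemma emeasure_heis_ball:
  assumes "0 < R"
  shows "emeasure lborel (heis_ball (w0::'d::finite heis) R) = ennreal (R ^ (2 * CARD('d) + 2)) * emeasure lborel (heis_ball (0::'d heis) 1)"
proof -
  have "emeasure lborel (heis_ball w0 R) = emeasure (distr lborel borel (heis_mult w0)) (heis_ball w0 R)"
    by (simp add: distr_heis_mult)
  also have "\<dots> = emeasure lborel (heis_mult w0 -` heis_ball w0 R)"
    by (simp add: emeasure_distr)
  also have "heis_mult w0 -` heis_ball w0 R = heis_ball 0 R"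
    unfolding heis_ball_def using heis_dist_translate[of w0 _ 0] by simp
  also have "emeasure lborel (heis_ball (0::'d heis) R) = (\<integral>\<^sup>+w. indicator (heis_ball 0 R) (w :: 'd heis) \<partial>lborel)"
    by simp
  also have "\<dots> = ennreal (R ^ (2 * CARD('d) + 2)) * (\<integral>\<^sup>+w. indicator (heis_ball 0 R) (heis_dil R w :: 'd heis) \<partial>lborel)"
    using assms by (intro nn_integral_heis_dil) measurable
  also have "(\<lambda>w::'d heis. indicator (heis_ball 0 R) (heis_dil R w) :: ennreal) = indicator (heis_ball 0 1)"
    using assms by (auto simp: fun_eq_iff indicator_def heis_ball_def heis_dist_def koranyi_dil)
  finally show ?thesis by simp
qed

lemma emeasure_heis_ball_finite: "emeasure lborel (heis_ball (0::'d::finite heis) R) < \<infinity>"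
proof -
  obtain r where "\<forall>w\<in>heis_ball (0::'d heis) R. norm w \<le> r"
    using bounded_heis_ball0[of R] unfolding bounded_iff by auto
  then have "heis_ball (0::'d heis) R \<subseteq> cball 0 r" by (intro subsetI) (simp only: mem_cball_0)
  then have "emeasure lborel (heis_ball (0::'d heis) R) \<le> emeasure lborel (cball (0::'d heis) r)"
    by (intro emeasure_mono) auto
  then show ?thesis using emeasure_lborel_cball_finite[of "0::'d heis" r] by (simp add: order.strict_trans1)
qed

text \<open>Along the centre the Koranyi norm is subadditive in the stronger \<open>\<ell>\<^sup>2\<close> sense,
  which keeps \<open>s / t\<close> away from the critical value \<open>4 * d\<close>.\<close>

lemma koranyi_vertical_bound:
  fixes w w' w0 :: "'d::finite heis"
  assumes a: "heis_dist w' w0 \<le> \<alpha>" and b: "heis_dist w w0 \<le> \<beta>" and "0 < \<alpha>" "0 < \<beta>"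
  shows "\<bar>snd (snd (heis_mult (heis_inv w') w))\<bar> \<le> (\<alpha> + \<beta>) * sqrt (\<alpha>\<^sup>2 + \<beta>\<^sup>2)"
proof -
  obtain y \<eta> s where A: "heis_mult (heis_inv w') w0 = (y, \<eta>, s)" by (metis prod.exhaust)
  obtain y' \<eta>' s' where B: "heis_mult (heis_inv w0) w = (y', \<eta>', s')" by (metis prod.exhaust)
  have "heis_mult (heis_inv w') w = heis_mult (y, \<eta>, s) (y', \<eta>', s')"
    unfolding A[symmetric] B[symmetric] by (simp add: heis_mult_assoc)
  then have S: "snd (snd (heis_mult (heis_inv w') w)) = s + s' + 2 * (\<eta> \<bullet> y' - \<eta>' \<bullet> y)"
    by (simp add: heis_mult_def)
  define p where "p = (norm y)\<^sup>2 + (norm \<eta>)\<^sup>2"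
  define q where "q = (norm y')\<^sup>2 + (norm \<eta>')\<^sup>2"
  have pq: "0 \<le> p" "0 \<le> q" by (auto simp: p_def q_def)
  have P: "p\<^sup>2 + s\<^sup>2 \<le> (\<alpha>\<^sup>2)\<^sup>2"
    using koranyi_bounds[of y \<eta> s \<alpha>] a A by (simp add: heis_dist_def p_def)
  have Q: "q\<^sup>2 + s'\<^sup>2 \<le> (\<beta>\<^sup>2)\<^sup>2"
    using koranyi_bounds[of y' \<eta>' s' \<beta>] b B by (subst (asm) heis_dist_commute) (simp add: heis_dist_def q_def)
  have "\<bar>\<eta> \<bullet> y' - \<eta>' \<bullet> y\<bar> = \<bar>(\<eta>, - y) \<bullet> (y', \<eta>')\<bar>"
    by (simp add: inner_commute)
  also have "\<dots> \<le> norm (\<eta>, - y) * norm (y', \<eta>')" by (rule Cauchy_Schwarz_ineq2)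
  also have "\<dots> = sqrt p * sqrt q" by (simp add: norm_Pair p_def q_def add.commute)
  finally have sym: "\<bar>\<eta> \<bullet> y' - \<eta>' \<bullet> y\<bar> \<le> sqrt p * sqrt q" .
  \<comment> \<open>Arithmetic-geometric mean with weight \<beta> / \<alpha>. The cross term splits
    into one part for each of the two points, and both parts then lead to the same square
    root.\<close>
  have am: "2 * (sqrt p * sqrt q) \<le> \<beta> / \<alpha> * p + \<alpha> / \<beta> * q"
  proof -
    have "0 \<le> (\<beta> * sqrt p - \<alpha> * sqrt q)\<^sup>2" by simp
    then have "2 * (sqrt p * sqrt q) * (\<alpha> * \<beta>) \<le> \<beta>\<^sup>2 * p + \<alpha>\<^sup>2 * q"
      using pq by (simp add: power2_diff power_mult_distrib algebra_simps)
    also have "\<dots> = (\<beta> / \<alpha> * p + \<alpha> / \<beta> * q) * (\<alpha> * \<beta>)"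
      using assms by (simp add: field_simps power2_eq_square)
    finally show ?thesis using assms by (simp only: mult_le_cancel_right_pos mult_pos_pos)
  qed
  have cs: "\<bar>u\<bar> + \<gamma> / \<epsilon> * v \<le> \<epsilon> * sqrt (\<epsilon>\<^sup>2 + \<gamma>\<^sup>2)"
    if "v\<^sup>2 + u\<^sup>2 \<le> (\<epsilon>\<^sup>2)\<^sup>2" "0 < \<epsilon>" "0 < \<gamma>" "0 \<le> v" for u v \<gamma> \<epsilon> :: real
  proof (rule power2_le_imp_le)
    \<comment> \<open>Cauchy-Schwarz for the vectors (1, g) and (\<bar>u\<bar>, v), used with g =
      \<gamma> / \<epsilon>.\<close>
    have "(\<bar>u\<bar> + g * v)\<^sup>2 \<le> (1 + g\<^sup>2) * (v\<^sup>2 + u\<^sup>2)" for g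
      using zero_le_power2[of "g * \<bar>u\<bar> - v"] by (simp add: power2_diff power2_sum power_mult_distrib algebra_simps)
    then have "(\<bar>u\<bar> + \<gamma> / \<epsilon> * v)\<^sup>2 \<le> (1 + (\<gamma> / \<epsilon>)\<^sup>2) * (v\<^sup>2 + u\<^sup>2)" .
    also have "\<dots> \<le> (1 + (\<gamma> / \<epsilon>)\<^sup>2) * (\<epsilon>\<^sup>2)\<^sup>2" using that by (intro mult_left_mono) auto
    also have "\<dots> = (\<epsilon> * sqrt (\<epsilon>\<^sup>2 + \<gamma>\<^sup>2))\<^sup>2"
      using that by (simp add: power_mult_distrib field_simps power2_eq_square)
    finally show "(\<bar>u\<bar> + \<gamma> / \<epsilon> * v)\<^sup>2 \<le> (\<epsilon> * sqrt (\<epsilon>\<^sup>2 + \<gamma>\<^sup>2))\<^sup>2" .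
  qed (use that in auto)
  have "\<bar>s + s' + 2 * (\<eta> \<bullet> y' - \<eta>' \<bullet> y)\<bar> \<le> \<bar>s\<bar> + \<bar>s'\<bar> + 2 * (sqrt p * sqrt q)"
  proof -
    have "\<bar>s + s' + 2 * u\<bar> \<le> \<bar>s\<bar> + \<bar>s'\<bar> + 2 * v" if "\<bar>u\<bar> \<le> v" for u v :: real
      using that by linarith
    then show ?thesis using sym by blast
  qed
  also have "\<dots> \<le> (\<bar>s\<bar> + \<beta> / \<alpha> * p) + (\<bar>s'\<bar> + \<alpha> / \<beta> * q)" using am by linarith
  also have "\<dots> \<le> \<alpha> * sqrt (\<alpha>\<^sup>2 + \<beta>\<^sup>2) + \<beta> * sqrt (\<beta>\<^sup>2 + \<alpha>\<^sup>2)"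
    using assms pq by (intro add_mono cs P Q)
  also have "\<dots> = (\<alpha> + \<beta>) * sqrt (\<alpha>\<^sup>2 + \<beta>\<^sup>2)" by (simp add: algebra_simps)
  finally show ?thesis unfolding S .
qed

section \<open>The sublaplacian on Fourier modes and cutoffs\<close>

lemma elem_dirder_linear:
  assumes "f \<in> elem"
  shows "dirder f (u + v) w = dirder f u w + dirder f v w"
    and "dirder f (c *\<^sub>R v) w = c *\<^sub>R dirder f v w"
proof -
  interpret bounded_linear "\<lambda>v. dirder f v w"
    by (rule has_derivative_bounded_linear[OF elem_has_derivative[OF assms]])
  show "dirder f (u + v) w = dirder f u w + dirder f v w" "dirder f (c *\<^sub>R v) w = c *\<^sub>R dirder f v w"
    by (rule add, rule scaleR)
qed

lemma dirder_add:
  assumes "f \<in> elem" "g \<in> elem" shows "dirder (\<lambda>w. f w + g w) v w = dirder f v w + dirder g v w"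
  by (rule has_derivative_dirder(2), rule has_derivative_add) (intro elem_has_derivative assms)+

lemma dirder_mult:
  assumes "f \<in> elem" "g \<in> elem" shows "dirder (\<lambda>w. f w * g w) v w = f w * dirder g v w + dirder f v w * g w"
  by (rule has_derivative_dirder(2), rule has_derivative_mult) (intro elem_has_derivative assms)+

lemma dirder_const [simp]: "dirder (\<lambda>_. c) v w = 0"
  by (rule has_derivative_dirder(2)[where f' = "\<lambda>_. 0"]) (rule has_derivative_const)

lemma dirder_exp:
  assumes "f \<in> elem" shows "dirder (\<lambda>w. exp (f w)) v w = exp (f w) * dirder f v w"
proof (rule has_derivative_dirder(2))
  have "(exp has_derivative (*) (exp (f w))) (at (f w))"
    using DERIV_exp[of "f w"] by (simp add: has_field_derivative_def)
  from has_derivative_compose[OF elem_has_derivative[OF assms] this]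
  show "((\<lambda>w. exp (f w)) has_derivative (\<lambda>v. exp (f w) * dirder f v w)) (at w)" .
qed

lemma dirder_flat:
  assumes "f \<in> elem"
  shows "dirder (\<lambda>w. complex_of_real (flat p (Re (f w)))) v w =
    complex_of_real (flat (pCons 0 (pCons 0 (p - pderiv p))) (Re (f w)) * Re (dirder f v w))"
proof (rule has_derivative_dirder(2)[where f' = "\<lambda>v. complex_of_real (flat (pCons 0 (pCons 0 (p - pderiv p))) (Re (f w)) * Re (dirder f v w))"])
  have "(flat p has_derivative (*) (flat (pCons 0 (pCons 0 (p - pderiv p))) (Re (f w)))) (at (Re (f w)))"
    using flat_has_derivative[of p "Re (f w)"] by (simp add: has_field_derivative_def)
  from has_derivative_compose[OF has_derivative_Re[OF elem_has_derivative[OF assms, of w]] this]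
  show "((\<lambda>w. complex_of_real (flat p (Re (f w)))) has_derivative
     (\<lambda>v. complex_of_real (flat (pCons 0 (pCons 0 (p - pderiv p))) (Re (f w)) * Re (dirder f v w)))) (at w)"
    by (rule has_derivative_of_real)
qed

lemma elem_affine_heis: "f \<in> elem \<Longrightarrow> (\<lambda>w. f (heis_mult a w)) \<in> elem"
  unfolding heis_mult_shear by (rule elem_affine[OF _ bounded_linear_heis_shear])

lemma dirder_heis_mult:
  assumes "f \<in> elem"
  shows "dirder (\<lambda>w. f (heis_mult a w)) v w = dirder f (heis_shear a v) (heis_mult a w)"
proof (rule has_derivative_dirder(2)[where f' = "\<lambda>v. dirder f (heis_shear a v) (heis_mult a w)"])
  have "(heis_mult a has_derivative heis_shear a) (at w)"
    unfolding heis_mult_shear[abs_def]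
    by (auto intro!: derivative_eq_intros bounded_linear_imp_has_derivative bounded_linear_heis_shear)
  from has_derivative_compose[OF this elem_has_derivative[OF assms]]
  show "((\<lambda>w. f (heis_mult a w)) has_derivative (\<lambda>v. dirder f (heis_shear a v) (heis_mult a w))) (at w)" .
qed

text \<open>The field becomes the derivative along a single direction that depends on the base
  point. Combining the two directional derivatives needs linearity in the direction, hence
  membership in \<open>elem\<close>.\<close>

lemma vfX_eq: 
  assumes "f \<in> elem" shows "vfX j f w = dirder f (axis j 1, 0, 2 * (fst (snd w) $ j)) w"
proof -
  have *: "(axis j 1, 0, 2 * (fst (snd w) $ j)) = (axis j 1, 0, 0) + (2 * (fst (snd w) $ j)) *\<^sub>R (0, 0, 1::real)"
    by simp
  show ?thesis
    unfolding vfX_def * by (simp only: elem_dirder_linear[OF assms] scaleR_conv_of_real)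
qed

lemma vfXi_eq: 
  assumes "f \<in> elem" shows "vfXi j f w = dirder f (0, axis j 1, - 2 * (fst w $ j)) w"
proof -
  have *: "(0, axis j 1, - 2 * (fst w $ j)) = (0, axis j 1, 0) + (- 2 * (fst w $ j)) *\<^sub>R (0, 0, 1::real)"
    by simp
  show ?thesis
    unfolding vfXi_def * by (simp only: elem_dirder_linear[OF assms] scaleR_conv_of_real) simp
qed

lemma elem_coord:
  fixes j :: "'d::finite"
  shows "(\<lambda>w::'d heis. complex_of_real (fst w $ j)) \<in> elem"
    "(\<lambda>w::'d heis. complex_of_real (fst (snd w) $ j)) \<in> elem"
    "(\<lambda>w::'d heis. complex_of_real (snd (snd w))) \<in> elem"
  by (rule elem.lin, intro bounded_linear_compose[OF bounded_linear_vec_nth]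
      bounded_linear_fst_comp bounded_linear_snd_comp bounded_linear_fst bounded_linear_snd bounded_linear_compose[OF bounded_linear_fst]
      bounded_linear_compose[OF bounded_linear_snd])+

lemma elem_vfX: assumes "f \<in> elem" shows "vfX j f \<in> elem"
proof -
  have "(\<lambda>w. dirder f (axis j 1, 0, 0) w
      + (2 * complex_of_real (fst (snd w) $ j)) * dirder f (0, 0, 1) w) \<in> elem"
    by (intro elem.add elem.mult elem_dirder assms elem_coord elem.const)
  then show ?thesis by (simp add: vfX_def[abs_def])
qed

lemma elem_vfXi: assumes "f \<in> elem" shows "vfXi j f \<in> elem"
proof -
  have "(\<lambda>w. dirder f (0, axis j 1, 0) w
      - (2 * complex_of_real (fst w $ j)) * dirder f (0, 0, 1) w) \<in> elem"
    by (intro elem_diff elem.mult elem_dirder assms elem_coord elem.const)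
  then show ?thesis by (simp add: vfXi_def[abs_def])
qed

lemma elem_sublap: "f \<in> elem \<Longrightarrow> sublap f \<in> elem"
  unfolding sublap_def[abs_def] by (intro elem_sum elem.add elem_vfX elem_vfXi)

text \<open>The fields are left invariant: the shear by a carries the direction of the field at w to
  its direction at \<open>heis_mult a w\<close>.\<close>

lemma vfX_translate:
  assumes "f \<in> elem" shows "vfX j (\<lambda>w. f (heis_mult a w)) w = vfX j f (heis_mult a w)"
    and "vfXi j (\<lambda>w. f (heis_mult a w)) w = vfXi j f (heis_mult a w)"
proof -
  have "heis_shear a (axis j 1, 0, 2 * (fst (snd w) $ j)) = (axis j 1, 0, 2 * (fst (snd (heis_mult a w)) $ j))"
    "heis_shear a (0, axis j 1, - 2 * (fst w $ j)) = (0, axis j 1, - 2 * (fst (heis_mult a w) $ j))"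
    by (cases a; cases w; simp add: heis_shear_def heis_mult_def inner_axis inner_axis')+
  then show "vfX j (\<lambda>w. f (heis_mult a w)) w = vfX j f (heis_mult a w)"
    "vfXi j (\<lambda>w. f (heis_mult a w)) w = vfXi j f (heis_mult a w)"
    by (simp_all only: vfX_eq vfXi_eq elem_affine_heis assms dirder_heis_mult)
qed

lemma sublap_translate:
  assumes "f \<in> elem" shows "sublap (\<lambda>w. f (heis_mult a w)) w = sublap f (heis_mult a w)"
proof -
  have "vfX j (\<lambda>w. f (heis_mult a w)) = (\<lambda>w. vfX j f (heis_mult a w))"
    "vfXi j (\<lambda>w. f (heis_mult a w)) = (\<lambda>w. vfXi j f (heis_mult a w))" for j
    using vfX_translate[OF assms] by (auto simp only: fun_eq_iff)
  then show ?thesis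
    unfolding sublap_def by (simp add: vfX_translate elem_vfX elem_vfXi assms)
qed

lemma vf_add:
  assumes "f \<in> elem" "g \<in> elem"
  shows "vfX j (\<lambda>w. f w + g w) w = vfX j f w + vfX j g w"
    "vfXi j (\<lambda>w. f w + g w) w = vfXi j f w + vfXi j g w"
  using assms by (simp_all add: vfX_eq vfXi_eq elem.add dirder_add)

lemma vf_mult:
  assumes "f \<in> elem" "g \<in> elem"
  shows "vfX j (\<lambda>w. f w * g w) w = f w * vfX j g w + vfX j f w * g w"
    "vfXi j (\<lambda>w. f w * g w) w = f w * vfXi j g w + vfXi j f w * g w"
  using assms by (simp_all add: vfX_eq vfXi_eq elem.mult dirder_mult)

text \<open>The last sum is the carre du champ. With a cutoff as f it is, next to the sublaplacian
  of the cutoff, the source of the commutator error.\<close>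

lemma sublap_mult:
  assumes f: "f \<in> elem" and g: "g \<in> elem"
  shows "sublap (\<lambda>w. f w * g w) w = f w * sublap g w + g w * sublap f w
     + 2 * (\<Sum>j\<in>UNIV. vfX j f w * vfX j g w + vfXi j f w * vfXi j g w)"
proof -
  have "vfX j (\<lambda>w. f w * g w) = (\<lambda>w. f w * vfX j g w + vfX j f w * g w)"
    "vfXi j (\<lambda>w. f w * g w) = (\<lambda>w. f w * vfXi j g w + vfXi j f w * g w)" for j
    using vf_mult[OF assms] by auto
  then have "sublap (\<lambda>w. f w * g w) w = (\<Sum>j\<in>UNIV. f w * (vfX j (vfX j g) w + vfXi j (vfXi j g) w)
      + g w * (vfX j (vfX j f) w + vfXi j (vfXi j f) w) + 2 * (vfX j f w * vfX j g w + vfXi j f w * vfXi j g w))"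
    unfolding sublap_def
    by (simp add: vf_add vf_mult elem.mult elem_vfX elem_vfXi f g algebra_simps)
  then show ?thesis
    unfolding sublap_def sum_distrib_left sum.distrib[symmetric] by (simp add: sublap_def)
qed

section \<open>Gaussian modes\<close>

definition hr :: "'d::finite heis \<Rightarrow> complex" where
  "hr w = complex_of_real (fst w \<bullet> fst w + fst (snd w) \<bullet> fst (snd w))"

definition hs :: "'d::finite heis \<Rightarrow> complex" where
  "hs w = complex_of_real (snd (snd w))"

lemma elem_hs: "hs \<in> elem"
  unfolding hs_def[abs_def] by (rule elem_coord)

lemma elem_hr: "(hr :: 'd::finite heis \<Rightarrow> complex) \<in> elem"
proof -
  have "hr = (\<lambda>w::'d heis. (\<Sum>j\<in>UNIV. complex_of_real (fst w $ j) * complex_of_real (fst w $ j))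
      + (\<Sum>j\<in>UNIV. complex_of_real (fst (snd w) $ j) * complex_of_real (fst (snd w) $ j)))"
    by (simp add: hr_def fun_eq_iff inner_vec_def)
  also have "\<dots> \<in> elem"
    by (intro elem.add elem_sum elem.mult elem_coord)
  finally show ?thesis .
qed

lemma vf_hs:
  "vfX j hs w = complex_of_real (2 * (fst (snd w) $ j))" "vfXi j hs w = - complex_of_real (2 * (fst w $ j))"
proof -
  have "dirder hs v w = complex_of_real (snd (snd v))" for v w :: "'a::finite heis"
    unfolding hs_def[abs_def]
    by (rule has_derivative_dirder(2)[where f' = "\<lambda>v. complex_of_real (snd (snd v))"])
       (auto intro!: derivative_eq_intros)
  then show "vfX j hs w = complex_of_real (2 * (fst (snd w) $ j))" "vfXi j hs w = - complex_of_real (2 * (fst w $ j))"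
    by (simp_all add: vfX_eq vfXi_eq elem_hs)
qed

lemma vf_hr:
  "vfX j hr w = complex_of_real (2 * (fst w $ j))" "vfXi j hr w = complex_of_real (2 * (fst (snd w) $ j))"
proof -
  have "dirder hr v w = complex_of_real (2 * (fst w \<bullet> fst v) + 2 * (fst (snd w) \<bullet> fst (snd v)))" for v w :: "'a::finite heis"
    unfolding hr_def[abs_def]
    by (rule has_derivative_dirder(2)[where f' = "\<lambda>v. complex_of_real (2 * (fst w \<bullet> fst v) + 2 * (fst (snd w) \<bullet> fst (snd v)))"])
       (auto intro!: derivative_eq_intros simp: inner_commute)
  then show "vfX j hr w = complex_of_real (2 * (fst w $ j))" "vfXi j hr w = complex_of_real (2 * (fst (snd w) $ j))"
    by (simp_all add: vfX_eq vfXi_eq elem_hr inner_axis)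
qed

lemma vf_coord:
  "vfX j (\<lambda>w. complex_of_real (fst w $ j)) w = 1" "vfXi j (\<lambda>w. complex_of_real (fst w $ j)) w = 0"
  "vfX j (\<lambda>w. complex_of_real (fst (snd w) $ j)) w = 0" "vfXi j (\<lambda>w. complex_of_real (fst (snd w) $ j)) w = 1"
proof -
  have 1: "dirder (\<lambda>w. complex_of_real (fst w $ j)) v w = complex_of_real (fst v $ j)" for v w :: "'a::finite heis"
    by (rule has_derivative_dirder(2)[where f' = "\<lambda>v. complex_of_real (fst v $ j)"])
       (intro has_derivative_of_real bounded_linear_imp_has_derivative bounded_linear_compose[OF bounded_linear_vec_nth] bounded_linear_fst)
  have 2: "dirder (\<lambda>w. complex_of_real (fst (snd w) $ j)) v w = complex_of_real (fst (snd v) $ j)" for v w :: "'a::finite heis"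
    by (rule has_derivative_dirder(2)[where f' = "\<lambda>v. complex_of_real (fst (snd v) $ j)"])
       (intro has_derivative_of_real bounded_linear_imp_has_derivative bounded_linear_compose[OF bounded_linear_vec_nth] bounded_linear_compose[OF bounded_linear_fst] bounded_linear_snd)
  show "vfX j (\<lambda>w. complex_of_real (fst w $ j)) w = 1" "vfXi j (\<lambda>w. complex_of_real (fst w $ j)) w = 0"
    "vfX j (\<lambda>w. complex_of_real (fst (snd w) $ j)) w = 0" "vfXi j (\<lambda>w. complex_of_real (fst (snd w) $ j)) w = 1"
    by (simp_all add: vfX_eq vfXi_eq elem_coord 1 2 axis_def)
qed

lemma vf_const: "vfX j (\<lambda>_. c) w = 0" "vfXi j (\<lambda>_. c) w = 0"
  by (simp_all add: vfX_eq vfXi_eq elem.const)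

lemma vf_cmult: "f \<in> elem \<Longrightarrow> vfX j (\<lambda>w. c * f w) w = c * vfX j f w"
  "f \<in> elem \<Longrightarrow> vfXi j (\<lambda>w. c * f w) w = c * vfXi j f w"
  by (simp_all add: vf_mult elem.const vf_const)

lemma vf_exp: "f \<in> elem \<Longrightarrow> vfX j (\<lambda>w. exp (f w)) w = exp (f w) * vfX j f w"
  "f \<in> elem \<Longrightarrow> vfXi j (\<lambda>w. exp (f w)) w = exp (f w) * vfXi j f w"
  by (simp_all add: vfX_eq vfXi_eq elem.exp dirder_exp)

definition hmode :: "real \<Rightarrow> complex \<Rightarrow> 'd::finite heis \<Rightarrow> complex" where
  "hmode m B w = exp (\<i> * complex_of_real m * hs w - B * hr w)"

lemma elem_hmode: "hmode m B \<in> elem"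
  unfolding hmode_def[abs_def] by (intro elem.exp elem_diff elem.mult elem.const elem_hs elem_hr)

lemma vf_hmode:
  "vfX j (hmode m B) w = hmode m B w * (2 * \<i> * m * (fst (snd w) $ j) - 2 * B * (fst w $ j))"
  "vfXi j (hmode m B) w = hmode m B w * (- 2 * \<i> * m * (fst w $ j) - 2 * B * (fst (snd w) $ j))"
proof -
  have Q: "(\<lambda>w. \<i> * complex_of_real m * hs w + (- B) * hr w) \<in> elem"
    by (intro elem.add elem.mult elem.const elem_hs elem_hr)
  have H: "hmode m B = (\<lambda>w. exp (\<i> * complex_of_real m * hs w + (- B) * hr w))"
    by (simp add: hmode_def fun_eq_iff)
  note s = vf_exp[OF Q] vf_add[OF elem.mult[OF elem.const elem_hs] elem.mult[OF elem.const elem_hr]]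
    vf_cmult[OF elem_hs] vf_cmult[OF elem_hr] vf_hs vf_hr
  show "vfX j (hmode m B) w = hmode m B w * (2 * \<i> * m * (fst (snd w) $ j) - 2 * B * (fst w $ j))"
    "vfXi j (hmode m B) w = hmode m B w * (- 2 * \<i> * m * (fst w $ j) - 2 * B * (fst (snd w) $ j))"
    unfolding H by (simp_all only: s) (simp_all add: algebra_simps)
qed

text \<open>The mixed terms in m * B * y * \<eta> cancel between the two squares, so the result is
  the mode times an affine function of r. Gaussians with a fixed central frequency are thus
  preserved by the flow, which reduces to ordinary differential equations for amplitude and
  width.\<close>

lemma sublap_hmode:
  fixes w :: "'d::finite heis" and B :: complex
  shows "sublap (hmode m B) w =
    hmode m B w * (4 * (B\<^sup>2 - (complex_of_real m)\<^sup>2) * hr w - 4 * complex_of_real (real CARD('d)) * B)"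
proof -
  have 1: "vfX j (vfX j (hmode m B)) w =
     hmode m B w * ((2 * \<i> * m * (fst (snd w) $ j) - 2 * B * (fst w $ j))\<^sup>2 - 2 * B)" for j
  proof -
    have "vfX j (hmode m B) = (\<lambda>w. hmode m B w * ((2 * \<i> * m) * complex_of_real (fst (snd w) $ j) + (- 2 * B) * complex_of_real (fst w $ j)))"
      by (simp add: vf_hmode fun_eq_iff)
    moreover have "(\<lambda>w::'d heis. (2 * \<i> * m) * complex_of_real (fst (snd w) $ j) + (- 2 * B) * complex_of_real (fst w $ j)) \<in> elem"
      by (intro elem.add elem.mult elem.const elem_coord)
    ultimately show ?thesis
      by (simp only: vf_mult[OF elem_hmode] vf_hmode vf_add[OF elem.mult[OF elem.const elem_coord(2)] elem.mult[OF elem.const elem_coord(1)]]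
        vf_cmult[OF elem_coord(1)] vf_cmult[OF elem_coord(2)] vf_coord) (simp add: power2_eq_square algebra_simps)
  qed
  have 2: "vfXi j (vfXi j (hmode m B)) w =
     hmode m B w * ((- 2 * \<i> * m * (fst w $ j) - 2 * B * (fst (snd w) $ j))\<^sup>2 - 2 * B)" for j
  proof -
    have "vfXi j (hmode m B) = (\<lambda>w. hmode m B w * ((- 2 * \<i> * m) * complex_of_real (fst w $ j) + (- 2 * B) * complex_of_real (fst (snd w) $ j)))"
      by (simp add: vf_hmode fun_eq_iff)
    moreover have "(\<lambda>w::'d heis. (- 2 * \<i> * m) * complex_of_real (fst w $ j) + (- 2 * B) * complex_of_real (fst (snd w) $ j)) \<in> elem"
      by (intro elem.add elem.mult elem.const elem_coord)
    ultimately show ?thesis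
      by (simp only: vf_mult[OF elem_hmode] vf_hmode vf_add[OF elem.mult[OF elem.const elem_coord(1)] elem.mult[OF elem.const elem_coord(2)]]
        vf_cmult[OF elem_coord(1)] vf_cmult[OF elem_coord(2)] vf_coord) (simp add: power2_eq_square algebra_simps)
  qed
  have "sublap (hmode m B) w = (\<Sum>j\<in>UNIV. hmode m B w *
      (4 * (B\<^sup>2 - (complex_of_real m)\<^sup>2) * (complex_of_real (fst w $ j) * complex_of_real (fst w $ j) + complex_of_real (fst (snd w) $ j) * complex_of_real (fst (snd w) $ j)) - 4 * B))"
    unfolding sublap_def 1 2 by (intro sum.cong refl) (simp add: power2_eq_square algebra_simps)
  also have "\<dots> = hmode m B w * (4 * (B\<^sup>2 - (complex_of_real m)\<^sup>2) * (\<Sum>j\<in>UNIV. complex_of_real (fst w $ j) * complex_of_real (fst w $ j) + complex_of_real (fst (snd w) $ j) * complex_of_real (fst (snd w) $ j)) - 4 * complex_of_real (real CARD('d)) * B)"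
    by (simp add: sum_distrib_left[symmetric] sum_subtractf)
  also have "(\<Sum>j\<in>UNIV. complex_of_real (fst w $ j) * complex_of_real (fst w $ j) + complex_of_real (fst (snd w) $ j) * complex_of_real (fst (snd w) $ j)) = hr w"
    by (simp add: hr_def inner_vec_def sum.distrib)
  finally show ?thesis .
qed

text \<open>Supplies the norm differentiability that \<open>sg_pairing_bound\<close> asks for. F' is
  bounded on a compact product of a time interval and S; the mean value inequality passes this bound
  on to the quotients, and dominated convergence upgrades the pointwise limit.\<close>

lemma l2_difference_quotient:
  fixes F F' :: "real \<Rightarrow> 'd::finite heis \<Rightarrow> complex"
  assumes D: "\<And>\<tau> w. ((\<lambda>\<tau>. F \<tau> w) has_vector_derivative F' \<tau> w) (at \<tau>)"
    and cF': "continuous_on UNIV (\<lambda>(\<tau>, w). F' \<tau> w)" and cF: "\<And>\<tau>. continuous_on UNIV (F \<tau>)"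
    and S: "compact S" and F0: "\<And>\<tau> w. w \<notin> S \<Longrightarrow> F \<tau> w = 0" and F'0: "\<And>\<tau> w. w \<notin> S \<Longrightarrow> F' \<tau> w = 0"
  shows "((\<lambda>h. l2norm (\<lambda>w. (F (\<tau> + h) w - F \<tau> w) / complex_of_real h - F' \<tau> w)) \<longlongrightarrow> 0) (at 0)"
proof -
  define G where "G h w = (F (\<tau> + h) w - F \<tau> w) / complex_of_real h - F' \<tau> w" for h w
  have mF: "F \<sigma> \<in> borel_measurable borel" for \<sigma> using cF by (rule borel_measurable_continuous_onI)
  have cF'1: "continuous_on UNIV (F' \<sigma>)" for \<sigma>
  proof -
    have "continuous_on UNIV (\<lambda>w. (\<lambda>(\<tau>, w). F' \<tau> w) (\<sigma>, w))"
      by (rule continuous_on_compose2[OF cF']) (auto intro!: continuous_on_Pair)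
    then show ?thesis by simp
  qed
  have mF': "F' \<sigma> \<in> borel_measurable borel" for \<sigma> using cF'1 by (rule borel_measurable_continuous_onI)
  have mG [measurable]: "G h \<in> borel_measurable borel" for h
    using mF mF' unfolding G_def by measurable
  have "compact ((\<lambda>(\<tau>, w). F' \<tau> w) ` ({\<tau> - 1..\<tau> + 1} \<times> S))"
    by (intro compact_continuous_image continuous_on_subset[OF cF'] compact_Times S) auto
  then have "bounded ((\<lambda>(\<tau>, w). F' \<tau> w) ` ({\<tau> - 1..\<tau> + 1} \<times> S))" by (rule compact_imp_bounded)
  then obtain M where "\<forall>x\<in>(\<lambda>(\<tau>, w). F' \<tau> w) ` ({\<tau> - 1..\<tau> + 1} \<times> S). norm x \<le> M"
    unfolding bounded_iff by blast
  then have M: "norm (F' \<sigma> w) \<le> M" if "\<sigma> \<in> {\<tau> - 1..\<tau> + 1}" "w \<in> S" for \<sigma> w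
    using that by auto
  have M': "norm (F' \<sigma> w) \<le> \<bar>M\<bar>" if "\<sigma> \<in> {\<tau> - 1..\<tau> + 1}" for \<sigma> w
    using M[OF that, of w] F'0[of w \<sigma>] by (cases "w \<in> S") auto
  have Gb: "norm (G h w) \<le> 2 * \<bar>M\<bar> * indicator S w" if h: "\<bar>h\<bar> \<le> 1" "h \<noteq> 0" for h w
  proof (cases "w \<in> S")
    case True
    have "norm (F (\<tau> + h) w - F \<tau> w) \<le> \<bar>M\<bar> * norm (\<tau> + h - \<tau>)"
    proof (rule differentiable_bound[where S = "{\<tau> - 1..\<tau> + 1}" and f = "\<lambda>\<tau>. F \<tau> w" and f' = "\<lambda>\<sigma> x. x *\<^sub>R F' \<sigma> w"])
      fix \<sigma> assume s: "\<sigma> \<in> {\<tau> - 1..\<tau> + 1}"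
      show "((\<lambda>\<tau>. F \<tau> w) has_derivative (\<lambda>x. x *\<^sub>R F' \<sigma> w)) (at \<sigma> within {\<tau> - 1..\<tau> + 1})"
        using D[of w \<sigma>] unfolding has_vector_derivative_def by (rule has_derivative_at_withinI)
      show "onorm (\<lambda>x. x *\<^sub>R F' \<sigma> w) \<le> \<bar>M\<bar>"
        using M'[OF s] by (intro onorm_le) (simp add: mult.commute mult_left_mono)
    qed (use h in auto)
    then have "norm ((F (\<tau> + h) w - F \<tau> w) / complex_of_real h) \<le> \<bar>M\<bar>"
      using h by (simp add: norm_divide field_simps)
    moreover have "norm (F' \<tau> w) \<le> \<bar>M\<bar>" by (rule M') auto
    ultimately show ?thesis
      unfolding G_def using True norm_triangle_ineq4[of "(F (\<tau> + h) w - F \<tau> w) / complex_of_real h" "F' \<tau> w"] by simp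
  next
    case False
    then show ?thesis by (simp add: G_def F0 F'0)
  qed
  have G0: "((\<lambda>h. G h w) \<longlongrightarrow> 0) (at 0)" for w
  proof -
    have "((\<lambda>h. norm (F (\<tau> + h) w - F \<tau> w - h *\<^sub>R F' \<tau> w) / norm h) \<longlongrightarrow> 0) (at 0)"
      using D[of w \<tau>] unfolding has_vector_derivative_def has_derivative_at by blast
    then have "((\<lambda>h. norm (G h w)) \<longlongrightarrow> 0) (at 0)"
    proof (rule Lim_transform_eventually)
      have "norm (F (\<tau> + h) w - F \<tau> w - h *\<^sub>R F' \<tau> w) / norm h = norm (G h w)" if "h \<noteq> 0" for h
      proof -
        have "G h w = (F (\<tau> + h) w - F \<tau> w - h *\<^sub>R F' \<tau> w) / complex_of_real h"
          using that by (simp add: G_def field_simps scaleR_conv_of_real)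
        then show ?thesis by (simp add: norm_divide)
      qed
      then show "\<forall>\<^sub>F h in at 0. norm (F (\<tau> + h) w - F \<tau> w - h *\<^sub>R F' \<tau> w) / norm h = norm (G h w)"
        by (simp add: eventually_at_filter)
    qed
    then show ?thesis by (rule tendsto_norm_zero_cancel)
  qed
  have "((\<lambda>h. \<integral>w. (norm (G h w))\<^sup>2 \<partial>lborel) \<longlongrightarrow> 0) (at 0)"
  proof (subst tendsto_at_iff_sequentially, intro allI impI)
    fix X :: "nat \<Rightarrow> real"
    assume X: "\<forall>i. X i \<in> UNIV - {0}" "X \<longlonglongrightarrow> 0"
    have XG: "(\<lambda>i. G (X i) w) \<longlonglongrightarrow> 0" for w
      using G0[of w] X unfolding tendsto_at_iff_sequentially o_def by auto
    obtain N where "\<forall>i\<ge>N. norm (X i - 0) < 1"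
      using X(2)[unfolded LIMSEQ_iff] zero_less_one by blast
    then have N: "\<bar>X i\<bar> \<le> 1" if "i \<ge> N" for i using that by force
    have "(\<lambda>i. \<integral>w. (norm (G (X (i + N)) w))\<^sup>2 \<partial>lborel) \<longlonglongrightarrow> (\<integral>w. 0 \<partial>(lborel :: 'd heis measure))"
    proof (rule integral_dominated_convergence)
      have "integrable lborel (\<lambda>w. indicator S w *\<^sub>R (2 * \<bar>M\<bar>)\<^sup>2)"
        by (intro borel_integrable_compact S continuous_intros)
      then show "integrable lborel (\<lambda>w. (2 * \<bar>M\<bar>)\<^sup>2 * indicator S w)" by (simp add: mult.commute)
      show "AE w in lborel. (\<lambda>i. (norm (G (X (i + N)) w))\<^sup>2) \<longlonglongrightarrow> 0"
      proof (rule AE_I2)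
        fix w
        from LIMSEQ_ignore_initial_segment[OF XG[of w], of N]
        show "(\<lambda>i. (norm (G (X (i + N)) w))\<^sup>2) \<longlonglongrightarrow> 0"
          by (auto intro!: tendsto_eq_intros)
      qed
      show "AE w in lborel. norm ((norm (G (X (i + N)) w))\<^sup>2) \<le> (2 * \<bar>M\<bar>)\<^sup>2 * indicator S w" for i
      proof (rule AE_I2)
        fix w
        have "(norm (G (X (i + N)) w))\<^sup>2 \<le> (2 * \<bar>M\<bar> * indicator S w)\<^sup>2"
          using X(1) N[of "i + N"] by (intro power_mono Gb) auto
        also have "\<dots> = (2 * \<bar>M\<bar>)\<^sup>2 * indicator S w"
          by (auto simp: indicator_def)
        finally show "norm ((norm (G (X (i + N)) w))\<^sup>2) \<le> (2 * \<bar>M\<bar>)\<^sup>2 * indicator S w" by simp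
      qed
    qed measurable
    then have "(\<lambda>i. \<integral>w. (norm (G (X (i + N)) w))\<^sup>2 \<partial>lborel) \<longlonglongrightarrow> 0" by simp
    then have "(\<lambda>i. \<integral>w. (norm (G (X i) w))\<^sup>2 \<partial>lborel) \<longlonglongrightarrow> 0"
      by (rule LIMSEQ_offset)
    then show "((\<lambda>h. \<integral>w. (norm (G h w))\<^sup>2 \<partial>lborel) \<circ> X) \<longlonglongrightarrow> 0" by (simp add: o_def)
  qed
  then have "((\<lambda>h. sqrt (\<integral>w. (norm (G h w))\<^sup>2 \<partial>lborel)) \<longlongrightarrow> sqrt 0) (at 0)"
    by (rule tendsto_real_sqrt)
  then show ?thesis unfolding l2norm_def G_def by simp
qed

section \<open>Finiteness of the Gaussian integrals\<close>

lemma nn_integral_inverse_square_finite: "(\<integral>\<^sup>+x. ennreal (1 / (1 + x\<^sup>2)) \<partial>(lborel :: real measure)) < \<infinity>"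
proof -
  have 0: "(\<integral>\<^sup>+x. ennreal (1 / (1 + x\<^sup>2)) * indicator {0..} x \<partial>lborel) = ennreal (pi / 2 - arctan 0)"
    by (rule nn_integral_FTC_atLeast[OF _ _ _ tendsto_arctan_at_top])
       (auto intro!: derivative_eq_intros simp: field_simps)
  have "(\<integral>\<^sup>+x. ennreal (1 / (1 + x\<^sup>2)) * indicator {..0} x \<partial>lborel)
     = (\<integral>\<^sup>+x. ennreal (1 / (1 + x\<^sup>2)) * indicator {0..} x \<partial>lborel)"
    by (subst lborel_distr_uminus[symmetric], subst nn_integral_distr)
       (auto simp: indicator_def intro!: nn_integral_cong)
  moreover have "(\<integral>\<^sup>+x. ennreal (1 / (1 + x\<^sup>2)) \<partial>lborel) \<le>
     (\<integral>\<^sup>+x. ennreal (1 / (1 + x\<^sup>2)) * indicator {0..} x + ennreal (1 / (1 + x\<^sup>2)) * indicator {..0} x \<partial>(lborel::real measure))"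
    by (intro nn_integral_mono) (auto simp: indicator_def)
  ultimately have "(\<integral>\<^sup>+x. ennreal (1 / (1 + x\<^sup>2)) \<partial>(lborel :: real measure)) \<le> ennreal (pi / 2) + ennreal (pi / 2)"
    using 0 by (simp add: nn_integral_add)
  also have "\<dots> < \<infinity>" by simp
  finally show ?thesis .
qed

lemma nn_integral_gaussian_finite:
  assumes "0 < \<beta>"
  shows "(\<integral>\<^sup>+x. ennreal (exp (- \<beta> * (x \<bullet> x))) \<partial>(lborel :: 'a::euclidean_space measure)) < \<infinity>"
proof -
  have one: "(\<integral>\<^sup>+x. ennreal (exp (- \<beta> * x\<^sup>2)) \<partial>(lborel :: real measure)) < \<infinity>"
  proof -
    have "exp (- \<beta> * x\<^sup>2) \<le> (1 + 1 / \<beta>) * (1 / (1 + x\<^sup>2))" for x :: real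
    proof -
      have "1 + x\<^sup>2 \<le> (1 + 1 / \<beta>) * (1 + \<beta> * x\<^sup>2)"
        using assms by (simp add: field_simps)
      also have "\<dots> \<le> (1 + 1 / \<beta>) * exp (\<beta> * x\<^sup>2)"
        using assms exp_ge_add_one_self by (intro mult_left_mono) auto
      finally have "(1 + x\<^sup>2) * exp (- \<beta> * x\<^sup>2) \<le> (1 + 1 / \<beta>) * exp (\<beta> * x\<^sup>2) * exp (- \<beta> * x\<^sup>2)"
        by (intro mult_right_mono) auto
      then have "(1 + x\<^sup>2) * exp (- \<beta> * x\<^sup>2) \<le> 1 + 1 / \<beta>" by (simp add: mult.assoc flip: exp_add)
      moreover have "0 < 1 + x\<^sup>2" by (simp add: add_pos_nonneg)
      ultimately show ?thesis by (simp add: pos_le_divide_eq mult.commute)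
    qed
    then have "(\<integral>\<^sup>+x. ennreal (exp (- \<beta> * x\<^sup>2)) \<partial>(lborel :: real measure)) \<le> (\<integral>\<^sup>+x. ennreal (1 + 1 / \<beta>) * ennreal (1 / (1 + x\<^sup>2)) \<partial>lborel)"
      using assms by (intro nn_integral_mono) (simp only: ennreal_mult[symmetric] divide_nonneg_nonneg add_nonneg_nonneg zero_le_power2 zero_le_one less_imp_le ennreal_leI)
    also have "\<dots> = ennreal (1 + 1 / \<beta>) * (\<integral>\<^sup>+x. ennreal (1 / (1 + x\<^sup>2)) \<partial>lborel)"
      by (intro nn_integral_cmult) auto
    also have "\<dots> < \<infinity>"
      using nn_integral_inverse_square_finite by (simp add: ennreal_mult_less_top)
    finally show ?thesis .
  qed
  have "(\<integral>\<^sup>+x. ennreal (exp (- \<beta> * (x \<bullet> x))) \<partial>(lborel :: 'a measure)) =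
     (\<integral>\<^sup>+x. (\<Prod>b\<in>Basis. ennreal (exp (- \<beta> * (x \<bullet> b)\<^sup>2))) \<partial>(lborel :: 'a measure))"
  proof (intro nn_integral_cong)
    fix x :: 'a
    have "x \<bullet> x = (\<Sum>b\<in>Basis. (x \<bullet> b)\<^sup>2)"
      by (subst euclidean_inner) (simp add: power2_eq_square)
    then show "ennreal (exp (- \<beta> * (x \<bullet> x))) = (\<Prod>b\<in>Basis. ennreal (exp (- \<beta> * (x \<bullet> b)\<^sup>2)))"
      by (simp add: prod_ennreal sum_distrib_left exp_sum[symmetric] sum_negf[symmetric])
  qed
  also have "\<dots> = (\<Prod>b\<in>(Basis::'a set). (\<integral>\<^sup>+x. ennreal (exp (- \<beta> * x\<^sup>2)) \<partial>lborel))"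
    by (rule nn_integral_lborel_prod) auto
  also have "\<dots> < \<infinity>"
    using one by (simp add: power_less_top_ennreal)
  finally show ?thesis .
qed

text \<open>Kept as an unevaluated finite constant: it multiplies an error that disappears when the
  cutoff radius grows.\<close>

definition gaussian_mass :: "real \<Rightarrow> 'd::finite itself \<Rightarrow> real" where
  "gaussian_mass \<beta> _ = enn2real (\<integral>\<^sup>+y. \<integral>\<^sup>+\<eta>. ennreal (exp (- \<beta> * (y \<bullet> y + \<eta> \<bullet> \<eta>))) \<partial>(lborel :: (real^'d) measure) \<partial>(lborel :: (real^'d) measure))"

lemma gaussian_mass:
  fixes T :: "'d::finite itself" assumes "0 < \<beta>"
  shows "(\<integral>\<^sup>+y. \<integral>\<^sup>+\<eta>. ennreal (exp (- \<beta> * (y \<bullet> y + \<eta> \<bullet> \<eta>))) \<partial>(lborel :: (real^'d) measure) \<partial>(lborel :: (real^'d) measure)) = ennreal (gaussian_mass \<beta> TYPE('d))"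
proof -
  have "(\<integral>\<^sup>+y. \<integral>\<^sup>+\<eta>. ennreal (exp (- \<beta> * (y \<bullet> y + \<eta> \<bullet> \<eta>))) \<partial>(lborel :: (real^'d) measure) \<partial>(lborel :: (real^'d) measure))
     = (\<integral>\<^sup>+y. ennreal (exp (- \<beta> * (y \<bullet> y))) * (\<integral>\<^sup>+\<eta>. ennreal (exp (- \<beta> * (\<eta> \<bullet> \<eta>))) \<partial>(lborel :: (real^'d) measure)) \<partial>(lborel :: (real^'d) measure))"
    by (intro nn_integral_cong, subst nn_integral_cmult[symmetric])
       (auto simp: distrib_left exp_add[symmetric] algebra_simps intro!: nn_integral_cong simp flip: ennreal_mult)
  also have "\<dots> = (\<integral>\<^sup>+y. ennreal (exp (- \<beta> * (y \<bullet> y))) \<partial>(lborel :: (real^'d) measure)) * (\<integral>\<^sup>+\<eta>. ennreal (exp (- \<beta> * (\<eta> \<bullet> \<eta>))) \<partial>(lborel :: (real^'d) measure))"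
    by (rule nn_integral_multc) measurable
  also have "\<dots> < \<infinity>"
    using nn_integral_gaussian_finite[OF assms, where 'a = "real^'d"] by (simp add: ennreal_mult_less_top)
  finally show ?thesis unfolding gaussian_mass_def by simp
qed

lemma gaussian_mass_nonneg: "0 \<le> gaussian_mass \<beta> T"
  by (simp add: gaussian_mass_def)

section \<open>Smooth cutoffs and their commutator with the sublaplacian\<close>

abbreviation flat_deriv :: "real poly \<Rightarrow> real poly" where
  "flat_deriv p \<equiv> pCons 0 (pCons 0 (p - pderiv p))"

lemma flat_bounded: "\<exists>M\<ge>0. \<forall>u\<le>1. \<bar>flat p u\<bar> \<le> M"
proof -
  have "compact (flat p ` {0..1})"
    by (intro compact_continuous_image flat_continuous) auto
  then have "bounded (flat p ` {0..1})" by (rule compact_imp_bounded)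
  then obtain M where "\<forall>x\<in>flat p ` {0..1}. norm x \<le> M"
    unfolding bounded_iff by blast
  then have M: "\<bar>flat p u\<bar> \<le> M" if "u \<in> {0..1}" for u using that by auto
  have "\<bar>flat p u\<bar> \<le> \<bar>M\<bar>" if "u \<le> 1" for u
    using M[of u] that by (cases "0 \<le> u") (auto simp: flat_def)
  then show ?thesis by (intro exI[of _ "\<bar>M\<bar>"]) auto
qed

text \<open>1 minus the square of the Euclidean norm of w / N. The Euclidean norm squared is r +
  s^2, a polynomial of low degree whose derivatives along the fields are short explicit
  expressions.\<close>

definition bumparg :: "real \<Rightarrow> 'd::finite heis \<Rightarrow> complex" where
  "bumparg N w = 1 + complex_of_real (- 1 / N\<^sup>2) * (hr w + hs w * hs w)"

definition bump :: "real poly \<Rightarrow> real \<Rightarrow> 'd::finite heis \<Rightarrow> complex" where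
  "bump p N w = complex_of_real (flat p (Re (bumparg N w)))"

lemma elem_bumparg: "bumparg N \<in> elem"
  unfolding bumparg_def[abs_def] by (intro elem.add elem.mult elem.const elem_hr elem_hs)

lemma elem_bump: "bump p N \<in> elem"
  unfolding bump_def[abs_def] by (intro elem.flat elem_bumparg)

lemma bumparg_eq: "bumparg N w = complex_of_real (1 - ((norm w)\<^sup>2) / N\<^sup>2)"
proof -
  have "(norm w)\<^sup>2 = fst w \<bullet> fst w + fst (snd w) \<bullet> fst (snd w) + (snd (snd w))\<^sup>2"
    by (cases w) (simp add: norm_Pair power2_norm_eq_inner)
  then show ?thesis unfolding bumparg_def hr_def hs_def by (simp add: power2_eq_square diff_divide_distrib add_divide_distrib)
qed

lemma bump_outside: assumes "0 < N" "N \<le> norm w" shows "bump p N w = 0"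
proof -
  have "N\<^sup>2 \<le> (norm w)\<^sup>2" using assms by (intro power_mono) auto
  then have "\<not> (norm w)\<^sup>2 < N\<^sup>2" by simp
  then show ?thesis using assms by (simp add: bump_def bumparg_eq flat_def)
qed

lemma vf_bumparg:
  "vfX j (bumparg N) w = complex_of_real (- (2 * (fst w $ j) + 4 * snd (snd w) * (fst (snd w) $ j)) / N\<^sup>2)"
  "vfXi j (bumparg N) w = complex_of_real (- (2 * (fst (snd w) $ j) - 4 * snd (snd w) * (fst w $ j)) / N\<^sup>2)"
proof -
  note e = elem.add[OF elem_hr elem.mult[OF elem_hs elem_hs]]
  show "vfX j (bumparg N) w = complex_of_real (- (2 * (fst w $ j) + 4 * snd (snd w) * (fst (snd w) $ j)) / N\<^sup>2)"
    "vfXi j (bumparg N) w = complex_of_real (- (2 * (fst (snd w) $ j) - 4 * snd (snd w) * (fst w $ j)) / N\<^sup>2)"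
    unfolding bumparg_def[abs_def]
    by (simp_all only: vf_add[OF elem.const elem.mult[OF elem.const e]] vf_const vf_cmult[OF e]
        vf_add[OF elem_hr elem.mult[OF elem_hs elem_hs]] vf_mult[OF elem_hs elem_hs] vf_hr vf_hs)
      (simp_all add: hs_def add_divide_distrib diff_divide_distrib)
qed

lemma vf2_bumparg:
  "vfX j (vfX j (bumparg N)) w = complex_of_real (- (2 + 8 * (fst (snd w) $ j)\<^sup>2) / N\<^sup>2)"
  "vfXi j (vfXi j (bumparg N)) w = complex_of_real (- (2 + 8 * (fst w $ j)\<^sup>2) / N\<^sup>2)"
proof -
  have X: "vfX j (bumparg N) = (\<lambda>w. complex_of_real (- 2 / N\<^sup>2) * complex_of_real (fst w $ j)
      + complex_of_real (- 4 / N\<^sup>2) * (hs w * complex_of_real (fst (snd w) $ j)))"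
    by (simp add: fun_eq_iff vf_bumparg hs_def diff_divide_distrib add_divide_distrib)
  have Xi: "vfXi j (bumparg N) = (\<lambda>w. complex_of_real (- 2 / N\<^sup>2) * complex_of_real (fst (snd w) $ j)
      + complex_of_real (4 / N\<^sup>2) * (hs w * complex_of_real (fst w $ j)))"
    by (simp add: fun_eq_iff vf_bumparg hs_def diff_divide_distrib add_divide_distrib)
  show "vfX j (vfX j (bumparg N)) w = complex_of_real (- (2 + 8 * (fst (snd w) $ j)\<^sup>2) / N\<^sup>2)"
    unfolding X
    by (simp only: vf_add[OF elem.mult[OF elem.const elem_coord(1)] elem.mult[OF elem.const elem.mult[OF elem_hs elem_coord(2)]]]
        vf_cmult[OF elem_coord(1)] vf_cmult[OF elem.mult[OF elem_hs elem_coord(2)]] vf_mult[OF elem_hs elem_coord(2)] vf_coord vf_hs)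
      (simp add: power2_eq_square add_divide_distrib diff_divide_distrib)
  show "vfXi j (vfXi j (bumparg N)) w = complex_of_real (- (2 + 8 * (fst w $ j)\<^sup>2) / N\<^sup>2)"
    unfolding Xi
    by (simp only: vf_add[OF elem.mult[OF elem.const elem_coord(2)] elem.mult[OF elem.const elem.mult[OF elem_hs elem_coord(1)]]]
        vf_cmult[OF elem_coord(2)] vf_cmult[OF elem.mult[OF elem_hs elem_coord(1)]] vf_mult[OF elem_hs elem_coord(1)] vf_coord vf_hs)
      (simp add: power2_eq_square add_divide_distrib diff_divide_distrib)
qed

lemma vf_bump:
  "vfX j (bump p N) w = bump (flat_deriv p) N w * vfX j (bumparg N) w"
  "vfXi j (bump p N) w = bump (flat_deriv p) N w * vfXi j (bumparg N) w"
proof -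
  note e = elem.flat[OF elem_bumparg, of p N]
  have r: "Im (vfX j (bumparg N) w) = 0" "Im (vfXi j (bumparg N) w) = 0"
    by (simp_all only: vf_bumparg Im_complex_of_real)
  have "vfX j (bump p N) w = complex_of_real (flat (flat_deriv p) (Re (bumparg N w)) * Re (vfX j (bumparg N) w))"
    unfolding bump_def[abs_def] by (simp only: vfX_eq[OF e] vfX_eq[OF elem_bumparg] dirder_flat[OF elem_bumparg])
  then show "vfX j (bump p N) w = bump (flat_deriv p) N w * vfX j (bumparg N) w"
    using r(1) by (simp add: bump_def complex_eq_iff)
  have "vfXi j (bump p N) w = complex_of_real (flat (flat_deriv p) (Re (bumparg N w)) * Re (vfXi j (bumparg N) w))"
    unfolding bump_def[abs_def] by (simp only: vfXi_eq[OF e] vfXi_eq[OF elem_bumparg] dirder_flat[OF elem_bumparg])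
  then show "vfXi j (bump p N) w = bump (flat_deriv p) N w * vfXi j (bumparg N) w"
    using r(2) by (simp add: bump_def complex_eq_iff)
qed

lemma vf2_bump:
  "vfX j (vfX j (bump p N)) w = bump (flat_deriv p) N w * vfX j (vfX j (bumparg N)) w
     + bump (flat_deriv (flat_deriv p)) N w * (vfX j (bumparg N) w)\<^sup>2"
  "vfXi j (vfXi j (bump p N)) w = bump (flat_deriv p) N w * vfXi j (vfXi j (bumparg N)) w
     + bump (flat_deriv (flat_deriv p)) N w * (vfXi j (bumparg N) w)\<^sup>2"
proof -
  have "vfX j (bump p N) = (\<lambda>w. bump (flat_deriv p) N w * vfX j (bumparg N) w)"
    "vfXi j (bump p N) = (\<lambda>w. bump (flat_deriv p) N w * vfXi j (bumparg N) w)"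
    by (simp_all only: vf_bump[abs_def])
  then show "vfX j (vfX j (bump p N)) w = bump (flat_deriv p) N w * vfX j (vfX j (bumparg N)) w
     + bump (flat_deriv (flat_deriv p)) N w * (vfX j (bumparg N) w)\<^sup>2"
  "vfXi j (vfXi j (bump p N)) w = bump (flat_deriv p) N w * vfXi j (vfXi j (bumparg N)) w
     + bump (flat_deriv (flat_deriv p)) N w * (vfXi j (bumparg N) w)\<^sup>2"
    by (simp_all only: vf_mult[OF elem_bump elem_vfX[OF elem_bumparg]] vf_mult[OF elem_bump elem_vfXi[OF elem_bumparg]] vf_bump
      power2_eq_square mult.assoc)
qed

definition bump_comm :: "real \<Rightarrow> real \<Rightarrow> complex \<Rightarrow> 'd::finite heis \<Rightarrow> complex" where
  "bump_comm N m B w = sublap (\<lambda>w. bump [:1:] N w * hmode m B w) w - bump [:1:] N w * sublap (hmode m B) w"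

text \<open>Only derivatives of the cutoff survive in the commutator. The field derivative of
  \<open>bumparg\<close> contains s / N^2, but \<bar>s\<bar> < N on the support, so it is still at
  most 6 * sqrt r / N. A second derivative of the cutoff costs 8 + 36 = 44, from the second
  derivative of the argument and the square of the first; the two families of fields make 88, which
  also dominates the 48 of the mixed terms. The indicator is kept because the mode itself does not
  decay in s.\<close>

lemma bump_comm_bound:
  fixes w :: "'d::finite heis"
  assumes M: "\<And>u. u \<le> 1 \<Longrightarrow> \<bar>flat (flat_deriv [:1:]) u\<bar> \<le> M" "\<And>u. u \<le> 1 \<Longrightarrow> \<bar>flat (flat_deriv (flat_deriv [:1:])) u\<bar> \<le> M"
    and N: "1 \<le> N"
  defines "r \<equiv> fst w \<bullet> fst w + fst (snd w) \<bullet> fst (snd w)"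
  shows "norm (bump_comm N m B w)
     \<le> 88 * real CARD('d) * M / N * (1 + \<bar>m\<bar> + norm B) * (1 + r) * exp (- Re B * r) * indicator {- N<..<N} (snd (snd w))"
proof (cases "N \<le> \<bar>snd (snd w)\<bar>")
  case True
  have "\<bar>snd (snd w)\<bar> \<le> norm w"
    by (metis norm_snd_le order_trans prod.collapse real_norm_def)
  then have "bump p N w = 0" for p using True N by (intro bump_outside) auto
  then show ?thesis
    using True unfolding bump_comm_def sublap_mult[OF elem_bump elem_hmode]
    by (auto simp: sublap_def vf_bump vf2_bump indicator_def)
next
  case False
  define s where "s = snd (snd w)"
  define \<kappa> where "\<kappa> = norm (hmode m B w)"
  have s: "\<bar>s\<bar> < N" using False by (simp add: s_def)
  have r: "0 \<le> r" by (simp add: r_def)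
  have M0: "0 \<le> M" using M(1)[of 0] by linarith
  have \<kappa>: "\<kappa> = exp (- Re B * r)"
    by (simp add: \<kappa>_def hmode_def norm_exp_eq_Re hs_def hr_def r_def)
  have cj: "\<bar>fst w $ j\<bar> \<le> sqrt r" "\<bar>fst (snd w) $ j\<bar> \<le> sqrt r" for j
  proof -
    have "\<bar>fst w $ j\<bar> \<le> norm (fst w)" "\<bar>fst (snd w) $ j\<bar> \<le> norm (fst (snd w))"
      by (rule component_le_norm_cart)+
    moreover have "norm (fst w) \<le> sqrt r" "norm (fst (snd w)) \<le> sqrt r"
      unfolding r_def norm_eq_sqrt_inner by (intro real_sqrt_le_mono; simp)+
    ultimately show "\<bar>fst w $ j\<bar> \<le> sqrt r" "\<bar>fst (snd w) $ j\<bar> \<le> sqrt r" by linarith+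
  qed
  have bM: "norm (bump (flat_deriv [:1:]) N w) \<le> M" "norm (bump (flat_deriv (flat_deriv [:1:])) N w) \<le> M"
    using M by (auto simp: bump_def bumparg_eq)
  have lin: "\<bar>2 * u + 4 * s * v\<bar> / N\<^sup>2 \<le> 6 * sqrt r / N" if "\<bar>u\<bar> \<le> sqrt r" "\<bar>v\<bar> \<le> sqrt r" for u v
  proof -
    have "\<bar>2 * u + 4 * (s * v)\<bar> \<le> 2 * \<bar>u\<bar> + 4 * \<bar>s * v\<bar>" by linarith
    then have "\<bar>2 * u + 4 * s * v\<bar> \<le> 2 * \<bar>u\<bar> + 4 * (\<bar>s\<bar> * \<bar>v\<bar>)"
      by (simp only: abs_mult mult.assoc)
    also have "\<dots> \<le> 2 * (N * sqrt r) + 4 * (N * sqrt r)"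
    proof -
      have "\<bar>u\<bar> \<le> N * sqrt r" using that(1) N mult_right_mono[OF N, of "sqrt r"] r by simp
      moreover have "\<bar>s\<bar> * \<bar>v\<bar> \<le> N * sqrt r" using s that N by (intro mult_mono) auto
      ultimately show ?thesis by linarith
    qed
    finally have "\<bar>2 * u + 4 * s * v\<bar> \<le> 6 * sqrt r * N" by (simp add: algebra_simps)
    then show ?thesis using N by (simp add: field_simps power2_eq_square)
  qed
  have Q1: "norm (vfX j (bumparg N) w) \<le> 6 * sqrt r / N" for j
    using lin[OF cj(1)[of j] cj(2)[of j]] by (simp only: vf_bumparg norm_of_real s_def abs_divide abs_minus_cancel abs_power2)
  have Q2: "norm (vfXi j (bumparg N) w) \<le> 6 * sqrt r / N" for j
    using lin[OF cj(2)[of j], of "- (fst w $ j)"] cj(1)[of j] by (simp only: vf_bumparg norm_of_real s_def abs_divide abs_minus_cancel abs_power2) simp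
  have QQ: "\<bar>- (2 + 8 * u\<^sup>2) / N\<^sup>2\<bar> \<le> 8 * (1 + r) / N" if "\<bar>u\<bar> \<le> sqrt r" for u
  proof -
    have "u\<^sup>2 \<le> (sqrt r)\<^sup>2" using that by (metis abs_ge_zero power2_abs power_mono)
    then have "2 + 8 * u\<^sup>2 \<le> 8 * (1 + r)" using r by simp
    also have "\<dots> \<le> 8 * (1 + r) * N" using N r by (simp add: mult_le_cancel_left1)
    finally have "(2 + 8 * u\<^sup>2) / N\<^sup>2 \<le> 8 * (1 + r) * N / N\<^sup>2" by (intro divide_right_mono) auto
    also have "8 * (1 + r) * N / N\<^sup>2 = 8 * (1 + r) / N" using N by (simp add: power2_eq_square)
    finally have "(2 + 8 * u\<^sup>2) / N\<^sup>2 \<le> 8 * (1 + r) / N" .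
    moreover have "\<bar>- (2 + 8 * u\<^sup>2) / N\<^sup>2\<bar> = (2 + 8 * u\<^sup>2) / N\<^sup>2"
      unfolding abs_divide abs_minus_cancel by (simp add: abs_of_nonneg)
    ultimately show ?thesis by linarith
  qed
  have sq: "(6 * sqrt r / N)\<^sup>2 \<le> 36 * (1 + r) / N"
  proof -
    have "(6 * sqrt r / N)\<^sup>2 = 36 * r / N\<^sup>2" using r by (simp add: power_divide power_mult_distrib)
    also have "\<dots> \<le> 36 * (1 + r) * N / N\<^sup>2"
      using N r by (intro divide_right_mono) (auto intro: order_trans[of _ "36 * (1 + r)"] simp: mult_le_cancel_left1)
    finally show ?thesis using N by (simp add: power2_eq_square)
  qed
  have gen2: "norm (b1 * x + b2 * y\<^sup>2) \<le> 44 * M * (1 + r) / N"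
    if "norm b1 \<le> M" "norm b2 \<le> M" "norm x \<le> 8 * (1 + r) / N" "norm y \<le> 6 * sqrt r / N" for b1 b2 x y :: complex
  proof -
    have "norm (y\<^sup>2) \<le> (6 * sqrt r / N)\<^sup>2" unfolding norm_power using that by (intro power_mono) auto
    then have y2: "norm (y\<^sup>2) \<le> 36 * (1 + r) / N" using sq by linarith
    have "norm (b1 * x + b2 * y\<^sup>2) \<le> norm b1 * norm x + norm b2 * norm (y\<^sup>2)"
      by (metis norm_mult norm_triangle_ineq)
    also have "\<dots> \<le> M * (8 * (1 + r) / N) + M * (36 * (1 + r) / N)"
      using that y2 M0 by (intro add_mono mult_mono) auto
    also have "\<dots> = 44 * M * (1 + r) / N" using N by (simp add: field_simps)
    finally show ?thesis .
  qed
  have V1: "norm (vfX j (vfX j (bump [:1:] N)) w) \<le> 44 * M * (1 + r) / N" for j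
    unfolding vf2_bump using QQ[OF cj(2)[of j]] by (intro gen2 bM Q1) (simp only: vf2_bumparg norm_of_real)
  have V2: "norm (vfXi j (vfXi j (bump [:1:] N)) w) \<le> 44 * M * (1 + r) / N" for j
    unfolding vf2_bump using QQ[OF cj(1)[of j]] by (intro gen2 bM Q2) (simp only: vf2_bumparg norm_of_real)
  have S: "norm (sublap (bump [:1:] N) w) \<le> real CARD('d) * (88 * M * (1 + r) / N)"
  proof -
    have "norm (sublap (bump [:1:] N) w) \<le> (\<Sum>j\<in>(UNIV::'d set). 44 * M * (1 + r) / N + 44 * M * (1 + r) / N)"
      unfolding sublap_def by (intro sum_norm_le order_trans[OF norm_triangle_ineq] add_mono V1 V2)
    then show ?thesis by simp
  qed
  have modegen: "norm (2 * \<i> * complex_of_real m * complex_of_real u - 2 * B * complex_of_real v) \<le> 2 * (\<bar>m\<bar> + norm B) * sqrt r"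
    if "\<bar>u\<bar> \<le> sqrt r" "\<bar>v\<bar> \<le> sqrt r" for u v
  proof -
    have "norm (2 * \<i> * complex_of_real m * complex_of_real u - 2 * B * complex_of_real v) \<le> 2 * \<bar>m\<bar> * \<bar>u\<bar> + 2 * norm B * \<bar>v\<bar>"
      by (rule order_trans[OF norm_triangle_ineq4]) (simp add: norm_mult)
    also have "\<dots> \<le> 2 * \<bar>m\<bar> * sqrt r + 2 * norm B * sqrt r"
      using that by (intro add_mono mult_left_mono) auto
    finally show ?thesis by (simp add: algebra_simps)
  qed
  have H1: "norm (vfX j (hmode m B) w) \<le> \<kappa> * (2 * (\<bar>m\<bar> + norm B) * sqrt r)" for j
    unfolding vf_hmode norm_mult[of "hmode m B w"] \<kappa>_def by (intro mult_left_mono modegen cj) auto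
  have H2: "norm (vfXi j (hmode m B) w) \<le> \<kappa> * (2 * (\<bar>m\<bar> + norm B) * sqrt r)" for j
    unfolding vf_hmode norm_mult[of "hmode m B w"] \<kappa>_def
    using modegen[of "- (fst w $ j)" "fst (snd w) $ j"] cj by (intro mult_left_mono) auto
  have b1: "norm (vfX j (bump [:1:] N) w) \<le> M * (6 * sqrt r / N)" "norm (vfXi j (bump [:1:] N) w) \<le> M * (6 * sqrt r / N)" for j
    unfolding vf_bump norm_mult by (intro mult_mono bM Q1 Q2 M0 norm_ge_zero)+
  have pr: "norm (x * y) \<le> 12 * M * \<kappa> * (\<bar>m\<bar> + norm B) * r / N"
    if "norm x \<le> M * (6 * sqrt r / N)" "norm y \<le> \<kappa> * (2 * (\<bar>m\<bar> + norm B) * sqrt r)" for x y :: complex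
  proof -
    have "norm (x * y) \<le> (M * (6 * sqrt r / N)) * (\<kappa> * (2 * (\<bar>m\<bar> + norm B) * sqrt r))"
      unfolding norm_mult using that M0 r N by (intro mult_mono) auto
    also have "\<dots> = 12 * M * \<kappa> * (\<bar>m\<bar> + norm B) * (sqrt r * sqrt r) / N"
    proof -
      have "(M * (6 * q / N)) * (\<kappa> * (2 * X * q)) = 12 * M * \<kappa> * X * (q * q) / N" for q X by simp
      then show ?thesis by blast
    qed
    finally show ?thesis using r by simp
  qed
  have C: "norm (\<Sum>j\<in>UNIV. vfX j (bump [:1:] N) w * vfX j (hmode m B) w + vfXi j (bump [:1:] N) w * vfXi j (hmode m B) w)
     \<le> real CARD('d) * (24 * M * \<kappa> * (\<bar>m\<bar> + norm B) * r / N)"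
  proof -
    have "norm (\<Sum>j\<in>UNIV. vfX j (bump [:1:] N) w * vfX j (hmode m B) w + vfXi j (bump [:1:] N) w * vfXi j (hmode m B) w)
      \<le> (\<Sum>j\<in>(UNIV::'d set). 12 * M * \<kappa> * (\<bar>m\<bar> + norm B) * r / N + 12 * M * \<kappa> * (\<bar>m\<bar> + norm B) * r / N)"
      by (intro sum_norm_le order_trans[OF norm_triangle_ineq] add_mono pr b1 H1 H2)
    then show ?thesis by (simp add: mult_ac)
  qed
  have "norm (bump_comm N m B w) \<le> norm (hmode m B w * sublap (bump [:1:] N) w)
     + norm (2 * (\<Sum>j\<in>UNIV. vfX j (bump [:1:] N) w * vfX j (hmode m B) w + vfXi j (bump [:1:] N) w * vfXi j (hmode m B) w))"
  proof -
    have "bump_comm N m B w = hmode m B w * sublap (bump [:1:] N) w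
     + 2 * (\<Sum>j\<in>UNIV. vfX j (bump [:1:] N) w * vfX j (hmode m B) w + vfXi j (bump [:1:] N) w * vfXi j (hmode m B) w)"
      unfolding bump_comm_def sublap_mult[OF elem_bump elem_hmode] by simp
    then show ?thesis by (simp only: norm_triangle_ineq)
  qed
  also have "\<dots> \<le> \<kappa> * (real CARD('d) * (88 * M * (1 + r) / N)) + 2 * (real CARD('d) * (24 * M * \<kappa> * (\<bar>m\<bar> + norm B) * r / N))"
    using mult_left_mono[OF S, of \<kappa>] C by (intro add_mono) (simp_all add: norm_mult \<kappa>_def)
  also have "\<dots> = real CARD('d) * M / N * \<kappa> * (88 * (1 + r) + 48 * ((\<bar>m\<bar> + norm B) * r))"
    using N by (simp add: field_simps)
  also have "\<dots> \<le> real CARD('d) * M / N * \<kappa> * (88 * ((1 + \<bar>m\<bar> + norm B) * (1 + r)))"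
  proof (intro mult_left_mono)
    have "0 \<le> (\<bar>m\<bar> + norm B) * r" "0 \<le> \<bar>m\<bar> + norm B" using r by auto
    then show "88 * (1 + r) + 48 * ((\<bar>m\<bar> + norm B) * r) \<le> 88 * ((1 + \<bar>m\<bar> + norm B) * (1 + r))"
      by (simp add: algebra_simps)
    show "0 \<le> real CARD('d) * M / N * \<kappa>" using M0 N by (simp add: \<kappa>_def)
  qed
  finally show ?thesis using s unfolding \<kappa> by (simp add: s_def indicator_def mult_ac abs_less_iff)
qed

text \<open>Half of the Gaussian rate absorbs the factor 1 + r, and the remaining half doubles back
  to \<beta> on squaring. The height of the strip enters as sqrt (2 * N), which the factor 1 / N of
  the commutator outweighs.\<close>

lemma L2_bound_strip:
  fixes e :: "'d::finite heis \<Rightarrow> complex"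
  assumes [measurable]: "e \<in> borel_measurable borel" and \<beta>: "0 < \<beta>" and N: "0 \<le> N" and K: "0 \<le> K"
    and e: "\<And>w. norm (e w) \<le> K * (1 + (fst w \<bullet> fst w + fst (snd w) \<bullet> fst (snd w)))
       * exp (- \<beta> * (fst w \<bullet> fst w + fst (snd w) \<bullet> fst (snd w))) * indicator {- N<..<N} (snd (snd w))"
  shows "L2 e" "l2norm e \<le> K * (1 + 2 / \<beta>) * sqrt (2 * N * gaussian_mass \<beta> TYPE('d))"
proof -
  define r where "r w = fst w \<bullet> fst w + fst (snd w) \<bullet> fst (snd w)" for w :: "'d heis"
  have [measurable]: "r \<in> borel_measurable borel"
    unfolding r_def[abs_def] by (intro borel_measurable_continuous_onI continuous_intros)
  have [measurable]: "(\<lambda>w::'d heis. snd (snd w)) \<in> borel_measurable borel"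
    by (intro borel_measurable_continuous_onI continuous_intros)
  have sq: "(norm (e w))\<^sup>2 \<le> (K * (1 + 2 / \<beta>))\<^sup>2 * (exp (- \<beta> * r w) * indicator {- N<..<N} (snd (snd w)))" for w
  proof -
    have r: "0 \<le> r w" by (simp add: r_def)
    have "1 + r w \<le> (1 + 2 / \<beta>) * exp (\<beta> / 2 * r w)"
      using power_le_exp[of "r w" 1 "\<beta> / 2" 1] r \<beta> by simp
    then have "K * (1 + r w) * exp (- \<beta> * r w) * indicator {- N<..<N} (snd (snd w)) \<le>
        K * ((1 + 2 / \<beta>) * exp (\<beta> / 2 * r w)) * exp (- \<beta> * r w) * indicator {- N<..<N} (snd (snd w))"
      using K by (intro mult_right_mono mult_left_mono) auto
    with e[of w] have "norm (e w) \<le> K * ((1 + 2 / \<beta>) * exp (\<beta> / 2 * r w)) * exp (- \<beta> * r w) * indicator {- N<..<N} (snd (snd w))"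
      unfolding r_def by linarith
    also have "\<dots> = K * (1 + 2 / \<beta>) * (exp (- (\<beta> / 2) * r w) * indicator {- N<..<N} (snd (snd w)))"
      by (simp add: mult.assoc mult_exp_exp)
    finally have "(norm (e w))\<^sup>2 \<le> (K * (1 + 2 / \<beta>) * (exp (- (\<beta> / 2) * r w) * indicator {- N<..<N} (snd (snd w))))\<^sup>2"
      by (intro power_mono) auto
    also have "\<dots> = (K * (1 + 2 / \<beta>))\<^sup>2 * ((exp (- (\<beta> / 2) * r w))\<^sup>2 * indicator {- N<..<N} (snd (snd w)))"
      by (simp add: power_mult_distrib indicator_def)
    also have "(exp (- (\<beta> / 2) * r w))\<^sup>2 = exp (- \<beta> * r w)"
      by (simp add: power2_eq_square mult_exp_exp)
    finally show ?thesis .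
  qed
  have "(\<integral>\<^sup>+w. ennreal ((norm (e w))\<^sup>2) \<partial>lborel) \<le>
     (\<integral>\<^sup>+w. ennreal ((K * (1 + 2 / \<beta>))\<^sup>2) * ennreal (exp (- \<beta> * r w) * indicator {- N<..<N} (snd (snd w))) \<partial>lborel)"
    using sq by (intro nn_integral_mono) (simp flip: ennreal_mult)
  also have "\<dots> = ennreal ((K * (1 + 2 / \<beta>))\<^sup>2) * (\<integral>\<^sup>+w. ennreal (exp (- \<beta> * r w) * indicator {- N<..<N} (snd (snd w))) \<partial>lborel)"
    by (rule nn_integral_cmult) measurable
  also have "(\<integral>\<^sup>+w. ennreal (exp (- \<beta> * r w) * indicator {- N<..<N} (snd (snd w))) \<partial>lborel)
     = (\<integral>\<^sup>+y. \<integral>\<^sup>+\<eta>. \<integral>\<^sup>+s. ennreal (exp (- \<beta> * r (y, \<eta>, s)) * indicator {- N<..<N} s) \<partial>lborel \<partial>lborel \<partial>lborel)"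
  proof -
    have [measurable]: "(\<lambda>w::'d heis. indicator {- N<..<N} (snd (snd w)) :: real) \<in> borel_measurable borel"
      by (rule measurable_compose[of "\<lambda>w. snd (snd w)" borel borel]) measurable
    have "(\<lambda>w. ennreal (exp (- \<beta> * r w) * indicator {- N<..<N} (snd (snd w)))) \<in> borel_measurable borel"
      by measurable
    from nn_integral_heis[OF this] show ?thesis by (simp only: snd_conv)
  qed
  also have "\<dots> = (\<integral>\<^sup>+y. \<integral>\<^sup>+\<eta>. ennreal (exp (- \<beta> * (y \<bullet> y + \<eta> \<bullet> \<eta>))) * ennreal (2 * N) \<partial>(lborel :: (real^'d) measure) \<partial>(lborel :: (real^'d) measure))"
  proof (rule nn_integral_cong, rule nn_integral_cong)
    fix y \<eta> :: "real^'d"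
    have "(\<integral>\<^sup>+s. ennreal (exp (- \<beta> * r (y, \<eta>, s)) * indicator {- N<..<N} s) \<partial>lborel)
       = (\<integral>\<^sup>+s. ennreal (exp (- \<beta> * (y \<bullet> y + \<eta> \<bullet> \<eta>))) * indicator {- N<..<N} s \<partial>lborel)"
      by (intro nn_integral_cong) (auto simp: r_def indicator_def)
    also have "\<dots> = ennreal (exp (- \<beta> * (y \<bullet> y + \<eta> \<bullet> \<eta>))) * ennreal (2 * N)"
      using N by (subst nn_integral_cmult_indicator) auto
    finally show "(\<integral>\<^sup>+s. ennreal (exp (- \<beta> * r (y, \<eta>, s)) * indicator {- N<..<N} s) \<partial>lborel)
      = ennreal (exp (- \<beta> * (y \<bullet> y + \<eta> \<bullet> \<eta>))) * ennreal (2 * N)" .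
  qed
  also have "\<dots> = ennreal (gaussian_mass \<beta> TYPE('d)) * ennreal (2 * N)"
    by (simp add: nn_integral_multc gaussian_mass[OF \<beta>, symmetric])
  also have "ennreal ((K * (1 + 2 / \<beta>))\<^sup>2) * (ennreal (gaussian_mass \<beta> TYPE('d)) * ennreal (2 * N)) =
      ennreal ((K * (1 + 2 / \<beta>) * sqrt (2 * N * gaussian_mass \<beta> TYPE('d)))\<^sup>2)"
    using N gaussian_mass_nonneg[of \<beta> "TYPE('d)"] by (simp add: ennreal_mult[symmetric] power_mult_distrib mult_ac)
  finally have I: "(\<integral>\<^sup>+w. ennreal ((norm (e w))\<^sup>2) \<partial>lborel) \<le> ennreal ((K * (1 + 2 / \<beta>) * sqrt (2 * N * gaussian_mass \<beta> TYPE('d)))\<^sup>2)" .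
  have int: "integrable lborel (\<lambda>w. (norm (e w))\<^sup>2)"
    using I by (intro integrableI_nonneg) (auto intro: order.strict_trans1)
  then show "L2 e" by (simp add: L2_iff)
  have "ennreal ((l2norm e)\<^sup>2) \<le> ennreal ((K * (1 + 2 / \<beta>) * sqrt (2 * N * gaussian_mass \<beta> TYPE('d)))\<^sup>2)"
    using I nn_integral_eq_integral[OF int] by (simp add: l2norm_sq)
  then have "(l2norm e)\<^sup>2 \<le> (K * (1 + 2 / \<beta>) * sqrt (2 * N * gaussian_mass \<beta> TYPE('d)))\<^sup>2" by simp
  then show "l2norm e \<le> K * (1 + 2 / \<beta>) * sqrt (2 * N * gaussian_mass \<beta> TYPE('d))"
    by (rule power2_le_imp_le) (use K \<beta> N gaussian_mass_nonneg[of \<beta> "TYPE('d)"] in auto)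
qed

lemma integral_heis_mult:
  fixes f :: "'d::finite heis \<Rightarrow> 'b::{banach, second_countable_topology}"
  assumes [measurable]: "f \<in> borel_measurable borel"
  shows "(\<integral>w. f (heis_mult a w) \<partial>lborel) = (\<integral>w. f w \<partial>lborel)"
    "integrable lborel (\<lambda>w. f (heis_mult a w)) \<longleftrightarrow> integrable lborel f"
proof -
  show "(\<integral>w. f (heis_mult a w) \<partial>lborel) = (\<integral>w. f w \<partial>lborel)"
    by (subst (2) distr_heis_mult[of a, symmetric]) (simp add: integral_distr)
  show "integrable lborel (\<lambda>w. f (heis_mult a w)) \<longleftrightarrow> integrable lborel f"
    by (subst (2) distr_heis_mult[of a, symmetric]) (simp add: integrable_distr_eq)
qed

lemma L2_translate:
  assumes "L2 f" shows "L2 (\<lambda>w. f (heis_mult a w))" "l2norm (\<lambda>w. f (heis_mult a w)) = l2norm f"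
proof -
  have [measurable]: "f \<in> borel_measurable borel" using assms by (simp add: L2_iff)
  have "(\<lambda>w. (norm (f w))\<^sup>2) \<in> borel_measurable borel" by measurable
  note t = integral_heis_mult[OF this, of a]
  show "L2 (\<lambda>w. f (heis_mult a w))" using assms t(2) by (simp add: L2_iff)
  show "l2norm (\<lambda>w. f (heis_mult a w)) = l2norm f" using t(1) by (simp add: l2norm_def)
qed

section \<open>Explicit evolution of a mode\<close>

definition hmodeE :: "real \<Rightarrow> real \<Rightarrow> real \<Rightarrow> real \<Rightarrow> 'd::finite heis \<Rightarrow> complex" where
  "hmodeE b \<sigma> l m w = (b / kD b \<sigma> l) ^ CARD('d) * hmode m (kE b \<sigma> l / kD b \<sigma> l) w"

text \<open>A linear system for the pair (kD, kE). It linearises the Riccati equation B' = 4 * \<i>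
  * (B^2 - l^2) of the width B = kE / kD, and this is where the formulas for \<open>kD\<close> and
  \<open>kE\<close> come from.\<close>

lemma kD_vector_derivative:
  assumes "l \<noteq> 0"
  shows "((\<lambda>\<sigma>. kD b \<sigma> (complex_of_real l)) has_vector_derivative - 4 * \<i> * kE b \<sigma> l) (at \<sigma>)"
    "((\<lambda>\<sigma>. kE b \<sigma> (complex_of_real l)) has_vector_derivative - 4 * \<i> * (complex_of_real l)\<^sup>2 * kD b \<sigma> l) (at \<sigma>)"
proof -
  have D: "(\<lambda>\<sigma>. kD b \<sigma> (complex_of_real l)) = (\<lambda>\<sigma>. cos (4 * complex_of_real l * complex_of_real \<sigma>) - \<i> * b * sin (4 * complex_of_real l * complex_of_real \<sigma>) / l)"
    using assms by (simp add: kD_nonzero fun_eq_iff)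
  show "((\<lambda>\<sigma>. kD b \<sigma> (complex_of_real l)) has_vector_derivative - 4 * \<i> * kE b \<sigma> l) (at \<sigma>)"
    unfolding D
    by (rule has_vector_derivative_real_field, unfold kE_def)
       (use assms in \<open>auto intro!: derivative_eq_intros simp: field_simps\<close>)
  show "((\<lambda>\<sigma>. kE b \<sigma> (complex_of_real l)) has_vector_derivative - 4 * \<i> * (complex_of_real l)\<^sup>2 * kD b \<sigma> l) (at \<sigma>)"
    unfolding kE_def
    by (rule has_vector_derivative_real_field)
       (use assms in \<open>auto intro!: derivative_eq_intros simp: kD_nonzero field_simps power2_eq_square\<close>)
qed

lemma has_vector_derivative_exp:
  fixes f :: "real \<Rightarrow> complex"
  assumes "(f has_vector_derivative f') (at x)"
  shows "((\<lambda>x. exp (f x)) has_vector_derivative f' * exp (f x)) (at x)"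
  using field_vector_diff_chain_at[OF assms, of exp "exp (f x)"] by (simp add: o_def DERIV_exp)

text \<open>The coefficients satisfy B' = 4 * \<i> * (B^2 - m^2) and A' = 4 * \<i> * d * B * A,
  which match the part proportional to r and the constant part in \<open>sublap_hmode\<close>.
  \<open>kD\<close> and \<open>kE\<close> are even in the frequency, so they are evaluated at a
  fixed l and the sign sits in m alone.\<close>

lemma hmodeE_derivative:
  fixes w :: "'d::finite heis"
  assumes l: "l \<noteq> 0" "0 < b" and m: "m\<^sup>2 = l\<^sup>2"
  shows "((\<lambda>\<sigma>. hmodeE b \<sigma> l m w) has_vector_derivative
     - \<i> * ((b / kD b \<sigma> l) ^ CARD('d) * sublap (hmode m (kE b \<sigma> l / kD b \<sigma> l)) w)) (at \<sigma>)"
proof -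
  define D E where "D = (\<lambda>\<sigma>. kD b \<sigma> (complex_of_real l))" and "E = (\<lambda>\<sigma>. kE b \<sigma> (complex_of_real l))"
  have D0: "D \<sigma> \<noteq> 0" for \<sigma> unfolding D_def by (rule kD_real_neq_0[OF l])
  have dD: "(D has_vector_derivative - 4 * \<i> * E \<sigma>) (at \<sigma>)"
    and dE: "(E has_vector_derivative - 4 * \<i> * (complex_of_real l)\<^sup>2 * D \<sigma>) (at \<sigma>)"
    unfolding D_def E_def by (rule kD_vector_derivative[OF l(1)])+
  have inv: "((\<lambda>\<sigma>. inverse (D \<sigma>)) has_vector_derivative 4 * \<i> * E \<sigma> / (D \<sigma>)\<^sup>2) (at \<sigma>)"
    using field_vector_diff_chain_at[OF dD DERIV_inverse[OF D0]] D0[of \<sigma>]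
    by (simp add: o_def power2_eq_square field_simps)
  have B: "((\<lambda>\<sigma>. E \<sigma> / D \<sigma>) has_vector_derivative 4 * \<i> * ((E \<sigma> / D \<sigma>)\<^sup>2 - (complex_of_real m)\<^sup>2)) (at \<sigma>)"
  proof -
    have ml: "(complex_of_real m)\<^sup>2 = (complex_of_real l)\<^sup>2" using m by (simp flip: of_real_power)
    have "E \<sigma> * (4 * \<i> * E \<sigma> / (D \<sigma>)\<^sup>2) + - 4 * \<i> * (complex_of_real l)\<^sup>2 * D \<sigma> * inverse (D \<sigma>)
      = 4 * \<i> * ((E \<sigma> / D \<sigma>)\<^sup>2 - (complex_of_real m)\<^sup>2)"
      using D0[of \<sigma>] unfolding ml by (simp add: power_divide power2_eq_square[of "E \<sigma>"] right_diff_distrib mult.assoc)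
    with has_vector_derivative_mult[OF dE inv] show ?thesis
      unfolding divide_inverse by (simp only: mult.assoc)
  qed
  have A: "((\<lambda>\<sigma>. (b / D \<sigma>) ^ n) has_vector_derivative 4 * \<i> * n * (E \<sigma> / D \<sigma>) * (b / D \<sigma>) ^ n) (at \<sigma>)" for n
  proof (induction n)
    case 0
    then show ?case by simp
  next
    case (Suc n)
    have "((\<lambda>\<sigma>. b / D \<sigma>) has_vector_derivative 4 * \<i> * (E \<sigma> / D \<sigma>) * (b / D \<sigma>)) (at \<sigma>)"
      using has_vector_derivative_mult[OF has_vector_derivative_const inv, of "complex_of_real b"] D0[of \<sigma>]
      by (simp add: divide_inverse power2_eq_square mult_ac)
    from has_vector_derivative_mult[OF this Suc.IH] show ?case by (simp add: algebra_simps)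
  qed
  have Q: "((\<lambda>\<sigma>. hmode m (E \<sigma> / D \<sigma>) w) has_vector_derivative
     (- (4 * \<i> * ((E \<sigma> / D \<sigma>)\<^sup>2 - (complex_of_real m)\<^sup>2) * hr w)) * hmode m (E \<sigma> / D \<sigma>) w) (at \<sigma>)"
    unfolding hmode_def
    by (rule has_vector_derivative_eq_rhs[OF has_vector_derivative_exp[OF
      has_vector_derivative_diff[OF has_vector_derivative_const has_vector_derivative_mult_left[OF B]]]]) simp
  show ?thesis
    unfolding hmodeE_def sublap_hmode
    using has_vector_derivative_mult[OF A[of "CARD('d)"] Q] unfolding D_def E_def
    by (rule has_vector_derivative_eq_rhs) (simp add: algebra_simps)
qed

text \<open>Bounds uniform over the times up to t. Since Re (kE * cnj kD) = b on the real axis, the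
  width has real part b / (norm kD)^2, so an upper bound for \<open>kD\<close> is a lower bound for
  the Gaussian decay; this gives the \<beta> of the later lemmas.\<close>

lemma kD_kE_real_bounds:
  assumes "0 < l" "0 < b" "\<bar>\<sigma>\<bar> \<le> t"
  shows "norm (kD b \<sigma> (complex_of_real l)) \<le> 1 + 4 * b * t"
    "b / (1 + 4 * b * t)\<^sup>2 \<le> Re (kE b \<sigma> l / kD b \<sigma> l)"
    "norm (kE b \<sigma> l / kD b \<sigma> l) \<le> (b + l) * ((b + l) / b)"
    "norm ((b / kD b \<sigma> l) ^ n) \<le> (b + l) ^ n"
proof -
  let ?D = "kD b \<sigma> (complex_of_real l)" and ?E = "kE b \<sigma> (complex_of_real l)"
  have l: "l \<noteq> 0" using assms by simp
  have cs: "cos (4 * complex_of_real l * \<sigma>) = complex_of_real (cos (4 * l * \<sigma>))"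
    "sin (4 * complex_of_real l * \<sigma>) = complex_of_real (sin (4 * l * \<sigma>))"
    by (simp_all flip: cos_of_real sin_of_real)
  have "norm ?D \<le> norm (complex_of_real (cos (4 * l * \<sigma>))) + norm (\<i> * b * complex_of_real (sin (4 * l * \<sigma>)) / l)"
    unfolding kD_nonzero[of "complex_of_real l", simplified, OF l] cs by (rule norm_triangle_ineq4)
  also have "\<dots> \<le> 1 + b * (\<bar>4 * l * \<sigma>\<bar> / l)"
  proof (intro add_mono)
    show "norm (complex_of_real (cos (4 * l * \<sigma>))) \<le> 1" by simp
    have "norm (\<i> * b * complex_of_real (sin (4 * l * \<sigma>)) / l) = b * (\<bar>sin (4 * l * \<sigma>)\<bar> / l)"
      using assms by (simp add: norm_mult norm_divide)
    also have "\<dots> \<le> b * (\<bar>4 * l * \<sigma>\<bar> / l)"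
      using assms by (intro mult_left_mono divide_right_mono abs_sin_x_le_abs_x) auto
    finally show "norm (\<i> * b * complex_of_real (sin (4 * l * \<sigma>)) / l) \<le> b * (\<bar>4 * l * \<sigma>\<bar> / l)" .
  qed
  also have "b * (\<bar>4 * l * \<sigma>\<bar> / l) = 4 * b * \<bar>\<sigma>\<bar>" using assms by (simp add: abs_mult)
  also have "1 + 4 * b * \<bar>\<sigma>\<bar> \<le> 1 + 4 * b * t" using assms by simp
  finally show D: "norm ?D \<le> 1 + 4 * b * t" .
  have D0: "0 < norm ?D" using kD_real_neq_0[OF l assms(2)] by simp
  have "Re (?E / ?D) = b / (norm ?D)\<^sup>2"
    unfolding Re_divide_norm Re_kE_kD_real[OF l] ..
  moreover have "(norm ?D)\<^sup>2 \<le> (1 + 4 * b * t)\<^sup>2" using D by (intro power_mono) auto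
  ultimately show "b / (1 + 4 * b * t)\<^sup>2 \<le> Re (?E / ?D)"
  proof -
    have "0 < 1 + 4 * b * t" using D D0 by linarith
    then have "0 < (norm ?D)\<^sup>2 * (1 + 4 * b * t)\<^sup>2" using D0 by simp
    with \<open>(norm ?D)\<^sup>2 \<le> (1 + 4 * b * t)\<^sup>2\<close> have "b / (1 + 4 * b * t)\<^sup>2 \<le> b / (norm ?D)\<^sup>2"
      using assms by (intro divide_left_mono) (auto simp: mult.commute)
    with \<open>Re (?E / ?D) = b / (norm ?D)\<^sup>2\<close> show ?thesis by simp
  qed
  have bD: "b / norm ?D \<le> b + l" using kD_real_bound assms by auto
  have "norm ?E \<le> norm (complex_of_real (b * cos (4 * l * \<sigma>))) + norm (\<i> * complex_of_real (l * sin (4 * l * \<sigma>)))"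
    unfolding kE_def cs using norm_triangle_ineq4[of "complex_of_real (b * cos (4 * l * \<sigma>))" "\<i> * complex_of_real (l * sin (4 * l * \<sigma>))"] by (simp add: mult.assoc)
  also have "\<dots> \<le> b + l"
    using assms by (intro add_mono) (auto simp: norm_mult abs_mult mult_left_le)
  finally have E: "norm ?E \<le> b + l" .
  have "norm (?E / ?D) = norm ?E * ((b / norm ?D) / b)" using assms by (simp add: norm_divide)
  also have "\<dots> \<le> (b + l) * ((b + l) / b)"
    using E bD assms by (intro mult_mono divide_right_mono) auto
  finally show "norm (?E / ?D) \<le> (b + l) * ((b + l) / b)" .
  have "norm ((b / ?D) ^ n) = (b / norm ?D) ^ n" using assms by (simp add: norm_power norm_divide)
  also have "\<dots> \<le> (b + l) ^ n" using bD assms by (intro power_mono) auto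
  finally show "norm ((b / ?D) ^ n) \<le> (b + l) ^ n" .
qed

lemma sublap_cmult: "f \<in> elem \<Longrightarrow> sublap (\<lambda>w. c * f w) w = c * sublap f w"
  by (simp add: sublap_mult elem.const sublap_def[of "\<lambda>_. c"] vf_const[abs_def] vf_const)

text \<open>The clock of the mode is \<tau> - t, so the path starts at the mode evolved by - t,
  paired with f, and ends at the initial mode, paired with U t f. The mode solves the equation
  exactly, so the residual is the amplitude times the commutator with the cutoff.\<close>

lemma bump_mode_pairing:
  fixes U :: "real \<Rightarrow> ('d::finite heis \<Rightarrow> complex) \<Rightarrow> ('d heis \<Rightarrow> complex)" and a :: "'d heis"
  assumes sg: "schroedinger_group U" and f: "L2 f" and b: "0 < b" and l: "0 < l" and m: "m\<^sup>2 = l\<^sup>2" and N: "1 \<le> N"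
    and M: "\<And>u. u \<le> 1 \<Longrightarrow> \<bar>flat (flat_deriv [:1:]) u\<bar> \<le> M" "\<And>u. u \<le> 1 \<Longrightarrow> \<bar>flat (flat_deriv (flat_deriv [:1:])) u\<bar> \<le> M"
    and \<beta>: "\<beta> = b / (1 + 4 * b * \<bar>t\<bar>)\<^sup>2"
  shows "norm (ip (\<lambda>w. bump [:1:] N (heis_mult a w) * hmodeE b 0 l m (heis_mult a w)) (U t f)
      - ip (\<lambda>w. bump [:1:] N (heis_mult a w) * hmodeE b (- t) l m (heis_mult a w)) f)
    \<le> (b + l) ^ CARD('d) * (88 * real CARD('d) * M / N * (1 + l + (b + l) * ((b + l) / b)) * (1 + 2 / \<beta>)
        * sqrt (2 * N * gaussian_mass \<beta> TYPE('d))) * l2norm f * \<bar>t\<bar>"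
proof -
  define A where "A \<tau> = (b / kD b (\<tau> - t) l) ^ CARD('d)" for \<tau>
  define B where "B \<tau> = kE b (\<tau> - t) l / kD b (\<tau> - t) l" for \<tau>
  define g where "g \<tau> = (\<lambda>w::'d heis. A \<tau> * (bump [:1:] N w * hmode m (B \<tau>) w))" for \<tau>
  define \<Phi> where "\<Phi> \<tau> = (\<lambda>w. g \<tau> (heis_mult a w))" for \<tau>
  define \<Phi>' where "\<Phi>' \<tau> = (\<lambda>w. bump [:1:] N (heis_mult a w) * (- \<i> * (A \<tau> * sublap (hmode m (B \<tau>)) (heis_mult a w))))" for \<tau>
  define S where "S = heis_mult (heis_inv a) ` cball 0 N"
  have l0: "l \<noteq> 0" using l by simp
  have N0: "0 < N" using N by simp
  have ml: "\<bar>m\<bar> = l" using m l by (metis abs_of_pos power2_eq_iff_nonneg abs_ge_zero power2_abs less_imp_le)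
  have M0: "0 \<le> M" using M(1)[of 0] by linarith
  have \<beta>0: "0 < \<beta>" unfolding \<beta> using b by (intro divide_pos_pos zero_less_power) (auto intro: add_pos_nonneg)
  have bh: "(\<lambda>w. bump [:1:] N w * hmode m (B \<tau>) w) \<in> elem" for \<tau>
    by (intro elem.mult elem_bump elem_hmode)
  have ge: "g \<tau> \<in> elem" for \<tau>
    unfolding g_def by (intro elem.mult elem.const bh)
  have \<Phi>e: "\<Phi> \<tau> \<in> elem" for \<tau>
    unfolding \<Phi>_def by (rule elem_affine_heis[OF ge])
  have \<Phi>eq: "\<Phi> \<tau> = (\<lambda>w. bump [:1:] N (heis_mult a w) * hmodeE b (\<tau> - t) l m (heis_mult a w))" for \<tau>
    by (simp add: \<Phi>_def g_def hmodeE_def A_def B_def mult_ac)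
  have S: "compact S"
    unfolding S_def by (intro compact_continuous_image continuous_intros) auto
  have out: "bump p N (heis_mult a w) = 0" if "w \<notin> S" for p w
  proof (rule bump_outside[OF N0], rule ccontr)
    assume "\<not> N \<le> norm (heis_mult a w)"
    then have "heis_mult (heis_inv a) (heis_mult a w) \<in> S" unfolding S_def by (intro imageI) simp
    with that show False by simp
  qed
  have sub\<Phi>: "sublap (\<Phi> \<tau>) w = A \<tau> * (bump [:1:] N (heis_mult a w) * sublap (hmode m (B \<tau>)) (heis_mult a w)
      + bump_comm N m (B \<tau>) (heis_mult a w))" for \<tau> w
    unfolding \<Phi>_def sublap_translate[OF ge] unfolding g_def sublap_cmult[OF bh] by (simp add: bump_comm_def)
  have \<Phi>0: "\<Phi> \<tau> w = 0" "\<Phi>' \<tau> w = 0" "sublap (\<Phi> \<tau>) w = 0" if "w \<notin> S" for \<tau> w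
  proof -
    show "\<Phi> \<tau> w = 0" "\<Phi>' \<tau> w = 0" by (simp_all add: \<Phi>_def g_def \<Phi>'_def out[OF that])
    show "sublap (\<Phi> \<tau>) w = 0"
      unfolding \<Phi>_def sublap_translate[OF ge] unfolding g_def sublap_cmult[OF bh] sublap_mult[OF elem_bump elem_hmode]
      by (simp add: sublap_def[of "bump _ _"] vf_bump vf2_bump out[OF that])
  qed
  have test: "test_fun (\<Phi> \<tau>)" for \<tau>
    unfolding test_fun_def
  proof
    show "smooth_fun (\<Phi> \<tau>)" by (rule elem_smooth[OF \<Phi>e])
    have "{x. \<Phi> \<tau> x \<noteq> 0} \<subseteq> S" using \<Phi>0 by auto
    then have "closure {x. \<Phi> \<tau> x \<noteq> 0} \<subseteq> S" by (rule closure_minimal[OF _ compact_imp_closed[OF S]])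
    then show "compact (closure {x. \<Phi> \<tau> x \<noteq> 0})"
      using S by (metis closed_closure compact_Int_closed inf.absorb2)
  qed
  have Lsub: "L2 (sublap (\<Phi> \<tau>))" for \<tau>
    by (rule continuous_compact_L2[OF elem_continuous[OF elem_sublap[OF \<Phi>e]] S \<Phi>0(3)])
  have cD: "continuous_on UNIV (\<lambda>\<tau>. kD b (\<tau> - t) (complex_of_real l))"
    and cE: "continuous_on UNIV (\<lambda>\<tau>. kE b (\<tau> - t) (complex_of_real l))"
  proof -
    have "continuous_on UNIV (\<lambda>\<tau>. kD b \<tau> (complex_of_real l))" "continuous_on UNIV (\<lambda>\<tau>. kE b \<tau> (complex_of_real l))"
      by (rule continuous_at_imp_continuous_on, rule ballI, rule has_vector_derivative_continuous,
          rule kD_vector_derivative[OF l0])+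
    from continuous_on_compose2[OF this(1), of UNIV "\<lambda>\<tau>. \<tau> - t"] continuous_on_compose2[OF this(2), of UNIV "\<lambda>\<tau>. \<tau> - t"]
    show "continuous_on UNIV (\<lambda>\<tau>. kD b (\<tau> - t) (complex_of_real l))" "continuous_on UNIV (\<lambda>\<tau>. kE b (\<tau> - t) (complex_of_real l))"
      by (simp_all add: continuous_on_diff continuous_on_id)
  qed
  have D0: "kD b \<sigma> (complex_of_real l) \<noteq> 0" for \<sigma> by (rule kD_real_neq_0[OF l0 b])
  have cA: "continuous_on UNIV A" unfolding A_def[abs_def] by (intro continuous_intros cD) (use D0 in auto)
  have cB: "continuous_on UNIV B" unfolding B_def[abs_def] by (intro continuous_intros cD cE) (use D0 in auto)
  have cp: "continuous_on UNIV (\<lambda>p. A (fst p :: real))" "continuous_on UNIV (\<lambda>p. B (fst p :: real))"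
    by (rule continuous_on_compose2[OF cA] continuous_on_compose2[OF cB]; auto intro!: continuous_intros)+
  have ce: "continuous_on UNIV (\<lambda>p. h (heis_mult a (snd p)))" if "h \<in> elem" for h :: "'d heis \<Rightarrow> complex"
    by (rule continuous_on_compose2[OF elem_continuous[OF that, of UNIV]]) (auto intro!: continuous_intros)
  have "continuous_on UNIV (\<lambda>p. \<Phi>' (fst p) (snd p))"
    unfolding \<Phi>'_def sublap_hmode hmode_def
    by (intro continuous_intros cp ce elem_bump elem_hr elem_hs cp[unfolded o_def])
  then have c\<Phi>': "continuous_on UNIV (\<lambda>(\<tau>, w). \<Phi>' \<tau> w)" by (simp add: case_prod_beta)
  have c\<Phi>'1: "continuous_on UNIV (\<Phi>' \<tau>)" for \<tau>
  proof -
    have "continuous_on UNIV (\<lambda>w. (\<lambda>(\<tau>, w). \<Phi>' \<tau> w) (\<tau>, w))"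
      by (rule continuous_on_compose2[OF c\<Phi>']) (auto intro!: continuous_on_Pair)
    then show ?thesis by simp
  qed
  have L\<Phi>': "L2 (\<Phi>' \<tau>)" for \<tau>
    by (rule continuous_compact_L2[OF c\<Phi>'1 S \<Phi>0(2)])
  have der: "((\<lambda>\<tau>. \<Phi> \<tau> w) has_vector_derivative \<Phi>' \<tau> w) (at \<tau>)" for \<tau> w
  proof -
    have "((\<lambda>\<tau>. hmodeE b (\<tau> - t) l m (heis_mult a w)) has_vector_derivative
       1 *\<^sub>R (- \<i> * (A \<tau> * sublap (hmode m (B \<tau>)) (heis_mult a w)))) (at \<tau>)"
    proof -
      have "((\<lambda>\<tau>. \<tau> - t) has_vector_derivative 1) (at \<tau>)" by (auto intro!: derivative_eq_intros)
      from vector_diff_chain_at[OF this hmodeE_derivative[OF l0 b m]] show ?thesis unfolding A_def B_def o_def .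
    qed
    then show ?thesis
      unfolding \<Phi>eq \<Phi>'_def by (intro has_vector_derivative_mult_right) simp
  qed
  have diff: "((\<lambda>h. l2norm (\<lambda>x. (\<Phi> (\<tau> + h) x - \<Phi> \<tau> x) / complex_of_real h - \<Phi>' \<tau> x)) \<longlongrightarrow> 0) (at 0)" for \<tau>
    by (rule l2_difference_quotient[OF der c\<Phi>' elem_continuous[OF \<Phi>e] S \<Phi>0(1,2)])
  define K where "K = (b + l) ^ CARD('d) * (88 * real CARD('d) * M / N * (1 + l + (b + l) * ((b + l) / b)) * (1 + 2 / \<beta>)
        * sqrt (2 * N * gaussian_mass \<beta> TYPE('d)))"
  have Kb: "l2norm (\<lambda>w. \<Phi>' \<tau> w + \<i> * sublap (\<Phi> \<tau>) w) \<le> K" if "\<tau> \<in> closed_segment 0 t" for \<tau>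
  proof -
    have \<sigma>: "\<bar>\<tau> - t\<bar> \<le> \<bar>t\<bar>" using that by (auto simp: closed_segment_eq_real_ivl split: if_splits)
    note bds = kD_kE_real_bounds[OF l b \<sigma>]
    let ?K1 = "88 * real CARD('d) * M / N * (1 + l + (b + l) * ((b + l) / b))"
    have comm: "norm (bump_comm N m (B \<tau>) w) \<le> ?K1 * (1 + (fst w \<bullet> fst w + fst (snd w) \<bullet> fst (snd w)))
        * exp (- \<beta> * (fst w \<bullet> fst w + fst (snd w) \<bullet> fst (snd w))) * indicator {- N<..<N} (snd (snd w))" for w :: "'d heis"
    proof -
      define r where "r = fst w \<bullet> fst w + fst (snd w) \<bullet> fst (snd w)"
      have r: "0 \<le> r" by (simp add: r_def)
      have "norm (bump_comm N m (B \<tau>) w) \<le> 88 * real CARD('d) * M / N * (1 + \<bar>m\<bar> + norm (B \<tau>)) * (1 + r)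
          * exp (- Re (B \<tau>) * r) * indicator {- N<..<N} (snd (snd w))"
        unfolding r_def by (rule bump_comm_bound[OF M N])
      also have "\<dots> \<le> ?K1 * (1 + r) * exp (- \<beta> * r) * indicator {- N<..<N} (snd (snd w))"
      proof (intro mult_mono)
        show "1 + \<bar>m\<bar> + norm (B \<tau>) \<le> 1 + l + (b + l) * ((b + l) / b)"
          using bds(3) ml unfolding B_def by simp
        show "exp (- Re (B \<tau>) * r) \<le> exp (- \<beta> * r)"
          using mult_right_mono[OF bds(2) r] unfolding B_def \<beta> by simp
      qed (use r M0 N b l in \<open>auto intro!: mult_nonneg_nonneg divide_nonneg_nonneg add_nonneg_nonneg\<close>)
      finally show ?thesis unfolding r_def .
    qed
    have mc: "(bump_comm N m (B \<tau>) :: 'd heis \<Rightarrow> complex) \<in> borel_measurable borel"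
      unfolding bump_comm_def
      by (intro borel_measurable_continuous_onI continuous_intros elem_continuous elem_sublap elem_bump elem_hmode elem.mult)
    have K1: "0 \<le> ?K1" using M0 N b l by (intro mult_nonneg_nonneg divide_nonneg_nonneg add_nonneg_nonneg) auto
    note strip = L2_bound_strip[OF mc \<beta>0 _ K1 comm]
    \<comment> \<open>The term in which the sublaplacian hits only the mode cancels against the time
      derivative.\<close>
    have "(\<lambda>w. \<Phi>' \<tau> w + \<i> * sublap (\<Phi> \<tau>) w) = (\<lambda>w. (\<i> * A \<tau>) * bump_comm N m (B \<tau>) (heis_mult a w))"
      by (simp add: fun_eq_iff \<Phi>'_def sub\<Phi> algebra_simps)
    then have "l2norm (\<lambda>w. \<Phi>' \<tau> w + \<i> * sublap (\<Phi> \<tau>) w) = norm (A \<tau>) * l2norm (bump_comm N m (B \<tau>) :: 'd heis \<Rightarrow> complex)"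
      using L2_translate(2)[OF strip(1), of a] N0 by (simp add: l2norm_cmult norm_mult)
    also have "\<dots> \<le> (b + l) ^ CARD('d) * (?K1 * (1 + 2 / \<beta>) * sqrt (2 * N * gaussian_mass \<beta> TYPE('d)))"
      using bds(4)[of "CARD('d)"] strip(2) N0 b l l2norm_nonneg unfolding A_def by (intro mult_mono) auto
    finally show ?thesis by (simp add: K_def)
  qed
  have "norm (ip (\<Phi> t) (U t f) - ip (\<Phi> 0) f) \<le> K * l2norm f * \<bar>t\<bar>"
    by (rule sg_pairing_bound[OF sg f test Lsub L\<Phi>' diff Kb])
  then show ?thesis unfolding \<Phi>eq K_def by simp
qed

section \<open>Superposition over the frequencies\<close>

lemma integral_exp_cos:
  fixes \<delta> s :: real assumes "0 < \<delta>"
  shows "(LINT x:{0..}|lborel. exp (- \<delta> * x) * cos (x * s)) = \<delta> / (\<delta>\<^sup>2 + s\<^sup>2)"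
    "set_integrable lborel {0..} (\<lambda>x. exp (- \<delta> * x) * cos (x * s))"
proof -
  let ?f = "\<lambda>x. indicator {0..} x *\<^sub>R (exp (- \<delta> * x) * cos (x * s))"
  let ?F = "\<lambda>x. exp (- \<delta> * x) * (s * sin (x * s) - \<delta> * cos (x * s)) / (\<delta>\<^sup>2 + s\<^sup>2)"
  have q: "0 < \<delta>\<^sup>2 + s\<^sup>2" using assms by (simp add: add_pos_nonneg)
  show int: "set_integrable lborel {0..} (\<lambda>x. exp (- \<delta> * x) * cos (x * s))"
    by (rule set_integrable_bound[OF set_integrable_exp[OF assms]])
       (auto simp: set_borel_measurable_def abs_mult mult_left_le)
  have "((\<lambda>R. \<integral>x. indicator {..R} x *\<^sub>R ?f x \<partial>lborel) \<longlongrightarrow> (\<integral>x. ?f x \<partial>lborel)) at_top"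
    using int unfolding set_integrable_def by (intro tendsto_integral_at_top) auto
  moreover have "((\<lambda>R. \<integral>x. indicator {..R} x *\<^sub>R ?f x \<partial>lborel) \<longlongrightarrow> \<delta> / (\<delta>\<^sup>2 + s\<^sup>2)) at_top"
  proof (rule Lim_transform_eventually)
    have "((\<lambda>R. exp (- \<delta> * R) * (s * sin (R * s) - \<delta> * cos (R * s))) \<longlongrightarrow> 0) at_top"
    proof (rule Lim_null_comparison)
      show "((\<lambda>R. exp (- \<delta> * R) * (\<bar>s\<bar> + \<delta>)) \<longlongrightarrow> 0) at_top" using assms by real_asymp
      have "norm (exp (- \<delta> * R) * (s * sin (R * s) - \<delta> * cos (R * s))) \<le> exp (- \<delta> * R) * (\<bar>s\<bar> + \<delta>)" for R
      proof -
        have "\<bar>s * sin (R * s)\<bar> \<le> \<bar>s\<bar>" "\<bar>\<delta> * cos (R * s)\<bar> \<le> \<delta>"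
          using assms by (auto simp: abs_mult mult_left_le)
        then have "\<bar>s * sin (R * s) - \<delta> * cos (R * s)\<bar> \<le> \<bar>s\<bar> + \<delta>" by linarith
        then show ?thesis by (simp add: abs_mult)
      qed
      then show "\<forall>\<^sub>F R in at_top. norm (exp (- \<delta> * R) * (s * sin (R * s) - \<delta> * cos (R * s))) \<le> exp (- \<delta> * R) * (\<bar>s\<bar> + \<delta>)"
        by simp
    qed
    from tendsto_divide_zero[OF this, of "\<delta>\<^sup>2 + s\<^sup>2"]
    have "(?F \<longlongrightarrow> 0) at_top" .
    from tendsto_diff[OF this tendsto_const, of "?F 0"]
    show "((\<lambda>R. ?F R - ?F 0) \<longlongrightarrow> \<delta> / (\<delta>\<^sup>2 + s\<^sup>2)) at_top" by simp
    show "\<forall>\<^sub>F R in at_top. ?F R - ?F 0 = (\<integral>x. indicator {..R} x *\<^sub>R ?f x \<partial>lborel)"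
      using eventually_ge_at_top[of "0::real"]
    proof eventually_elim
      case (elim R)
      have "(\<integral>x. (exp (- \<delta> * x) * cos (x * s)) * indicator {0..R} x \<partial>lborel) = ?F R - ?F 0"
      proof (rule integral_FTC_Icc_real[OF elim])
        show "DERIV ?F x :> exp (- \<delta> * x) * cos (x * s)" for x
        proof -
          have "DERIV ?F x :> ((exp (- \<delta> * x) * (- \<delta>)) * (s * sin (x * s) - \<delta> * cos (x * s))
              + exp (- \<delta> * x) * (s * (cos (x * s) * s) - \<delta> * (- sin (x * s) * s))) / (\<delta>\<^sup>2 + s\<^sup>2)"
            using q by (auto intro!: derivative_eq_intros)
          moreover have "(exp (- \<delta> * x) * (- \<delta>)) * (s * sin (x * s) - \<delta> * cos (x * s))
              + exp (- \<delta> * x) * (s * (cos (x * s) * s) - \<delta> * (- sin (x * s) * s)) = exp (- \<delta> * x) * cos (x * s) * (\<delta>\<^sup>2 + s\<^sup>2)"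
            by (simp add: algebra_simps power2_eq_square)
          ultimately show ?thesis using q assms by simp
        qed
        show "isCont (\<lambda>x. exp (- \<delta> * x) * cos (x * s)) x" for x by (intro continuous_intros)
      qed
      moreover have "(\<integral>x. indicator {..R} x *\<^sub>R ?f x \<partial>lborel) = (\<integral>x. (exp (- \<delta> * x) * cos (x * s)) * indicator {0..R} x \<partial>lborel)"
        by (intro Bochner_Integration.integral_cong) (auto simp: indicator_def)
      ultimately show ?case by simp
    qed
  qed
  ultimately show "(LINT x:{0..}|lborel. exp (- \<delta> * x) * cos (x * s)) = \<delta> / (\<delta>\<^sup>2 + s\<^sup>2)"
    unfolding set_lebesgue_integral_def by (rule tendsto_unique[OF trivial_limit_at_top_linorder])
qed

text \<open>Fubini's theorem; the majorant \<phi> must not depend on w, because the modes have no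
  decay in s and integrability in w comes from the product of \<theta> and g alone.\<close>

lemma ip_superposition:
  fixes k :: "real \<Rightarrow> 'd::finite heis \<Rightarrow> complex" and \<theta> g :: "'d heis \<Rightarrow> complex"
  assumes mk [measurable]: "(\<lambda>p. k (fst p) (snd p)) \<in> borel_measurable (borel \<Otimes>\<^sub>M borel)"
    and k: "\<And>x w. norm (k x w) \<le> \<phi> x" and \<phi>: "integrable lborel \<phi>"
    and [measurable]: "\<theta> \<in> borel_measurable borel" "g \<in> borel_measurable borel"
    and \<theta>g: "integrable lborel (\<lambda>w. norm (\<theta> w) * norm (g w))"
  shows "integrable lborel (\<lambda>x. ip (\<lambda>w. \<theta> w * k x w) g)"
    "(\<integral>x. ip (\<lambda>w. \<theta> w * k x w) g \<partial>lborel) = ip (\<lambda>w. \<theta> w * (\<integral>x. k x w \<partial>lborel)) g"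
proof -
  define F where "F = (\<lambda>x w. cnj (\<theta> w * k x w) * g w)"
  have mF: "(\<lambda>p. F (fst p) (snd p)) \<in> borel_measurable (borel \<Otimes>\<^sub>M borel)"
    unfolding F_def by measurable
  have mk1 [measurable]: "k x \<in> borel_measurable borel" for x
    using measurable_compose[OF measurable_Pair1' mk, of x] by simp
  have \<phi>0: "0 \<le> \<phi> x" for x using k[of x 0] norm_ge_zero order_trans by blast
  have Fb: "norm (F x w) \<le> \<phi> x * (norm (\<theta> w) * norm (g w))" for x w
    using mult_right_mono[OF k[of x w], of "norm (\<theta> w) * norm (g w)"] by (simp add: F_def norm_mult mult_ac)
  have intw: "integrable lborel (F x)" for x
    by (rule Bochner_Integration.integrable_bound[OF integrable_mult_right[OF \<theta>g, of "\<phi> x"]])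
       (use Fb \<phi>0 in \<open>auto simp: F_def abs_mult\<close>)
  have mN: "(\<lambda>x. \<integral>w. norm (F x w) \<partial>lborel) \<in> borel_measurable lborel"
    using mF by (intro lborel.borel_measurable_lebesgue_integral) (simp add: case_prod_beta)
  have int: "integrable (lborel \<Otimes>\<^sub>M lborel) (\<lambda>(x, w). F x w)"
  proof (rule lborel_pair.Fubini_integrable)
    show "(\<lambda>(x, w). F x w) \<in> borel_measurable (lborel \<Otimes>\<^sub>M lborel)"
      using mF by (simp add: case_prod_beta)
    show "integrable lborel (\<lambda>x. \<integral>w. norm (case (x, w) of (x, w) \<Rightarrow> F x w) \<partial>lborel)"
    proof (rule Bochner_Integration.integrable_bound)
      show "integrable lborel (\<lambda>x. \<phi> x * (\<integral>w. norm (\<theta> w) * norm (g w) \<partial>lborel))"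
        by (rule integrable_mult_left[OF \<phi>])
      show "AE x in lborel. norm (\<integral>w. norm (case (x, w) of (x, w) \<Rightarrow> F x w) \<partial>lborel)
         \<le> norm (\<phi> x * (\<integral>w. norm (\<theta> w) * norm (g w) \<partial>lborel))"
      proof (rule AE_I2)
        fix x
        have "(\<integral>w. norm (F x w) \<partial>lborel) \<le> (\<integral>w. \<phi> x * (norm (\<theta> w) * norm (g w)) \<partial>lborel)"
          by (intro integral_mono integrable_norm intw integrable_mult_right \<theta>g Fb)
        then show "norm (\<integral>w. norm (case (x, w) of (x, w) \<Rightarrow> F x w) \<partial>lborel)
         \<le> norm (\<phi> x * (\<integral>w. norm (\<theta> w) * norm (g w) \<partial>lborel))"
          using \<phi>0[of x] by (simp add: abs_mult integral_nonneg)
      qed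
    qed (use mN in simp)
    show "AE x in lborel. integrable lborel (\<lambda>w. case (x, w) of (x, w) \<Rightarrow> F x w)"
      using intw by simp
  qed
  show "integrable lborel (\<lambda>x. ip (\<lambda>w. \<theta> w * k x w) g)"
    using lborel_pair.integrable_fst[OF int] unfolding ip_def F_def by simp
  have kx: "(\<integral>x. F x w \<partial>lborel) = cnj (\<theta> w * (\<integral>x. k x w \<partial>lborel)) * g w" for w
  proof -
    have "(\<integral>x. F x w \<partial>lborel) = (\<integral>x. cnj (k x w) * (cnj (\<theta> w) * g w) \<partial>lborel)"
      by (simp add: F_def mult_ac)
    also have "\<dots> = (\<integral>x. cnj (k x w) \<partial>lborel) * (cnj (\<theta> w) * g w)"
      by (rule integral_mult_left_zero)
    finally show ?thesis by (simp add: mult_ac)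
  qed
  have "(\<integral>x. ip (\<lambda>w. \<theta> w * k x w) g \<partial>lborel) = (\<integral>x. \<integral>w. F x w \<partial>lborel \<partial>lborel)"
    by (simp add: ip_def F_def)
  also have "\<dots> = (\<integral>w. \<integral>x. F x w \<partial>lborel \<partial>lborel)"
    by (rule lborel_pair.Fubini_integral[OF int, symmetric])
  also have "\<dots> = ip (\<lambda>w. \<theta> w * (\<integral>x. k x w \<partial>lborel)) g"
    unfolding kx ip_def ..
  finally show "(\<integral>x. ip (\<lambda>w. \<theta> w * k x w) g \<partial>lborel) = ip (\<lambda>w. \<theta> w * (\<integral>x. k x w \<partial>lborel)) g" .
qed

section \<open>Wave packets\<close>

text \<open>At time \<open>0\<close> the packet is \<open>b ^ d * exp (- b * r) * (2 * \<delta> / (\<delta>\<^sup>2 + s\<^sup>2))\<close>; up to a constant it is an approximate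
  identity for \<open>b = 1 / \<delta>\<close>, as it is then a dilate of \<open>packet 1 1 0\<close>.\<close>

definition packet_mode :: "real \<Rightarrow> real \<Rightarrow> real \<Rightarrow> real \<Rightarrow> 'd::finite heis \<Rightarrow> complex" where
  "packet_mode b \<delta> \<sigma> x w = indicator {0<..} x *\<^sub>R (complex_of_real (exp (- \<delta> * x)) * (hmodeE b \<sigma> x x w + hmodeE b \<sigma> x (- x) w))"

definition packet :: "real \<Rightarrow> real \<Rightarrow> real \<Rightarrow> 'd::finite heis \<Rightarrow> complex" where
  "packet b \<delta> \<sigma> w = (\<integral>x. packet_mode b \<delta> \<sigma> x w \<partial>lborel)"

lemma measurable_kD [measurable]: "kD b t \<in> borel_measurable borel"
  and measurable_kE [measurable]: "kE b t \<in> borel_measurable borel"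
  by (intro borel_measurable_continuous_onI continuous_on_kD continuous_on_kE)+

lemma measurable_hr [measurable]: "hr \<in> borel_measurable borel"
  and measurable_hs [measurable]: "hs \<in> borel_measurable borel"
  by (intro borel_measurable_continuous_onI elem_continuous elem_hr elem_hs)+

lemma measurable_packet_mode:
  "(\<lambda>p. packet_mode b \<delta> \<sigma> (fst p) (heis_mult a (snd p))) \<in> borel_measurable (borel \<Otimes>\<^sub>M borel)"
  unfolding packet_mode_def hmodeE_def hmode_def by measurable

lemma norm_hmode: "norm (hmode m B w) = exp (- (Re B * (fst w \<bullet> fst w + fst (snd w) \<bullet> fst (snd w))))"
  unfolding hmode_def norm_exp_eq_Re hs_def hr_def by simp

lemma norm_hmodeE_le:
  assumes "0 < b" "0 < x" shows "norm (hmodeE b \<sigma> x m (w :: 'd::finite heis)) \<le> (b + x) ^ CARD('d)"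
proof -
  note bds = kD_kE_real_bounds[OF assms(2,1) order_refl, of \<sigma>]
  have "0 \<le> Re (kE b \<sigma> x / kD b \<sigma> x)"
    using bds(2) assms by (intro order_trans[OF _ bds(2)] divide_nonneg_nonneg) auto
  then have "norm (hmode m (kE b \<sigma> x / kD b \<sigma> x) w) \<le> 1"
    unfolding norm_hmode by (simp add: mult_nonneg_nonneg)
  then have "norm (hmodeE b \<sigma> x m w) \<le> (b + x) ^ CARD('d) * 1"
    unfolding hmodeE_def norm_mult using bds(4) assms by (intro mult_mono) auto
  then show ?thesis by simp
qed

definition packet_weight :: "nat \<Rightarrow> real \<Rightarrow> real \<Rightarrow> real \<Rightarrow> real" where
  "packet_weight n b \<delta> x = indicator {0..} x *\<^sub>R (2 * ((b + x) ^ n * exp (- \<delta> * x)))"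

lemma packet_weight_integrable: "0 < b \<Longrightarrow> 0 < \<delta> \<Longrightarrow> integrable lborel (packet_weight n b \<delta>)"
  using set_integrable_mult_right[OF set_integrable_poly_exp[of b \<delta> n], of 2]
  unfolding packet_weight_def[abs_def] set_integrable_def by simp

lemma norm_packet_mode_le:
  assumes "0 < b"
  shows "norm (packet_mode b \<delta> \<sigma> x (w :: 'd::finite heis)) \<le> packet_weight CARD('d) b \<delta> x"
proof (cases "0 < x")
  case True
  have "norm (hmodeE b \<sigma> x x w + hmodeE b \<sigma> x (- x) w) \<le> 2 * (b + x) ^ CARD('d)"
    using norm_triangle_ineq[of "hmodeE b \<sigma> x x w" "hmodeE b \<sigma> x (- x) w"]
      norm_hmodeE_le[OF assms True, of \<sigma> x w] norm_hmodeE_le[OF assms True, of \<sigma> "- x" w] by linarith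
  then have "exp (- \<delta> * x) * norm (hmodeE b \<sigma> x x w + hmodeE b \<sigma> x (- x) w) \<le> exp (- \<delta> * x) * (2 * (b + x) ^ CARD('d))"
    by (intro mult_left_mono) auto
  then show ?thesis
    using True by (simp add: packet_mode_def packet_weight_def norm_mult mult_ac)
next
  case False
  then show ?thesis using assms by (simp add: packet_mode_def packet_weight_def indicator_def)
qed

lemma measurable_packet_mode1 [measurable]: "(\<lambda>x. packet_mode b \<delta> \<sigma> x w) \<in> borel_measurable borel"
  unfolding packet_mode_def hmodeE_def hmode_def by measurable

lemma packet_mode_integrable:
  assumes "0 < b" "0 < \<delta>" shows "integrable lborel (\<lambda>x. packet_mode b \<delta> \<sigma> x (w :: 'd::finite heis))"
proof (rule Bochner_Integration.integrable_bound[OF packet_weight_integrable[OF assms, of "CARD('d)"]])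
  have "0 \<le> packet_weight CARD('d) b \<delta> x" for x
    using norm_packet_mode_le[OF assms(1), of \<delta> \<sigma> x w] norm_ge_zero order_trans by blast
  then show "AE x in lborel. norm (packet_mode b \<delta> \<sigma> x w) \<le> norm (packet_weight CARD('d) b \<delta> x)"
    using norm_packet_mode_le[OF assms(1), of \<delta> \<sigma> _ w] by auto
qed measurable

lemma packet_bounded:
  assumes "0 < b" "0 < \<delta>"
  shows "norm (packet b \<delta> \<sigma> (w :: 'd::finite heis)) \<le> (\<integral>x. packet_weight CARD('d) b \<delta> x \<partial>lborel)"
  unfolding packet_def
  by (rule Bochner_Integration.integral_norm_bound_integral[OF packet_mode_integrable[OF assms] packet_weight_integrable[OF assms]])
     (rule norm_packet_mode_le[OF assms(1)])

lemma packet_0: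
  assumes "0 < b" "0 < \<delta>"
  shows "packet b \<delta> 0 (w :: 'd::finite heis) = complex_of_real (b ^ CARD('d)
    * exp (- b * (fst w \<bullet> fst w + fst (snd w) \<bullet> fst (snd w))) * (2 * (\<delta> / (\<delta>\<^sup>2 + (snd (snd w))\<^sup>2))))"
proof -
  define r s where "r = fst w \<bullet> fst w + fst (snd w) \<bullet> fst (snd w)" and "s = snd (snd w)"
  have hm: "hmodeE b 0 x m w = complex_of_real (b ^ CARD('d) * exp (- b * r)) * exp (\<i> * complex_of_real (m * s))" for x m
  proof -
    have "kD b 0 x = 1" "kE b 0 x = b" by (simp_all add: kD_def kE_def csinc_def)
    then show ?thesis
      by (simp add: hmodeE_def hmode_def hr_def hs_def r_def[symmetric] s_def[symmetric] exp_diff exp_minus divide_inverse mult.assoc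
        flip: exp_of_real)
  qed
  have cosb: "exp (\<i> * complex_of_real (x * s)) + exp (\<i> * complex_of_real (- x * s)) = complex_of_real (2 * cos (x * s))" for x
    by (simp add: complex_eq_iff Re_exp Im_exp)
  have "packet b \<delta> 0 w = (\<integral>x. complex_of_real (b ^ CARD('d) * exp (- b * r) * (2 * (indicator {0..} x *\<^sub>R (exp (- \<delta> * x) * cos (x * s))))) \<partial>lborel)"
    unfolding packet_def
  proof (rule integral_cong_AE)
    show "AE x in lborel. packet_mode b \<delta> 0 x w = complex_of_real (b ^ CARD('d) * exp (- b * r) * (2 * (indicator {0..} x *\<^sub>R (exp (- \<delta> * x) * cos (x * s)))))"
      using AE_lborel_singleton[of "0::real"]
    proof eventually_elim
      case (elim x)
      have "hmodeE b 0 x x w + hmodeE b 0 x (- x) w = complex_of_real (b ^ CARD('d) * exp (- b * r)) * complex_of_real (2 * cos (x * s))"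
        unfolding hm distrib_left[symmetric] cosb ..
      then show ?case using elim by (simp add: packet_mode_def indicator_def)
    qed
  qed measurable
  also have "\<dots> = complex_of_real (b ^ CARD('d) * exp (- b * r) * (2 * (LINT x:{0..}|lborel. exp (- \<delta> * x) * cos (x * s))))"
    unfolding set_lebesgue_integral_def integral_complex_of_real by simp
  finally show ?thesis unfolding integral_exp_cos(1)[OF assms(2)] r_def s_def .
qed

text \<open>Time reversal is complex conjugation, which swaps the frequencies x and - x; the packet
  is invariant under this swap because it sums both. It reduces negative times to the range t > 0 of
  the contour estimates.\<close>

lemma packet_uminus: "packet b \<delta> (- \<sigma>) (w :: 'd::finite heis) = cnj (packet b \<delta> \<sigma> w)"
proof -
  have kD: "kD b (- \<sigma>) (complex_of_real x) = cnj (kD b \<sigma> (complex_of_real x))" if "x \<noteq> 0" for x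
    using that by (simp add: kD_nonzero cnj_cos cnj_sin)
  have kE: "kE b (- \<sigma>) (complex_of_real x) = cnj (kE b \<sigma> (complex_of_real x))" for x
    by (simp add: kE_def cnj_cos cnj_sin)
  have "hmodeE b (- \<sigma>) x m w = cnj (hmodeE b \<sigma> x (- m) w)" if "x \<noteq> 0" for x m
    using that unfolding hmodeE_def hmode_def kD[OF that] kE by (simp add: exp_cnj hs_def hr_def)
  then have "packet_mode b \<delta> (- \<sigma>) x w = cnj (packet_mode b \<delta> \<sigma> x w)" for x
    by (cases "0 < x") (simp_all add: packet_mode_def indicator_def add.commute)
  then show ?thesis unfolding packet_def by simp
qed

text \<open>The frequencies x and - x give \<open>kG\<close> with central coordinate s and - s. The
  contour bound sees only \<bar>s\<bar>, so each half obeys it, whence the factor 2.\<close>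

lemma packet_dispersive:
  fixes w :: "'d::finite heis"
  assumes "0 < b" "0 < \<delta>" "\<sigma> \<noteq> 0" "0 < c" "\<bar>snd (snd w)\<bar> \<le> (4 * real CARD('d) - c) * \<bar>\<sigma>\<bar>"
  shows "norm (packet b \<delta> \<sigma> w) \<le> 2 * (((1 + 16 * real CARD('d) / c) / (4 * \<bar>\<sigma>\<bar>)) ^ CARD('d) * (2 / (c * \<bar>\<sigma>\<bar>)))"
proof -
  define t where "t = \<bar>\<sigma>\<bar>"
  have t: "0 < t" using assms by (simp add: t_def)
  define r s where "r = fst w \<bullet> fst w + fst (snd w) \<bullet> fst (snd w)" and "s = snd (snd w)"
  have r: "0 \<le> r" by (simp add: r_def)
  have "norm (packet b \<delta> \<sigma> w) = norm (packet b \<delta> t w)"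
    using packet_uminus[of b \<delta> t w] by (cases "0 \<le> \<sigma>") (simp_all add: t_def)
  also have "packet b \<delta> t w = (\<integral>x. indicator {0..} x *\<^sub>R kG CARD('d) b \<delta> t r s (complex_of_real x)
      + indicator {0..} x *\<^sub>R kG CARD('d) b \<delta> t r (- s) (complex_of_real x) \<partial>lborel)"
    unfolding packet_def
  proof (rule integral_cong_AE)
    show "AE x in lborel. packet_mode b \<delta> t x w = indicator {0..} x *\<^sub>R kG CARD('d) b \<delta> t r s (complex_of_real x)
      + indicator {0..} x *\<^sub>R kG CARD('d) b \<delta> t r (- s) (complex_of_real x)"
      using AE_lborel_singleton[of "0::real"]
    proof eventually_elim
      case (elim x)
      have "kG CARD('d) b \<delta> t r s' (complex_of_real x) = complex_of_real (exp (- \<delta> * x)) *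
          ((b / kD b t x) ^ CARD('d) * exp (\<i> * x * s' - kE b t x / kD b t x * r))" for s'
        unfolding kG_def by (simp add: exp_add[symmetric] exp_diff[symmetric] exp_of_real[symmetric] mult_exp_exp algebra_simps)
      then show ?case
        using elim by (simp add: packet_mode_def hmodeE_def hmode_def hr_def hs_def r_def s_def indicator_def distrib_left)
    qed
  qed (unfold kG_def, measurable)
  also have "\<dots> = (LINT x:{0..}|lborel. kG CARD('d) b \<delta> t r s (complex_of_real x))
      + (LINT x:{0..}|lborel. kG CARD('d) b \<delta> t r (- s) (complex_of_real x))"
    unfolding set_lebesgue_integral_def
    using assms t r by (intro Bochner_Integration.integral_add kG_integrable[unfolded set_integrable_def]) auto
  also have "norm \<dots> \<le> norm (LINT x:{0..}|lborel. kG CARD('d) b \<delta> t r s (complex_of_real x))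
      + norm (LINT x:{0..}|lborel. kG CARD('d) b \<delta> t r (- s) (complex_of_real x))"
    by (rule norm_triangle_ineq)
  also have "\<dots> \<le> 2 * (((1 + 16 * real CARD('d) / c) / (4 * t)) ^ CARD('d) * (2 / (c * t)))"
    using kG_integral_bound[of b \<delta> t r c s "CARD('d)"] kG_integral_bound[of b \<delta> t r c "- s" "CARD('d)"] assms t r
    by (simp add: s_def t_def)
  finally show ?thesis by (simp add: t_def)
qed

section \<open>Removal of the cutoffs\<close>

lemma flat_one_bounds: "0 \<le> flat [:1:] u" "flat [:1:] u \<le> 1"
  by (auto simp: flat_def)

lemma measurable_bump [measurable]: "bump p N \<in> borel_measurable borel"
  by (intro borel_measurable_continuous_onI elem_continuous elem_bump)

lemma bump_tendsto: "(\<lambda>n. bump p (real (Suc n)) w) \<longlonglongrightarrow> complex_of_real (flat p 1)"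
proof -
  have "(\<lambda>n. 1 - (norm w)\<^sup>2 / (real (Suc n))\<^sup>2) \<longlonglongrightarrow> 1"
    by real_asymp
  moreover have "isCont (flat p) 1"
    using flat_has_derivative by (rule DERIV_isCont)
  ultimately have "(\<lambda>n. flat p (1 - (norm w)\<^sup>2 / (real (Suc n))\<^sup>2)) \<longlonglongrightarrow> flat p 1"
    using isCont_tendsto_compose by blast
  then show ?thesis unfolding bump_def bumparg_eq by (intro tendsto_of_real) simp
qed

lemma ip_bump_tendsto:
  fixes h g :: "'d::finite heis \<Rightarrow> complex"
  assumes [measurable]: "h \<in> borel_measurable borel" "g \<in> borel_measurable borel"
    and hg: "integrable lborel (\<lambda>w. norm (h w) * norm (g w))"
  shows "(\<lambda>n. ip (\<lambda>w. bump [:1:] (real (Suc n)) (heis_mult a w) * h w) g) \<longlonglongrightarrow> complex_of_real (flat [:1:] 1) * ip h g"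
proof -
  have "(\<lambda>n. ip (\<lambda>w. bump [:1:] (real (Suc n)) (heis_mult a w) * h w) g) \<longlonglongrightarrow> ip (\<lambda>w. complex_of_real (flat [:1:] 1) * h w) g"
    unfolding ip_def
  proof (rule integral_dominated_convergence[where w = "\<lambda>w. norm (h w) * norm (g w)"])
    show "AE w in lborel. (\<lambda>n. cnj (bump [:1:] (real (Suc n)) (heis_mult a w) * h w) * g w)
       \<longlonglongrightarrow> cnj (complex_of_real (flat [:1:] 1) * h w) * g w"
      by (intro AE_I2 tendsto_intros bump_tendsto)
    show "AE w in lborel. norm (cnj (bump [:1:] (real (Suc n)) (heis_mult a w) * h w) * g w) \<le> norm (h w) * norm (g w)" for n
    proof (rule AE_I2)
      fix w
      have "norm (bump [:1:] (real (Suc n)) (heis_mult a w)) \<le> 1"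
        using flat_one_bounds by (simp add: bump_def)
      then have "norm (bump [:1:] (real (Suc n)) (heis_mult a w)) * (norm (h w) * norm (g w)) \<le> 1 * (norm (h w) * norm (g w))"
        by (intro mult_right_mono) auto
      then show "norm (cnj (bump [:1:] (real (Suc n)) (heis_mult a w) * h w) * g w) \<le> norm (h w) * norm (g w)"
        by (simp add: norm_mult mult.assoc)
    qed
  qed (use hg in measurable)
  then show ?thesis by (simp add: ip_cmult_left)
qed

lemma packet_0_integrable:
  assumes "0 < b" "0 < \<delta>"
  shows "integrable lborel (packet b \<delta> 0 :: 'd::finite heis \<Rightarrow> complex)" "L2 (packet b \<delta> 0 :: 'd heis \<Rightarrow> complex)"
proof -
  define h where "h w = b ^ CARD('d) * exp (- b * (fst w \<bullet> fst w + fst (snd w) \<bullet> fst (snd w))) * (2 * (\<delta> / (\<delta>\<^sup>2 + (snd (snd w))\<^sup>2)))"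
    for w :: "'d heis"
  have peq: "packet b \<delta> 0 = (\<lambda>w. complex_of_real (h w))"
    unfolding h_def by (rule ext, rule packet_0[OF assms])
  have q: "\<delta>\<^sup>2 + x\<^sup>2 \<noteq> 0" for x :: real
    using assms by (metis add_pos_nonneg less_irrefl zero_le_power2 zero_less_power)
  have hc: "continuous_on UNIV h"
    unfolding h_def by (intro continuous_intros) (use q in auto)
  have mh [measurable]: "h \<in> borel_measurable borel" by (rule borel_measurable_continuous_onI[OF hc])
  have h0: "0 \<le> h w" for w using assms by (simp add: h_def)
  define K where "K = 2 * \<delta> * (1 + 1 / \<delta>\<^sup>2)"
  have K: "2 * (\<delta> / (\<delta>\<^sup>2 + x\<^sup>2)) \<le> K * (1 / (1 + x\<^sup>2))" for x
  proof -
    have "1 + x\<^sup>2 \<le> (1 + 1 / \<delta>\<^sup>2) * (\<delta>\<^sup>2 + x\<^sup>2)"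
      using assms by (simp add: field_simps)
    then have "2 * \<delta> * (1 + x\<^sup>2) \<le> 2 * \<delta> * ((1 + 1 / \<delta>\<^sup>2) * (\<delta>\<^sup>2 + x\<^sup>2))"
      using assms by (intro mult_left_mono) auto
    moreover have "0 < \<delta>\<^sup>2 + x\<^sup>2" "0 < 1 + x\<^sup>2" using assms by (auto intro: add_pos_nonneg)
    ultimately show ?thesis unfolding K_def by (simp add: divide_simps mult_ac)
  qed
  have K0: "0 \<le> K" using assms by (simp add: K_def)
  have "(\<integral>\<^sup>+w. ennreal (h w) \<partial>lborel) = (\<integral>\<^sup>+y. \<integral>\<^sup>+\<eta>. \<integral>\<^sup>+s. ennreal (h (y, \<eta>, s)) \<partial>lborel \<partial>lborel \<partial>lborel)"
    by (rule nn_integral_heis) measurable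
  also have "\<dots> \<le> (\<integral>\<^sup>+y. \<integral>\<^sup>+\<eta>. ennreal (exp (- b * (y \<bullet> y + \<eta> \<bullet> \<eta>))) * (ennreal (b ^ CARD('d) * K) * (\<integral>\<^sup>+s. ennreal (1 / (1 + s\<^sup>2)) \<partial>lborel)) \<partial>(lborel :: (real^'d) measure) \<partial>(lborel :: (real^'d) measure))"
  proof (rule nn_integral_mono, rule nn_integral_mono)
    fix y \<eta> :: "real^'d"
    have "(\<integral>\<^sup>+s. ennreal (h (y, \<eta>, s)) \<partial>lborel) \<le> (\<integral>\<^sup>+s. ennreal (exp (- b * (y \<bullet> y + \<eta> \<bullet> \<eta>)) * (b ^ CARD('d) * K)) * ennreal (1 / (1 + s\<^sup>2)) \<partial>lborel)"
    proof (rule nn_integral_mono)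
      fix s :: real
      have "h (y, \<eta>, s) \<le> exp (- b * (y \<bullet> y + \<eta> \<bullet> \<eta>)) * (b ^ CARD('d) * K) * (1 / (1 + s\<^sup>2))"
        using mult_left_mono[OF K[of s], of "b ^ CARD('d) * exp (- b * (y \<bullet> y + \<eta> \<bullet> \<eta>))"] assms
        by (simp add: h_def mult_ac)
      then show "ennreal (h (y, \<eta>, s)) \<le> ennreal (exp (- b * (y \<bullet> y + \<eta> \<bullet> \<eta>)) * (b ^ CARD('d) * K)) * ennreal (1 / (1 + s\<^sup>2))"
        using assms K0 by (subst ennreal_mult[symmetric]) (auto intro!: ennreal_leI)
    qed
    also have "\<dots> = ennreal (exp (- b * (y \<bullet> y + \<eta> \<bullet> \<eta>)) * (b ^ CARD('d) * K)) * (\<integral>\<^sup>+s. ennreal (1 / (1 + s\<^sup>2)) \<partial>lborel)"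
      by (rule nn_integral_cmult) measurable
    also have "ennreal (exp (- b * (y \<bullet> y + \<eta> \<bullet> \<eta>)) * (b ^ CARD('d) * K)) = ennreal (exp (- b * (y \<bullet> y + \<eta> \<bullet> \<eta>))) * ennreal (b ^ CARD('d) * K)"
      using assms K0 by (intro ennreal_mult) auto
    finally show "(\<integral>\<^sup>+s. ennreal (h (y, \<eta>, s)) \<partial>lborel) \<le> ennreal (exp (- b * (y \<bullet> y + \<eta> \<bullet> \<eta>))) * (ennreal (b ^ CARD('d) * K) * (\<integral>\<^sup>+s. ennreal (1 / (1 + s\<^sup>2)) \<partial>lborel))"
      by (simp add: mult.assoc)
  qed
  also have "\<dots> = ennreal (gaussian_mass b TYPE('d)) * (ennreal (b ^ CARD('d) * K) * (\<integral>\<^sup>+s. ennreal (1 / (1 + s\<^sup>2)) \<partial>lborel))"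
    by (simp add: nn_integral_multc gaussian_mass[OF assms(1), symmetric])
  also have "\<dots> < \<infinity>"
    using nn_integral_inverse_square_finite by (simp add: ennreal_mult_less_top)
  finally have hint: "integrable lborel h" using h0 by (intro integrableI_nonneg) auto
  then show "integrable lborel (packet b \<delta> 0 :: 'd heis \<Rightarrow> complex)" unfolding peq by simp
  define W where "W = (\<integral>x. packet_weight CARD('d) b \<delta> x \<partial>lborel)"
  have hW: "h w \<le> W" for w
    using packet_bounded[OF assms, of 0 w] h0[of w] by (simp add: peq W_def)
  \<comment> \<open>A bounded integrable function is square integrable.\<close>
  have "integrable lborel (\<lambda>w. (h w)\<^sup>2)"
  proof (rule Bochner_Integration.integrable_bound[OF integrable_mult_right[OF hint, of W]])
    show "AE w in lborel. norm ((h w)\<^sup>2) \<le> norm (W * h w)"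
    proof (rule AE_I2)
      fix w
      have "(h w)\<^sup>2 \<le> W * h w" unfolding power2_eq_square by (rule mult_right_mono[OF hW h0])
      then show "norm ((h w)\<^sup>2) \<le> norm (W * h w)" by simp
    qed
  qed measurable
  then show "L2 (packet b \<delta> 0 :: 'd heis \<Rightarrow> complex)" unfolding peq L2_iff by simp
qed

lemma measurable_packet [measurable]: "packet b \<delta> \<sigma> \<in> borel_measurable borel"
proof -
  have "(\<lambda>(w, x). packet_mode b \<delta> \<sigma> x w) \<in> borel_measurable (borel \<Otimes>\<^sub>M lborel)"
    unfolding packet_mode_def hmodeE_def hmode_def by measurable
  then have "(\<lambda>w. \<integral>x. packet_mode b \<delta> \<sigma> x w \<partial>lborel) \<in> borel_measurable borel"
    by (rule lborel.borel_measurable_lebesgue_integral)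
  then show ?thesis by (simp add: packet_def[abs_def])
qed

text \<open>The error of \<open>bump_mode_pairing\<close>, of order 1 / sqrt N, is integrated over
  the frequencies and vanishes as N grows, while dominated convergence removes the cutoffs from both
  pairings. On the left the packet is square integrable; on the right the evolved packet is only
  known to be bounded, which is why f is taken integrable as well.\<close>

lemma packet_pairing:
  fixes U :: "real \<Rightarrow> ('d::finite heis \<Rightarrow> complex) \<Rightarrow> ('d heis \<Rightarrow> complex)" and a :: "'d heis"
  assumes sg: "schroedinger_group U" and f: "L2 f" "integrable lborel f" and b: "0 < b" and \<delta>: "0 < \<delta>"
  shows "ip (\<lambda>w. packet b \<delta> 0 (heis_mult a w)) (U t f) = ip (\<lambda>w. packet b \<delta> (- t) (heis_mult a w)) f"
proof -
  have Uf: "L2 (U t f)" by (rule sg_L2[OF sg f(1)])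
  have [measurable]: "f \<in> borel_measurable borel" "U t f \<in> borel_measurable borel"
    using f Uf by (auto simp: L2_iff)
  obtain M1 where M1: "\<And>u. u \<le> 1 \<Longrightarrow> \<bar>flat (flat_deriv [:1:]) u\<bar> \<le> M1" using flat_bounded by blast
  obtain M2 where M2: "\<And>u. u \<le> 1 \<Longrightarrow> \<bar>flat (flat_deriv (flat_deriv [:1:])) u\<bar> \<le> M2" using flat_bounded by blast
  define M where "M = max M1 M2"
  have M: "\<And>u. u \<le> 1 \<Longrightarrow> \<bar>flat (flat_deriv [:1:]) u\<bar> \<le> M" "\<And>u. u \<le> 1 \<Longrightarrow> \<bar>flat (flat_deriv (flat_deriv [:1:])) u\<bar> \<le> M"
    unfolding M_def by (erule order_trans[OF M1 max.cobounded1], erule order_trans[OF M2 max.cobounded2])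
  have M0: "0 \<le> M" using M(1)[of 0] by linarith
  define \<beta> where "\<beta> = b / (1 + 4 * b * \<bar>t\<bar>)\<^sup>2"
  have \<beta>: "0 < \<beta>" unfolding \<beta>_def using b by (intro divide_pos_pos zero_less_power) (auto intro: add_pos_nonneg)
  define \<gamma> where "\<gamma> = gaussian_mass \<beta> TYPE('d)"
  define H :: "nat \<Rightarrow> 'd heis \<Rightarrow> complex" where "H n = bump [:1:] (real (Suc n))" for n
  define I where "I n = ip (\<lambda>w. H n (heis_mult a w) * packet b \<delta> 0 (heis_mult a w)) (U t f)
     - ip (\<lambda>w. H n (heis_mult a w) * packet b \<delta> (- t) (heis_mult a w)) f" for n
  define C where "C = 88 * real CARD('d) * M * (1 + 2 / \<beta>) * sqrt (2 * \<gamma>) * l2norm f * \<bar>t\<bar>"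
  have C0: "0 \<le> C" using M0 \<beta> gaussian_mass_nonneg[of \<beta> "TYPE('d)"] l2norm_nonneg[of f] by (simp add: C_def \<gamma>_def)
  define K where "K = 1 / b\<^sup>2 + 2 / b"
  have Hm [measurable]: "H n \<in> borel_measurable borel" for n unfolding H_def by measurable
  have H2: "L2 (\<lambda>w. H n (heis_mult a w))" for n
  proof (rule L2_translate(1), rule continuous_compact_L2)
    show "continuous_on UNIV (H n)" unfolding H_def by (rule elem_continuous[OF elem_bump])
    show "compact (cball (0 :: 'd heis) (real (Suc n)))" by (rule compact_cball)
    show "H n w = 0" if "w \<notin> cball 0 (real (Suc n))" for w :: "'d heis"
      unfolding H_def by (rule bump_outside) (use that in auto)
  qed
  have Ibound: "norm (I n) \<le> C / sqrt (real (Suc n)) * (K * (\<integral>x. packet_weight (CARD('d) + 2) b \<delta> x \<partial>lborel))" for n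
  proof -
    let ?N = "real (Suc n)"
    let ?J1 = "\<lambda>x. ip (\<lambda>w. H n (heis_mult a w) * packet_mode b \<delta> 0 x (heis_mult a w)) (U t f)"
    let ?J2 = "\<lambda>x. ip (\<lambda>w. H n (heis_mult a w) * packet_mode b \<delta> (- t) x (heis_mult a w)) f"
    note sp1 = ip_superposition[where k = "\<lambda>x w. packet_mode b \<delta> 0 x (heis_mult a w)" and \<phi> = "packet_weight CARD('d) b \<delta>"
      and \<theta> = "\<lambda>w. H n (heis_mult a w)" and g = "U t f", OF measurable_packet_mode norm_packet_mode_le[OF b] packet_weight_integrable[OF b \<delta>] _ _ L2_product_bound(1)[OF H2 Uf]]
    note sp2 = ip_superposition[where k = "\<lambda>x w. packet_mode b \<delta> (- t) x (heis_mult a w)" and \<phi> = "packet_weight CARD('d) b \<delta>"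
      and \<theta> = "\<lambda>w. H n (heis_mult a w)" and g = f, OF measurable_packet_mode norm_packet_mode_le[OF b] packet_weight_integrable[OF b \<delta>] _ _ L2_product_bound(1)[OF H2 f(1)]]
    have int1: "integrable lborel ?J1" and int2: "integrable lborel ?J2" by (rule sp1(1) sp2(1); measurable)+
    have "I n = (\<integral>x. ?J1 x \<partial>lborel) - (\<integral>x. ?J2 x \<partial>lborel)"
      unfolding I_def packet_def by (subst sp1(2), measurable, subst sp2(2), measurable)
    also have "\<dots> = (\<integral>x. ?J1 x - ?J2 x \<partial>lborel)"
      using int1 int2 by simp
    also have "norm \<dots> \<le> (\<integral>x. C / sqrt ?N * (K * packet_weight (CARD('d) + 2) b \<delta> x) \<partial>lborel)"
    proof (rule Bochner_Integration.integral_norm_bound_integral)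
      show "integrable lborel (\<lambda>x. ?J1 x - ?J2 x)" using int1 int2 by simp
      show "integrable lborel (\<lambda>x. C / sqrt ?N * (K * packet_weight (CARD('d) + 2) b \<delta> x))"
        using packet_weight_integrable[OF b \<delta>] by simp
      fix x
      show "norm (?J1 x - ?J2 x) \<le> C / sqrt ?N * (K * packet_weight (CARD('d) + 2) b \<delta> x)"
      proof (cases "0 < x")
        case False
        then have "?J1 x - ?J2 x = 0" by (simp add: packet_mode_def ip_def)
        then show ?thesis using False C0 b \<delta> by (auto simp: packet_weight_def K_def indicator_def intro!: mult_nonneg_nonneg divide_nonneg_nonneg)
      next
        case True
        let ?e = "complex_of_real (exp (- \<delta> * x))"
        let ?G = "\<lambda>\<sigma> m w. H n (heis_mult a w) * hmodeE b \<sigma> x m (heis_mult a w)"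
        have GL2: "L2 (?G \<sigma> m)" for \<sigma> m
        proof -
          have [measurable]: "hmodeE b \<sigma> x m \<in> borel_measurable borel"
            unfolding hmodeE_def[abs_def] hmode_def by measurable
          have "integrable lborel (\<lambda>w. ((b + x) ^ CARD('d))\<^sup>2 * (norm (H n (heis_mult a w)))\<^sup>2)"
            using H2 by (simp add: L2_iff)
          then have "integrable lborel (\<lambda>w. (norm (?G \<sigma> m w))\<^sup>2)"
          proof (rule Bochner_Integration.integrable_bound)
            have "(norm (?G \<sigma> m w))\<^sup>2 \<le> ((b + x) ^ CARD('d))\<^sup>2 * (norm (H n (heis_mult a w)))\<^sup>2" for w
            proof -
              have "norm (?G \<sigma> m w) \<le> (b + x) ^ CARD('d) * norm (H n (heis_mult a w))"
                using mult_right_mono[OF norm_hmodeE_le[OF b True, of \<sigma> m "heis_mult a w"] norm_ge_zero[of "H n (heis_mult a w)"]]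
                by (simp only: norm_mult mult.commute)
              then have "(norm (?G \<sigma> m w))\<^sup>2 \<le> ((b + x) ^ CARD('d) * norm (H n (heis_mult a w)))\<^sup>2"
                by (intro power_mono) auto
              then show ?thesis by (simp only: power_mult_distrib)
            qed
            then show "AE w in lborel. norm ((norm (?G \<sigma> m w))\<^sup>2) \<le> norm (((b + x) ^ CARD('d))\<^sup>2 * (norm (H n (heis_mult a w)))\<^sup>2)"
              by (intro AE_I2) (simp add: abs_mult)
          qed measurable
          then show ?thesis unfolding L2_iff by (intro conjI) measurable
        qed
        have split: "ip (\<lambda>w. H n (heis_mult a w) * packet_mode b \<delta> \<sigma> x (heis_mult a w)) g = ?e * (ip (?G \<sigma> x) g + ip (?G \<sigma> (- x)) g)"
          if "L2 g" for \<sigma> g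
        proof -
          have "(\<lambda>w. H n (heis_mult a w) * packet_mode b \<delta> \<sigma> x (heis_mult a w)) = (\<lambda>w. ?e * (?G \<sigma> x w + ?G \<sigma> (- x) w))"
            using True by (simp add: packet_mode_def fun_eq_iff algebra_simps)
          then show ?thesis by (simp only: ip_cmult_left ip_add_left[OF GL2 GL2 that]) simp
        qed
        let ?b = "(b + x) ^ CARD('d) * (88 * real CARD('d) * M / ?N * (1 + x + (b + x) * ((b + x) / b)) * (1 + 2 / \<beta>)
          * sqrt (2 * ?N * \<gamma>)) * l2norm f * \<bar>t\<bar>"
        have d: "norm (ip (?G 0 m) (U t f) - ip (?G (- t) m) f) \<le> ?b" if "m\<^sup>2 = x\<^sup>2" for m
          unfolding H_def \<gamma>_def by (rule bump_mode_pairing[OF sg f(1) b True that _ M \<beta>_def]) auto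
        have "?J1 x - ?J2 x = ?e * ((ip (?G 0 x) (U t f) - ip (?G (- t) x) f) + (ip (?G 0 (- x)) (U t f) - ip (?G (- t) (- x)) f))"
          unfolding split[OF Uf] split[OF f(1)] by (simp add: algebra_simps)
        then have "norm (?J1 x - ?J2 x) \<le> exp (- \<delta> * x) * (?b + ?b)"
          using d[of x] d[of "- x"] by (simp only: norm_mult norm_of_real abs_exp_cancel)
            (intro mult_left_mono order_trans[OF norm_triangle_ineq] add_mono, auto)
        also have "\<dots> = C / sqrt ?N * ((1 + x + (b + x) * ((b + x) / b)) * (2 * ((b + x) ^ CARD('d) * exp (- \<delta> * x))))"
        proof -
          \<comment> \<open>The net gain 1 / sqrt N: commutator 1 / N against sqrt N from the height
            of the strip.\<close>
          have E: "sqrt (2 * ?N * \<gamma>) / ?N = sqrt (2 * \<gamma>) / sqrt ?N"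
          proof -
            have "sqrt (2 * ?N * \<gamma>) = sqrt (2 * \<gamma>) * sqrt ?N"
              unfolding real_sqrt_mult[symmetric] by (simp only: mult_ac)
            moreover have "sqrt ?N * sqrt ?N = ?N" by simp
            ultimately show ?thesis by (simp add: field_simps del: of_nat_Suc)
          qed
          have g1: "e * (P * (q / N' * Z * B' * S) * L * T + P * (q / N' * Z * B' * S) * L * T)
              = q * B' * (S / N') * L * T * (Z * (2 * (P * e)))" for e P q N' Z B' S L T :: real by simp
          have g2: "q * B' * (S / N') * L * T = q * B' * S * L * T / N'" for q N' B' S L T :: real by simp
          show ?thesis unfolding g1 E g2 C_def ..
        qed
        also have "\<dots> \<le> C / sqrt ?N * ((K * (b + x)\<^sup>2) * (2 * ((b + x) ^ CARD('d) * exp (- \<delta> * x))))"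
        proof (intro mult_left_mono mult_right_mono)
          \<comment> \<open>Each of the three terms is at most a multiple of (b + x)^2, with factors
            1 / b^2, 1 / b and 1 / b whose sum is K. This accounts for the weight of degree d +
            2.\<close>
          have "1 + x \<le> 1 / b\<^sup>2 * (b + x)\<^sup>2 + 1 / b * (b + x)\<^sup>2"
          proof -
            have "1 \<le> ((b + x) / b)\<^sup>2" using b True by (simp add: one_le_power)
            then have "1 \<le> 1 / b\<^sup>2 * (b + x)\<^sup>2" by (simp add: power_divide)
            moreover have "x * b \<le> (b + x) * (b + x)" using b True by (intro mult_mono) auto
            then have "x \<le> 1 / b * (b + x)\<^sup>2" using b by (simp add: pos_le_divide_eq power2_eq_square)
            ultimately show ?thesis by linarith
          qed
          then show "1 + x + (b + x) * ((b + x) / b) \<le> K * (b + x)\<^sup>2"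
          proof -
            have "(b + x) * ((b + x) / b) = 1 / b * (b + x)\<^sup>2" by (simp add: power2_eq_square)
            moreover have "K * (b + x)\<^sup>2 = 1 / b\<^sup>2 * (b + x)\<^sup>2 + 1 / b * (b + x)\<^sup>2 + 1 / b * (b + x)\<^sup>2"
              unfolding K_def by (simp add: distrib_right)
            ultimately show ?thesis using \<open>1 + x \<le> 1 / b\<^sup>2 * (b + x)\<^sup>2 + 1 / b * (b + x)\<^sup>2\<close> by linarith
          qed
        qed (use C0 b True in \<open>auto intro!: divide_nonneg_nonneg\<close>)
        also have "\<dots> = C / sqrt ?N * (K * packet_weight (CARD('d) + 2) b \<delta> x)"
          using True by (simp add: packet_weight_def power_add power2_eq_square mult_ac)
        finally show ?thesis .
      qed
    qed
    also have "\<dots> = C / sqrt ?N * (K * (\<integral>x. packet_weight (CARD('d) + 2) b \<delta> x \<partial>lborel))"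
      by simp
    finally show ?thesis .
  qed
  have "(\<lambda>n. C / sqrt (real (Suc n)) * W) \<longlonglongrightarrow> 0" for W
    by real_asymp
  then have "(\<lambda>n. C / sqrt (real (Suc n)) * (K * (\<integral>x. packet_weight (CARD('d) + 2) b \<delta> x \<partial>lborel))) \<longlonglongrightarrow> 0" .
  from Lim_null_comparison[OF always_eventually[OF allI[OF Ibound]] this] have I0: "I \<longlonglongrightarrow> 0" .
  have int1: "integrable lborel (\<lambda>w. norm (packet b \<delta> 0 (heis_mult a w)) * norm (U t f w))"
    by (intro L2_product_bound Uf L2_translate packet_0_integrable b \<delta>)
  have int2: "integrable lborel (\<lambda>w. norm (packet b \<delta> (- t) (heis_mult a w)) * norm (f w))"
  proof (rule Bochner_Integration.integrable_bound[OF integrable_mult_right[OF integrable_norm[OF f(2)], of "\<integral>x. packet_weight CARD('d) b \<delta> x \<partial>lborel"]])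
    define W where "W = (\<integral>x. packet_weight CARD('d) b \<delta> x \<partial>lborel)"
    have W: "norm (packet b \<delta> (- t) (heis_mult a w)) \<le> W" for w
      unfolding W_def by (rule packet_bounded[OF b \<delta>])
    have "norm (norm (packet b \<delta> (- t) (heis_mult a w)) * norm (f w)) \<le> norm (W * norm (f w))" for w
    proof -
      have "norm (packet b \<delta> (- t) (heis_mult a w)) * norm (f w) \<le> W * norm (f w)"
        by (rule mult_right_mono[OF W norm_ge_zero])
      also have "\<dots> \<le> norm (W * norm (f w))" by simp
      finally show ?thesis by simp
    qed
    then show "AE w in lborel. norm (norm (packet b \<delta> (- t) (heis_mult a w)) * norm (f w)) \<le> norm ((\<integral>x. packet_weight CARD('d) b \<delta> x \<partial>lborel) * norm (f w))"
      unfolding W_def by (rule AE_I2)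
  qed measurable
  \<comment> \<open>The cutoffs tend to the constant \<open>flat [:1:] 1\<close> = exp (- 1) rather
    than to 1. It is a common nonzero factor of both pairings and cancels.\<close>
  have "I \<longlonglongrightarrow> complex_of_real (flat [:1:] 1) * ip (\<lambda>w. packet b \<delta> 0 (heis_mult a w)) (U t f)
      - complex_of_real (flat [:1:] 1) * ip (\<lambda>w. packet b \<delta> (- t) (heis_mult a w)) f"
    unfolding I_def[abs_def] H_def
    by (intro tendsto_diff ip_bump_tendsto int1 int2; measurable)
  from LIMSEQ_unique[OF this I0] show ?thesis by (simp add: flat_def)
qed

section \<open>The local dispersive estimate\<close>

text \<open>If g exceeded A by a fixed amount on a set of positive measure, inner regularity would
  give a compact subset of positive measure violating the averaged bound. Inner regularity is
  applied to the restriction of Lebesgue measure to B, which is finite.\<close>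

lemma AE_le_of_compact_integrals:
  fixes g :: "'a::euclidean_space \<Rightarrow> real"
  assumes [measurable]: "g \<in> borel_measurable borel" and B [measurable]: "B \<in> sets borel" and fin: "emeasure lborel B < \<infinity>"
    and int: "\<And>K. compact K \<Longrightarrow> K \<subseteq> B \<Longrightarrow> set_integrable lborel K g"
    and le: "\<And>K. compact K \<Longrightarrow> K \<subseteq> B \<Longrightarrow> (LINT x:K|lborel. g x) \<le> A * measure lborel K"
  shows "AE x in lborel. x \<in> B \<longrightarrow> g x \<le> A"
proof -
  have null: "{x \<in> B. A + 1 / real (Suc n) \<le> g x} \<in> null_sets lborel" (is "?D n \<in> _") for n
  proof (rule ccontr)
    assume "?D n \<notin> null_sets lborel"
    have D [measurable]: "?D n \<in> sets borel" by measurable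
    with \<open>?D n \<notin> null_sets lborel\<close> have pos: "0 < emeasure lborel (?D n)"
      by (auto simp: null_sets_def zero_less_iff_neq_zero)
    define M where "M = density lborel (indicator B)"
    have eM: "emeasure M X = emeasure lborel (B \<inter> X)" if X [measurable]: "X \<in> sets borel" for X
    proof -
      have "emeasure M X = (\<integral>\<^sup>+x. indicator B x * indicator X x \<partial>lborel)"
        unfolding M_def by (rule emeasure_density) simp_all
      also have "\<dots> = (\<integral>\<^sup>+x. indicator (B \<inter> X) x \<partial>lborel)"
        by (intro nn_integral_cong) (simp add: indicator_def)
      finally show ?thesis by simp
    qed
    have "emeasure M (?D n) = (SUP K \<in> {K. K \<subseteq> ?D n \<and> compact K}. emeasure M K)"
    proof (rule inner_regular)
      show "sets M = sets borel" by (simp add: M_def)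
      show "emeasure M (space M) \<noteq> \<infinity>" using fin eM[of UNIV] by (simp add: M_def)
    qed (rule D)
    moreover have "emeasure M (?D n) = emeasure lborel (?D n)"
      using eM[OF D] by (simp add: Int_absorb1 subset_eq)
    ultimately have "0 < (SUP K \<in> {K. K \<subseteq> ?D n \<and> compact K}. emeasure M K)" using pos by simp
    then obtain K where K: "K \<subseteq> ?D n" "compact K" "0 < emeasure M K"
      by (auto simp: less_SUP_iff)
    have KB: "K \<subseteq> B" using K(1) by auto
    have Kb [measurable]: "K \<in> sets borel" using K(2) by (simp add: borel_compact)
    have "0 < emeasure lborel K" using K(3) eM[OF Kb] KB by (simp add: Int_absorb1)
    moreover have Kfin: "emeasure lborel K < \<infinity>" by (rule emeasure_compact_finite[OF K(2)])
    ultimately have mK: "0 < measure lborel K" by (simp add: measure_def enn2real_positive_iff)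
    have "(A + 1 / real (Suc n)) * measure lborel K = (LINT x:K|lborel. A + 1 / real (Suc n))"
      using Kfin by (simp add: set_integral_const)
    also have "\<dots> \<le> (LINT x:K|lborel. g x)"
      by (rule set_integral_mono) (use K(1) Kfin int[OF K(2) KB] in \<open>auto simp: set_integrable_def\<close>)
    also have "\<dots> \<le> A * measure lborel K" by (rule le[OF K(2) KB])
    finally have "1 / real (Suc n) * measure lborel K \<le> 0" by (simp only: distrib_right)
    moreover have "0 < 1 / real (Suc n) * measure lborel K" using mK by (intro mult_pos_pos) auto
    ultimately show False by linarith
  qed
  have "AE x in lborel. \<forall>n. x \<notin> ?D n"
    by (intro AE_all_countable[THEN iffD2] allI AE_not_in null)
  then show ?thesis
  proof eventually_elim
    case (elim x)
    show ?case
    proof (intro impI, rule ccontr)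
      assume x: "x \<in> B" "\<not> g x \<le> A"
      then obtain n where "1 / real (Suc n) < g x - A"
        using reals_Archimedean[of "g x - A"] by (auto simp: inverse_eq_divide)
      then have "A + 1 / real (Suc n) \<le> g x" by linarith
      with elim x(1) show False by blast
    qed
  qed
qed

text \<open>The modulus is recovered from real parts of d * f. Countably many d leave a single
  exceptional null set; density and continuity then extend the bound to every multiplier, in
  particular to \<open>cnj (f x)\<close>.\<close>

lemma AE_norm_le_of_compact_integrals:
  fixes f :: "'a::euclidean_space \<Rightarrow> complex"
  assumes [measurable]: "f \<in> borel_measurable borel" and B: "B \<in> sets borel" "emeasure lborel B < \<infinity>"
    and int: "\<And>K. compact K \<Longrightarrow> K \<subseteq> B \<Longrightarrow> set_integrable lborel K f"
    and le: "\<And>K. compact K \<Longrightarrow> K \<subseteq> B \<Longrightarrow> norm (LINT x:K|lborel. f x) \<le> A * measure lborel K"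
    and A: "0 \<le> A"
  shows "AE x in lborel. x \<in> B \<longrightarrow> norm (f x) \<le> A"
proof -
  obtain D :: "complex set" where D: "countable D" "\<And>X. open X \<Longrightarrow> X \<noteq> {} \<Longrightarrow> \<exists>d\<in>D. d \<in> X"
    using countable_dense_exists by blast
  have "AE x in lborel. x \<in> B \<longrightarrow> Re (d * f x) \<le> A * norm d" for d
  proof (rule AE_le_of_compact_integrals[OF _ B])
    fix K :: "'a set" assume K: "compact K" "K \<subseteq> B"
    have i: "set_integrable lborel K (\<lambda>x. d * f x)" using int[OF K] by simp
    then show "set_integrable lborel K (\<lambda>x. Re (d * f x))"
      unfolding set_integrable_def using integrable_Re by fastforce
    have "(LINT x:K|lborel. Re (d * f x)) = Re (LINT x:K|lborel. d * f x)"
      unfolding set_lebesgue_integral_def using i[unfolded set_integrable_def]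
      by (subst integral_Re[symmetric]) auto
    also have "\<dots> \<le> norm (d * (LINT x:K|lborel. f x))"
      by (subst set_integral_mult_right) (rule complex_Re_le_cmod)
    also have "\<dots> \<le> norm d * (A * measure lborel K)"
      unfolding norm_mult by (intro mult_left_mono le K) auto
    finally show "(LINT x:K|lborel. Re (d * f x)) \<le> A * norm d * measure lborel K"
      by (simp add: mult_ac)
  qed measurable
  then have "AE x in lborel. \<forall>d\<in>D. x \<in> B \<longrightarrow> Re (d * f x) \<le> A * norm d"
    by (subst AE_ball_countable[OF D(1)]) blast
  then show ?thesis
  proof eventually_elim
    case (elim x)
    show ?case
    proof
      assume x: "x \<in> B"
      have all: "Re (z * f x) \<le> A * norm z" for z
      proof (rule ccontr)
        assume "\<not> Re (z * f x) \<le> A * norm z"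
        then have "z \<in> {z. A * norm z < Re (z * f x)}" by simp
        moreover have "open {z. A * norm z < Re (z * f x)}"
          by (intro open_Collect_less continuous_intros)
        ultimately obtain d where "d \<in> D" "A * norm d < Re (d * f x)" using D(2) by blast
        with elim x show False by force
      qed
      have "Re (cnj (f x) * f x) = (norm (f x))\<^sup>2"
        unfolding cmod_power2 by (simp add: power2_eq_square)
      then have "(norm (f x))\<^sup>2 \<le> A * norm (f x)" using all[of "cnj (f x)"] by (simp only: complex_mod_cnj)
      then show "norm (f x) \<le> A"
        using A by (cases "f x = 0") (auto simp: power2_eq_square)
    qed
  qed
qed

section \<open>Right translations and dilations of integrals\<close>

lemma lborel_distr_uminus_euclidean: "distr lborel borel uminus = (lborel :: 'a::euclidean_space measure)"
  by (subst lborel_affine[of "-1" 0]) (auto simp: density_1 one_ennreal_def[symmetric])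

text \<open>The group inverse is negation of coordinates, which preserves Lebesgue measure and
  interchanges left and right translations.\<close>

lemma integral_heis_mult_right:
  fixes f :: "'d::finite heis \<Rightarrow> 'b::{banach, second_countable_topology}"
  assumes [measurable]: "f \<in> borel_measurable borel"
  shows "(\<integral>w. f (heis_mult w a) \<partial>lborel) = (\<integral>w. f w \<partial>lborel)"
    "integrable lborel (\<lambda>w. f (heis_mult w a)) \<longleftrightarrow> integrable lborel f"
proof -
  have neg: "(\<integral>w. g (- w) \<partial>lborel) = (\<integral>w. g w \<partial>lborel)" "integrable lborel (\<lambda>w. g (- w)) \<longleftrightarrow> integrable lborel g"
    if [measurable]: "g \<in> borel_measurable borel" for g :: "'d heis \<Rightarrow> 'b"
  proof -
    show "(\<integral>w. g (- w) \<partial>lborel) = (\<integral>w. g w \<partial>lborel)"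
      by (subst (2) lborel_distr_uminus_euclidean[symmetric]) (simp add: integral_distr)
    show "integrable lborel (\<lambda>w. g (- w)) \<longleftrightarrow> integrable lborel g"
      by (subst (2) lborel_distr_uminus_euclidean[symmetric]) (simp add: integrable_distr_eq)
  qed
  have eq: "heis_mult w a = - (heis_mult (- a) (- w))" for w
    by (cases w; cases a) (simp add: heis_mult_def inner_commute)
  have m1 [measurable]: "(\<lambda>w. f (- w)) \<in> borel_measurable borel" by measurable
  have m2: "(\<lambda>w. f (- (heis_mult (- a) w))) \<in> borel_measurable borel" by measurable
  show "(\<integral>w. f (heis_mult w a) \<partial>lborel) = (\<integral>w. f w \<partial>lborel)"
    unfolding eq using neg(1)[OF m2] integral_heis_mult(1)[OF m1, of "- a"] neg(1)[OF assms] by simp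
  show "integrable lborel (\<lambda>w. f (heis_mult w a)) \<longleftrightarrow> integrable lborel f"
    unfolding eq using neg(2)[OF m2] integral_heis_mult(2)[OF m1, of "- a"] neg(2)[OF assms] by simp
qed

lemma L2_translate_right:
  assumes "L2 f" shows "L2 (\<lambda>w. f (heis_mult w a))" "l2norm (\<lambda>w. f (heis_mult w a)) = l2norm f"
proof -
  have [measurable]: "f \<in> borel_measurable borel" using assms by (simp add: L2_iff)
  have "(\<lambda>w. (norm (f w))\<^sup>2) \<in> borel_measurable borel" by measurable
  note t = integral_heis_mult_right[OF this, of a]
  have [measurable]: "(\<lambda>w. heis_mult w a) \<in> borel_measurable borel"
    by (intro borel_measurable_continuous_onI continuous_intros)
  show "L2 (\<lambda>w. f (heis_mult w a))" using assms t(2) by (simp add: L2_iff)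
  show "l2norm (\<lambda>w. f (heis_mult w a)) = l2norm f" using t(1) by (simp add: l2norm_def)
qed

lemma integral_heis_dil:
  fixes f :: "'d::finite heis \<Rightarrow> 'b::{banach, second_countable_topology}"
  assumes [measurable]: "f \<in> borel_measurable borel" and c: "0 < c"
  shows "(\<integral>w. f w \<partial>lborel) = c ^ (2 * CARD('d) + 2) *\<^sub>R (\<integral>w. f (heis_dil c w) \<partial>lborel)"
proof -
  have L: "lborel = density (distr lborel borel (heis_dil c :: 'd heis \<Rightarrow> 'd heis)) (\<lambda>_. ennreal (c ^ (2 * CARD('d) + 2)))" (is "_ = ?D")
  proof (rule measure_eqI)
    fix X :: "'d heis set" assume "X \<in> sets lborel"
    then have [measurable]: "X \<in> sets borel" by simp
    have "emeasure lborel X = ennreal (c ^ (2 * CARD('d) + 2)) * (\<integral>\<^sup>+w. indicator X (heis_dil c w) \<partial>lborel)"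
      using nn_integral_heis_dil[of "indicator X" c] c by simp
    also have "\<dots> = emeasure ?D X"
    proof -
      have "emeasure (distr lborel borel (heis_dil c)) X = (\<integral>\<^sup>+w. indicator X (heis_dil c w) \<partial>lborel)"
        by (subst nn_integral_indicator[symmetric], simp, subst nn_integral_distr) simp_all
      then show ?thesis by (simp add: emeasure_density_const)
    qed
    finally show "emeasure lborel X = emeasure ?D X" .
  qed simp
  show "(\<integral>w. f w \<partial>lborel) = c ^ (2 * CARD('d) + 2) *\<^sub>R (\<integral>w. f (heis_dil c w) \<partial>lborel)"
    using c by (subst L) (simp add: integral_density integral_distr)
qed

section \<open>Packets as an approximate identity\<close>

definition hker :: "'d::finite heis \<Rightarrow> real" where
  "hker w = exp (- (fst w \<bullet> fst w + fst (snd w) \<bullet> fst (snd w))) * (2 / (1 + (snd (snd w))\<^sup>2))"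

lemma packet_hker: "packet 1 1 0 (w :: 'd::finite heis) = complex_of_real (hker w)"
  by (subst packet_0) (simp_all add: hker_def)

lemma hker_pos: "0 < hker w"
  by (simp add: hker_def add_pos_nonneg)

lemma measurable_hker [measurable]: "hker \<in> borel_measurable borel"
proof -
  have "1 + x\<^sup>2 \<noteq> 0" for x :: real by (metis add_pos_nonneg less_irrefl zero_le_power2 zero_less_one)
  then have "continuous_on UNIV (hker :: 'a::finite heis \<Rightarrow> real)"
    unfolding hker_def[abs_def] by (intro continuous_intros) auto
  then show ?thesis by (rule borel_measurable_continuous_onI)
qed

lemma integrable_hker: "integrable lborel (hker :: 'd::finite heis \<Rightarrow> real)"
proof -
  have "integrable lborel (\<lambda>w :: 'd heis. complex_of_real (hker w))"
    using packet_0_integrable(1)[of 1 1, where 'd = 'd] by (simp flip: packet_hker add: eta_contract_eq)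
  then show ?thesis by (simp add: complex_of_real_integrable_eq)
qed

lemma integral_hker_pos: "0 < (\<integral>w. hker (w :: 'd::finite heis) \<partial>lborel)"
proof -
  have "(\<integral>w. hker (w :: 'd heis) \<partial>lborel) \<noteq> 0"
  proof
    assume "(\<integral>w. hker (w :: 'd heis) \<partial>lborel) = 0"
    then have "AE w :: 'd heis in lborel. hker w = 0"
      using integral_nonneg_eq_0_iff_AE[OF integrable_hker] hker_pos by (metis (mono_tags, lifting) AE_I2 less_imp_le)
    then have "AE w :: 'd heis in lborel. False"
      by eventually_elim (use hker_pos in \<open>metis less_irrefl\<close>)
    then show False using emeasure_lborel_UNIV[where 'a = "'d heis"] by (simp add: AE_iff_null null_sets_def)
  qed
  moreover have "0 \<le> (\<integral>w. hker (w :: 'd heis) \<partial>lborel)"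
    using hker_pos by (intro Bochner_Integration.integral_nonneg less_imp_le)
  ultimately show ?thesis by linarith
qed

text \<open>With b = c^2 and \<delta> = 1 / c^2 both profiles scale like the dilation: the Gaussian
  amplitude contributes c ^ (2 * d) and the Poisson kernel in s contributes c^2, together exactly
  the Jacobian c ^ Q.\<close>

lemma packet_hker_dil:
  fixes w :: "'d::finite heis"
  assumes c: "0 < c"
  shows "packet (c\<^sup>2) (1 / c\<^sup>2) 0 (heis_dil (1 / c) w) = complex_of_real (c ^ (2 * CARD('d) + 2) * hker w)"
proof -
  obtain y \<eta> s where w: "w = (y, \<eta>, s)" by (cases w)
  have p: "packet (c\<^sup>2) (1 / c\<^sup>2) 0 v = complex_of_real ((c\<^sup>2) ^ CARD('d)
    * exp (- (c\<^sup>2) * (fst v \<bullet> fst v + fst (snd v) \<bullet> fst (snd v))) * (2 * (1 / c\<^sup>2 / ((1 / c\<^sup>2)\<^sup>2 + (snd (snd v))\<^sup>2))))" for v :: "'d heis"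
    by (rule packet_0) (use c in simp_all)
  have e: "- (c\<^sup>2) * (((1 / c) *\<^sub>R y) \<bullet> ((1 / c) *\<^sub>R y) + ((1 / c) *\<^sub>R \<eta>) \<bullet> ((1 / c) *\<^sub>R \<eta>)) = - (y \<bullet> y + \<eta> \<bullet> \<eta>)"
    using c by (simp add: power2_eq_square field_simps)
  have l: "1 / c\<^sup>2 / ((1 / c\<^sup>2)\<^sup>2 + ((1 / c)\<^sup>2 * s)\<^sup>2) = c\<^sup>2 * (1 / (1 + s\<^sup>2))"
  proof -
    have "(1 / c\<^sup>2)\<^sup>2 + ((1 / c)\<^sup>2 * s)\<^sup>2 = (1 / c\<^sup>2)\<^sup>2 * (1 + s\<^sup>2)"
    proof -
      have "k\<^sup>2 + (k * s)\<^sup>2 = k\<^sup>2 * (1 + s\<^sup>2)" for k by (simp add: distrib_left power_mult_distrib)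
      moreover have "(1 / c)\<^sup>2 = 1 / c\<^sup>2" by (simp add: power_one_over)
      ultimately show ?thesis by (simp only:)
    qed
    then show ?thesis using c by (simp add: power2_eq_square)
  qed
  have "(c\<^sup>2) ^ CARD('d) * c\<^sup>2 = c ^ (2 * CARD('d) + 2)" by (simp add: power_mult power_add power2_eq_square)
  then have c2: "(c\<^sup>2) ^ CARD('d) * x * (2 * (c\<^sup>2 * z)) = c ^ (2 * CARD('d) + 2) * (x * (2 * z))" for x z
  proof -
    have "q * x * (2 * (k * z)) = q * k * (x * (2 * z))" for q k :: real by simp
    then show ?thesis using \<open>(c\<^sup>2) ^ CARD('d) * c\<^sup>2 = c ^ (2 * CARD('d) + 2)\<close> by metis
  qed
  show ?thesis unfolding p w heis_dil_def hker_def by (simp only: prod.case fst_conv snd_conv e l c2) simp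
qed

lemma heis_dil_zero: "heis_dil 0 v = 0" "heis_inv 0 = 0"
  by (simp_all add: heis_dil_def heis_inv_def case_prod_beta zero_prod_def)

lemma continuous_heis_dil_param: "continuous_on A f \<Longrightarrow> continuous_on A (\<lambda>x. heis_dil (f x) v)"
  unfolding heis_dil_def case_prod_beta by (intro continuous_intros)

text \<open>Translating and then dilating the variable puts all dependence on c into the argument of
  f, against a fixed kernel.\<close>

lemma packet_pairing_eq:
  fixes f :: "'d::finite heis \<Rightarrow> complex"
  assumes [measurable]: "f \<in> borel_measurable borel" and c: "0 < c"
  shows "ip (\<lambda>w. packet (c\<^sup>2) (1 / c\<^sup>2) 0 (heis_mult (heis_inv w') w)) f
    = (\<integral>v. complex_of_real (hker v) * f (heis_mult w' (heis_dil (1 / c) v)) \<partial>lborel)"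
proof -
  let ?p = "packet (c\<^sup>2) (1 / c\<^sup>2) 0 :: 'd heis \<Rightarrow> complex"
  have "ip (\<lambda>w. ?p (heis_mult (heis_inv w') w)) f = (\<integral>u. cnj (?p u) * f (heis_mult w' u) \<partial>lborel)"
    unfolding ip_def by (subst integral_heis_mult(1)[symmetric, of _ w']) simp_all
  also have "\<dots> = (1 / c) ^ (2 * CARD('d) + 2) *\<^sub>R (\<integral>v. cnj (?p (heis_dil (1 / c) v)) * f (heis_mult w' (heis_dil (1 / c) v)) \<partial>lborel)"
    by (rule integral_heis_dil) (use c in simp_all)
  also have "\<dots> = (\<integral>v. (1 / c) ^ (2 * CARD('d) + 2) *\<^sub>R (cnj (?p (heis_dil (1 / c) v)) * f (heis_mult w' (heis_dil (1 / c) v))) \<partial>lborel)"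
    by (rule integral_scaleR_right[symmetric]) 
  also have "\<dots> = (\<integral>v. complex_of_real (hker v) * f (heis_mult w' (heis_dil (1 / c) v)) \<partial>lborel)"
  proof (rule Bochner_Integration.integral_cong[OF refl])
    fix v :: "'d heis"
    have "(1 / c) ^ (2 * CARD('d) + 2) * (c ^ (2 * CARD('d) + 2) * hker v) = hker v"
      using c by (simp add: power_one_over)
    then show "(1 / c) ^ (2 * CARD('d) + 2) *\<^sub>R (cnj (?p (heis_dil (1 / c) v)) * f (heis_mult w' (heis_dil (1 / c) v)))
      = complex_of_real (hker v) * f (heis_mult w' (heis_dil (1 / c) v))"
      unfolding packet_hker_dil[OF c] complex_cnj_complex_of_real scaleR_conv_of_real mult.assoc[symmetric] of_real_mult[symmetric]
      by (simp only: mult.assoc)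
  qed
  finally show ?thesis .
qed

text \<open>f is only square integrable, so convergence is tested against a continuous \<psi>. After
  Fubini, right invariance moves the small translation from f onto \<psi>, where continuity applies.
  The kernel is not normalised, hence its integral in the limit.\<close>

lemma packet_approximate_identity:
  fixes f :: "'d::finite heis \<Rightarrow> complex" and \<psi> :: "'d heis \<Rightarrow> real"
  assumes f: "L2 f" and c\<psi>: "continuous_on UNIV \<psi>" and S: "compact S" and \<psi>0: "\<And>w. w \<notin> S \<Longrightarrow> \<psi> w = 0"
  shows "(\<lambda>n. \<integral>w'. complex_of_real (\<psi> w') * ip (\<lambda>w. packet (real (Suc n)) (1 / real (Suc n)) 0 (heis_mult (heis_inv w') w)) f \<partial>lborel)
    \<longlonglongrightarrow> complex_of_real (\<integral>v. hker (v :: 'd heis) \<partial>lborel) * (\<integral>w. complex_of_real (\<psi> w) * f w \<partial>lborel)"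
proof -
  have fm [measurable]: "f \<in> borel_measurable borel" using f by (simp add: L2_iff)
  have [measurable]: "\<psi> \<in> borel_measurable borel" by (rule borel_measurable_continuous_onI[OF c\<psi>])
  define \<Psi> where "\<Psi> w = complex_of_real (\<psi> w)" for w
  have \<Psi>L2: "L2 \<Psi>" unfolding \<Psi>_def
    by (rule continuous_compact_L2[OF _ S]) (use \<psi>0 c\<psi> in \<open>auto intro!: continuous_intros\<close>)
  define G where "G \<kappa> v = (\<integral>w'. \<Psi> w' * f (heis_mult w' (heis_dil \<kappa> v)) \<partial>lborel)" for \<kappa> v
  define \<kappa> where "\<kappa> n = 1 / sqrt (real (Suc n))" for n
  have Gip: "G k v = ip \<Psi> (\<lambda>w'. f (heis_mult w' (heis_dil k v)))" for k v
    by (simp add: G_def ip_def \<Psi>_def)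
  have Gb: "norm (G k v) \<le> l2norm \<Psi> * l2norm f" for k v
    unfolding Gip using norm_ip_le[OF \<Psi>L2 L2_translate_right(1)[OF f]] L2_translate_right(2)[OF f] by metis
  have eq: "(\<integral>w'. \<Psi> w' * ip (\<lambda>w. packet (real (Suc n)) (1 / real (Suc n)) 0 (heis_mult (heis_inv w') w)) f \<partial>lborel)
     = (\<integral>v. complex_of_real (hker v) * G (\<kappa> n) v \<partial>lborel)" for n
  proof -
    define F where "F = (\<lambda>v w'. complex_of_real (hker v) * (\<Psi> w' * f (heis_mult w' (heis_dil (\<kappa> n) v))))"
    have mm: "(\<lambda>p. heis_mult (snd p) (heis_dil (\<kappa> n) (fst p)) :: 'd heis) \<in> borel_measurable (borel \<Otimes>\<^sub>M borel)"
      unfolding borel_prod by (intro borel_measurable_continuous_onI continuous_intros)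
    have mF0: "(\<lambda>p. f (heis_mult (snd p) (heis_dil (\<kappa> n) (fst p)))) \<in> borel_measurable (borel \<Otimes>\<^sub>M borel)"
      by (rule measurable_compose[OF mm fm])
    have mF: "(\<lambda>(v, w'). F v w') \<in> borel_measurable (lborel \<Otimes>\<^sub>M lborel)"
    proof -
      have "(\<lambda>p. F (fst p) (snd p)) \<in> borel_measurable (borel \<Otimes>\<^sub>M borel)"
        unfolding F_def \<Psi>_def using mF0 by measurable
      then show ?thesis by (simp add: case_prod_beta)
    qed
    have LT: "L2 (\<lambda>w'. f (heis_mult w' (heis_dil (\<kappa> n) v)))" for v by (rule L2_translate_right(1)[OF f])
    have intw: "integrable lborel (F v)" for v
      unfolding F_def using ip_integrable[OF \<Psi>L2 LT, of v] by (simp add: \<Psi>_def)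
    have nb: "(\<integral>w'. norm (F v w') \<partial>lborel) \<le> hker v * (l2norm \<Psi> * l2norm f)" for v
    proof -
      have "(\<integral>w'. norm (F v w') \<partial>lborel) = hker v * (\<integral>w'. norm (\<Psi> w') * norm (f (heis_mult w' (heis_dil (\<kappa> n) v))) \<partial>lborel)"
        using hker_pos[of v] by (simp add: F_def norm_mult)
      also have "\<dots> \<le> hker v * (l2norm \<Psi> * l2norm f)"
        using L2_product_bound(2)[OF \<Psi>L2 LT, of v] L2_translate_right(2)[OF f] hker_pos[of v] by (intro mult_left_mono) auto
      finally show ?thesis .
    qed
    have int: "integrable (lborel \<Otimes>\<^sub>M lborel) (\<lambda>(v, w'). F v w')"
    proof (rule lborel_pair.Fubini_integrable[OF mF])
      show "AE v in lborel. integrable lborel (\<lambda>w'. case (v, w') of (v, w') \<Rightarrow> F v w')" using intw by simp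
      show "integrable lborel (\<lambda>v. \<integral>w'. norm (case (v, w') of (v, w') \<Rightarrow> F v w') \<partial>lborel)"
      proof (rule Bochner_Integration.integrable_bound[OF integrable_mult_left[OF integrable_hker, of "l2norm \<Psi> * l2norm f"]])
        show "(\<lambda>v. \<integral>w'. norm (case (v, w') of (v, w') \<Rightarrow> F v w') \<partial>lborel) \<in> borel_measurable lborel"
          using mF by (intro lborel.borel_measurable_lebesgue_integral) (simp add: case_prod_beta)
        have "norm (\<integral>w'. norm (F v w') \<partial>lborel) \<le> norm (hker v * (l2norm \<Psi> * l2norm f))" for v
        proof -
          have "0 \<le> (\<integral>w'. norm (F v w') \<partial>lborel)" by simp
          then show ?thesis using nb[of v] unfolding real_norm_def by linarith
        qed
        then show "AE v in lborel. norm (\<integral>w'. norm (case (v, w') of (v, w') \<Rightarrow> F v w') \<partial>lborel) \<le> norm (hker v * (l2norm \<Psi> * l2norm f))"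
          by simp
      qed
    qed
    have c: "0 < sqrt (real (Suc n))" "(sqrt (real (Suc n)))\<^sup>2 = real (Suc n)" by auto
    have "(\<integral>w'. \<Psi> w' * ip (\<lambda>w. packet (real (Suc n)) (1 / real (Suc n)) 0 (heis_mult (heis_inv w') w)) f \<partial>lborel)
       = (\<integral>w'. \<integral>v. F v w' \<partial>lborel \<partial>lborel)"
    proof (rule Bochner_Integration.integral_cong[OF refl])
      fix w'
      have "(\<integral>v. F v w' \<partial>lborel) = (\<integral>v. \<Psi> w' * (complex_of_real (hker v) * f (heis_mult w' (heis_dil (\<kappa> n) v))) \<partial>lborel)"
        unfolding F_def by (intro Bochner_Integration.integral_cong refl) (simp only: mult.left_commute)
      also have "\<dots> = \<Psi> w' * (\<integral>v. complex_of_real (hker v) * f (heis_mult w' (heis_dil (\<kappa> n) v)) \<partial>lborel)"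
        by (rule integral_mult_right_zero)
      finally show "\<Psi> w' * ip (\<lambda>w. packet (real (Suc n)) (1 / real (Suc n)) 0 (heis_mult (heis_inv w') w)) f = (\<integral>v. F v w' \<partial>lborel)"
        using packet_pairing_eq[OF fm c(1), of w'] unfolding c(2) \<kappa>_def by simp
    qed
    also have "\<dots> = (\<integral>v. \<integral>w'. F v w' \<partial>lborel \<partial>lborel)"
      by (rule lborel_pair.Fubini_integral[OF int])
    also have "\<dots> = (\<integral>v. complex_of_real (hker v) * G (\<kappa> n) v \<partial>lborel)"
      unfolding F_def G_def by (simp only: integral_mult_right_zero)
    finally show ?thesis .
  qed
  have \<kappa>0: "\<kappa> \<longlonglongrightarrow> 0" unfolding \<kappa>_def by real_asymp
  have \<kappa>1: "\<kappa> n \<in> {0..1}" for n unfolding \<kappa>_def by simp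
  obtain M where M: "\<And>w. norm (\<Psi> w) \<le> M" "0 \<le> M"
  proof -
    have "compact (\<psi> ` S)" by (intro compact_continuous_image continuous_on_subset[OF c\<psi>] S) auto
    then have "bounded (\<psi> ` S)" by (rule compact_imp_bounded)
    then obtain M where M: "\<forall>x\<in>\<psi> ` S. norm x \<le> M" unfolding bounded_iff by blast
    have "norm (\<Psi> w) \<le> \<bar>M\<bar>" for w
    proof (cases "w \<in> S")
      case True
      then have "norm (\<psi> w) \<le> M" using M by blast
      then show ?thesis by (simp add: \<Psi>_def)
    next
      case False
      then show ?thesis by (simp add: \<Psi>_def \<psi>0)
    qed
    then show ?thesis by (intro that[of "\<bar>M\<bar>"]) auto
  qed
  have G0: "(\<lambda>n. G (\<kappa> n) v) \<longlonglongrightarrow> (\<integral>w. \<Psi> w * f w \<partial>lborel)" for v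
  proof -
    \<comment> \<open>One compact set containing the supports of all translates of \<psi> with
      dilation parameter in [0, 1]; it provides a majorant independent of n.\<close>
    define S' where "S' = (\<lambda>p. heis_mult (fst p) (heis_dil (snd p) v)) ` (S \<times> {0..1::real})"
    have S': "compact S'" unfolding S'_def
      by (intro compact_continuous_image compact_Times S continuous_intros continuous_heis_dil_param) auto
    have [measurable]: "S' \<in> sets borel" using S' by (rule borel_compact)
    have IS: "L2 (\<lambda>w. indicator S' w :: complex)"
    proof -
      have "integrable lborel (indicator S' :: 'd heis \<Rightarrow> real)"
        using emeasure_compact_finite[OF S'] by simp
      moreover have "(\<lambda>w. (norm (indicator S' w :: complex))\<^sup>2) = (indicator S' :: 'd heis \<Rightarrow> real)"
        by (auto simp: indicator_def fun_eq_iff)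
      ultimately show ?thesis unfolding L2_iff by simp
    qed
    have [measurable]: "\<Psi> \<in> borel_measurable borel" unfolding \<Psi>_def by measurable
    have [measurable]: "(\<lambda>w. heis_mult w a) \<in> borel_measurable borel" for a :: "'d heis"
      by (intro borel_measurable_continuous_onI continuous_intros)
    have Gs: "G k v = (\<integral>w. \<Psi> (heis_mult w (heis_inv (heis_dil k v))) * f w \<partial>lborel)" for k
    proof -
      have "(\<lambda>w. \<Psi> (heis_mult w (heis_inv (heis_dil k v))) * f w) \<in> borel_measurable borel" by measurable
      from integral_heis_mult_right(1)[OF this, of "heis_dil k v"] show ?thesis
        by (simp add: G_def heis_mult_assoc)
    qed
    show ?thesis unfolding Gs
    proof (rule integral_dominated_convergence[where w = "\<lambda>w. M * (norm (indicator S' w :: complex) * norm (f w))"])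
      show "integrable lborel (\<lambda>w. M * (norm (indicator S' w :: complex) * norm (f w)))"
        by (intro integrable_mult_right L2_product_bound(1)[OF IS f])
      show "AE w in lborel. (\<lambda>n. \<Psi> (heis_mult w (heis_inv (heis_dil (\<kappa> n) v))) * f w) \<longlonglongrightarrow> \<Psi> w * f w"
      proof (rule AE_I2)
        fix w
        have "continuous_on UNIV (\<lambda>k. \<Psi> (heis_mult w (heis_inv (heis_dil k v))))"
          unfolding \<Psi>_def
          by (intro continuous_intros continuous_on_compose2[OF c\<psi>] continuous_heis_dil_param) auto
        then have "isCont (\<lambda>k. \<Psi> (heis_mult w (heis_inv (heis_dil k v)))) 0"
          by (simp add: continuous_on_eq_continuous_at)
        from isCont_tendsto_compose[OF this \<kappa>0]
        have "(\<lambda>n. \<Psi> (heis_mult w (heis_inv (heis_dil (\<kappa> n) v)))) \<longlonglongrightarrow> \<Psi> w"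
          by (simp add: heis_dil_zero)
        then show "(\<lambda>n. \<Psi> (heis_mult w (heis_inv (heis_dil (\<kappa> n) v))) * f w) \<longlonglongrightarrow> \<Psi> w * f w"
          by (intro tendsto_mult tendsto_const)
      qed
      show "AE w in lborel. norm (\<Psi> (heis_mult w (heis_inv (heis_dil (\<kappa> n) v))) * f w) \<le> M * (norm (indicator S' w :: complex) * norm (f w))" for n
      proof (rule AE_I2)
        fix w
        show "norm (\<Psi> (heis_mult w (heis_inv (heis_dil (\<kappa> n) v))) * f w) \<le> M * (norm (indicator S' w :: complex) * norm (f w))"
        proof (cases "w \<in> S'")
          case True
          then show ?thesis using mult_right_mono[OF M(1) norm_ge_zero[of "f w"]] by (simp add: norm_mult)
        next
          case False
          have "heis_mult w (heis_inv (heis_dil (\<kappa> n) v)) \<notin> S"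
          proof
            assume "heis_mult w (heis_inv (heis_dil (\<kappa> n) v)) \<in> S"
            then have "heis_mult (heis_mult w (heis_inv (heis_dil (\<kappa> n) v))) (heis_dil (\<kappa> n) v) \<in> S'"
              unfolding S'_def using \<kappa>1[of n]
              by (intro image_eqI[of _ _ "(heis_mult w (heis_inv (heis_dil (\<kappa> n) v)), \<kappa> n)"]) auto
            then show False using False by (simp add: heis_mult_assoc)
          qed
          then show ?thesis using \<psi>0 M(2) by (simp add: \<Psi>_def)
        qed
      qed
    qed measurable
  qed
  have "(\<lambda>n. \<integral>v. complex_of_real (hker v) * G (\<kappa> n) v \<partial>lborel) \<longlonglongrightarrow> (\<integral>v. complex_of_real (hker (v::'d heis)) * (\<integral>w. \<Psi> w * f w \<partial>lborel) \<partial>lborel)"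
  proof (rule integral_dominated_convergence[where w = "\<lambda>v::'d heis. hker v * (l2norm \<Psi> * l2norm f)"])
    show "integrable lborel (\<lambda>v :: 'd heis. hker v * (l2norm \<Psi> * l2norm f))"
      by (rule integrable_mult_left[OF integrable_hker])
    show "AE v :: 'd heis in lborel. (\<lambda>n. complex_of_real (hker v) * G (\<kappa> n) v) \<longlonglongrightarrow> complex_of_real (hker v) * (\<integral>w. \<Psi> w * f w \<partial>lborel)"
      by (intro AE_I2 tendsto_mult tendsto_const G0)
    show "AE v :: 'd heis in lborel. norm (complex_of_real (hker v) * G (\<kappa> n) v) \<le> hker v * (l2norm \<Psi> * l2norm f)" for n
    proof (rule AE_I2)
      fix v :: "'d heis"
      show "norm (complex_of_real (hker v) * G (\<kappa> n) v) \<le> hker v * (l2norm \<Psi> * l2norm f)"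
        using mult_left_mono[OF Gb[of "\<kappa> n" v], of "hker v"] hker_pos[of v] by (simp add: norm_mult)
    qed
    show "(\<lambda>v. complex_of_real (hker v) * G (\<kappa> n) v) \<in> borel_measurable lborel" for n
    proof -
      have mm: "(\<lambda>p. heis_mult (snd p) (heis_dil (\<kappa> n) (fst p)) :: 'd heis) \<in> borel_measurable (borel \<Otimes>\<^sub>M borel)"
        unfolding borel_prod by (intro borel_measurable_continuous_onI continuous_intros)
      have mF0: "(\<lambda>p. f (heis_mult (snd p) (heis_dil (\<kappa> n) (fst p)))) \<in> borel_measurable (borel \<Otimes>\<^sub>M borel)"
        by (rule measurable_compose[OF mm fm])
      have "(\<lambda>p. \<Psi> (snd p) * f (heis_mult (snd p) (heis_dil (\<kappa> n) (fst p)))) \<in> borel_measurable (borel \<Otimes>\<^sub>M borel)"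
        unfolding \<Psi>_def using mF0 by measurable
      then have "(\<lambda>(v, w'). \<Psi> w' * f (heis_mult w' (heis_dil (\<kappa> n) v))) \<in> borel_measurable (lborel \<Otimes>\<^sub>M lborel)"
        by (simp add: case_prod_beta)
      from lborel.borel_measurable_lebesgue_integral[OF this] have [measurable]: "G (\<kappa> n) \<in> borel_measurable lborel"
        unfolding G_def[abs_def] by simp
      show ?thesis by measurable
    qed
  qed measurable
  then show ?thesis unfolding eq[unfolded \<Psi>_def] by (simp only: integral_mult_left_zero integral_complex_of_real \<Psi>_def)
qed

text \<open>A bound on the pairing with packets centred at every point of B passes to weak limits
  against nonnegative continuous functions supported in B, then to indicators of compact sets, and
  so to almost every point. Openness of B leaves room for the supports.\<close>

lemma AE_bound_of_packet_pairings:
  fixes f :: "'d::finite heis \<Rightarrow> complex"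
  assumes f: "L2 f" and B: "open B" "emeasure lborel B < \<infinity>" and A: "0 \<le> A"
    and le: "\<And>w' n. w' \<in> B \<Longrightarrow> norm (ip (\<lambda>w. packet (real (Suc n)) (1 / real (Suc n)) 0 (heis_mult (heis_inv w') w)) f) \<le> A"
  shows "AE w in lborel. w \<in> B \<longrightarrow> norm (f w) \<le> A / (\<integral>v. hker (v :: 'd heis) \<partial>lborel)"
proof -
  define m where "m = (\<integral>v. hker (v :: 'd heis) \<partial>lborel)"
  have m: "0 < m" unfolding m_def by (rule integral_hker_pos)
  have fm [measurable]: "f \<in> borel_measurable borel" using f by (simp add: L2_iff)
  have fK: "set_integrable lborel K f" if K: "compact K" for K
  proof -
    have [measurable]: "K \<in> sets borel" using K by (rule borel_compact)
    have "L2 (\<lambda>w. indicator K w :: complex)"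
    proof -
      have "integrable lborel (indicator K :: 'd heis \<Rightarrow> real)" using emeasure_compact_finite[OF K] by simp
      moreover have "(\<lambda>w. (norm (indicator K w :: complex))\<^sup>2) = (indicator K :: 'd heis \<Rightarrow> real)"
        by (auto simp: indicator_def fun_eq_iff)
      ultimately show ?thesis unfolding L2_iff by simp
    qed
    from ip_integrable[OF this f] have "integrable lborel (\<lambda>w. cnj (indicator K w) * f w)" .
    moreover have "(\<lambda>w. cnj (indicator K w) * f w) = (\<lambda>w. indicator K w *\<^sub>R f w)" by (auto simp: indicator_def)
    ultimately show ?thesis by (simp add: set_integrable_def)
  qed
  have test: "m * norm (\<integral>w. complex_of_real (\<psi> w) * f w \<partial>lborel) \<le> A * (\<integral>w. \<psi> w \<partial>lborel)"
    if c\<psi>: "continuous_on UNIV \<psi>" and T: "compact T" "T \<subseteq> B" and \<psi>0: "\<And>w. w \<notin> T \<Longrightarrow> \<psi> w = 0" and \<psi>: "\<And>w. 0 \<le> \<psi> w"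
    for \<psi> :: "'d heis \<Rightarrow> real" and T
  proof -
    let ?P = "\<lambda>n w'. ip (\<lambda>w. packet (real (Suc n)) (1 / real (Suc n)) 0 (heis_mult (heis_inv w') w)) f"
    have i\<psi>: "integrable lborel \<psi>"
    proof -
      have "integrable lborel (\<lambda>w. indicator T w *\<^sub>R \<psi> w)"
        by (rule borel_integrable_compact[OF T(1) continuous_on_subset[OF c\<psi>]]) simp
      moreover have "(\<lambda>w. indicator T w *\<^sub>R \<psi> w) = \<psi>" using \<psi>0 by (auto simp: indicator_def fun_eq_iff)
      ultimately show ?thesis by simp
    qed
    have b: "norm (\<integral>w'. complex_of_real (\<psi> w') * ?P n w' \<partial>lborel) \<le> A * (\<integral>w. \<psi> w \<partial>lborel)" for n
    proof (cases "integrable lborel (\<lambda>w'. complex_of_real (\<psi> w') * ?P n w')")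
      case True
      have "norm (\<integral>w'. complex_of_real (\<psi> w') * ?P n w' \<partial>lborel) \<le> (\<integral>w. A * \<psi> w \<partial>lborel)"
      proof (rule Bochner_Integration.integral_norm_bound_integral[OF True integrable_mult_right[OF i\<psi>]])
        fix w'
        show "norm (complex_of_real (\<psi> w') * ?P n w') \<le> A * \<psi> w'"
        proof (cases "w' \<in> T")
          case True
          then have "norm (?P n w') \<le> A" using le T(2) by blast
          then show ?thesis using mult_left_mono[of "norm (?P n w')" A "\<psi> w'"] \<psi>[of w'] by (simp add: norm_mult mult.commute)
        next
          case False
          then show ?thesis using \<psi>0 by simp
        qed
      qed
      then show ?thesis by simp
    next
      \<comment> \<open>The Bochner integral of a nonintegrable function is 0, so the bound holds
        here without any regularity of the pairing in w'.\<close>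
      case False
      then show ?thesis using A \<psi> by (simp add: not_integrable_integral_eq)
    qed
    have "norm (complex_of_real m * (\<integral>w. complex_of_real (\<psi> w) * f w \<partial>lborel)) \<le> A * (\<integral>w. \<psi> w \<partial>lborel)"
      by (rule LIMSEQ_le_const2[OF tendsto_norm[OF packet_approximate_identity[OF f c\<psi> T(1) \<psi>0, folded m_def]]])
         (use b in blast)+
    then show ?thesis using m by (simp add: norm_mult)
  qed
  show ?thesis unfolding m_def[symmetric]
  proof (rule AE_norm_le_of_compact_integrals[OF fm borel_open[OF B(1)] B(2)])
    fix K assume K: "compact K" "K \<subseteq> B"
    show "set_integrable lborel K f" by (rule fK[OF K(1)])
    show "norm (LINT x:K|lborel. f x) \<le> A / m * measure lborel K"
    proof (cases "K = {}")
      case True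
      then show ?thesis by (simp add: set_lebesgue_integral_def)
    next
      case False
      have Km [measurable]: "K \<in> sets borel" using K(1) by (rule borel_compact)
      obtain e where e: "0 < e" "{x. infdist x K \<le> e} \<subseteq> B"
        using compact_in_open_separated[OF False K(1) B(1) K(2)] by blast
      define T where "T = {x. infdist x K \<le> e}"
      have T: "compact T" "T \<subseteq> B" unfolding T_def using compact_infdist_le[OF False K(1) e(1)] e(2) by auto
      have [measurable]: "T \<in> sets borel" using T(1) by (rule borel_compact)
      \<comment> \<open>Tent functions around K with slope (n + 1) / e: equal to 1 on K, zero
        outside T, and decreasing to the indicator of K.\<close>
      define \<psi> where "\<psi> n w = max 0 (1 - real (Suc n) / e * infdist w K)" for n and w :: "'d heis"
      have c\<psi>: "continuous_on UNIV (\<psi> n)" for n unfolding \<psi>_def by (intro continuous_intros)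
      have [measurable]: "\<psi> n \<in> borel_measurable borel" for n by (rule borel_measurable_continuous_onI[OF c\<psi>])
      have \<psi>T: "\<psi> n w = 0" if "w \<notin> T" for n w
      proof -
        have "1 \<le> infdist w K / e" using that e(1) by (simp add: T_def)
        also have "\<dots> \<le> real (Suc n) * (infdist w K / e)"
          using mult_right_mono[of 1 "real (Suc n)" "infdist w K / e"] e(1) by (simp add: infdist_nonneg)
        finally show ?thesis by (simp add: \<psi>_def)
      qed
      have \<psi>01: "0 \<le> \<psi> n w" "\<psi> n w \<le> 1" for n w
        using e(1) by (auto simp: \<psi>_def infdist_nonneg)
      have \<psi>i: "\<psi> n w \<le> indicator T w" for n w using \<psi>01[of n w] \<psi>T[of w n] by (simp add: indicator_def)
      have lim: "(\<lambda>n. \<psi> n w) \<longlonglongrightarrow> indicator K w" for w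
      proof (cases "w \<in> K")
        case True
        then show ?thesis by (simp add: \<psi>_def)
      next
        case False
        have "0 < infdist w K"
          using in_closed_iff_infdist_zero[OF compact_imp_closed[OF K(1)] \<open>K \<noteq> {}\<close>, of w] infdist_nonneg[of w K] False by linarith
        then obtain N where N: "1 < real N * (infdist w K / e)"
          using reals_Archimedean3[of "infdist w K / e"] e(1) by (meson divide_pos_pos)
        have "\<psi> n w = 0" if "n \<ge> N" for n
        proof -
          have "real N * (infdist w K / e) \<le> real (Suc n) * (infdist w K / e)"
            using that e(1) by (intro mult_right_mono divide_nonneg_pos infdist_nonneg) auto
          then show ?thesis using N by (simp add: \<psi>_def)
        qed
        then have "eventually (\<lambda>n. \<psi> n w = indicator K w) sequentially"
          using False unfolding eventually_sequentially by auto
        then show ?thesis by (rule tendsto_eventually)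
      qed
      have Tint: "integrable lborel (indicator T :: 'd heis \<Rightarrow> real)" using emeasure_compact_finite[OF T(1)] by simp
      have L1: "(\<lambda>n. \<integral>w. \<psi> n w \<partial>lborel) \<longlonglongrightarrow> (\<integral>w. indicator K w \<partial>lborel)"
      proof (rule integral_dominated_convergence[OF _ _ Tint])
        show "AE w in lborel. norm (\<psi> n w) \<le> indicator T w" for n using \<psi>i \<psi>01 by simp
      qed (use lim in auto)
      have L2': "(\<lambda>n. \<integral>w. complex_of_real (\<psi> n w) * f w \<partial>lborel) \<longlonglongrightarrow> (\<integral>w. indicator K w *\<^sub>R f w \<partial>lborel)"
      proof (rule integral_dominated_convergence[where w = "\<lambda>w. norm (indicator T w *\<^sub>R f w)"])
        show "integrable lborel (\<lambda>w. norm (indicator T w *\<^sub>R f w))"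
          using fK[OF T(1)] unfolding set_integrable_def by (rule integrable_norm)
        show "AE w in lborel. (\<lambda>n. complex_of_real (\<psi> n w) * f w) \<longlonglongrightarrow> indicator K w *\<^sub>R f w"
          unfolding scaleR_conv_of_real by (intro AE_I2 tendsto_mult tendsto_const tendsto_of_real lim)
        show "AE w in lborel. norm (complex_of_real (\<psi> n w) * f w) \<le> norm (indicator T w *\<^sub>R f w)" for n
          using \<psi>i[of n] \<psi>01[of n] by (intro AE_I2) (simp add: norm_mult mult_right_mono)
      qed measurable
      have "m * norm (\<integral>w. indicator K w *\<^sub>R f w \<partial>lborel) \<le> A * (\<integral>w. indicator K w \<partial>lborel)"
      proof (rule LIMSEQ_le)
        show "(\<lambda>n. m * norm (\<integral>w. complex_of_real (\<psi> n w) * f w \<partial>lborel)) \<longlonglongrightarrow> m * norm (\<integral>w. indicator K w *\<^sub>R f w \<partial>lborel)"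
          by (intro tendsto_mult tendsto_const tendsto_norm L2')
        show "(\<lambda>n. A * (\<integral>w. \<psi> n w \<partial>lborel)) \<longlonglongrightarrow> A * (\<integral>w. indicator K w \<partial>lborel)"
          by (intro tendsto_mult tendsto_const L1)
        show "\<exists>N. \<forall>n\<ge>N. m * norm (\<integral>w. complex_of_real (\<psi> n w) * f w \<partial>lborel) \<le> A * (\<integral>w. \<psi> n w \<partial>lborel)"
          using test[OF c\<psi> T \<psi>T \<psi>01(1)] by blast
      qed
      then show ?thesis using m by (simp add: set_lebesgue_integral_def pos_le_divide_eq mult.commute)
    qed
  qed (use A m in simp)
qed

section \<open>Dispersion for data supported in a ball\<close>

lemma supported_L1_bound:
  fixes u0 :: "'d::finite heis \<Rightarrow> complex"
  assumes u0: "L2 u0" and supp: "AE x in lborel. x \<notin> heis_ball w0 R \<longrightarrow> u0 x = 0" and R: "0 < R"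
  shows "integrable lborel u0"
    "(\<integral>x. norm (u0 x) \<partial>lborel) \<le> sqrt (measure lborel (heis_ball (0::'d heis) 1)) * R ^ (CARD('d) + 1) * l2norm u0"
proof -
  have [measurable]: "u0 \<in> borel_measurable borel" using u0 by (simp add: L2_iff)
  let ?B = "heis_ball w0 R"
  have eB: "emeasure lborel ?B = ennreal (R ^ (2 * CARD('d) + 2) * measure lborel (heis_ball (0::'d heis) 1))"
    using emeasure_heis_ball[OF R, of w0] emeasure_heis_ball_finite[of 1, where 'd = 'd] R
    by (simp add: emeasure_eq_ennreal_measure less_top[symmetric] ennreal_mult)
  have mB: "measure lborel ?B = (R ^ (CARD('d) + 1))\<^sup>2 * measure lborel (heis_ball (0::'d heis) 1)"
  proof -
    have "R ^ (2 * CARD('d) + 2) = (R ^ (CARD('d) + 1))\<^sup>2"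
      by (subst power_mult[symmetric]) (simp add: algebra_simps)
    then show ?thesis using eB R by (simp add: measure_def)
  qed
  have Bi: "integrable lborel (indicator ?B :: 'd heis \<Rightarrow> real)" using eB by simp
  have sqi: "(\<lambda>w. (norm (indicator ?B w :: complex))\<^sup>2) = (indicator ?B :: 'd heis \<Rightarrow> real)"
    by (auto simp: indicator_def fun_eq_iff)
  have IB: "L2 (\<lambda>w. indicator ?B w :: complex)" unfolding L2_iff sqi using Bi by simp
  have nB: "l2norm (\<lambda>w. indicator ?B w :: complex) = sqrt (measure lborel (heis_ball (0::'d heis) 1)) * R ^ (CARD('d) + 1)"
    unfolding l2norm_def sqi using mB R by (simp add: real_sqrt_mult)
  note pb = L2_product_bound[OF IB u0]
  have ae: "AE x in lborel. norm (u0 x) = norm (indicator ?B x :: complex) * norm (u0 x)"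
    using supp by eventually_elim (auto simp: indicator_def)
  have "integrable lborel (\<lambda>x. norm (u0 x))"
    by (rule integrable_cong_AE_imp[OF pb(1)]) (use ae in \<open>auto elim: eventually_mono\<close>)
  then show "integrable lborel u0" by (simp add: integrable_norm_iff)
  have "(\<integral>x. norm (u0 x) \<partial>lborel) = (\<integral>x. norm (indicator ?B x :: complex) * norm (u0 x) \<partial>lborel)"
    by (rule integral_cong_AE) (use ae in auto)
  with pb(2) show "(\<integral>x. norm (u0 x) \<partial>lborel) \<le> sqrt (measure lborel (heis_ball (0::'d heis) 1)) * R ^ (CARD('d) + 1) * l2norm u0"
    unfolding nB by simp
qed

text \<open>The packet at w' in the ball of radius \<kappa> * sqrt \<bar>t\<bar> meets the data in
  the ball of radius R, so \<open>koranyi_vertical_bound\<close> controls s, and the kernel is at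
  most a constant times the power - (d + 1) of \<bar>t\<bar>. Cauchy-Schwarz on the support costs R
  ^ (d + 1), the square root of the volume growth R ^ Q; this explains the shape (R / \<bar>t\<bar>)
  ^ (d + 1).\<close>

lemma local_dispersive:
  fixes \<kappa> :: real
  assumes \<kappa>: "0 < \<kappa>" "\<kappa> < sqrt (4 * real CARD('d::finite))"
  obtains C where "0 < C" "\<And>U t R w0 (u0 :: 'd heis \<Rightarrow> complex). schroedinger_group U \<Longrightarrow> 0 < R \<Longrightarrow> L2 u0 \<Longrightarrow>
     AE x in lborel. x \<notin> heis_ball w0 R \<longrightarrow> u0 x = 0 \<Longrightarrow> R \<le> (sqrt (4 * real CARD('d)) - \<kappa>) * sqrt \<bar>t\<bar> \<Longrightarrow>
     AE w in lborel. w \<in> heis_ball w0 (\<kappa> * sqrt \<bar>t\<bar>) \<longrightarrow> norm (U t u0 w) \<le> C * (R / \<bar>t\<bar>) ^ (CARD('d) + 1) * l2norm u0"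
proof -
  define D where "D = sqrt (4 * real CARD('d))"
  \<comment> \<open>The margin left by \<open>koranyi_vertical_bound\<close> with radii \<kappa> and
    D - \<kappa> in units of sqrt \<bar>t\<bar>, whose sum is D. It is positive because the sum of
    their squares is strictly below D^2; the plain triangle inequality would give margin 0.\<close>
  define c where "c = 4 * real CARD('d) - D * sqrt (\<kappa>\<^sup>2 + (D - \<kappa>)\<^sup>2)"
  have D: "0 < D" "D\<^sup>2 = 4 * real CARD('d)" "\<kappa> < D" using \<kappa> by (auto simp: D_def)
  have c: "0 < c"
  proof -
    have "\<kappa>\<^sup>2 + (D - \<kappa>)\<^sup>2 < D\<^sup>2"
    proof -
      have "D\<^sup>2 - (\<kappa>\<^sup>2 + (D - \<kappa>)\<^sup>2) = 2 * \<kappa> * (D - \<kappa>)" by (simp add: power2_eq_square algebra_simps)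
      moreover have "0 < 2 * \<kappa> * (D - \<kappa>)" using \<kappa> D by simp
      ultimately show ?thesis by linarith
    qed
    then have "sqrt (\<kappa>\<^sup>2 + (D - \<kappa>)\<^sup>2) < D" using D by (intro real_less_lsqrt) auto
    then have "D * sqrt (\<kappa>\<^sup>2 + (D - \<kappa>)\<^sup>2) < D * D" using D by simp
    then show ?thesis using D(2) by (simp add: c_def power2_eq_square)
  qed
  define C0 where "C0 = 2 * (((1 + 16 * real CARD('d) / c) / 4) ^ CARD('d) * (2 / c))"
  define V where "V = measure lborel (heis_ball (0::'d heis) 1)"
  define m where "m = (\<integral>v. hker (v :: 'd heis) \<partial>lborel)"
  have m: "0 < m" unfolding m_def by (rule integral_hker_pos)
  have C0: "0 < C0" using c by (simp add: C0_def add_pos_nonneg)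
  have V: "0 \<le> V" by (simp add: V_def)
  \<comment> \<open>Adding 1 to sqrt V makes C positive when only V \<ge> 0 has been
    established.\<close>
  define C where "C = C0 * (sqrt V + 1) / m"
  show ?thesis
  proof (rule that[of C])
    show "0 < C" using C0 V m by (simp add: C_def add_nonneg_pos)
    fix U :: "real \<Rightarrow> ('d heis \<Rightarrow> complex) \<Rightarrow> 'd heis \<Rightarrow> complex" and t R :: real and w0 and u0 :: "'d heis \<Rightarrow> complex"
    assume sg: "schroedinger_group U" and R: "0 < R" and u0: "L2 u0"
      and supp: "AE x in lborel. x \<notin> heis_ball w0 R \<longrightarrow> u0 x = 0" and Rt: "R \<le> (sqrt (4 * real CARD('d)) - \<kappa>) * sqrt \<bar>t\<bar>"
    have Rt': "R \<le> (D - \<kappa>) * sqrt \<bar>t\<bar>" using Rt by (simp add: D_def)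
    have t: "0 < \<bar>t\<bar>" using R Rt' by (cases "t = 0") auto
    note L1 = supported_L1_bound[OF u0 supp R]
    define I where "I = (\<integral>x. norm (u0 x) \<partial>lborel)"
    define A where "A = C0 / \<bar>t\<bar> ^ (CARD('d) + 1) * I"
    have I0: "0 \<le> I" by (simp add: I_def)
    have A0: "0 \<le> A" using C0 I0 by (simp add: A_def)
    have bound: "norm (ip (\<lambda>w. packet (real (Suc n)) (1 / real (Suc n)) 0 (heis_mult (heis_inv w') w)) (U t u0)) \<le> A"
      if w': "w' \<in> heis_ball w0 (\<kappa> * sqrt \<bar>t\<bar>)" for w' n
    proof -
      let ?p = "\<lambda>w. packet (real (Suc n)) (1 / real (Suc n)) (- t) (heis_mult (heis_inv w') w)"
      have pos: "0 < real (Suc n)" "0 < 1 / real (Suc n)" by auto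
      have "ip (\<lambda>w. packet (real (Suc n)) (1 / real (Suc n)) 0 (heis_mult (heis_inv w') w)) (U t u0) = ip ?p u0"
        by (rule packet_pairing[OF sg u0 L1(1) pos])
      also have "norm (ip ?p u0) \<le> (\<integral>w. norm (cnj (?p w) * u0 w) \<partial>lborel)"
        unfolding ip_def by (rule integral_norm_bound)
      also have "\<dots> \<le> (\<integral>w. C0 / \<bar>t\<bar> ^ (CARD('d) + 1) * norm (u0 w) \<partial>lborel)"
      proof (rule integral_mono_AE')
        show "integrable lborel (\<lambda>w. C0 / \<bar>t\<bar> ^ (CARD('d) + 1) * norm (u0 w))"
          by (intro integrable_mult_right integrable_norm L1(1))
        show "AE w in lborel. norm (cnj (?p w) * u0 w) \<le> C0 / \<bar>t\<bar> ^ (CARD('d) + 1) * norm (u0 w)"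
          using supp
        proof eventually_elim
          case (elim w)
          show ?case
          proof (cases "w \<in> heis_ball w0 R")
            case True
            let ?\<alpha> = "\<kappa> * sqrt \<bar>t\<bar>" and ?\<beta> = "(D - \<kappa>) * sqrt \<bar>t\<bar>"
            have "\<bar>snd (snd (heis_mult (heis_inv w') w))\<bar> \<le> (?\<alpha> + ?\<beta>) * sqrt (?\<alpha>\<^sup>2 + ?\<beta>\<^sup>2)"
              using w' True Rt' \<kappa> D t by (intro koranyi_vertical_bound[of w' w0 _ w]) (auto simp: heis_ball_def)
            also have "(?\<alpha> + ?\<beta>) * sqrt (?\<alpha>\<^sup>2 + ?\<beta>\<^sup>2) = (4 * real CARD('d) - c) * \<bar>- t\<bar>"
            proof -
              have "?\<alpha>\<^sup>2 + ?\<beta>\<^sup>2 = (\<kappa>\<^sup>2 + (D - \<kappa>)\<^sup>2) * \<bar>t\<bar>" by (simp add: power_mult_distrib distrib_right)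
              then have "sqrt (?\<alpha>\<^sup>2 + ?\<beta>\<^sup>2) = sqrt (\<kappa>\<^sup>2 + (D - \<kappa>)\<^sup>2) * sqrt \<bar>t\<bar>" by (simp only: real_sqrt_mult)
              moreover have "?\<alpha> + ?\<beta> = D * sqrt \<bar>t\<bar>" by (simp add: left_diff_distrib)
              moreover have "D * sqrt \<bar>t\<bar> * (q * sqrt \<bar>t\<bar>) = D * q * \<bar>t\<bar>" for q
                using real_sqrt_mult_self[of "\<bar>t\<bar>"] by (metis abs_abs mult.assoc mult.left_commute)
              ultimately show ?thesis by (simp add: c_def)
            qed
            finally have s: "\<bar>snd (snd (heis_mult (heis_inv w') w))\<bar> \<le> (4 * real CARD('d) - c) * \<bar>- t\<bar>" .
            have "norm (?p w) \<le> 2 * (((1 + 16 * real CARD('d) / c) / (4 * \<bar>- t\<bar>)) ^ CARD('d) * (2 / (c * \<bar>- t\<bar>)))"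
              using t by (intro packet_dispersive[OF pos _ c s]) auto
            also have "\<dots> = C0 / \<bar>t\<bar> ^ (CARD('d) + 1)"
              by (simp add: C0_def power_divide power_mult_distrib mult_ac)
            finally show ?thesis unfolding norm_mult complex_mod_cnj by (intro mult_right_mono) auto
          next
            case False
            with elim show ?thesis by simp
          qed
        qed
      qed (use C0 t in \<open>simp_all add: divide_nonneg_pos\<close>)
      also have "\<dots> = A" by (simp add: A_def I_def)
      finally show ?thesis .
    qed
    have fin: "emeasure lborel (heis_ball w0 (\<kappa> * sqrt \<bar>t\<bar>)) < \<infinity>"
      using emeasure_heis_ball[of "\<kappa> * sqrt \<bar>t\<bar>" w0] emeasure_heis_ball_finite[of 1, where 'd = 'd] \<kappa> t
      by (simp add: ennreal_mult_less_top)
    have "A / m \<le> C * (R / \<bar>t\<bar>) ^ (CARD('d) + 1) * l2norm u0"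
    proof -
      have "I \<le> (sqrt V + 1) * R ^ (CARD('d) + 1) * l2norm u0"
        unfolding I_def V_def
        by (rule order_trans[OF L1(2)]) (use R l2norm_nonneg[of u0] in \<open>intro mult_right_mono; simp\<close>)
      then have "A \<le> C0 / \<bar>t\<bar> ^ (CARD('d) + 1) * ((sqrt V + 1) * R ^ (CARD('d) + 1) * l2norm u0)"
        unfolding A_def using C0 by (intro mult_left_mono) auto
      then have "A / m \<le> C0 / \<bar>t\<bar> ^ (CARD('d) + 1) * ((sqrt V + 1) * R ^ (CARD('d) + 1) * l2norm u0) / m"
        using m by (intro divide_right_mono) auto
      also have "\<dots> = C * (R / \<bar>t\<bar>) ^ (CARD('d) + 1) * l2norm u0"
        unfolding C_def power_divide by (simp add: mult_ac)
      finally show ?thesis .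
    qed
    with AE_bound_of_packet_pairings[OF sg_L2[OF sg u0] open_heis_ball fin A0 bound, folded m_def]
    show "AE w in lborel. w \<in> heis_ball w0 (\<kappa> * sqrt \<bar>t\<bar>) \<longrightarrow> norm (U t u0 w) \<le> C * (R / \<bar>t\<bar>) ^ (CARD('d) + 1) * l2norm u0"
      by (auto elim!: eventually_mono)
  qed
qed

section \<open>Strichartz norms\<close>

text \<open>Continuity from below along rational parameters. A supremum over countably many fixed
  sets is what keeps measurability when \<rho> varies with another variable.\<close>

lemma emeasure_SUP_rat:
  fixes A :: "real \<Rightarrow> 'a set"
  assumes A: "\<And>r. A r \<in> sets M" and mono: "\<And>r s. r \<le> s \<Longrightarrow> A r \<subseteq> A s"
    and ex: "\<And>x. x \<in> A \<rho> \<Longrightarrow> \<exists>r<\<rho>. x \<in> A r"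
  shows "emeasure M (A \<rho>) = (SUP q::rat. if real_of_rat q < \<rho> then emeasure M (A (real_of_rat q)) else 0)"
proof (rule antisym)
  have "A \<rho> = (\<Union>n. A (\<rho> - 1 / real (Suc n)))"
  proof (intro equalityI subsetI)
    fix x assume "x \<in> A \<rho>"
    then obtain r where r: "r < \<rho>" "x \<in> A r" using ex by blast
    then obtain n where "1 / real (Suc n) < \<rho> - r"
      using reals_Archimedean[of "\<rho> - r"] by (auto simp: inverse_eq_divide)
    then have "r \<le> \<rho> - 1 / real (Suc n)" by simp
    with mono r(2) show "x \<in> (\<Union>n. A (\<rho> - 1 / real (Suc n)))" by blast
  next
    fix x assume "x \<in> (\<Union>n. A (\<rho> - 1 / real (Suc n)))"
    then obtain n where n: "x \<in> A (\<rho> - 1 / real (Suc n))" by blast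
    have "\<rho> - 1 / real (Suc n) \<le> \<rho>" by simp
    with mono n show "x \<in> A \<rho>" by blast
  qed
  moreover have "incseq (\<lambda>n. A (\<rho> - 1 / real (Suc n)))"
    by (intro incseq_SucI mono) (simp add: frac_le)
  ultimately have "emeasure M (A \<rho>) = (SUP n. emeasure M (A (\<rho> - 1 / real (Suc n))))"
    using A by (subst SUP_emeasure_incseq) auto
  also have "\<dots> \<le> (SUP q::rat. if real_of_rat q < \<rho> then emeasure M (A (real_of_rat q)) else 0)"
  proof (rule SUP_least)
    fix n
    obtain q :: rat where q: "\<rho> - 1 / real (Suc n) < of_rat q" "of_rat q < \<rho>"
      using of_rat_dense[of "\<rho> - 1 / real (Suc n)" \<rho>] by auto
    have "emeasure M (A (\<rho> - 1 / real (Suc n))) \<le> emeasure M (A (of_rat q))"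
      using q by (intro emeasure_mono A mono) auto
    then show "emeasure M (A (\<rho> - 1 / real (Suc n))) \<le> (SUP q::rat. if real_of_rat q < \<rho> then emeasure M (A (real_of_rat q)) else 0)"
      using q by (intro SUP_upper2[of q]) auto
  qed
  finally show "emeasure M (A \<rho>) \<le> (SUP q::rat. if real_of_rat q < \<rho> then emeasure M (A (real_of_rat q)) else 0)" .
  show "(SUP q::rat. if real_of_rat q < \<rho> then emeasure M (A (real_of_rat q)) else 0) \<le> emeasure M (A \<rho>)"
    by (intro SUP_least) (auto intro!: emeasure_mono A mono)
qed

lemma L2_indicator_mult:
  fixes f :: "'d::finite heis \<Rightarrow> complex"
  assumes f: "L2 f" and B: "B \<in> sets borel"
  shows "L2 (\<lambda>w. indicator B w * f w)" "l2norm (\<lambda>w. indicator B w * f w) \<le> l2norm f"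
    "(\<integral>\<^sup>+w. ennreal ((norm (f w))\<^sup>2) \<partial>restrict_space lborel B) = ennreal ((l2norm (\<lambda>w. indicator B w * f w))\<^sup>2)"
proof -
  note [measurable] = B
  have [measurable]: "f \<in> borel_measurable borel" and i: "integrable lborel (\<lambda>w. (norm (f w))\<^sup>2)"
    using f by (auto simp: L2_iff)
  have le: "(norm (indicator B w * f w))\<^sup>2 \<le> (norm (f w))\<^sup>2" for w by (simp add: indicator_def)
  have iB: "integrable lborel (\<lambda>w. (norm (indicator B w * f w))\<^sup>2)"
    by (rule Bochner_Integration.integrable_bound[OF i]) (use le in auto)
  then show "L2 (\<lambda>w. indicator B w * f w)" by (simp add: L2_iff)
  show "l2norm (\<lambda>w. indicator B w * f w) \<le> l2norm f"
    unfolding l2norm_def using le by (intro real_sqrt_le_mono integral_mono iB i)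
  have "(\<integral>\<^sup>+w. ennreal ((norm (f w))\<^sup>2) \<partial>restrict_space lborel B) = (\<integral>\<^sup>+w. ennreal ((norm (indicator B w * f w))\<^sup>2) \<partial>lborel)"
    by (subst nn_integral_restrict_space) (auto intro!: nn_integral_cong simp: indicator_def)
  also have "\<dots> = ennreal ((l2norm (\<lambda>w. indicator B w * f w))\<^sup>2)"
    unfolding l2norm_sq by (rule nn_integral_eq_integral[OF iB]) simp
  finally show "(\<integral>\<^sup>+w. ennreal ((norm (f w))\<^sup>2) \<partial>restrict_space lborel B) = ennreal ((l2norm (\<lambda>w. indicator B w * f w))\<^sup>2)" .
qed

lemma lpnorm_2_restrict:
  assumes "L2 f" "B \<in> sets borel"
  shows "lpnorm (restrict_space lborel B) 2 f = ennreal (l2norm (\<lambda>w. indicator B w * f w))"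
  unfolding lpnorm_2 L2_indicator_mult(3)[OF assms] by (simp add: ennpow_ennreal powr_half_sqrt l2norm_nonneg)

text \<open>Multiplication by an indicator is a contraction, so strong continuity of the group
  passes to the norm over a fixed set.\<close>

lemma continuous_on_l2norm_indicator:
  assumes sg: "schroedinger_group U" and u0: "L2 u0" and B: "B \<in> sets borel"
  shows "continuous_on UNIV (\<lambda>t. l2norm (\<lambda>w. indicator B w * U t u0 w))"
  unfolding continuous_on_def
proof
  fix t0
  let ?N = "\<lambda>t. l2norm (\<lambda>w. indicator B w * U t u0 w)"
  let ?D = "\<lambda>t. l2norm (\<lambda>w. U t u0 w - U t0 u0 w)"
  have L: "L2 (U t u0)" for t by (rule sg_L2[OF sg u0])
  note I = L2_indicator_mult(1)[OF L B]
  have le: "?N t \<le> ?N s + l2norm (\<lambda>w. U t u0 w - U s u0 w)" for s t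
  proof -
    have "?N t = l2norm (\<lambda>w. indicator B w * U s u0 w + indicator B w * (U t u0 w - U s u0 w))"
      by (simp add: algebra_simps)
    also have "\<dots> \<le> ?N s + l2norm (\<lambda>w. indicator B w * (U t u0 w - U s u0 w))"
      by (intro l2norm_triangle I L2_indicator_mult(1) L2_diff L B)
    also have "\<dots> \<le> ?N s + l2norm (\<lambda>w. U t u0 w - U s u0 w)"
      by (intro add_left_mono L2_indicator_mult(2) L2_diff L B)
    finally show ?thesis .
  qed
  have sw: "l2norm (\<lambda>w. U t u0 w - U s u0 w) = l2norm (\<lambda>w. U s u0 w - U t u0 w)" for s t
    unfolding l2norm_def by (simp add: norm_minus_commute)
  have "((\<lambda>t. ?N t - ?N t0) \<longlongrightarrow> 0) (at t0)"
  proof (rule Lim_null_comparison[OF _ sg_continuous[OF sg u0, of t0]])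
    show "eventually (\<lambda>t. norm (?N t - ?N t0) \<le> ?D t) (at t0)"
    proof (rule always_eventually, rule allI)
      fix t show "norm (?N t - ?N t0) \<le> ?D t" using le[of t t0] le[of t0 t] sw[of t0 t] by simp
    qed
  qed
  then show "(?N \<longlongrightarrow> ?N t0) (at t0 within UNIV)" by (simp add: LIM_zero_iff)
qed

text \<open>The essential supremum of a nonmeasurable function is \<open>\<infinity>\<close> by convention, so at the endpoint
  \<open>p = 2\<close>, \<open>q = \<infinity>\<close> measurability in \<open>t\<close> is not automatic; the ball moves with \<open>t\<close>, hence the rational radii.\<close>

lemma measurable_lpnorm_2_ball:
  fixes u0 :: "'d::finite heis \<Rightarrow> complex"
  assumes sg: "schroedinger_group U" and u0: "L2 u0"
  shows "(\<lambda>t. lpnorm (restrict_space lborel (heis_ball w0 (\<kappa> * sqrt \<bar>t\<bar>))) 2 (U t u0)) \<in> borel_measurable borel"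
proof -
  define D where "D t = density lborel (\<lambda>w. ennreal ((norm (U t u0 w))\<^sup>2))" for t
  have L: "L2 (U t u0)" for t by (rule sg_L2[OF sg u0])
  have [measurable]: "U t u0 \<in> borel_measurable borel" for t using L by (simp add: L2_iff)
  have B: "heis_ball w0 r \<in> sets borel" for r by (rule borel_open[OF open_heis_ball])
  have em: "emeasure (D t) (heis_ball w0 r) = (\<integral>\<^sup>+w. ennreal ((norm (U t u0 w))\<^sup>2) \<partial>restrict_space lborel (heis_ball w0 r))" for t r
    unfolding D_def using B by (subst emeasure_density) (auto simp: nn_integral_restrict_space)
  have "(\<lambda>t. l2norm (\<lambda>w. indicator (heis_ball w0 r) w * U t u0 w)) \<in> borel_measurable borel" for r
    by (rule borel_measurable_continuous_onI[OF continuous_on_l2norm_indicator[OF sg u0 B]])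
  then have [measurable]: "(\<lambda>t. emeasure (D t) (heis_ball w0 r)) \<in> borel_measurable borel" for r
    unfolding em L2_indicator_mult(3)[OF L B] by measurable
  have "emeasure (D t) (heis_ball w0 \<rho>) = (SUP q::rat. if real_of_rat q < \<rho> then emeasure (D t) (heis_ball w0 (real_of_rat q)) else 0)" for t \<rho>
  proof (rule emeasure_SUP_rat)
    show "heis_ball w0 r \<in> sets (D t)" for r using B by (simp add: D_def)
    show "heis_ball w0 r \<subseteq> heis_ball w0 s" if "r \<le> s" for r s using that by (auto simp: heis_ball_def)
    fix x assume "x \<in> heis_ball w0 \<rho>"
    then show "\<exists>r<\<rho>. x \<in> heis_ball w0 r" using dense[of "heis_dist x w0" \<rho>] by (auto simp: heis_ball_def)
  qed
  then have "(\<lambda>t. emeasure (D t) (heis_ball w0 (\<kappa> * sqrt \<bar>t\<bar>)))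
    = (\<lambda>t. SUP q::rat. if real_of_rat q < \<kappa> * sqrt \<bar>t\<bar> then emeasure (D t) (heis_ball w0 (real_of_rat q)) else 0)"
    by (intro ext)
  also have "\<dots> \<in> borel_measurable borel" by measurable
  finally show ?thesis unfolding lpnorm_2 em by measurable
qed

text \<open>For finite p = r, on B the power norm f ^ r is at most the square of norm f times the
  power r - 2 of the supremum bound, and the square integrates to (l2norm f)^2. At p = \<infinity>
  the quotient 2 / p is 0, so the same formula gives the supremum bound.\<close>

lemma lpnorm_interpolation:
  fixes f :: "'d::finite heis \<Rightarrow> complex"
  assumes f: "L2 f" and B: "B \<in> sets borel" and a: "0 < a"
    and bound: "AE w in lborel. w \<in> B \<longrightarrow> norm (f w) \<le> a * l2norm f"
    and p: "2 \<le> p" "p \<noteq> 2"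
  shows "lpnorm (restrict_space lborel B) p f \<le> ennreal (a powr (1 - enn2real (2 / p)) * l2norm f)"
proof (cases p)
  case top
  have [measurable]: "f \<in> borel_measurable borel" using f by (simp add: L2_iff)
  have "esssup (restrict_space lborel B) (\<lambda>w. ennreal (norm (f w))) \<le> ennreal (a * l2norm f)"
  proof (rule esssup_I)
    show "(\<lambda>w. ennreal (norm (f w))) \<in> borel_measurable (restrict_space lborel B)"
      by (rule measurable_restrict_space1) measurable
    show "AE w in restrict_space lborel B. ennreal (norm (f w)) \<le> ennreal (a * l2norm f)"
      using B bound by (subst AE_restrict_space_iff) (auto elim!: eventually_mono intro: ennreal_leI)
  qed
  then show ?thesis using top a by (simp add: lpnorm_def lpnorm_enn_def)
next
  case (real r)
  let ?M = "l2norm f"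
  have [measurable]: "f \<in> borel_measurable borel" and i: "integrable lborel (\<lambda>w. (norm (f w))\<^sup>2)"
    using f by (auto simp: L2_iff)
  have r: "2 < r"
  proof -
    have "2 \<le> r" using p(1) real by (metis ennreal_le_iff ennreal_numeral)
    moreover have "r \<noteq> 2" using p(2) real by auto
    ultimately show ?thesis by simp
  qed
  have p2: "enn2real (2 / p) = 2 / r"
    using r real by (simp add: divide_ennreal flip: ennreal_numeral)
  have "(\<integral>\<^sup>+w. ennpow (ennreal (norm (f w))) r \<partial>restrict_space lborel B)
      = (\<integral>\<^sup>+w. ennreal (norm (f w) powr r) * indicator B w \<partial>lborel)"
    using B by (subst nn_integral_restrict_space) (auto simp: ennpow_ennreal)
  also have "\<dots> \<le> (\<integral>\<^sup>+w. ennreal ((a * ?M) powr (r - 2)) * ennreal ((norm (f w))\<^sup>2) \<partial>lborel)"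
  proof (rule nn_integral_mono_AE)
    show "AE w in lborel. ennreal (norm (f w) powr r) * indicator B w \<le> ennreal ((a * ?M) powr (r - 2)) * ennreal ((norm (f w))\<^sup>2)"
      using bound
    proof eventually_elim
      fix w assume b: "w \<in> B \<longrightarrow> norm (f w) \<le> a * ?M"
      show "ennreal (norm (f w) powr r) * indicator B w \<le> ennreal ((a * ?M) powr (r - 2)) * ennreal ((norm (f w))\<^sup>2)"
      proof (cases "w \<in> B")
        case True
        have "norm (f w) powr r = norm (f w) powr (r - 2) * (norm (f w))\<^sup>2"
          using powr_add[of "norm (f w)" "r - 2" 2] by (cases "f w = 0") auto
        also have "\<dots> \<le> (a * ?M) powr (r - 2) * (norm (f w))\<^sup>2"
          using b True r by (intro mult_right_mono powr_mono2) auto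
        finally show ?thesis using True by (simp add: ennreal_mult[symmetric] ennreal_leI)
      qed simp
    qed
  qed
  also have "\<dots> = ennreal ((a * ?M) powr (r - 2) * ?M\<^sup>2)"
    using nn_integral_eq_integral[OF i] by (subst nn_integral_cmult) (auto simp: l2norm_sq ennreal_mult)
  also have "(a * ?M) powr (r - 2) * ?M\<^sup>2 = a powr (r - 2) * ?M powr r"
    using powr_add[of ?M "r - 2" 2] a l2norm_nonneg[of f] r by (cases "?M = 0") (auto simp: powr_mult)
  finally have "ennpow (\<integral>\<^sup>+w. ennpow (ennreal (norm (f w))) r \<partial>restrict_space lborel B) (1 / r)
      \<le> ennpow (ennreal (a powr (r - 2) * ?M powr r)) (1 / r)"
    using r by (intro ennpow_mono) auto
  also have "\<dots> = ennreal (a powr (1 - 2 / r) * ?M)"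
    using r a l2norm_nonneg[of f] by (simp add: ennpow_ennreal powr_mult powr_powr diff_divide_distrib)
  finally show ?thesis unfolding p2 using real r by (simp add: lpnorm_def lpnorm_enn_def)
qed

section \<open>Integration in time and admissible exponents\<close>

lemma nn_integral_inverse_square_tails:
  assumes "0 < (T::real)"
  shows "(\<integral>\<^sup>+t. ennreal (1 / t\<^sup>2) * indicator {t. T \<le> \<bar>t\<bar>} t \<partial>lborel) = ennreal (2 / T)"
proof -
  have 1: "(\<integral>\<^sup>+t. ennreal (1 / t\<^sup>2) * indicator {T..} t \<partial>lborel) = ennreal (1 / T)"
  proof -
    have "(\<integral>\<^sup>+t. ennreal (1 / t\<^sup>2) * indicator {T..} t \<partial>lborel) = ennreal (0 - (- (1 / T)))"
    proof (rule nn_integral_FTC_atLeast)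
      show "((\<lambda>t::real. - (1 / t)) \<longlongrightarrow> 0) at_top" by real_asymp
      fix t assume "T \<le> t"
      with assms show "((\<lambda>t. - (1 / t)) has_real_derivative 1 / t\<^sup>2) (at t)"
        by (auto intro!: derivative_eq_intros simp: power2_eq_square)
    qed auto
    then show ?thesis by simp
  qed
  have 2: "(\<integral>\<^sup>+t. ennreal (1 / t\<^sup>2) * indicator {..-T} t \<partial>lborel) = ennreal (1 / T)"
    using nn_integral_real_affine[of "\<lambda>t. ennreal (1 / t\<^sup>2) * indicator {..-T} t" "-1" 0] 1
    by (simp add: indicator_def)
  have "(\<integral>\<^sup>+t. ennreal (1 / t\<^sup>2) * indicator {t. T \<le> \<bar>t\<bar>} t \<partial>lborel)
      = (\<integral>\<^sup>+t. ennreal (1 / t\<^sup>2) * indicator {T..} t + ennreal (1 / t\<^sup>2) * indicator {..-T} t \<partial>lborel)"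
    using assms by (intro nn_integral_cong) (auto simp: indicator_def)
  also have "\<dots> = ennreal (1 / T) + ennreal (1 / T)"
    using 1 2 by (subst nn_integral_add) auto
  also have "\<dots> = ennreal (2 / T)"
    using assms by (simp add: ennreal_plus[symmetric] del: ennreal_plus)
  finally show ?thesis .
qed

text \<open>Here n + 1 stands for Q / 2. In extended arithmetic q = 0 would make 2 / q infinite, so
  it is excluded, and q = \<infinity> is compatible with p = 2 only. Otherwise q is a positive real,
  even when p is infinite.\<close>

lemma admissible_exponents:
  assumes p: "2 \<le> p" and pq: "2 / q + ennreal (2 * n + 2) / p = ennreal (2 * n + 2) / 2" and n: "0 \<le> n"
  obtains "p = 2" "q = \<infinity>"
    | r where "p \<noteq> 2" "q = ennreal r" "0 < r" "2 / r = (n + 1) * (1 - enn2real (2 / p))"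
proof -
  have Q2: "ennreal (2 * n + 2) / 2 = ennreal (n + 1)"
    using n divide_ennreal[of "2 * n + 2" 2] by (simp add: add_divide_distrib)
  have q0: "q \<noteq> 0"
  proof
    assume "q = 0"
    then have "2 / q + ennreal (2 * n + 2) / p = \<infinity>" by (simp add: ennreal_divide_zero)
    with pq Q2 show False by simp
  qed
  show ?thesis
  proof (cases "p = 2")
    case True
    then have "2 / q = 0" using pq Q2 by (simp add: ennreal_add_left_cancel)
    then have "q = \<infinity>" by (simp add: ennreal_divide_eq_0_iff)
    with True that(1) show ?thesis by blast
  next
    case False
    have Qp: "ennreal (2 * n + 2) / p = ennreal ((n + 1) * enn2real (2 / p)) \<and> enn2real (2 / p) < 1"
    proof (cases p)
      case top then show ?thesis by simp
    next
      case (real s)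
      have s: "2 < s"
      proof -
        have "2 \<le> s" using p real by (metis ennreal_le_iff ennreal_numeral)
        moreover have "s \<noteq> 2" using False real by auto
        ultimately show ?thesis by simp
      qed
      then have "ennreal (2 * n + 2) / p = ennreal ((2 * n + 2) / s)" "enn2real (2 / p) = 2 / s"
        using real n divide_ennreal[of 2 s] divide_ennreal[of "2 * n + 2" s] by (simp_all del: ennreal_plus)
      moreover have "(2 * n + 2) / s = (n + 1) * (2 / s)" by (simp add: field_simps)
      ultimately show ?thesis using s by simp
    qed
    define \<sigma> where "\<sigma> = enn2real (2 / p)"
    have \<sigma>: "0 \<le> \<sigma>" "\<sigma> < 1" using Qp by (auto simp: \<sigma>_def)
    have e: "2 / q + ennreal ((n + 1) * \<sigma>) = ennreal (n + 1)" using pq Q2 Qp by (simp add: \<sigma>_def)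
    show ?thesis
    proof (cases q)
      case top
      then have "(n + 1) * \<sigma> = n + 1" using e n \<sigma> by (simp del: ennreal_plus)
      with \<sigma> n show ?thesis by simp
    next
      case (real r)
      then have r: "0 < r" using q0 by (cases "r = 0") auto
      then have "2 / q = ennreal (2 / r)" using real divide_ennreal[of 2 r] by simp
      then have "2 / r + (n + 1) * \<sigma> = n + 1"
        using e n \<sigma> r by (simp add: ennreal_plus[symmetric] del: ennreal_plus)
      then have "2 / r = (n + 1) * (1 - \<sigma>)" by (simp add: algebra_simps)
      with that(2) False real r show ?thesis by (simp add: \<sigma>_def)
    qed
  qed
qed


theorem theorem1p6:
  fixes \<kappa> :: real and p q :: ennreal
  defines "Q \<equiv> 2 * real CARD('d::finite) + 2"
  assumes "0 < \<kappa>" and "\<kappa> < sqrt (4 * real CARD('d))"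
    and "2 \<le> p"
    and "2 / q + ennreal Q / p = ennreal Q / 2"
  shows "\<exists>C>0. \<forall>U :: real \<Rightarrow> ('d heis \<Rightarrow> complex) \<Rightarrow> ('d heis \<Rightarrow> complex).
     schroedinger_group U \<longrightarrow>
     (\<forall>R0 w0 u0. 0 < R0 \<longrightarrow> L2 u0 \<longrightarrow>
        (AE x in lborel. x \<notin> heis_ball w0 R0 \<longrightarrow> u0 x = 0) \<longrightarrow>
        lpnorm_enn (restrict_space lborel
                      {t. (sqrt (4 * real CARD('d)) - \<kappa>) powr (-2) * R0\<^sup>2 \<le> \<bar>t\<bar>}) q
           (\<lambda>t. lpnorm (restrict_space lborel (heis_ball w0 (\<kappa> * sqrt \<bar>t\<bar>))) p (U t u0))
        \<le> ennreal C * lpnorm (restrict_space lborel (heis_ball w0 R0)) 2 u0)"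
proof -
  define n where "n = CARD('d)"
  define \<delta> where "\<delta> = sqrt (4 * real CARD('d)) - \<kappa>"
  define T where "T R0 = {t::real. \<delta> powr (-2) * R0\<^sup>2 \<le> \<bar>t\<bar>}" for R0
  have \<delta>: "0 < \<delta>" using assms(3) by (simp add: \<delta>_def)
  have Tm: "T R0 \<in> sets borel" for R0
    unfolding T_def by (intro borel_closed closed_Collect_le continuous_intros)
  have B: "heis_ball w0 r \<in> sets borel" for w0 :: "'d heis" and r by (rule borel_open[OF open_heis_ball])
  have rhs: "lpnorm (restrict_space lborel (heis_ball w0 R0)) 2 u0 = ennreal (l2norm u0)"
    if u0: "L2 u0" and supp: "AE x in lborel. x \<notin> heis_ball w0 R0 \<longrightarrow> u0 x = 0" for w0 R0 and u0 :: "'d heis \<Rightarrow> complex"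
  proof -
    have "l2norm (\<lambda>w. indicator (heis_ball w0 R0) w * u0 w) = l2norm u0"
      by (intro l2norm_cong_AE L2_indicator_mult(1) u0 B) (use supp in \<open>auto elim!: eventually_mono simp: indicator_def\<close>)
    then show ?thesis by (simp add: lpnorm_2_restrict[OF u0 B])
  qed
  have pq: "2 / q + ennreal (2 * real n + 2) / p = ennreal (2 * real n + 2) / 2"
    using assms(5) by (simp add: Q_def n_def)
  from admissible_exponents[OF assms(4) pq of_nat_0_le_iff] show ?thesis
  proof cases
    case 1
    show ?thesis
    \<comment> \<open>At the endpoint, conservation of the L2 norm and restriction to a ball give
      the bound at every time, with constant 1.\<close>
    proof (intro exI[of _ 1] conjI allI impI)
      fix U :: "real \<Rightarrow> ('d heis \<Rightarrow> complex) \<Rightarrow> ('d heis \<Rightarrow> complex)" and R0 and w0 :: "'d heis" and u0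
      assume sg: "schroedinger_group U" and u0: "L2 u0" and supp: "AE x in lborel. x \<notin> heis_ball w0 R0 \<longrightarrow> u0 x = 0"
      have "esssup (restrict_space lborel (T R0)) (\<lambda>t. lpnorm (restrict_space lborel (heis_ball w0 (\<kappa> * sqrt \<bar>t\<bar>))) 2 (U t u0)) \<le> ennreal (l2norm u0)"
      proof (rule esssup_I)
        show "(\<lambda>t. lpnorm (restrict_space lborel (heis_ball w0 (\<kappa> * sqrt \<bar>t\<bar>))) 2 (U t u0)) \<in> borel_measurable (restrict_space lborel (T R0))"
          using measurable_lpnorm_2_ball[OF sg u0] by (intro measurable_restrict_space1) simp
        show "AE t in restrict_space lborel (T R0). lpnorm (restrict_space lborel (heis_ball w0 (\<kappa> * sqrt \<bar>t\<bar>))) 2 (U t u0) \<le> ennreal (l2norm u0)"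
        proof (rule AE_I2)
          fix t
          show "lpnorm (restrict_space lborel (heis_ball w0 (\<kappa> * sqrt \<bar>t\<bar>))) 2 (U t u0) \<le> ennreal (l2norm u0)"
            using L2_indicator_mult(2)[OF sg_L2[OF sg u0] B] sg_norm[OF sg u0]
            by (simp add: lpnorm_2_restrict[OF sg_L2[OF sg u0] B] ennreal_leI)
        qed
      qed
      then show "lpnorm_enn (restrict_space lborel {t. (sqrt (4 * real CARD('d)) - \<kappa>) powr (-2) * R0\<^sup>2 \<le> \<bar>t\<bar>}) q
           (\<lambda>t. lpnorm (restrict_space lborel (heis_ball w0 (\<kappa> * sqrt \<bar>t\<bar>))) p (U t u0))
        \<le> ennreal 1 * lpnorm (restrict_space lborel (heis_ball w0 R0)) 2 u0"
        unfolding 1 rhs[OF u0 supp] by (simp add: lpnorm_enn_def T_def \<delta>_def)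
    qed simp
  next
    case (2 r)
    \<comment> \<open>The interpolation exponent. Admissibility says (n + 1) * \<theta> = 2 / r, so
      the dispersive factor (R0 / \<bar>t\<bar>) ^ (n + 1) enters with exponent 2 / r.\<close>
    define \<theta> where "\<theta> = 1 - enn2real (2 / p)"
    have r: "2 / r = real (n + 1) * \<theta>" "0 < r" using 2 by (auto simp: \<theta>_def add.commute)
    obtain C1 where C1: "0 < C1" and disp: "\<And>U t R w0 (u0 :: 'd heis \<Rightarrow> complex). schroedinger_group U \<Longrightarrow> 0 < R \<Longrightarrow> L2 u0 \<Longrightarrow>
      AE x in lborel. x \<notin> heis_ball w0 R \<longrightarrow> u0 x = 0 \<Longrightarrow> R \<le> (sqrt (4 * real CARD('d)) - \<kappa>) * sqrt \<bar>t\<bar> \<Longrightarrow>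
      AE w in lborel. w \<in> heis_ball w0 (\<kappa> * sqrt \<bar>t\<bar>) \<longrightarrow> norm (U t u0 w) \<le> C1 * (R / \<bar>t\<bar>) ^ (CARD('d) + 1) * l2norm u0"
      by (rule local_dispersive[OF assms(2,3)]) blast
    define K where "K = C1 powr \<theta>"
    have K: "0 < K" using C1 by (simp add: K_def)
    \<comment> \<open>2 * \<delta>^2 is R0^2 times the tail integral 2 / T0 of 1 / t^2; with T0 =
      R0^2 / \<delta>^2 the radius cancels, which makes the constant independent of R0.\<close>
    define C where "C = K * (2 * \<delta>\<^sup>2) powr (1 / r)"
    show ?thesis
    proof (intro exI[of _ C] conjI allI impI)
      show "0 < C" using K \<delta> by (simp add: C_def)
      fix U :: "real \<Rightarrow> ('d heis \<Rightarrow> complex) \<Rightarrow> ('d heis \<Rightarrow> complex)" and R0 :: real and w0 :: "'d heis" and u0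
      assume sg: "schroedinger_group U" and R0: "0 < R0" and u0: "L2 u0"
        and supp: "AE x in lborel. x \<notin> heis_ball w0 R0 \<longrightarrow> u0 x = 0"
      define M where "M = l2norm u0"
      have M: "0 \<le> M" by (simp add: M_def l2norm_nonneg)
      define T0 where "T0 = \<delta> powr (-2) * R0\<^sup>2"
      have T0: "T0 = R0\<^sup>2 / \<delta>\<^sup>2" "0 < T0" using \<delta> R0 by (auto simp: T0_def powr_minus_divide)
      let ?g = "\<lambda>t. lpnorm (restrict_space lborel (heis_ball w0 (\<kappa> * sqrt \<bar>t\<bar>))) p (U t u0)"
      have pt: "ennpow (?g t) r \<le> ennreal ((K * M) powr r * R0\<^sup>2) * ennreal (1 / t\<^sup>2)" if t: "T0 \<le> \<bar>t\<bar>" for t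
      proof -
        have t0: "0 < \<bar>t\<bar>" using t T0 by linarith
        \<comment> \<open>The time threshold with its exponent - 2 is precisely the condition R0
          \<le> \<delta> * sqrt \<bar>t\<bar> of the dispersive bound.\<close>
        have "R0\<^sup>2 \<le> (\<delta> * sqrt \<bar>t\<bar>)\<^sup>2"
          using t \<delta> unfolding T0(1) by (simp add: power_mult_distrib pos_divide_le_eq mult.commute)
        then have "R0 \<le> \<delta> * sqrt \<bar>t\<bar>" by (rule power2_le_imp_le) (use \<delta> in simp)
        note b = disp[OF sg R0 u0 supp, folded \<delta>_def n_def, OF this]
        have "?g t \<le> ennreal ((C1 * (R0 / \<bar>t\<bar>) ^ (n + 1)) powr (1 - enn2real (2 / p)) * l2norm (U t u0))"
          by (rule lpnorm_interpolation[OF sg_L2[OF sg u0] B])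
             (use C1 R0 t0 b 2 assms(4) in \<open>simp_all add: sg_norm[OF sg u0]\<close>)
        also have "(C1 * (R0 / \<bar>t\<bar>) ^ (n + 1)) powr (1 - enn2real (2 / p)) * l2norm (U t u0) = K * (R0 / \<bar>t\<bar>) powr (2 / r) * M"
        proof -
          have "(R0 / \<bar>t\<bar>) ^ (n + 1) = (R0 / \<bar>t\<bar>) powr real (n + 1)" using R0 t0 by (intro powr_realpow[symmetric]) simp
          then show ?thesis using C1 R0 t0 by (simp add: powr_mult powr_powr r(1) K_def \<theta>_def[symmetric] sg_norm[OF sg u0] M_def)
        qed
        finally have "ennpow (?g t) r \<le> ennpow (ennreal (K * (R0 / \<bar>t\<bar>) powr (2 / r) * M)) r"
          using r by (intro ennpow_mono) auto
        also have "\<dots> = ennreal ((K * M) powr r * ((R0 / \<bar>t\<bar>) powr (2 / r)) powr r)"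
          using K M by (simp add: ennpow_ennreal powr_mult mult_ac)
        \<comment> \<open>Scale invariance of the admissible pairs: after the power q = r the
          exponent of R0 / \<bar>t\<bar> is 2, whichever pair is chosen.\<close>
        also have "((R0 / \<bar>t\<bar>) powr (2 / r)) powr r = R0\<^sup>2 * (1 / t\<^sup>2)"
          using R0 t0 r(2) by (simp add: powr_powr power_divide)
        finally show ?thesis by (simp add: ennreal_mult[symmetric] mult.assoc)
      qed
      have "(\<integral>\<^sup>+t. ennpow (?g t) r \<partial>restrict_space lborel (T R0)) = (\<integral>\<^sup>+t. ennpow (?g t) r * indicator (T R0) t \<partial>lborel)"
        using Tm by (subst nn_integral_restrict_space) auto
      also have "\<dots> \<le> (\<integral>\<^sup>+t. ennreal ((K * M) powr r * R0\<^sup>2) * (ennreal (1 / t\<^sup>2) * indicator {t. T0 \<le> \<bar>t\<bar>} t) \<partial>lborel)"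
        using pt by (intro nn_integral_mono) (auto simp: T_def T0_def indicator_def)
      also have "\<dots> = ennreal ((K * M) powr r * R0\<^sup>2) * ennreal (2 / T0)"
        unfolding nn_integral_inverse_square_tails[OF T0(2), symmetric] by (rule nn_integral_cmult) measurable
      also have "\<dots> = ennreal ((K * M) powr r * (2 * \<delta>\<^sup>2))"
        using R0 \<delta> by (simp add: ennreal_mult[symmetric] T0(1))
      finally have "ennpow (\<integral>\<^sup>+t. ennpow (?g t) r \<partial>restrict_space lborel (T R0)) (1 / r) \<le> ennpow (ennreal ((K * M) powr r * (2 * \<delta>\<^sup>2))) (1 / r)"
        using r by (intro ennpow_mono) auto
      also have "\<dots> = ennreal (C * M)"
        using K M r by (simp add: ennpow_ennreal powr_mult powr_powr C_def mult_ac)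
      also have "\<dots> = ennreal C * ennreal M" using \<open>0 < C\<close> M by (simp add: ennreal_mult)
      finally show "lpnorm_enn (restrict_space lborel {t. (sqrt (4 * real CARD('d)) - \<kappa>) powr (-2) * R0\<^sup>2 \<le> \<bar>t\<bar>}) q ?g
        \<le> ennreal C * lpnorm (restrict_space lborel (heis_ball w0 R0)) 2 u0"
        unfolding rhs[OF u0 supp] using 2 r(2) by (simp add: lpnorm_enn_def M_def T_def \<delta>_def)
    qed
  qed
qed

end
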